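(* Let $G$ be a finite solvable group. Then for every torsion unit $u \in \mathrm{V}(\mathbb{Z}G)$ there is an element $x \in G$ whose order equals the order of $u$ and such that the partial augmentation of $u$ with respect to the conjugacy class of $x$ is nonzero, i.e. $\varepsilon_x(u) \neq 0$. In particular, the orders of the torsion units in $\mathrm{V}(\mathbb{Z}G)$ are precisely the orders of the elements of $G$.
   Context: For a finite group $G$, $\mathbb{Z}G$ denotes the integral group ring, and $\mathrm{V}(\mathbb{Z}G)$ denotes the group of units of $\mathbb{Z}G$ of augmentation one, i.e. units $u=\sum_{g\in G} a_g g$ (with all $a_g \in \mathbb{Z}$) such that $\sum_{g\in G} a_g = 1$. A torsion unit is a unit of finite multiplicative order. For $u=\sum_{g\in G} a_g g \in \mathbb{Z}G$ and $x\in G$, the partial augmentation of $u$ with respect to $x$ (or rather with respect to its conjugacy class $x^G$ in $G$) is $\varepsilon_x(u)=\sum_{g\in x^G} a_g$. *)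

theory Defs
  imports "HOL-Algebra.Algebra"
begin

text \<open>
  The element \<open>\<Sum>g\<in>G. a\<^sub>g g\<close> of the integral group ring of a finite group \<open>G\<close> is encoded
  as its coefficient function \<open>g \<mapsto> a\<^sub>g\<close>, extended by \<open>0\<close> outside \<open>carrier G\<close>. There is no
  finite-support condition, so this is the group ring for finite groups only.
\<close>

definition int_group_ring :: "('a, 'b) monoid_scheme \<Rightarrow> ('a \<Rightarrow> int) ring" where
  "int_group_ring G =
     \<lparr> carrier = {u. \<forall>g. g \<notin> carrier G \<longrightarrow> u g = 0},
       monoid.mult = (\<lambda>u v x. \<Sum>(h, k) \<in> {(h, k). h \<in> carrier G \<and> k \<in> carrier G \<and> h \<otimes>\<^bsub>G\<^esub> k = x}. u h * v k),
       one = (\<lambda>x. if x = \<one>\<^bsub>G\<^esub> then 1 else 0),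
       ring.zero = (\<lambda>x. 0),
       add = (\<lambda>u v x. u x + v x) \<rparr>"

definition augmentation :: "('a, 'b) monoid_scheme \<Rightarrow> ('a \<Rightarrow> int) \<Rightarrow> int" where
  "augmentation G u = (\<Sum>g\<in>carrier G. u g)"

definition normalized_units :: "('a, 'b) monoid_scheme \<Rightarrow> ('a \<Rightarrow> int) monoid" where
  "normalized_units G =
     (units_of (int_group_ring G))
       \<lparr> carrier := {u \<in> Units (int_group_ring G). augmentation G u = 1} \<rparr>"

definition torsion_elements :: "('a, 'b) monoid_scheme \<Rightarrow> 'a set" where
  "torsion_elements H = {u \<in> carrier H. \<exists>n::nat. n > 0 \<and> u [^]\<^bsub>H\<^esub> n = \<one>\<^bsub>H\<^esub>}"

definition conjugacy_class :: "('a, 'b) monoid_scheme \<Rightarrow> 'a \<Rightarrow> 'a set" where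
  "conjugacy_class G x = {g \<otimes>\<^bsub>G\<^esub> x \<otimes>\<^bsub>G\<^esub> inv\<^bsub>G\<^esub> g | g. g \<in> carrier G}"

definition partial_augmentation :: "('a, 'b) monoid_scheme \<Rightarrow> 'a \<Rightarrow> ('a \<Rightarrow> int) \<Rightarrow> int" where
  "partial_augmentation G x u = (\<Sum>g\<in>conjugacy_class G x. u g)"

text \<open>
  The constant \<open>group.ord\<close> is characterised by its defining equation only for groups; the facts
  below ensure that it can be used for \<open>normalized_units G\<close>.
\<close>

context group
begin

lemma int_group_ring_mult_outside:
  "x \<notin> carrier G \<Longrightarrow> (u \<otimes>\<^bsub>int_group_ring G\<^esub> v) x = 0"
  unfolding int_group_ring_def by (auto intro!: sum.neutral)

lemma int_group_ring_mult:
  assumes x: "x \<in> carrier G"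
  shows "(u \<otimes>\<^bsub>int_group_ring G\<^esub> v) x = (\<Sum>h\<in>carrier G. u h * v (inv h \<otimes> x))"
proof -
  have "(\<Sum>(h, k) \<in> {(h, k). h \<in> carrier G \<and> k \<in> carrier G \<and> h \<otimes> k = x}. u h * v k)
      = (\<Sum>h\<in>carrier G. u h * v (inv h \<otimes> x))"
    by (rule sum.reindex_bij_witness[where i = "\<lambda>h. (h, inv h \<otimes> x)" and j = fst])
       (use x in \<open>auto simp: inv_solve_left m_assoc[symmetric]\<close>)
  then show ?thesis by (simp add: int_group_ring_def)
qed

lemma sum_translate:
  fixes f :: "'a \<Rightarrow> int"
  assumes h: "h \<in> carrier G"
  shows "(\<Sum>x\<in>carrier G. f (inv h \<otimes> x)) = (\<Sum>x\<in>carrier G. f x)"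
  by (rule sum.reindex_bij_witness[where i = "\<lambda>x. h \<otimes> x" and j = "\<lambda>x. inv h \<otimes> x"])
     (use h in \<open>auto simp: m_assoc[symmetric]\<close>)

lemma augmentation_mult:
  "augmentation G (u \<otimes>\<^bsub>int_group_ring G\<^esub> v) = augmentation G u * augmentation G v"
proof -
  have "augmentation G (u \<otimes>\<^bsub>int_group_ring G\<^esub> v)
      = (\<Sum>x\<in>carrier G. \<Sum>h\<in>carrier G. u h * v (inv h \<otimes> x))"
    by (simp add: augmentation_def int_group_ring_mult)
  also have "\<dots> = (\<Sum>h\<in>carrier G. u h * (\<Sum>x\<in>carrier G. v (inv h \<otimes> x)))"
    by (subst sum.swap) (simp add: sum_distrib_left)
  also have "\<dots> = (\<Sum>h\<in>carrier G. u h * (\<Sum>x\<in>carrier G. v x))"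
    by (intro sum.cong refl arg_cong2[where f = "(*)"] sum_translate)
  finally show ?thesis by (simp add: augmentation_def sum_distrib_right)
qed

lemma int_group_ring_assoc:
  "(u \<otimes>\<^bsub>int_group_ring G\<^esub> v) \<otimes>\<^bsub>int_group_ring G\<^esub> w
    = u \<otimes>\<^bsub>int_group_ring G\<^esub> (v \<otimes>\<^bsub>int_group_ring G\<^esub> w)"
proof
  fix x
  show "((u \<otimes>\<^bsub>int_group_ring G\<^esub> v) \<otimes>\<^bsub>int_group_ring G\<^esub> w) x
      = (u \<otimes>\<^bsub>int_group_ring G\<^esub> (v \<otimes>\<^bsub>int_group_ring G\<^esub> w)) x"
  proof (cases "x \<in> carrier G")
    case False
    then show ?thesis by (simp add: int_group_ring_mult_outside)
  next
    case x: True
    have "((u \<otimes>\<^bsub>int_group_ring G\<^esub> v) \<otimes>\<^bsub>int_group_ring G\<^esub> w) x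
        = (\<Sum>a\<in>carrier G. \<Sum>h\<in>carrier G. u h * v (inv h \<otimes> a) * w (inv a \<otimes> x))"
      by (simp add: int_group_ring_mult x sum_distrib_right)
    also have "\<dots> = (\<Sum>h\<in>carrier G. \<Sum>a\<in>carrier G. u h * v (inv h \<otimes> a) * w (inv a \<otimes> x))"
      by (rule sum.swap)
    also have "\<dots> = (\<Sum>h\<in>carrier G. \<Sum>k\<in>carrier G. u h * (v k * w (inv k \<otimes> (inv h \<otimes> x))))"
    proof (rule sum.cong[OF refl])
      fix h assume h: "h \<in> carrier G"
      have "inv a \<otimes> x = inv (inv h \<otimes> a) \<otimes> (inv h \<otimes> x)" if a: "a \<in> carrier G" for a
      proof -
        have "inv (inv h \<otimes> a) \<otimes> (inv h \<otimes> x) = inv a \<otimes> (h \<otimes> (inv h \<otimes> x))"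
          using a h x by (simp add: inv_mult_group m_assoc)
        also have "h \<otimes> (inv h \<otimes> x) = x"
          using h x by (simp flip: m_assoc)
        finally show ?thesis by simp
      qed
      then have "(\<Sum>a\<in>carrier G. u h * v (inv h \<otimes> a) * w (inv a \<otimes> x))
          = (\<Sum>a\<in>carrier G. u h * (v (inv h \<otimes> a) * w (inv (inv h \<otimes> a) \<otimes> (inv h \<otimes> x))))"
        by (intro sum.cong) (simp_all add: mult.assoc)
      also have "\<dots> = (\<Sum>k\<in>carrier G. u h * (v k * w (inv k \<otimes> (inv h \<otimes> x))))"
        by (rule sum_translate[OF h])
      finally show "(\<Sum>a\<in>carrier G. u h * v (inv h \<otimes> a) * w (inv a \<otimes> x))
          = (\<Sum>k\<in>carrier G. u h * (v k * w (inv k \<otimes> (inv h \<otimes> x))))" .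
    qed
    also have "\<dots> = (u \<otimes>\<^bsub>int_group_ring G\<^esub> (v \<otimes>\<^bsub>int_group_ring G\<^esub> w)) x"
      by (simp add: int_group_ring_mult x sum_distrib_left)
    finally show ?thesis .
  qed
qed

lemma ring_int_group_ring:
  assumes fin: "finite (carrier G)"
  shows "ring (int_group_ring G)"
proof (rule ringI)
  show "abelian_group (int_group_ring G)"
  proof (rule abelian_groupI)
    fix u assume "u \<in> carrier (int_group_ring G)"
    then show "\<exists>v\<in>carrier (int_group_ring G). v \<oplus>\<^bsub>int_group_ring G\<^esub> u = \<zero>\<^bsub>int_group_ring G\<^esub>"
      by (intro bexI[of _ "\<lambda>x. - u x"]) (auto simp: int_group_ring_def)
  qed (auto simp: int_group_ring_def)
  show "monoid (int_group_ring G)"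
  proof (rule monoidI)
    fix u assume u: "u \<in> carrier (int_group_ring G)"
    show "\<one>\<^bsub>int_group_ring G\<^esub> \<otimes>\<^bsub>int_group_ring G\<^esub> u = u"
    proof
      fix x
      show "(\<one>\<^bsub>int_group_ring G\<^esub> \<otimes>\<^bsub>int_group_ring G\<^esub> u) x = u x"
      proof (cases "x \<in> carrier G")
        case True
        have "(\<Sum>h\<in>carrier G. (if h = \<one> then 1 else 0) * u (inv h \<otimes> x))
            = (\<Sum>h\<in>carrier G. if h = \<one> then u x else 0)"
          by (intro sum.cong) (use True in auto)
        then show ?thesis
          using True fin by (simp add: int_group_ring_mult) (simp add: int_group_ring_def)
      qed (use u in \<open>auto simp: int_group_ring_mult_outside\<close>, simp add: int_group_ring_def)
    qed
    show "u \<otimes>\<^bsub>int_group_ring G\<^esub> \<one>\<^bsub>int_group_ring G\<^esub> = u"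
    proof
      fix x
      show "(u \<otimes>\<^bsub>int_group_ring G\<^esub> \<one>\<^bsub>int_group_ring G\<^esub>) x = u x"
      proof (cases "x \<in> carrier G")
        case True
        have "(\<Sum>h\<in>carrier G. u h * (if inv h \<otimes> x = \<one> then 1 else 0))
            = (\<Sum>h\<in>carrier G. if h = x then u h else 0)"
        proof (intro sum.cong refl)
          fix h assume h: "h \<in> carrier G"
          have "inv h \<otimes> x = \<one> \<longleftrightarrow> h = x"
            using h True inv_solve_left'[of "\<one>" h x] by auto
          then show "u h * (if inv h \<otimes> x = \<one> then 1 else 0) = (if h = x then u h else 0)"
            by simp
        qed
        then show ?thesis
          using True fin by (simp add: int_group_ring_mult) (simp add: int_group_ring_def)
      qed (use u in \<open>auto simp: int_group_ring_mult_outside\<close>, simp add: int_group_ring_def)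
    qed
  next
    show "\<one>\<^bsub>int_group_ring G\<^esub> \<in> carrier (int_group_ring G)"
      by (auto simp: int_group_ring_def)
  next
    fix u v
    show "u \<otimes>\<^bsub>int_group_ring G\<^esub> v \<in> carrier (int_group_ring G)"
      using int_group_ring_mult_outside[of _ u v] by (simp add: int_group_ring_def)
  qed (rule int_group_ring_assoc)
qed (auto simp: int_group_ring_def algebra_simps case_prod_unfold sum.distrib)

lemma augmentation_one:
  assumes "finite (carrier G)"
  shows "augmentation G \<one>\<^bsub>int_group_ring G\<^esub> = 1"
  using assms by (simp add: augmentation_def int_group_ring_def)

lemma group_normalized_units:
  assumes fin: "finite (carrier G)"
  shows "group (normalized_units G)"
proof -
  interpret R: ring "int_group_ring G" by (rule ring_int_group_ring[OF fin])
  interpret U: group "units_of (int_group_ring G)" by (rule R.units_group)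
  have "subgroup {u \<in> Units (int_group_ring G). augmentation G u = 1} (units_of (int_group_ring G))"
  proof (rule U.subgroupI)
    fix u assume u: "u \<in> {u \<in> Units (int_group_ring G). augmentation G u = 1}"
    then have "augmentation G u * augmentation G (inv\<^bsub>int_group_ring G\<^esub> u) = 1"
      using augmentation_one[OF fin] by (simp only: augmentation_mult[symmetric]) (simp add: R.Units_r_inv)
    with u show "inv\<^bsub>units_of (int_group_ring G)\<^esub> u
        \<in> {u \<in> Units (int_group_ring G). augmentation G u = 1}"
      by (simp add: R.units_of_inv)
  qed (use augmentation_one[OF fin] in \<open>auto simp: units_of_carrier units_of_mult augmentation_mult\<close>)
  then show ?thesis
    unfolding normalized_units_def by (rule U.subgroup_imp_group)
qed

end

end

theory Submission
  imports Defs "HOL-Number_Theory.Number_Theory" "HOL-Library.Function_Algebras"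
begin

text \<open>For \<open>x \<in> G\<close> and a unit \<open>u\<close>, the operator \<open>m \<mapsto> x\<^sup>-\<^sup>1 m u\<close> of the integral group ring has trace
\<open>\<Sum>m. u (m\<^sup>-\<^sup>1 x m)\<close>, which is the order of the centraliser of \<open>x\<close> times the partial augmentation of
\<open>u\<close> at \<open>x\<close> (\<open>tr_act\<close>, \<open>ctr_partial_augmentation\<close>). If \<open>u\<close> is a torsion unit this operator has
finite order, so the theorem becomes a question about vanishing traces of operators of finite order
on a lattice, and such vanishing can be detected modulo a prime \<open>p\<close>: if \<open>T\<^sup>n = 1\<close>, \<open>p\<close> divides \<open>n\<close>,
and the lattice modulo \<open>p\<close> is free over the group of order \<open>p\<close> generated by \<open>T\<^bsup>n/p\<^esup>\<close>, then \<open>T\<close> has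
trace zero (\<open>trace_zero_op\<close>). Freeness appears there as the inequality saying that the image of
\<open>T\<^bsup>n/p\<^esup> - 1\<close> modulo \<open>p\<close> has codimension at most a \<open>p\<close>-th of the rank.

The theorem itself goes by induction on the order of \<open>G\<close>. A nontrivial solvable group has a
nontrivial normal elementary abelian \<open>p\<close>-subgroup \<open>N\<close> (\<open>minimal_elementary_normal\<close>); put \<open>H = G / N\<close>. For the image of \<open>u\<close>
in \<open>\<int>H\<close> the induction hypothesis supplies some \<open>y\<close> of the right order with nonzero trace. Summing the class traces over the \<open>N\<close>-coset above \<open>y\<close>
gives a positive multiple of the class trace downstairs (\<open>ctr_sum_N\<close>), so some lift \<open>x\<close> of \<open>y\<close> has
nonzero trace; its order is that of \<open>y\<close> or \<open>p\<close> times it. The order of \<open>u\<close> is that of its image times a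
power of \<open>p\<close>, because a normalised unit in the kernel of \<open>\<int>G \<rightarrow> \<int>H\<close> of order prime to \<open>p\<close> is trivial
(\<open>kernel_p_element\<close>). If the orders of \<open>x\<close> and \<open>u\<close> were different, one of two freeness criteria
would force the trace at \<open>x\<close> to vanish: \<open>ctr_zero_if_p_part_large\<close>, where a power of
\<open>x\<close> acts freely by left multiplication, or \<open>ctr_zero_if_p_part_in_kernel\<close>, where a power \<open>z\<close> of \<open>u\<close>
with \<open>z\<^sup>p = 1 \<noteq> z\<close> and trivial image in \<open>\<int>H\<close> acts by right multiplication.

The heart of the proof is that such a \<open>z\<close> acts freely modulo \<open>p\<close> (\<open>kernel_unit_rank\<close>). It is compared with all operators
\<open>y\<^sub>n: m \<mapsto> n m z\<close> for \<open>n \<in> N\<close> simultaneously. The trace of the norm \<open>1 + y\<^sub>n + \<dots> + y\<^sub>n\<^bsup>p-1\<^esup>\<close> is at most \<open>p\<close> times the codimension of the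
image of \<open>y\<^sub>n - 1\<close> modulo \<open>p\<close> (\<open>norm_trace\<close>), and the sum over \<open>n\<close> of these traces is explicit. On the
other side, \<open>\<int>H\<close> has a basis modulo \<open>p\<close> whose members \<open>w\<^sub>s\<close>, lifted to \<open>\<int>G\<close>, satisfy
\<open>w\<^sub>s z \<equiv> n\<^sub>s w\<^sub>s\<close> modulo the square of the augmentation ideal of \<open>N\<close> (\<open>adapted_basis\<close>), which bounds every codimension from
above (\<open>span_bound\<close>). Both sums are equal, hence equality holds for every \<open>n\<close>; and for \<open>n = 1\<close> the trace
is \<open>|G|\<close> by the theorem of Berman and Higman (\<open>berman_higman_prime\<close>).

The adapted basis consists of joint eigenvectors: to first order, \<open>z - 1\<close> is described by operators \<open>At z t\<close> on \<open>\<int>H\<close>, one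
for each additive character \<open>t\<close> of \<open>N\<close>. From \<open>z\<^sup>p = 1\<close> one obtains \<open>A\<^sup>p = A\<close> modulo \<open>p\<close> for
every one of them (\<open>At_pow\<close>), hence diagonalisability; and since the relation holds on a whole linear space
of operators, they preserve each other's eigenspaces (\<open>commute_eigen\<close>).\<close>

section \<open>Integer vectors and subspaces modulo a prime\<close>
definition cs :: "int \<Rightarrow> ('i \<Rightarrow> int) \<Rightarrow> 'i \<Rightarrow> int" where
  "cs c v = (\<lambda>x. c * v x)"

definition vecs :: "'i set \<Rightarrow> ('i \<Rightarrow> int) set" where
  "vecs S = {v. \<forall>x. x \<notin> S \<longrightarrow> v x = 0}"

definition dl :: "'i \<Rightarrow> 'i \<Rightarrow> int" where
  "dl s = (\<lambda>x. if x = s then 1 else 0)"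

definition lin :: "'i set \<Rightarrow> 'j set \<Rightarrow> (('i \<Rightarrow> int) \<Rightarrow> 'j \<Rightarrow> int) \<Rightarrow> bool" where
  "lin S S' A \<longleftrightarrow> (\<forall>v\<in>vecs S. A v \<in> vecs S') \<and> (\<forall>v\<in>vecs S. \<forall>w\<in>vecs S. A (v + w) = A v + A w)"

definition tr :: "'i set \<Rightarrow> (('i \<Rightarrow> int) \<Rightarrow> 'i \<Rightarrow> int) \<Rightarrow> int" where
  "tr S A = (\<Sum>s\<in>S. A (dl s) s)"

definition lc :: "(nat \<Rightarrow> int) \<Rightarrow> ('i \<Rightarrow> int) list \<Rightarrow> 'i \<Rightarrow> int" where
  "lc c xs = (\<Sum>i<length xs. cs (c i) (xs ! i))"

lemma sum_fun_apply: "(\<Sum>i\<in>A. f i) x = (\<Sum>i\<in>A. f i (x::'b) :: int)"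
  by (induction A rule: infinite_finite_induct) auto

declare plus_fun_apply [simp del] zero_fun_apply [simp del] minus_apply [simp del] uminus_apply [simp del]
  times_fun_apply [simp del] one_fun_apply [simp del]

lemma cs_apply: "cs c v x = c * v x" by (simp add: cs_def)

lemmas fapp = plus_fun_apply zero_fun_apply minus_apply uminus_apply cs_apply sum_fun_apply

lemma cs_add: "cs c (v + w) = cs c v + cs c w" by (rule ext) (simp add: fapp algebra_simps)
lemma cs_diff: "cs c (v - w) = cs c v - cs c w" by (rule ext) (simp add: fapp algebra_simps)
lemma cs_uminus: "cs c (- w) = - cs c w" by (rule ext) (simp add: fapp algebra_simps)
lemma cs_add_left: "cs (c + d) v = cs c v + cs d v" by (rule ext) (simp add: fapp algebra_simps)
lemma cs_diff_left: "cs (c - d) v = cs c v - cs d v" by (rule ext) (simp add: fapp algebra_simps)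
lemma cs_cs [simp]: "cs c (cs d v) = cs (c * d) v" by (rule ext) (simp add: fapp algebra_simps)
lemma cs_1 [simp]: "cs 1 v = v" by (rule ext) (simp add: fapp)
lemma cs_0 [simp]: "cs 0 v = 0" by (rule ext) (simp add: fapp)
lemma cs_zero [simp]: "cs c 0 = 0" by (rule ext) (simp add: fapp)
lemma cs_minus [simp]: "cs (- c) v = - cs c v" by (rule ext) (simp add: fapp)
lemma cs_sum: "cs c (\<Sum>i\<in>A. f i) = (\<Sum>i\<in>A. cs c (f i))"
  by (rule ext) (simp add: fapp sum_distrib_left)
lemma cs_sum_left: "cs (\<Sum>i\<in>A. f i) v = (\<Sum>i\<in>A. cs (f i) v)"
  by (rule ext) (simp add: fapp sum_distrib_right)

lemma vecs_0 [simp]: "0 \<in> vecs S" by (simp add: vecs_def fapp)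
lemma vecs_add [simp]: "v \<in> vecs S \<Longrightarrow> w \<in> vecs S \<Longrightarrow> v + w \<in> vecs S" by (simp add: vecs_def fapp)
lemma vecs_diff [simp]: "v \<in> vecs S \<Longrightarrow> w \<in> vecs S \<Longrightarrow> v - w \<in> vecs S" by (simp add: vecs_def fapp)
lemma vecs_uminus [simp]: "v \<in> vecs S \<Longrightarrow> - v \<in> vecs S" by (simp add: vecs_def fapp)
lemma vecs_cs [simp]: "v \<in> vecs S \<Longrightarrow> cs c v \<in> vecs S" by (simp add: vecs_def fapp)
lemma vecs_dl [simp]: "s \<in> S \<Longrightarrow> dl s \<in> vecs S" by (auto simp: vecs_def dl_def)
lemma vecs_sum: "(\<And>i. i \<in> A \<Longrightarrow> f i \<in> vecs S) \<Longrightarrow> (\<Sum>i\<in>A. f i) \<in> vecs S"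
  by (induction A rule: infinite_finite_induct) auto
lemma vecs_expand:
  assumes "finite S" "v \<in> vecs S" shows "v = (\<Sum>s\<in>S. cs (v s) (dl s))"
proof
  fix x show "v x = (\<Sum>s\<in>S. cs (v s) (dl s)) x"
    using assms by (cases "x \<in> S") (auto simp: fapp dl_def vecs_def if_distrib[of "\<lambda>y. _ * y"] sum.delta' cong: if_cong)
qed

lemma lin_vecs: "lin S S' A \<Longrightarrow> v \<in> vecs S \<Longrightarrow> A v \<in> vecs S'" by (simp add: lin_def)
lemma lin_add: "lin S S' A \<Longrightarrow> v \<in> vecs S \<Longrightarrow> w \<in> vecs S \<Longrightarrow> A (v + w) = A v + A w" by (simp add: lin_def)
lemma lin_0: "lin S S' A \<Longrightarrow> A 0 = 0"
  using lin_add[of S S' A 0 0] by simp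
lemma lin_uminus: assumes "lin S S' A" "v \<in> vecs S" shows "A (- v) = - A v"
proof -
  have "A v + A (- v) = 0"
    using lin_add[of S S' A v "- v"] assms lin_0 vecs_uminus by (metis add.right_inverse)
  then show ?thesis by (metis add.commute eq_neg_iff_add_eq_0)
qed
lemma lin_diff: assumes A: "lin S S' A" and "v \<in> vecs S" "w \<in> vecs S" shows "A (v - w) = A v - A w"
  using lin_add[OF A, of v "- w"] lin_uminus[OF A, of w] assms by simp
lemma lin_sum:
  assumes A: "lin S S' A" and "\<And>i. i \<in> I \<Longrightarrow> f i \<in> vecs S"
  shows "A (\<Sum>i\<in>I. f i) = (\<Sum>i\<in>I. A (f i))"
  using assms(2)
proof (induction I rule: infinite_finite_induct)
  case (insert i I)
  then show ?case using lin_add[OF A, of "f i" "sum f I"] by (simp add: vecs_sum)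
qed (simp_all add: lin_0[OF A])
lemma lin_cs: assumes A: "lin S S' A" and v: "v \<in> vecs S" shows "A (cs c v) = cs c (A v)"
proof -
  have nat: "A (cs (int n) v) = cs (int n) (A v)" for n
  proof (induction n)
    case 0 then show ?case by (simp add: lin_0[OF A])
  next
    case (Suc n) then show ?case
      using lin_add[OF A v vecs_cs[OF v, of "int n"]] by (simp add: cs_add_left)
  qed
  show ?thesis
  proof (cases "c \<ge> 0")
    case True then show ?thesis using nat[of "nat c"] by simp
  next
    case False
    then have "c = - int (nat (- c))" by simp
    then have "cs c v = - cs (int (nat (- c))) v" "cs c (A v) = - cs (int (nat (- c))) (A v)" using cs_minus by metis+
    then show ?thesis using nat[of "nat (- c)"] lin_uminus[OF A vecs_cs[OF v]] by simp
  qed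
qed
lemma lin_comp: "lin S S' A \<Longrightarrow> lin S' S'' B \<Longrightarrow> lin S S'' (\<lambda>v. B (A v))"
  by (simp add: lin_def)
lemma lin_id: "lin S S (\<lambda>v. v)" by (simp add: lin_def)
lemma lin_minus: "lin S S' A \<Longrightarrow> lin S S' B \<Longrightarrow> lin S S' (\<lambda>v. A v - B v)"
  by (auto simp: lin_def algebra_simps)
lemma lin_scale: "lin S S' A \<Longrightarrow> lin S S' (\<lambda>v. cs c (A v))"
  by (auto simp: lin_def cs_add)
lemma lin_setsum: "(\<And>i. i \<in> I \<Longrightarrow> lin S S' (A i)) \<Longrightarrow> lin S S' (\<lambda>v. \<Sum>i\<in>I. A i v)"
  by (auto simp: lin_def sum.distrib vecs_sum)
lemma lin_funpow: "lin S S A \<Longrightarrow> lin S S (A ^^ n)"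
  by (induction n) (auto simp: lin_def)

lemma lin_expand:
  assumes "finite S" "lin S S' A" "v \<in> vecs S" shows "A v = (\<Sum>s\<in>S. cs (v s) (A (dl s)))"
proof -
  have "A v = A (\<Sum>s\<in>S. cs (v s) (dl s))" using vecs_expand[OF assms(1,3)] by simp
  also have "\<dots> = (\<Sum>s\<in>S. A (cs (v s) (dl s)))" by (rule lin_sum[OF assms(2)]) simp
  finally show ?thesis using lin_cs[OF assms(2)] by simp
qed

lemma vecs_lc: "set xs \<subseteq> vecs S \<Longrightarrow> lc c xs \<in> vecs S"
  unfolding lc_def by (intro vecs_sum vecs_cs) auto
lemma lin_lc: assumes "lin S S' A" "set xs \<subseteq> vecs S" shows "A (lc c xs) = lc c (map A xs)"
proof -
  have "\<And>i. i < length xs \<Longrightarrow> xs ! i \<in> vecs S" using assms(2) nth_mem by blast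
  then show ?thesis unfolding lc_def
    by (subst lin_sum[OF assms(1)]) (auto simp: lin_cs[OF assms(1)] intro!: sum.cong)
qed
lemma lc_add: "lc (\<lambda>i. c i + d i) xs = lc c xs + lc d xs"
  by (simp add: lc_def cs_add_left sum.distrib)
lemma lc_diff: "lc (\<lambda>i. c i - d i) xs = lc c xs - lc d xs"
  by (simp add: lc_def cs_diff_left sum_subtractf)
lemma lc_cs: "lc (\<lambda>i. k * c i) xs = cs k (lc c xs)"
  by (simp add: lc_def cs_sum)
lemma lc_Cons: "lc c (x # xs) = cs (c 0) x + lc (\<lambda>i. c (Suc i)) xs"
  by (simp add: lc_def sum.lessThan_Suc_shift del: sum.lessThan_Suc)
lemma lc_apply: "lc c xs x = (\<Sum>i<length xs. c i * (xs ! i) x)"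
  by (simp add: lc_def fapp)
lemma lc_cong: "(\<And>i. i < length xs \<Longrightarrow> c i = d i) \<Longrightarrow> lc c xs = lc d xs"
  by (simp add: lc_def)
lemma lc_sum: "(\<Sum>j\<in>J. lc (c j) xs) = lc (\<lambda>i. \<Sum>j\<in>J. c j i) xs"
  by (simp add: lc_def cs_sum_left sum.swap[of _ J])

definition cg :: "int \<Rightarrow> ('i \<Rightarrow> int) \<Rightarrow> ('i \<Rightarrow> int) \<Rightarrow> bool" where
  "cg k v w \<longleftrightarrow> (\<forall>x. k dvd v x - w x)"

lemma cg_refl [simp]: "cg k v v" by (simp add: cg_def fapp)
lemma cg_iff_cong: "cg k v w \<longleftrightarrow> (\<forall>x. [v x = w x] (mod k))"
  by (simp add: cg_def cong_iff_dvd_diff)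
lemma cg_sym: "cg k v w \<Longrightarrow> cg k w v" by (simp add: cg_iff_cong cong_sym)
lemma cg_trans [trans]: "cg k u v \<Longrightarrow> cg k v w \<Longrightarrow> cg k u w"
  unfolding cg_iff_cong by (blast intro: cong_trans)
lemma cg_eq_trans [trans]: "cg k u v \<Longrightarrow> v = w \<Longrightarrow> cg k u w" by simp
lemma eq_cg_trans [trans]: "u = v \<Longrightarrow> cg k v w \<Longrightarrow> cg k u w" by simp
lemma cg_add: "cg k v w \<Longrightarrow> cg k v' w' \<Longrightarrow> cg k (v + v') (w + w')"
  unfolding cg_iff_cong by (simp add: fapp cong_add)
lemma cg_diff: "cg k v w \<Longrightarrow> cg k v' w' \<Longrightarrow> cg k (v - v') (w - w')"
  unfolding cg_iff_cong by (simp add: fapp cong_diff)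
lemma cg_cs: "cg k v w \<Longrightarrow> cg k (cs c v) (cs c w)"
  unfolding cg_iff_cong by (simp add: fapp cong_scalar_left)
lemma cg_sum: "(\<And>i. i \<in> A \<Longrightarrow> cg k (f i) (g i)) \<Longrightarrow> cg k (\<Sum>i\<in>A. f i) (\<Sum>i\<in>A. g i)"
  by (induction A rule: infinite_finite_induct) (auto intro: cg_add)
lemma cg_0_cs [simp]: "cg k (cs k v) 0" by (simp add: cg_def fapp)
lemma cg_iff: assumes "v \<in> vecs S" "w \<in> vecs S" shows "cg k v w \<longleftrightarrow> (\<exists>u\<in>vecs S. v = w + cs k u)"
proof
  assume c: "cg k v w"
  define u where "u = (\<lambda>x. (v x - w x) div k)"
  have "v = w + cs k u" using c by (auto simp: cg_def u_def fun_eq_iff fapp)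
  moreover have "u \<in> vecs S" using assms by (auto simp: vecs_def u_def)
  ultimately show "\<exists>u\<in>vecs S. v = w + cs k u" by blast
qed (auto simp: cg_def fapp)
lemma lin_cg: assumes A: "lin S S' A" and "v \<in> vecs S" "w \<in> vecs S" "cg k v w" shows "cg k (A v) (A w)"
proof -
  obtain u where "u \<in> vecs S" "v = w + cs k u" using assms cg_iff by blast
  then have "A v = A w + cs k (A u)"
    using lin_add[OF A assms(3) vecs_cs] lin_cs[OF A] by simp
  then show ?thesis by (auto simp: cg_def fapp)
qed
lemma cg_cs_coeff: "[c = d] (mod k) \<Longrightarrow> cg k (cs c v) (cs d v)"
  unfolding cg_iff_cong by (simp add: fapp cong_scalar_right)
lemma cg_dvd: "cg k v w \<Longrightarrow> l dvd k \<Longrightarrow> cg l v w" unfolding cg_def by (meson dvd_trans)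

text \<open>Subspaces of the reduction of \<open>\<int>[S]\<close> modulo \<open>p\<close> are represented by their preimages in
\<open>\<int>[S]\<close>, that is, by the subgroups between \<open>p\<int>[S]\<close> and \<open>\<int>[S]\<close> (\<open>subm\<close> below). Thus integral vectors, which are needed for traces,
and linear algebra over the field with \<open>p\<close> elements live on the same type.\<close>
locale fp_vecs =
  fixes S :: "'i set" and p :: nat
  assumes fin: "finite S" and prime: "Factorial_Ring.prime p"
begin

abbreviation "V \<equiv> vecs S"
abbreviation "cp \<equiv> cg (int p)"

lemma p_gt_1: "p > 1" by (rule prime_gt_1_nat[OF prime])
lemma p_pos [simp]: "p > 0" by (rule prime_gt_0_nat[OF prime])

definition subm :: "('i \<Rightarrow> int) set \<Rightarrow> bool" where
  "subm U \<longleftrightarrow> U \<subseteq> V \<and> 0 \<in> U \<and> (\<forall>v\<in>U. \<forall>w\<in>U. v + w \<in> U) \<and> (\<forall>v\<in>U. - v \<in> U)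
     \<and> (\<forall>v\<in>V. cs (int p) v \<in> U)"

definition pV :: "('i \<Rightarrow> int) set" where "pV = cs (int p) ` V"

definition addl :: "('i \<Rightarrow> int) set \<Rightarrow> ('i \<Rightarrow> int) \<Rightarrow> ('i \<Rightarrow> int) set" where
  "addl U x = {u + cs c x | u c. u \<in> U}"

text \<open>Lists serve as generating families, because bases will be indexed by numbers.\<close>
fun ext :: "('i \<Rightarrow> int) set \<Rightarrow> ('i \<Rightarrow> int) list \<Rightarrow> ('i \<Rightarrow> int) set" where
  "ext U [] = U"
| "ext U (x # xs) = addl (ext U xs) x"

definition red :: "('i \<Rightarrow> int) \<Rightarrow> 'i \<Rightarrow> int" where "red v = (\<lambda>x. v x mod int p)"
definition Box :: "('i \<Rightarrow> int) set" where "Box = {v\<in>V. \<forall>x. 0 \<le> v x \<and> v x < int p}"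

text \<open>The representatives with entries in \<open>{0..<p}\<close> count the elements of the quotient of \<open>U\<close> by \<open>p\<int>[S]\<close>;
this number is \<open>p\<close> to the power of the dimension \<open>dm U\<close>.\<close>
definition cd :: "('i \<Rightarrow> int) set \<Rightarrow> nat" where "cd U = card (U \<inter> Box)"

lemma subm_V: "subm U \<Longrightarrow> v \<in> U \<Longrightarrow> v \<in> V" by (auto simp: subm_def)
lemma subm_0: "subm U \<Longrightarrow> 0 \<in> U" by (simp add: subm_def)
lemma subm_add: "subm U \<Longrightarrow> v \<in> U \<Longrightarrow> w \<in> U \<Longrightarrow> v + w \<in> U" by (simp add: subm_def)
lemma subm_uminus: "subm U \<Longrightarrow> v \<in> U \<Longrightarrow> - v \<in> U" by (simp add: subm_def)
lemma subm_diff: "subm U \<Longrightarrow> v \<in> U \<Longrightarrow> w \<in> U \<Longrightarrow> v - w \<in> U"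
  using subm_add[of U v "- w"] subm_uminus by simp
lemma subm_p: "subm U \<Longrightarrow> v \<in> V \<Longrightarrow> cs (int p) v \<in> U" by (simp add: subm_def)
lemma subm_cs: assumes "subm U" "v \<in> U" shows "cs c v \<in> U"
proof -
  have nat: "cs (int n) v \<in> U" for n
    by (induction n) (use assms in \<open>auto simp: subm_0 cs_add_left subm_add\<close>)
  show ?thesis
  proof (cases "c \<ge> 0")
    case True then show ?thesis using nat[of "nat c"] by simp
  next
    case False
    then have "c = - int (nat (- c))" by simp
    then have "cs c v = - cs (int (nat (- c))) v" using cs_minus by metis
    then show ?thesis using nat[of "nat (- c)"] assms by (simp add: subm_uminus)
  qed
qed
lemma subm_sum: "subm U \<Longrightarrow> (\<And>i. i \<in> I \<Longrightarrow> f i \<in> U) \<Longrightarrow> (\<Sum>i\<in>I. f i) \<in> U"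
  by (induction I rule: infinite_finite_induct) (auto simp: subm_0 subm_add)
lemma subm_lc: "subm U \<Longrightarrow> set xs \<subseteq> U \<Longrightarrow> lc c xs \<in> U"
  unfolding lc_def by (intro subm_sum subm_cs) auto
lemma subm_cp: assumes "subm U" "v \<in> U" "w \<in> V" "cp v w" shows "w \<in> U"
proof -
  obtain u where "u \<in> V" "w = v + cs (int p) u" using assms cg_iff[of w S v "int p"] cg_sym subm_V by metis
  then show ?thesis using assms subm_add subm_p by simp
qed

lemma subm_vecs [simp]: "subm V" by (simp add: subm_def)
lemma subm_pV [simp]: "subm pV"
  unfolding subm_def
proof (intro conjI ballI)
  show "pV \<subseteq> V" unfolding pV_def by (rule image_subsetI) (rule vecs_cs)
  have "cs (int p) 0 \<in> pV" unfolding pV_def by (rule imageI) (rule vecs_0)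
  then show "0 \<in> pV" by simp
next
  fix v w assume "v \<in> pV" "w \<in> pV"
  then obtain a b where "a \<in> V" "b \<in> V" "v = cs (int p) a" "w = cs (int p) b" unfolding pV_def by blast
  moreover from this have "v + w = cs (int p) (a + b)" by (simp only: cs_add)
  ultimately show "v + w \<in> pV" unfolding pV_def by (simp add: image_eqI)
next
  fix v assume "v \<in> pV"
  then obtain a where "a \<in> V" "v = cs (int p) a" unfolding pV_def by blast
  moreover from this have "- v = cs (int p) (- a)" by (simp add: cs_uminus)
  ultimately show "- v \<in> pV" unfolding pV_def by (simp add: image_eqI)
next
  fix v assume "v \<in> V" then show "cs (int p) v \<in> pV" unfolding pV_def by blast
qed
lemma pV_iff: "v \<in> pV \<longleftrightarrow> v \<in> V \<and> cp v 0"
  using cg_iff[of v S 0 "int p"] by (auto simp: pV_def)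
lemma pV_subset: "subm U \<Longrightarrow> pV \<subseteq> U" by (auto simp: pV_def subm_p)
lemma subm_Int: "subm U \<Longrightarrow> subm U' \<Longrightarrow> subm (U \<inter> U')" by (auto simp: subm_def)

lemma subm_addl: assumes "subm U" "x \<in> V" shows "subm (addl U x)"
  unfolding subm_def
proof (intro conjI ballI)
  show "addl U x \<subseteq> V" using assms by (auto simp: addl_def subm_V)
  show "0 \<in> addl U x" unfolding addl_def using subm_0[OF assms(1)] by (force intro: exI[of _ 0])
next
  fix v w assume "v \<in> addl U x" "w \<in> addl U x"
  then obtain a b c d where "v = a + cs c x" "w = b + cs d x" "a \<in> U" "b \<in> U" by (auto simp: addl_def)
  moreover from this have "v + w = (a + b) + cs (c + d) x" by (simp add: cs_add_left cs_diff_left algebra_simps)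
  ultimately show "v + w \<in> addl U x" using assms unfolding addl_def by (blast intro: subm_add)
next
  fix v assume "v \<in> addl U x"
  then obtain a c where "v = a + cs c x" "a \<in> U" by (auto simp: addl_def)
  moreover from this have "- v = (- a) + cs (- c) x" by (simp add: cs_add_left cs_diff_left algebra_simps)
  ultimately show "- v \<in> addl U x" using assms unfolding addl_def by (blast intro: subm_uminus)
next
  fix v assume "v \<in> V"
  then have "cs (int p) v + cs 0 x \<in> addl U x" using assms unfolding addl_def by (blast intro: subm_p)
  then show "cs (int p) v \<in> addl U x" by simp
qed

lemma addl_mono: "U \<subseteq> addl U x"
proof
  fix v assume "v \<in> U"
  then have "v + cs 0 x \<in> addl U x" unfolding addl_def by blast
  then show "v \<in> addl U x" by simp
qed
lemma addl_in: assumes "subm U" shows "x \<in> addl U x"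
proof -
  have "0 + cs 1 x \<in> addl U x" unfolding addl_def using subm_0[OF assms] by blast
  then show ?thesis by simp
qed
lemma addl_least: "subm U' \<Longrightarrow> U \<subseteq> U' \<Longrightarrow> x \<in> U' \<Longrightarrow> addl U x \<subseteq> U'"
  by (auto simp: addl_def intro!: subm_add subm_cs)

lemma subm_ext: "subm U \<Longrightarrow> set xs \<subseteq> V \<Longrightarrow> subm (ext U xs)"
  by (induction xs) (auto simp: subm_addl)
lemma ext_mono: "U \<subseteq> ext U xs"
proof (induction xs)
  case (Cons x xs) then show ?case using addl_mono[of "ext U xs" x] by simp
qed simp
lemma ext_set: "subm U \<Longrightarrow> set xs \<subseteq> V \<Longrightarrow> set xs \<subseteq> ext U xs"
proof (induction xs)
  case (Cons x xs)
  then have "subm (ext U xs)" "set xs \<subseteq> ext U xs" using subm_ext by auto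
  then show ?case using addl_mono[of "ext U xs" x] addl_in[of "ext U xs" x] by auto
qed simp
lemma ext_least: "subm U' \<Longrightarrow> U \<subseteq> U' \<Longrightarrow> set xs \<subseteq> U' \<Longrightarrow> ext U xs \<subseteq> U'"
  by (induction xs) (auto simp: addl_least)
lemma ext_append: "ext U (xs @ ys) = ext (ext U ys) xs"
  by (induction xs) auto

lemma ext_iff: "v \<in> ext U xs \<longleftrightarrow> (\<exists>c. \<exists>u\<in>U. v = u + lc c xs)"
proof (induction xs arbitrary: v)
  case Nil then show ?case by (simp add: lc_def)
next
  case (Cons x xs)
  show ?case
  proof
    assume "v \<in> ext U (x # xs)"
    then obtain w k where w: "w \<in> ext U xs" "v = w + cs k x" by (auto simp: addl_def)
    then obtain c u where "u \<in> U" "w = u + lc c xs" using Cons by blast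
    then have "v = u + lc (\<lambda>i. case i of 0 \<Rightarrow> k | Suc i \<Rightarrow> c i) (x # xs)"
      using w by (simp add: lc_Cons algebra_simps)
    then show "\<exists>c. \<exists>u\<in>U. v = u + lc c (x # xs)" using \<open>u \<in> U\<close> by blast
  next
    assume "\<exists>c. \<exists>u\<in>U. v = u + lc c (x # xs)"
    then obtain c u where "u \<in> U" "v = u + lc c (x # xs)" by blast
    then have "v = (u + lc (\<lambda>i. c (Suc i)) xs) + cs (c 0) x" by (simp add: lc_Cons algebra_simps)
    then show "v \<in> ext U (x # xs)" using Cons \<open>u \<in> U\<close> by (auto simp: addl_def)
  qed
qed

lemma ext_pV_iff: assumes "set xs \<subseteq> V" "v \<in> V" shows "v \<in> ext pV xs \<longleftrightarrow> (\<exists>c. cp v (lc c xs))"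
proof
  assume "v \<in> ext pV xs"
  then obtain c u where "u \<in> pV" "v = u + lc c xs" by (auto simp: ext_iff)
  then show "\<exists>c. cp v (lc c xs)" by (auto simp: pV_iff cg_def fapp intro!: exI[of _ c])
next
  assume "\<exists>c. cp v (lc c xs)"
  then obtain c where c: "cp v (lc c xs)" by blast
  have "v - lc c xs \<in> pV" using c assms vecs_lc[of xs S c] by (auto simp: pV_iff cg_def fapp)
  moreover have "v = (v - lc c xs) + lc c xs" by simp
  ultimately show "v \<in> ext pV xs" unfolding ext_iff by blast
qed

subsection \<open>Counting\<close>
lemma red_cp: "cp v (red v)" by (auto simp: cg_def red_def minus_mod_eq_mult_div)
lemma red_vecs [simp]: "v \<in> V \<Longrightarrow> red v \<in> V" by (simp add: vecs_def red_def)
lemma red_Box: "v \<in> V \<Longrightarrow> red v \<in> Box" by (auto simp: Box_def) (auto simp: red_def)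
lemma Box_cp_eq: "v \<in> Box \<Longrightarrow> w \<in> Box \<Longrightarrow> cp v w \<Longrightarrow> v = w"
  unfolding Box_def cg_def fun_eq_iff by (auto simp: mod_eq_dvd_iff[symmetric])
lemma red_mem: "subm U \<Longrightarrow> v \<in> U \<Longrightarrow> red v \<in> U"
  using subm_cp red_cp red_vecs subm_V by metis

lemma bij_Box: "bij_betw (\<lambda>f x. if x \<in> S then f x else 0) (S \<rightarrow>\<^sub>E {0..<int p}) Box"
  by (rule bij_betw_byWitness[where f' = "\<lambda>v. restrict v S"])
     (auto simp: Box_def vecs_def fun_eq_iff PiE_def extensional_def Pi_def)
lemma finite_Box [simp]: "finite Box"
  using bij_Box fin bij_betw_finite[OF bij_Box] by (simp add: finite_PiE)
lemma card_Box: "card Box = p ^ card S"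
  using bij_betw_same_card[OF bij_Box] fin by (simp add: card_PiE)
lemma finite_cd [simp]: "finite (U \<inter> Box)" by simp
lemma cd_V: "cd V = p ^ card S"
  using card_Box by (simp add: cd_def Box_def Int_absorb1 Collect_conj_eq[symmetric] inf.absorb2 Int_def conj_ac)
lemma cd_pV: "cd pV = 1"
proof -
  have "pV \<inter> Box = {0}"
  proof -
    have "v = 0" if "v \<in> pV" "v \<in> Box" for v
      using Box_cp_eq[of v 0] that by (auto simp: pV_iff Box_def fapp)
    moreover have "0 \<in> Box" by (auto simp: Box_def fapp)
    ultimately show ?thesis using subm_0[OF subm_pV] by blast
  qed
  then show ?thesis by (simp add: cd_def)
qed
lemma cd_mono: "U \<subseteq> U' \<Longrightarrow> cd U \<le> cd U'" unfolding cd_def by (intro card_mono) auto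
lemma cd_eq: assumes "subm U" "subm U'" "U \<subseteq> U'" "cd U = cd U'" shows "U = U'"
proof -
  have e: "U \<inter> Box = U' \<inter> Box"
    using assms unfolding cd_def by (intro card_subset_eq) auto
  have "v \<in> U" if "v \<in> U'" for v
  proof -
    have "red v \<in> U" using that e assms red_mem red_Box subm_V by blast
    then show ?thesis using subm_cp[OF assms(1)] red_cp cg_sym that subm_V[OF assms(2)] by blast
  qed
  then show ?thesis using assms by blast
qed
lemma cd_less: "subm U \<Longrightarrow> subm U' \<Longrightarrow> U \<subset> U' \<Longrightarrow> cd U < cd U'"
  using cd_eq cd_mono by (metis le_neq_implies_less order_less_imp_le psubset_imp_subset psubset_eq)
lemma coeff_in: assumes "subm U" "x \<in> V" "cs c x \<in> U" "\<not> int p dvd c" shows "x \<in> U"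
proof -
  have "coprime c (int p)" using assms(4) prime
    by (metis coprime_commute prime_imp_coprime prime_nat_int_transfer)
  then obtain d where d: "[c * d = 1] (mod int p)" using cong_solve_coprime_int by blast
  have "cs d (cs c x) \<in> U" using assms subm_cs by blast
  moreover have "cp (cs d (cs c x)) x"
    using cg_cs_coeff[OF d, of x] by (simp add: mult.commute)
  ultimately show ?thesis using subm_cp assms by blast
qed

lemma cd_addl: assumes U: "subm U" and x: "x \<in> V" "x \<notin> U" shows "cd (addl U x) = p * cd U"
proof -
  let ?f = "\<lambda>(a, c). red (a + cs (int c) x)"
  have "bij_betw ?f ((U \<inter> Box) \<times> {..<p}) (addl U x \<inter> Box)"
    unfolding bij_betw_def
  proof
    show "inj_on ?f ((U \<inter> Box) \<times> {..<p})"
    proof (rule inj_onI, clarify)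
      fix a c b d assume a: "a \<in> U" "a \<in> Box" "b \<in> U" "b \<in> Box" "c < p" "d < p"
        and e: "red (a + cs (int c) x) = red (b + cs (int d) x)"
      have cp: "cp (a + cs (int c) x) (b + cs (int d) x)"
        using red_cp[of "a + cs (int c) x"] red_cp[of "b + cs (int d) x"] e cg_sym cg_trans by metis
      have "cp (a - b) (cs (int d - int c) x)"
        using cp by (auto simp: cg_def fapp algebra_simps)
      then have "cs (int d - int c) x \<in> U"
        using subm_cp[OF U] subm_diff[OF U a(1,3)] x by simp
      then have "int p dvd int d - int c" using coeff_in[OF U x(1)] x(2) by blast
      then have cd: "c = d" using a(5,6)
        by (metis cong_iff_dvd_diff cong_int_iff cong_less_modulus_unique_nat)
      then have "cp a b" using cp by (auto simp: cg_def fapp)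
      then show "a = b \<and> c = d" using Box_cp_eq a cd by blast
    qed
    show "?f ` ((U \<inter> Box) \<times> {..<p}) = addl U x \<inter> Box"
    proof
      show "?f ` ((U \<inter> Box) \<times> {..<p}) \<subseteq> addl U x \<inter> Box"
        using red_mem[OF subm_addl[OF U x(1)]] red_Box subm_V[OF U] x
        by (force simp: addl_def)
      show "addl U x \<inter> Box \<subseteq> ?f ` ((U \<inter> Box) \<times> {..<p})"
      proof
        fix v assume v: "v \<in> addl U x \<inter> Box"
        then obtain u c where u: "u \<in> U" "v = u + cs c x" by (auto simp: addl_def)
        define d where "d = nat (c mod int p)"
        have d: "int d = c mod int p" "d < p" by (auto simp: d_def nat_less_iff)
        have "cp (red u + cs (int d) x) v"
          unfolding u(2) by (intro cg_add cg_sym[OF red_cp] cg_cs_coeff) (simp add: d)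
        then have "cp (red (red u + cs (int d) x)) v" by (rule cg_trans[OF cg_sym[OF red_cp]])
        then have "red (red u + cs (int d) x) = v"
          using Box_cp_eq red_Box u v subm_V[OF U] x by auto
        then show "v \<in> ?f ` ((U \<inter> Box) \<times> {..<p})"
          using d red_mem[OF U u(1)] red_Box[OF subm_V[OF U u(1)]] by (intro image_eqI[of _ _ "(red u, d)"]) auto
      qed
    qed
  qed
  then show ?thesis unfolding cd_def by (auto dest!: bij_betw_same_card simp: card_cartesian_product mult.commute)
qed

lemma addl_same: "subm U \<Longrightarrow> x \<in> U \<Longrightarrow> addl U x = U"
  using addl_least[of U U x] addl_mono by blast

lemma cd_addl_le: "subm U \<Longrightarrow> x \<in> V \<Longrightarrow> cd (addl U x) \<le> p * cd U"
  using cd_addl[of U x] addl_same[of U x] p_gt_1 by (cases "x \<in> U") auto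

lemma cd_ext_le: "subm U \<Longrightarrow> set xs \<subseteq> V \<Longrightarrow> cd (ext U xs) \<le> p ^ length xs * cd U"
proof (induction xs)
  case (Cons x xs)
  then have "cd (ext U (x # xs)) \<le> p * cd (ext U xs)" using cd_addl_le subm_ext by simp
  also have "\<dots> \<le> p * (p ^ length xs * cd U)" using Cons by simp
  finally show ?case by (simp add: mult.assoc)
qed simp

text \<open>Greedy choice of a basis: a vector of \<open>Y\<close> outside the span reached so far multiplies the number of elements by exactly \<open>p\<close>.\<close>
lemma select_basis:
  assumes "subm U" "subm U'" "Y \<subseteq> U'" "U \<subseteq> U'"
    and gen: "\<And>W. subm W \<Longrightarrow> U \<subseteq> W \<Longrightarrow> Y \<subseteq> W \<Longrightarrow> U' \<subseteq> W"
  shows "\<exists>xs. set xs \<subseteq> Y \<and> ext U xs = U' \<and> cd U' = p ^ length xs * cd U"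
  using assms
proof (induction "cd U' - cd U" arbitrary: U rule: less_induct)
  case less
  show ?case
  proof (cases "Y \<subseteq> U")
    case True
    then have "U' = U" using less.prems by blast
    then show ?thesis by (intro exI[of _ "[]"]) auto
  next
    case False
    then obtain x where x: "x \<in> Y" "x \<notin> U" by blast
    then have xV: "x \<in> V" using less.prems subm_V by blast
    let ?U1 = "addl U x"
    have s1: "subm ?U1" "?U1 \<subseteq> U'" "U \<subseteq> ?U1"
      using subm_addl less.prems xV addl_least[of U' U x] x addl_mono by auto
    have c: "cd ?U1 = p * cd U" using cd_addl less.prems xV x by blast
    have "U \<subset> ?U1" using s1 addl_in[OF less.prems(1), of x] x by blast
    then have "cd U < cd ?U1" using cd_less less.prems s1 by blast
    then have lt: "cd U' - cd ?U1 < cd U' - cd U" using cd_mono[OF s1(2)] by simp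
    have "\<exists>xs. set xs \<subseteq> Y \<and> ext ?U1 xs = U' \<and> cd U' = p ^ length xs * cd ?U1"
    proof (rule less.hyps[OF lt s1(1) less.prems(2,3) s1(2)])
      fix W assume "subm W" "?U1 \<subseteq> W" "Y \<subseteq> W" then show "U' \<subseteq> W" using less.prems(5) s1(3) by blast
    qed
    then obtain xs where "set xs \<subseteq> Y" "ext ?U1 xs = U'" "cd U' = p ^ length xs * cd ?U1" by blast
    then show ?thesis using c x by (intro exI[of _ "xs @ [x]"]) (auto simp: ext_append)
  qed
qed

definition dm :: "('i \<Rightarrow> int) set \<Rightarrow> nat" where "dm U = (THE k. cd U = p ^ k)"

lemma dm_unique: "cd U = p ^ k \<Longrightarrow> dm U = k"
  unfolding dm_def using p_gt_1 by (auto intro!: the_equality)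
lemma cd_dm: assumes "subm U" shows "cd U = p ^ dm U"
proof -
  have "\<exists>xs. set xs \<subseteq> U \<and> ext pV xs = U \<and> cd U = p ^ length xs * cd pV"
    by (rule select_basis[OF subm_pV assms subset_refl pV_subset[OF assms]])
  then obtain xs where "set xs \<subseteq> U" "cd U = p ^ length xs * cd pV" by blast
  then have "cd U = p ^ length xs" by (simp add: cd_pV)
  then show ?thesis using dm_unique by simp
qed
lemma dm_V: "dm V = card S" using dm_unique cd_V by blast
lemma dm_pV: "dm pV = 0" using dm_unique[of pV 0] cd_pV by simp
lemma dm_mono: "subm U \<Longrightarrow> subm U' \<Longrightarrow> U \<subseteq> U' \<Longrightarrow> dm U \<le> dm U'"
  using cd_mono[of U U'] power_le_imp_le_exp[OF p_gt_1] by (simp add: cd_dm)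
lemma dm_eq: "subm U \<Longrightarrow> subm U' \<Longrightarrow> U \<subseteq> U' \<Longrightarrow> dm U = dm U' \<Longrightarrow> U = U'"
  using cd_eq by (simp add: cd_dm)
lemma dm_le: "subm U \<Longrightarrow> dm U \<le> card S" using dm_mono[of U V] dm_V subm_V by auto
lemma dm_ext_le: assumes "subm U" "set xs \<subseteq> V" shows "dm (ext U xs) \<le> dm U + length xs"
  using cd_ext_le[OF assms] assms power_le_imp_le_exp[OF p_gt_1, of "dm (ext U xs)" "length xs + dm U"]
  by (simp add: cd_dm subm_ext add.commute flip: power_add)
lemma select_basis_dm:
  assumes "subm U" "subm U'" "Y \<subseteq> U'" "U \<subseteq> U'"
    and gen: "\<And>W. subm W \<Longrightarrow> U \<subseteq> W \<Longrightarrow> Y \<subseteq> W \<Longrightarrow> U' \<subseteq> W"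
  shows "\<exists>xs. set xs \<subseteq> Y \<and> ext U xs = U' \<and> length xs = dm U' - dm U"
proof -
  obtain xs where xs: "set xs \<subseteq> Y" "ext U xs = U'" "cd U' = p ^ length xs * cd U"
    using select_basis[OF assms] by blast
  then have "p ^ dm U' = p ^ (length xs + dm U)" using assms by (simp add: cd_dm power_add)
  then have "dm U' = length xs + dm U" using p_gt_1 by simp
  then show ?thesis using xs by auto
qed

subsection \<open>Bases modulo powers of p\<close>

text \<open>Newton-style lifting: a family spanning modulo \<open>p\<close> spans modulo every power of \<open>p\<close>, because the
remainder is \<open>p\<close> times a vector that can be expanded again.\<close>
lemma span_lift:
  assumes xs: "set xs \<subseteq> V" "ext pV xs = V" and v: "v \<in> V"
  shows "\<exists>c. cg (int p ^ k) v (lc c xs)"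
  using v
proof (induction k arbitrary: v)
  case 0 then show ?case by (simp add: cg_def)
next
  case (Suc k)
  obtain c where "cp v (lc c xs)" using ext_pV_iff xs Suc.prems by blast
  then obtain u where u: "u \<in> V" "v = lc c xs + cs (int p) u" using cg_iff Suc.prems vecs_lc xs(1) by blast
  obtain d where d: "cg (int p ^ k) u (lc d xs)" using Suc.IH u by blast
  have "cg (int p ^ Suc k) v (lc (\<lambda>i. c i + int p * d i) xs)"
    using d unfolding u(2) cg_def by (auto simp: lc_add lc_cs fapp simp flip: right_diff_distrib)
  then show ?case by blast
qed

text \<open>By counting: a map from a set of \<open>p\<^bsup>|S|\<^esup>\<close> coefficient vectors onto as many residues is injective.\<close>
lemma basis_indep1:
  assumes xs: "set xs \<subseteq> V" "ext pV xs = V" "length xs = card S" and c: "cp (lc c xs) 0" and i: "i < card S"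
  shows "int p dvd c i"
proof -
  let ?f = "\<lambda>c. red (lc c xs)" and ?D = "{..<card S} \<rightarrow>\<^sub>E {0..<int p}"
  have surj: "?f ` ?D = Box"
  proof
    show "?f ` ?D \<subseteq> Box" using red_Box vecs_lc xs by blast
    show "Box \<subseteq> ?f ` ?D"
    proof
      fix v assume v: "v \<in> Box"
      then have "v \<in> V" by (simp add: Box_def)
      then obtain d where d: "cp v (lc d xs)" using ext_pV_iff xs by blast
      define e where "e = restrict (\<lambda>i. d i mod int p) {..<card S}"
      have "cp (lc e xs) (lc d xs)"
        unfolding lc_def by (intro cg_sum cg_cs_coeff) (auto simp: e_def xs)
      then have "cp (red (lc e xs)) v"
        by (intro cg_trans[OF cg_sym[OF red_cp]] cg_trans[OF _ cg_sym[OF d]])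
      then have "?f e = v" by (intro Box_cp_eq v red_Box vecs_lc xs)
      moreover have "e \<in> ?D" by (auto simp: e_def)
      ultimately show "v \<in> ?f ` ?D" by blast
    qed
  qed
  have "card (?f ` ?D) = card ?D" unfolding surj card_Box by (simp add: card_PiE)
  then have inj: "inj_on ?f ?D" by (intro eq_card_imp_inj_on) (auto intro!: finite_PiE)
  define e where "e = restrict (\<lambda>i. c i mod int p) {..<card S}"
  define z :: "nat \<Rightarrow> int" where "z = restrict (\<lambda>i. 0) {..<card S}"
  have "cp (lc e xs) (lc c xs)"
    unfolding lc_def by (intro cg_sum cg_cs_coeff) (auto simp: e_def xs)
  then have "cp (red (lc e xs)) 0" by (intro cg_trans[OF cg_sym[OF red_cp]] cg_trans[OF _ c])
  moreover have "lc z xs = 0" using lc_cong[of xs z "\<lambda>i. 0"] xs by (simp add: z_def lc_def)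
  ultimately have "?f e = ?f z" using Box_cp_eq[of "?f e" 0] red_Box[OF vecs_lc[OF xs(1)]]
    by (auto simp: red_def Box_def zero_fun_def vecs_def)
  moreover have "e \<in> ?D" "z \<in> ?D" by (auto simp: e_def z_def)
  ultimately have "e = z" using inj by (auto dest: inj_onD)
  then have "e i = z i" by simp
  then show ?thesis using i by (auto simp: e_def z_def)
qed

lemma basis_indep:
  assumes xs: "set xs \<subseteq> V" "ext pV xs = V" "length xs = card S" and i: "i < card S"
    and c: "cg (int p ^ k) (lc c xs) 0"
  shows "int p ^ k dvd c i"
  using c
proof (induction k arbitrary: c)
  case (Suc k)
  have "cp (lc c xs) 0" using Suc.prems by (rule cg_dvd) simp
  then have d: "int p dvd c j" if "j < card S" for j using basis_indep1[OF xs] that by blast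
  define d where "d = (\<lambda>i. c i div int p)"
  have c: "c j = int p * d j" if "j < card S" for j using d[OF that] by (simp add: d_def)
  have "lc c xs = cs (int p) (lc d xs)" using c xs lc_cong[of xs c "\<lambda>i. int p * d i"] by (simp add: lc_cs)
  then have "cg (int p ^ k) (lc d xs) 0" using Suc.prems p_gt_1 by (auto simp: cg_def fapp)
  then have "int p ^ k dvd d i" using Suc.IH by blast
  then show ?case using c[OF i] by simp
qed simp

text \<open>A basis modulo \<open>p\<close> need not be a basis of \<open>\<int>[S]\<close>, but modulo \<open>p\<^sup>k\<close> it is as good as one for computing
traces. The traces needed later are recovered from all their residues modulo powers of \<open>p\<close>.\<close>
lemma trace_basis:
  assumes xs: "set xs \<subseteq> V" "ext pV xs = V" "length xs = card S" and A: "lin S S A"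
    and a: "\<And>l. l < card S \<Longrightarrow> cg (int p ^ k) (A (xs ! l)) (lc (a l) xs)"
  shows "[tr S A = (\<Sum>l<card S. a l l)] (mod int p ^ k)"
proof -
  let ?n = "card S" and ?P = "int p ^ k"
  have "\<forall>s\<in>S. \<exists>c. cg ?P (dl s) (lc c xs)" using span_lift[OF xs(1,2)] by simp
  then obtain b where b: "\<And>s. s \<in> S \<Longrightarrow> cg ?P (dl s) (lc (b s) xs)" by metis
  have xV: "l < ?n \<Longrightarrow> xs ! l \<in> V" for l using xs nth_mem by fastforce
  have delta: "[(\<Sum>s\<in>S. (xs ! l) s * b s i) = (if i = l then 1 else 0)] (mod ?P)" if "l < ?n" "i < ?n" for l i
  proof -
    have "cg ?P (xs ! l) (\<Sum>s\<in>S. cs ((xs ! l) s) (lc (b s) xs))"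
      by (subst vecs_expand[OF fin xV[OF that(1)]]) (intro cg_sum cg_cs b)
    also have "(\<Sum>s\<in>S. cs ((xs ! l) s) (lc (b s) xs)) = lc (\<lambda>i. \<Sum>s\<in>S. (xs ! l) s * b s i) xs"
      by (simp add: lc_cs flip: lc_sum)
    finally have 1: "cg ?P (xs ! l) (lc (\<lambda>i. \<Sum>s\<in>S. (xs ! l) s * b s i) xs)" .
    have "lc (\<lambda>i. if i = l then 1 else 0) xs = (\<Sum>i<length xs. if i = l then xs ! l else 0)"
      unfolding lc_def by (intro sum.cong) auto
    also have "\<dots> = xs ! l" using that xs by simp
    finally have "cg ?P (lc (\<lambda>i. (\<Sum>s\<in>S. (xs ! l) s * b s i) - (if i = l then 1 else 0)) xs) 0"
      using 1 by (simp only: lc_diff) (auto simp: cg_def fapp dest: dvd_diff_commute[THEN iffD1])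
    then have "?P dvd (\<Sum>s\<in>S. (xs ! l) s * b s i) - (if i = l then 1 else 0)"
      by (rule basis_indep[OF xs that(2)])
    then show ?thesis by (simp only: cong_iff_dvd_diff)
  qed
  have "[tr S A = (\<Sum>s\<in>S. \<Sum>l<?n. b s l * (\<Sum>i<?n. a l i * (xs ! i) s))] (mod ?P)"
    unfolding tr_def
  proof (rule cong_sum)
    fix s assume s: "s \<in> S"
    have "cg ?P (A (dl s)) (A (lc (b s) xs))"
      by (rule lin_cg[OF A _ vecs_lc[OF xs(1)] b[OF s]]) (simp add: s)
    also have "A (lc (b s) xs) = (\<Sum>l<?n. cs (b s l) (A (xs ! l)))"
      using lin_lc[OF A xs(1)] xs(3) by (simp add: lc_def)
    also have "cg ?P \<dots> (\<Sum>l<?n. cs (b s l) (lc (a l) xs))"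
      by (intro cg_sum cg_cs a) simp
    finally have "?P dvd A (dl s) s - (\<Sum>l<?n. cs (b s l) (lc (a l) xs)) s" by (simp add: cg_def)
    then show "[A (dl s) s = (\<Sum>l<?n. b s l * (\<Sum>i<?n. a l i * (xs ! i) s))] (mod ?P)"
      by (simp add: cong_iff_dvd_diff fapp lc_apply xs)
  qed
  also have "(\<Sum>s\<in>S. \<Sum>l<?n. b s l * (\<Sum>i<?n. a l i * (xs ! i) s))
      = (\<Sum>l<?n. \<Sum>i<?n. a l i * (\<Sum>s\<in>S. (xs ! i) s * b s l))"
  proof -
    have "(\<Sum>s\<in>S. \<Sum>l<?n. b s l * (\<Sum>i<?n. a l i * (xs ! i) s))
       = (\<Sum>s\<in>S. \<Sum>l<?n. \<Sum>i<?n. a l i * ((xs ! i) s * b s l))"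
      by (simp add: sum_distrib_left mult_ac)
    also have "\<dots> = (\<Sum>l<?n. \<Sum>s\<in>S. \<Sum>i<?n. a l i * ((xs ! i) s * b s l))" by (rule sum.swap)
    also have "\<dots> = (\<Sum>l<?n. \<Sum>i<?n. \<Sum>s\<in>S. a l i * ((xs ! i) s * b s l))"
      by (intro sum.cong refl sum.swap)
    finally show ?thesis by (simp add: sum_distrib_left)
  qed
  also have "[\<dots> = (\<Sum>l<?n. \<Sum>i<?n. a l i * (if l = i then 1 else 0))] (mod ?P)"
    by (intro cong_sum cong_mult cong_refl delta) auto
  also have "(\<Sum>l<?n. \<Sum>i<?n. a l i * (if l = i then 1 else 0)) = (\<Sum>l<?n. a l l)"
    by (simp add: if_distrib[of "\<lambda>y. _ * y"] cong: if_cong)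
  finally show ?thesis .
qed

end

section \<open>Operators of order p and the trace of their norm\<close>
lemma sum_const_cs: "(\<Sum>i<n. v) = cs (int n) v"
  by (induction n) (simp_all add: cs_add_left add.commute del: sum_constant)

lemma lc_append: "lc c (xs @ ys) = lc c xs + lc (\<lambda>i. c (length xs + i)) ys"
proof -
  have "lc c (xs @ ys) = (\<Sum>i\<in>{..<length xs} \<union> {length xs..<length xs + length ys}. cs (c i) ((xs @ ys) ! i))"
    unfolding lc_def by (intro sum.cong) auto
  also have "\<dots> = (\<Sum>i<length xs. cs (c i) ((xs @ ys) ! i)) + (\<Sum>i\<in>{length xs..<length xs + length ys}. cs (c i) ((xs @ ys) ! i))"
    by (rule sum.union_disjoint) auto
  also have "(\<Sum>i<length xs. cs (c i) ((xs @ ys) ! i)) = lc c xs"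
    unfolding lc_def by (intro sum.cong) (auto simp: nth_append)
  also have "(\<Sum>i\<in>{length xs..<length xs + length ys}. cs (c i) ((xs @ ys) ! i)) = lc (\<lambda>i. c (length xs + i)) ys"
    unfolding lc_def
    by (rule sum.reindex_bij_witness[where i = "\<lambda>i. length xs + i" and j = "\<lambda>i. i - length xs"])
       (auto simp: nth_append)
  finally show ?thesis .
qed

lemma lc_single: "l < length xs \<Longrightarrow> lc (\<lambda>i. if i = l then k else 0) xs = cs k (xs ! l)"
proof -
  assume l: "l < length xs"
  have "lc (\<lambda>i. if i = l then k else 0) xs = (\<Sum>i<length xs. if i = l then cs k (xs ! l) else 0)"
    unfolding lc_def by (intro sum.cong) auto
  then show ?thesis using l by simp
qed

lemma lc_zero [simp]: "lc (\<lambda>i. 0) xs = 0" by (simp add: lc_def)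

lemma eq_if_cong_powers:
  fixes a b :: int
  assumes "p > (1::nat)" "\<And>s. [a = b] (mod int p ^ s)" shows "a = b"
proof (rule ccontr)
  assume "a \<noteq> b"
  define s where "s = nat \<bar>a - b\<bar>"
  have "s < p ^ s" using assms(1) by (simp add: power_gt_expt)
  then have "\<bar>a - b\<bar> < int p ^ s" by (simp add: s_def nat_less_iff)
  moreover have "int p ^ s dvd a - b" using assms(2)[of s] by (simp add: cong_iff_dvd_diff)
  ultimately show False using \<open>a \<noteq> b\<close> dvd_imp_le_int[of "a - b" "int p ^ s"] by simp
qed

lemma funpow_lin_commute:
  assumes "lin S S A" "lin S S B" "\<And>v. v \<in> vecs S \<Longrightarrow> A (B v) = B (A v)" "v \<in> vecs S"
  shows "(A ^^ n) (B v) = B ((A ^^ n) v)"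
  using assms(4)
proof (induction n)
  case (Suc n) then show ?case using assms(3) lin_vecs[OF lin_funpow[OF assms(1)]] by simp
qed simp

text \<open>The binomial theorem for an operator and a scalar.\<close>
lemma binom_op:
  assumes A: "lin S S A" and B: "\<And>v. v \<in> vecs S \<Longrightarrow> B v = A v - cs k v" and v: "v \<in> vecs S"
  shows "(A ^^ n) v = (\<Sum>i\<le>n. cs (int (n choose i) * k ^ (n - i)) ((B ^^ i) v))"
proof (induction n)
  case 0 then show ?case by simp
next
  case (Suc n)
  have wV: "(B ^^ i) v \<in> vecs S" for i
    by (induction i) (use v B lin_vecs[OF A] in auto)
  define w where "w i = (B ^^ i) v" for i
  have w: "w i \<in> vecs S" for i using wV by (simp add: w_def)
  have Aw: "A (w i) = w (Suc i) + cs k (w i)" for i using B[OF w[of i]] by (simp add: w_def)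
  have "(A ^^ Suc n) v = A (\<Sum>i\<le>n. cs (int (n choose i) * k ^ (n - i)) (w i))"
    using Suc by (simp add: w_def)
  also have "\<dots> = (\<Sum>i\<le>n. cs (int (n choose i) * k ^ (n - i)) (w (Suc i) + cs k (w i)))"
    by (subst lin_sum[OF A]) (auto simp: w lin_cs[OF A] Aw)
  also have "\<dots> = (\<Sum>i\<le>n. cs (int (n choose i) * k ^ (n - i)) (w (Suc i)))
      + (\<Sum>i\<le>n. cs (int (n choose i) * k ^ (Suc n - i)) (w i))"
    by (simp add: cs_add sum.distrib Suc_diff_le mult_ac)
  also have "(\<Sum>i\<le>n. cs (int (n choose i) * k ^ (Suc n - i)) (w i))
      = (\<Sum>i\<le>Suc n. cs (int (n choose i) * k ^ (Suc n - i)) (w i))"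
    by (simp add: binomial_eq_0)
  also have "\<dots> = cs (k ^ Suc n) (w 0) + (\<Sum>i\<le>n. cs (int (n choose Suc i) * k ^ (n - i)) (w (Suc i)))"
    by (subst sum.atMost_Suc_shift) simp
  also have "(\<Sum>i\<le>n. cs (int (n choose i) * k ^ (n - i)) (w (Suc i)))
      + (cs (k ^ Suc n) (w 0) + (\<Sum>i\<le>n. cs (int (n choose Suc i) * k ^ (n - i)) (w (Suc i))))
      = cs (k ^ Suc n) (w 0) + (\<Sum>i\<le>n. cs (int (Suc n choose Suc i) * k ^ (n - i)) (w (Suc i)))"
    by (simp add: algebra_simps cs_add_left sum.distrib)
  also have "\<dots> = (\<Sum>i\<le>Suc n. cs (int (Suc n choose i) * k ^ (Suc n - i)) (w i))"
    by (subst sum.atMost_Suc_shift) simp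
  finally show ?case by (simp add: w_def)
qed

lemma prime_dvd_choose_prime_power:
  assumes "Factorial_Ring.prime (p::nat)" "0 < i" "i < p ^ e" shows "p dvd (p ^ e choose i)"
proof (rule ccontr)
  assume "\<not> p dvd (p ^ e choose i)"
  then have "coprime (p ^ e) (p ^ e choose i)"
    using assms(1) by (simp add: prime_imp_coprime)
  moreover have "i * (p ^ e choose i) = p ^ e * ((p ^ e - 1) choose (i - 1))"
    by (rule times_binomial_minus1_eq[OF assms(2)])
  then have "p ^ e dvd i * (p ^ e choose i)" by simp
  ultimately have "p ^ e dvd i" by (simp add: coprime_dvd_mult_left_iff)
  then show False using assms(2,3) by (simp add: nat_dvd_not_less)
qed

text \<open>Used for the dimensions of successive quotients by powers of a nilpotent operator: they do not increase,
and if the first \<open>Q\<close> of them carry no more than the average, they are all equal.\<close>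
lemma nonincreasing_sum:
  fixes c :: "nat \<Rightarrow> nat"
  assumes mono: "\<And>i. Suc i < p * Q \<Longrightarrow> c (Suc i) \<le> c i" and p: "p \<ge> 2" "Q > 0"
    and le: "p * (\<Sum>i<Q. c i) \<le> (\<Sum>i<p * Q. c i)"
  shows "(p * Q) * c 0 = (\<Sum>i<p * Q. c i)"
proof -
  have dec: "c j \<le> c i" if "i \<le> j" "j < p * Q" for i j
    using that
  proof (induction j rule: dec_induct)
    case (step n) then show ?case using mono[of n] by simp
  qed simp
  have Q: "Q < p * Q" using p by simp
  have split: "(\<Sum>i<p * Q. c i) = (\<Sum>i<Q. c i) + (\<Sum>i=Q..<p * Q. c i)"
    using Q by (metis less_imp_le_nat lessThan_atLeast0 sum.atLeastLessThan_concat zero_le)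
  have tail: "(\<Sum>i=Q..<p * Q. c i) \<le> (\<Sum>i=Q..<p * Q. c Q)" by (intro sum_mono dec) auto
  then have tail': "(\<Sum>i=Q..<p * Q. c i) \<le> (p * Q - Q) * c Q" by simp
  have head: "(\<Sum>i<Q. c i) \<ge> (\<Sum>i<Q. c Q)" by (intro sum_mono dec) (use Q in auto)
  obtain r where r: "p = Suc r" "r > 0" using p by (cases p) auto
  have rS: "r * (\<Sum>i<Q. c i) \<le> (\<Sum>i=Q..<p * Q. c i)" using le split r by simp
  also have "\<dots> \<le> r * (Q * c Q)" using tail' r by (simp add: mult.assoc)
  finally have "(\<Sum>i<Q. c i) \<le> Q * c Q" using r by simp
  then have eqS: "(\<Sum>i<Q. c i) = (\<Sum>i<Q. c Q)" using head by simp
  have all: "\<forall>i\<in>{..<Q}. c Q = c i"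
  proof (rule ccontr)
    assume "\<not> (\<forall>i\<in>{..<Q}. c Q = c i)"
    then obtain j where "j < Q" "c Q \<noteq> c j" by auto
    then have "c Q < c j" using dec[of j Q] Q by simp
    then have "(\<Sum>i<Q. c Q) < (\<Sum>i<Q. c i)" using \<open>j < Q\<close> dec Q
      by (intro sum_strict_mono_ex1) (auto intro!: bexI[of _ j])
    then show False using eqS by simp
  qed
  then have c0: "c 0 = c Q" using p by simp
  have "(\<Sum>i=Q..<p * Q. c i) = r * (Q * c Q)" using rS eqS tail' r by (simp add: mult.assoc)
  then show ?thesis using split eqS c0 r by (simp add: algebra_simps)
qed

context fp_vecs
begin

text \<open>The preimage in \<open>\<int>[S]\<close> of the image of \<open>A\<close> modulo \<open>p\<close>.\<close>
definition img :: "(('i \<Rightarrow> int) \<Rightarrow> 'i \<Rightarrow> int) \<Rightarrow> ('i \<Rightarrow> int) set" where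
  "img A = {A v + cs (int p) w | v w. v \<in> V \<and> w \<in> V}"

lemma subm_img: assumes A: "lin S S A" shows "subm (img A)"
  unfolding subm_def
proof (intro conjI ballI)
  show "img A \<subseteq> V" using lin_vecs[OF A] by (auto simp: img_def)
  have "A 0 + cs (int p) 0 \<in> img A" unfolding img_def using vecs_0 by blast
  then show "0 \<in> img A" using lin_0[OF A] by simp
next
  fix x y assume "x \<in> img A" "y \<in> img A"
  then obtain v w v' w' where *: "x = A v + cs (int p) w" "y = A v' + cs (int p) w'"
    "v \<in> V" "w \<in> V" "v' \<in> V" "w' \<in> V" unfolding img_def by blast
  then have "x + y = A (v + v') + cs (int p) (w + w')"
    using lin_add[OF A *(3,5)] by (simp add: cs_add algebra_simps)
  moreover have "v + v' \<in> V" "w + w' \<in> V" using * by simp_all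
  ultimately show "x + y \<in> img A" unfolding img_def by blast
next
  fix x assume "x \<in> img A"
  then obtain v w where *: "x = A v + cs (int p) w" "v \<in> V" "w \<in> V" unfolding img_def by blast
  then have "- x = A (- v) + cs (int p) (- w)"
    using lin_uminus[OF A *(2)] by (simp add: cs_uminus algebra_simps)
  moreover have "- v \<in> V" "- w \<in> V" using * by simp_all
  ultimately show "- x \<in> img A" unfolding img_def by blast
next
  fix v assume v: "v \<in> V"
  have "A 0 + cs (int p) v \<in> img A" unfolding img_def using vecs_0 v by blast
  then show "cs (int p) v \<in> img A" using lin_0[OF A] by simp
qed

lemma img_mem: assumes "v \<in> V" shows "A v \<in> img A"
proof -
  have "A v + cs (int p) 0 \<in> img A" unfolding img_def using assms vecs_0 by blast
  then show ?thesis by simp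
qed

lemma img_subset: "subm W \<Longrightarrow> (\<And>v. v \<in> V \<Longrightarrow> A v \<in> W) \<Longrightarrow> img A \<subseteq> W"
  unfolding img_def by (auto intro: subm_add subm_p)

lemma img_cong: assumes A: "lin S S A" and B: "lin S S B" and c: "\<And>v. v \<in> V \<Longrightarrow> cp (A v) (B v)"
  shows "img A = img B"
proof
  show "img A \<subseteq> img B"
    by (rule img_subset[OF subm_img[OF B]])
       (rule subm_cp[OF subm_img[OF B] img_mem _ cg_sym[OF c]], auto intro: lin_vecs[OF A])
  show "img B \<subseteq> img A"
    by (rule img_subset[OF subm_img[OF A]])
       (rule subm_cp[OF subm_img[OF A] img_mem _ c], auto intro: lin_vecs[OF B])
qed

text \<open>The Frobenius rule \<open>(B + k)\<^sup>q = B\<^sup>q + k\<^sup>q\<close> modulo \<open>p\<close>, for a power \<open>q\<close> of \<open>p\<close>.\<close>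
lemma prime_power_op:
  assumes A: "lin S S A" and B: "\<And>v. v \<in> V \<Longrightarrow> B v = A v - cs k v" and v: "v \<in> V"
  shows "cp ((A ^^ (p ^ e)) v) ((B ^^ (p ^ e)) v + cs (k ^ (p ^ e)) v)"
proof -
  let ?q = "p ^ e"
  let ?f = "\<lambda>i. cs (int (?q choose i) * k ^ (?q - i)) ((B ^^ i) v)"
  have q: "?q > 0" by simp
  have "(A ^^ ?q) v = (\<Sum>i\<le>?q. ?f i)" by (rule binom_op[OF A B v])
  also have "\<dots> = (\<Sum>i\<in>{0, ?q} \<union> {0<..<?q}. ?f i)" by (intro sum.cong) auto
  also have "\<dots> = (\<Sum>i\<in>{0, ?q}. ?f i) + (\<Sum>i\<in>{0<..<?q}. ?f i)" by (rule sum.union_disjoint) auto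
  also have "(\<Sum>i\<in>{0, ?q}. ?f i) = (B ^^ ?q) v + cs (k ^ ?q) v" using q by (simp add: add.commute)
  finally have e: "(A ^^ ?q) v = ((B ^^ ?q) v + cs (k ^ ?q) v) + (\<Sum>i\<in>{0<..<?q}. ?f i)" .
  have "cp (\<Sum>i\<in>{0<..<?q}. ?f i) (\<Sum>i\<in>{0<..<?q}. 0)"
  proof (rule cg_sum)
    fix i assume "i \<in> {0<..<?q}"
    then have "p dvd (?q choose i)" using prime_dvd_choose_prime_power[OF prime] by simp
    then have "int p dvd int (?q choose i) * k ^ (?q - i)" by (metis dvd_mult2 of_nat_dvd_iff)
    then show "cp (?f i) 0" by (simp add: cg_def fapp)
  qed
  then show ?thesis unfolding e by (auto simp: cg_def fapp)
qed

subsection \<open>The trace of the norm operator of a cyclic action of order p\<close>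

text \<open>The norm \<open>sg\<close> of \<open>y\<close> satisfies \<open>sg \<circ> sg = p sg\<close>, so it acts as \<open>p\<close> modulo its kernel and its trace is \<open>p\<close> times its rank. The kernel is a pure sublattice, hence the rank is
visible modulo \<open>p\<close>; and it contains the image of \<open>y - 1\<close>. In the two extreme cases the
kernel is zero or everything, which survives the reduction because of purity.\<close>
lemma norm_trace:
  assumes y: "lin S S y" and yp: "\<And>v. v \<in> V \<Longrightarrow> (y ^^ p) v = v"
  defines "sg \<equiv> (\<lambda>v. \<Sum>i<p. (y ^^ i) v)"
  defines "Kh \<equiv> {v + cs (int p) w | v w. v \<in> V \<and> sg v = 0 \<and> w \<in> V}"
  shows "subm Kh" "img (\<lambda>v. y v - v) \<subseteq> Kh" "tr S sg = int p * (int (card S) - int (dm Kh))"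
    "dm Kh = 0 \<Longrightarrow> v \<in> V \<Longrightarrow> y v = v" "dm Kh = card S \<Longrightarrow> v \<in> V \<Longrightarrow> sg v = 0"
proof -
  define K where "K = {v \<in> V. sg v = 0}"
  have sg: "lin S S sg" unfolding sg_def by (intro lin_setsum lin_funpow y)
  have KV: "v \<in> V" if "v \<in> K" for v using that by (simp add: K_def)
  have K0: "sg v = 0" if "v \<in> K" for v using that by (simp add: K_def)
  have Kadd: "v + w \<in> K" if "v \<in> K" "w \<in> K" for v w
    using that lin_add[OF sg, of v w] by (simp add: K_def)
  have Kcs: "cs c v \<in> K" if "v \<in> K" for v c
    using that lin_cs[OF sg, of v c] by (simp add: K_def)
  have Klc: "lc c xs \<in> K" if "set xs \<subseteq> K" for c xs
  proof -
    have sumK: "sum f I \<in> K" if "\<And>i. i \<in> I \<Longrightarrow> f i \<in> K" for f and I :: "nat set"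
      using that
    proof (induction I rule: infinite_finite_induct)
      case (insert x F) then show ?case using Kadd[of "f x" "sum f F"] by simp
    qed (simp_all add: K_def lin_0[OF sg])
    show ?thesis unfolding lc_def
      by (rule sumK, rule Kcs) (use that in auto)
  qed
  have Kh_eq: "Kh = {v + cs (int p) w | v w. v \<in> K \<and> w \<in> V}" by (auto simp: Kh_def K_def)
  have sgy: "sg (y v) = sg v" if v: "v \<in> V" for v
  proof -
    have "sg (y v) + v = (\<Sum>i<p. (y ^^ Suc i) v) + v" unfolding sg_def by (simp add: funpow_swap1)
    also have "\<dots> = (\<Sum>i<Suc p. (y ^^ i) v)"
      by (subst sum.lessThan_Suc_shift) (simp add: add.commute)
    also have "\<dots> = sg v + v" using yp[OF v] by (simp add: sg_def)
    finally show ?thesis by simp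
  qed
  have sgyi: "sg ((y ^^ i) v) = sg v" if v: "v \<in> V" for v i
    by (induction i) (use v sgy lin_vecs[OF lin_funpow[OF y]] in auto)
  have sgsg: "sg (sg v) = cs (int p) (sg v)" if v: "v \<in> V" for v
  proof -
    have "sg (sg v) = (\<Sum>i<p. sg ((y ^^ i) v))"
      by (subst (2) sg_def) (rule lin_sum[OF sg lin_vecs[OF lin_funpow[OF y] v]])
    also have "\<dots> = (\<Sum>i<p. sg v)" by (simp add: sgyi v)
    also have "\<dots> = cs (int p) (sg v)" by (rule sum_const_cs)
    finally show ?thesis .
  qed
  have ymem: "y v - v \<in> K" if "v \<in> V" for v
    using that lin_diff[OF sg, of "y v" v] sgy lin_vecs[OF y] by (simp add: K_def)
  have wmem: "sg v - cs (int p) v \<in> K" if "v \<in> V" for v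
    using that lin_diff[OF sg lin_vecs[OF sg that] vecs_cs[OF that]] sgsg lin_cs[OF sg that] lin_vecs[OF sg that]
    by (simp add: K_def)
  show subK: "subm Kh"
    unfolding subm_def
  proof (intro conjI ballI)
    show "Kh \<subseteq> V" by (auto simp: Kh_eq K_def)
    have K0: "0 \<in> K" using lin_0[OF sg] by (simp add: K_def)
    then have "0 + cs (int p) 0 \<in> Kh" unfolding Kh_eq using vecs_0 by blast
    then show "0 \<in> Kh" by simp
    fix v assume "v \<in> V"
    then have "0 + cs (int p) v \<in> Kh" unfolding Kh_eq using K0 by blast
    then show "cs (int p) v \<in> Kh" by simp
  next
    fix a b assume "a \<in> Kh" "b \<in> Kh"
    then obtain v w v' w' where *: "a = v + cs (int p) w" "b = v' + cs (int p) w'"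
      "v \<in> K" "w \<in> V" "v' \<in> K" "w' \<in> V" unfolding Kh_eq by blast
    then have "a + b = (v + v') + cs (int p) (w + w')" by (simp add: cs_add algebra_simps)
    moreover have "v + v' \<in> K" "w + w' \<in> V" using * Kadd by simp_all
    ultimately show "a + b \<in> Kh" unfolding Kh_eq by blast
  next
    fix a assume "a \<in> Kh"
    then obtain v w where *: "a = v + cs (int p) w" "v \<in> K" "w \<in> V" unfolding Kh_eq by blast
    then have "- a = cs (-1) v + cs (int p) (- w)" by (simp add: cs_uminus algebra_simps)
    moreover have "cs (-1) v \<in> K" by (rule Kcs[OF *(2)])
    moreover have "- w \<in> V" using *(3) by simp
    ultimately show "- a \<in> Kh" unfolding Kh_eq by blast
  qed
  have KKh: "K \<subseteq> Kh"
  proof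
    fix v assume "v \<in> K" then have "v + cs (int p) 0 \<in> Kh" unfolding Kh_eq using vecs_0 by blast
    then show "v \<in> Kh" by simp
  qed
  show "img (\<lambda>v. y v - v) \<subseteq> Kh" by (rule img_subset[OF subK]) (use ymem KKh in blast)
  have "\<exists>ks. set ks \<subseteq> K \<and> ext pV ks = Kh \<and> length ks = dm Kh - dm pV"
  proof (rule select_basis_dm[OF subm_pV subK KKh pV_subset[OF subK]])
    fix W assume "subm W" "K \<subseteq> W" then show "Kh \<subseteq> W" by (auto simp: Kh_eq intro!: subm_add subm_p)
  qed
  then obtain ks where ks: "set ks \<subseteq> K" "ext pV ks = Kh" "length ks = dm Kh" using dm_pV by auto
  have "\<exists>ws. set ws \<subseteq> V \<and> ext Kh ws = V \<and> length ws = dm V - dm Kh"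
    by (rule select_basis_dm[OF subK subm_vecs]) (use subm_V[OF subK] in auto)
  then obtain ws where ws: "set ws \<subseteq> V" "ext Kh ws = V" "length ws = card S - dm Kh" using dm_V by auto
  let ?xs = "ws @ ks"
  have ksV: "set ks \<subseteq> V" using ks KV by blast
  have xs: "set ?xs \<subseteq> V" "ext pV ?xs = V" "length ?xs = card S"
    using ks ws ksV dm_le[OF subK] by (auto simp: ext_append)
  have Kspan: "\<exists>c. cg (int p ^ s) v (lc c ks)" if "v \<in> K" for v s
    using that
  proof (induction s arbitrary: v)
    case 0 then show ?case by (simp add: cg_def)
  next
    case (Suc s)
    have "v \<in> ext pV ks" using ks KKh Suc.prems by blast
    then obtain c where "cp v (lc c ks)" using ext_pV_iff ksV KV[OF Suc.prems] by blast
    then obtain u where u: "u \<in> V" "v = lc c ks + cs (int p) u"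
      using cg_iff[OF KV[OF Suc.prems] vecs_lc[OF ksV]] by blast
    have "0 = sg (lc c ks) + cs (int p) (sg u)"
      using K0[OF Suc.prems] lin_add[OF sg vecs_lc[OF ksV] vecs_cs[OF u(1)]] lin_cs[OF sg u(1)] u(2) by simp
    then have "cs (int p) (sg u) = 0" using K0[OF Klc[OF ks(1)]] by simp
    then have "sg u = 0" using p_gt_1 by (auto simp: fun_eq_iff fapp)
    then have "u \<in> K" using u by (simp add: K_def)
    then obtain d where d: "cg (int p ^ s) u (lc d ks)" using Suc.IH by blast
    have "cg (int p ^ Suc s) v (lc (\<lambda>i. c i + int p * d i) ks)"
      using d unfolding u(2) cg_def by (auto simp: lc_add lc_cs fapp simp flip: right_diff_distrib)
    then show ?case by blast
  qed
  have cong: "[tr S sg = int p * int (length ws)] (mod int p ^ s)" for s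
  proof -
    have "\<forall>l<card S. \<exists>a. cg (int p ^ s) (sg (?xs ! l)) (lc a ?xs) \<and> a l = (if l < length ws then int p else 0)"
    proof (intro allI impI)
      fix l assume l: "l < card S"
      show "\<exists>a. cg (int p ^ s) (sg (?xs ! l)) (lc a ?xs) \<and> a l = (if l < length ws then int p else 0)"
      proof (cases "l < length ws")
        case True
        then have wV: "ws ! l \<in> V" using ws(1) by auto
        obtain c where c: "cg (int p ^ s) (sg (ws ! l) - cs (int p) (ws ! l)) (lc c ks)"
          using Kspan[OF wmem[OF wV]] by blast
        define a where "a = (\<lambda>i. if i < length ws then (if i = l then int p else 0) else c (i - length ws))"
        have "lc a ws = lc (\<lambda>i. if i = l then int p else 0) ws" by (rule lc_cong) (simp add: a_def)
        then have "lc a ?xs = cs (int p) (ws ! l) + lc c ks"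
          using True by (simp add: lc_append lc_single) (simp add: a_def)
        then have "cg (int p ^ s) (sg (?xs ! l)) (lc a ?xs)"
          using c True by (simp add: nth_append) (auto simp: cg_def fapp algebra_simps)
        moreover have "a l = int p" using True by (simp add: a_def)
        ultimately show ?thesis using True by auto
      next
        case False
        then have "?xs ! l \<in> K" using l ks(1) xs(3) by (auto simp: nth_append)
        then have "cg (int p ^ s) (sg (?xs ! l)) (lc (\<lambda>i. 0) ?xs)" using K0 by simp
        then show ?thesis using False by (intro exI[of _ "\<lambda>i. 0"]) auto
      qed
    qed
    then obtain a where a: "\<And>l. l < card S \<Longrightarrow> cg (int p ^ s) (sg (?xs ! l)) (lc (a l) ?xs)"
      "\<And>l. l < card S \<Longrightarrow> a l l = (if l < length ws then int p else 0)" by metis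
    have "[tr S sg = (\<Sum>l<card S. a l l)] (mod int p ^ s)" by (rule trace_basis[OF xs sg a(1)])
    also have "(\<Sum>l<card S. a l l) = (\<Sum>l<card S. if l < length ws then int p else 0)"
      by (intro sum.cong) (simp_all add: a(2))
    also have "\<dots> = (\<Sum>l\<in>{..<card S} \<inter> {l. l < length ws}. int p)"
      by (subst sum.inter_restrict) auto
    also have "{..<card S} \<inter> {l. l < length ws} = {..<length ws}" using xs(3) by auto
    finally show ?thesis by (simp add: mult.commute)
  qed
  have "tr S sg = int p * int (length ws)" by (rule eq_if_cong_powers[OF p_gt_1 cong])
  then show "tr S sg = int p * (int (card S) - int (dm Kh))"
    using ws(3) dm_le[OF subK] by simp
  show "y v = v" if d: "dm Kh = 0" and v: "v \<in> V"
  proof -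
    have KpV: "K \<subseteq> pV" using dm_eq[OF subm_pV subK pV_subset[OF subK]] d dm_pV KKh by auto
    have "\<And>u. u \<in> K \<Longrightarrow> cg (int p ^ s) u 0" for s
    proof (induction s)
      case (Suc s)
      then obtain w where w: "w \<in> V" "u = cs (int p) w" using KpV by (auto simp: pV_def)
      then have "cs (int p) (sg w) = 0" using K0[OF Suc.prems] lin_cs[OF sg w(1)] by simp
      then have "w \<in> K" using w p_gt_1 by (auto simp: fun_eq_iff fapp K_def)
      then have "cg (int p ^ s) w 0" using Suc.IH by blast
      then show ?case using w(2) by (auto simp: cg_def fapp)
    qed (simp add: cg_def)
    then have "\<And>s. cg (int p ^ s) (y v - v) 0" using ymem[OF v] by blast
    then have "(y v - v) x = 0" for x
      by (intro eq_if_cong_powers[OF p_gt_1]) (simp add: cg_iff_cong fapp)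
    then show ?thesis by (auto simp: fun_eq_iff fapp)
  qed
  show "sg v = 0" if d: "dm Kh = card S" and v: "v \<in> V"
  proof -
    have KhV: "Kh = V" using dm_eq[OF subK subm_vecs] subm_V[OF subK] d dm_V by auto
    have "\<And>u. u \<in> V \<Longrightarrow> cg (int p ^ s) (sg u) 0" for s
    proof (induction s)
      case (Suc s)
      then obtain k w where w: "k \<in> K" "w \<in> V" "u = k + cs (int p) w" using KhV unfolding Kh_eq by blast
      then have "sg u = cs (int p) (sg w)"
        using K0[OF w(1)] lin_add[OF sg KV[OF w(1)] vecs_cs[OF w(2)]] lin_cs[OF sg w(2)] by simp
      moreover have "cg (int p ^ s) (sg w) 0" using Suc.IH w by blast
      ultimately show ?case by (auto simp: cg_def fapp)
    qed (simp add: cg_def)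
    then have "\<And>s. cg (int p ^ s) (sg v) 0" using v by blast
    then have "(sg v) x = 0" for x
      by (intro eq_if_cong_powers[OF p_gt_1]) (simp add: cg_iff_cong fapp)
    then show ?thesis by (auto simp: fun_eq_iff fapp)
  qed
qed

end

section \<open>Freeness modulo p forces trace zero\<close>

context fp_vecs
begin

text \<open>Nakayama's lemma for the nilpotent operator \<open>D\<close>.\<close>
lemma stable_span:
  assumes g: "lin S S D" and W: "subm W" and stab: "\<And>v. v \<in> W \<Longrightarrow> D v \<in> W"
    and vs: "set vs \<subseteq> W" and ext: "ext (img D) vs = V" and nil: "img (D ^^ q) = pV"
  shows "W = V"
proof -
  have vsV: "set vs \<subseteq> V" using vs subm_V[OF W] by blast
  have Dj: "(D ^^ j) v \<in> W" if "v \<in> W" for v j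
    by (induction j) (use that stab in auto)
  have lj: "lin S S (D ^^ j)" for j by (rule lin_funpow[OF g])
  have chain: "\<exists>x\<in>V. v - (D ^^ j) x \<in> W" if v: "v \<in> V" for v j
  proof (induction j)
    case 0 then show ?case using v subm_0[OF W] by (intro bexI[of _ v]) auto
  next
    case (Suc j)
    then obtain x where x: "x \<in> V" "v - (D ^^ j) x \<in> W" by blast
    then have "x \<in> ext (img D) vs" using ext by simp
    then obtain c u where u: "u \<in> img D" "x = u + lc c vs" unfolding ext_iff by blast
    then obtain y w where yw: "y \<in> V" "w \<in> V" "u = D y + cs (int p) w" unfolding img_def by blast
    have DyV: "D y \<in> V" by (rule lin_vecs[OF g yw(1)])
    have "(D ^^ j) x = ((D ^^ j) (D y) + (D ^^ j) (cs (int p) w)) + (D ^^ j) (lc c vs)"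
      unfolding u(2) yw(3)
      using lin_add[OF lj vecs_add[OF DyV vecs_cs[OF yw(2)]] vecs_lc[OF vsV]]
        lin_add[OF lj DyV vecs_cs[OF yw(2)]] by simp
    note eq = this
    have 1: "(D ^^ j) (cs (int p) w) \<in> W"
      using lin_cs[OF lj yw(2)] subm_p[OF W lin_vecs[OF lj yw(2)]] by simp
    have 2: "(D ^^ j) (lc c vs) \<in> W" by (rule Dj[OF subm_lc[OF W vs]])
    have "(v - (D ^^ j) x) + ((D ^^ j) (cs (int p) w) + (D ^^ j) (lc c vs)) \<in> W"
      by (intro subm_add[OF W] x(2) 1 2)
    moreover have "(v - (D ^^ j) x) + ((D ^^ j) (cs (int p) w) + (D ^^ j) (lc c vs)) = v - (D ^^ Suc j) y"
      unfolding eq by (simp add: funpow_swap1)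
    ultimately show ?case using yw(1) by (intro bexI[of _ y]) simp_all
  qed
  have "v \<in> W" if v: "v \<in> V" for v
  proof -
    obtain x where x: "x \<in> V" "v - (D ^^ q) x \<in> W" using chain[OF v] by blast
    have "(D ^^ q) x \<in> W" using img_mem[OF x(1), of "D ^^ q"] nil pV_subset[OF W] by blast
    then have "(v - (D ^^ q) x) + (D ^^ q) x \<in> W" using x(2) subm_add[OF W] by blast
    then show ?thesis by simp
  qed
  then show ?thesis using subm_V[OF W] by blast
qed

text \<open>With \<open>D = g - 1\<close> and \<open>q = p\<^bsup>a+1\<^esup>\<close> one has \<open>D\<^sup>q = 0\<close> modulo \<open>p\<close>, and \<open>D\<^bsup>q/p\<^esup>\<close> is \<open>g\<^bsup>q/p\<^esup> - 1\<close>. The codimension bound for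
the latter says that the first \<open>q / p\<close> of the \<open>q\<close> successive quotients by the powers of \<open>D\<close> are not larger than average. As
these dimensions do not increase, all of them agree: the space is free over the group generated by \<open>g\<close>.\<close>
lemma free_dimension:
  assumes g: "lin S S g" and q: "\<And>v. v \<in> V \<Longrightarrow> (g ^^ (p ^ Suc a)) v = v"
    and le: "p * (card S - dm (img (\<lambda>v. (g ^^ (p ^ a)) v - v))) \<le> card S"
  defines "D \<equiv> (\<lambda>v. g v - v)"
  shows "p ^ Suc a * (card S - dm (img D)) = card S" "img (D ^^ (p ^ Suc a)) = pV" "lin S S D"
proof -
  have D: "lin S S D" unfolding D_def by (intro lin_minus g lin_id)
  then show "lin S S D" .
  define U where "U i = img (D ^^ i)" for i
  have lj: "lin S S (D ^^ j)" for j by (rule lin_funpow[OF D])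
  have sU: "subm (U i)" for i unfolding U_def by (rule subm_img[OF lj])
  have op: "cp ((g ^^ (p ^ e)) v) ((D ^^ (p ^ e)) v + v)" if "v \<in> V" for v e
    using prime_power_op[OF g, of D 1 v e] that by (simp add: D_def)
  have op': "cp ((D ^^ (p ^ e)) v) ((g ^^ (p ^ e)) v - v)" if "v \<in> V" for v e
    using op[OF that, of e] by (auto simp: cg_def fapp dvd_diff_commute algebra_simps)
  have UQ: "U (p ^ a) = img (\<lambda>v. (g ^^ (p ^ a)) v - v)"
    unfolding U_def by (rule img_cong[OF lj lin_minus[OF lin_funpow[OF g] lin_id] op'])
  have Uq: "U (p ^ Suc a) = pV"
  proof
    show "U (p ^ Suc a) \<subseteq> pV" unfolding U_def
    proof (rule img_subset[OF subm_pV])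
      fix v assume v: "v \<in> V"
      have "cp ((D ^^ (p ^ Suc a)) v) 0" using op'[OF v, of "Suc a"] q[OF v] by simp
      then show "(D ^^ (p ^ Suc a)) v \<in> pV" using lin_vecs[OF lj v] by (simp add: pV_iff)
    qed
  qed (rule pV_subset[OF sU])
  then show "img (D ^^ (p ^ Suc a)) = pV" by (simp add: U_def)
  have U0: "U 0 = V" using subm_V[OF sU] img_mem[of _ "\<lambda>v. v"] by (fastforce simp: U_def id_def)
  have Udec: "U (Suc i) \<subseteq> U i" for i unfolding U_def
  proof (rule img_subset)
    show "subm (img (D ^^ i))" using sU by (simp add: U_def)
    fix v assume v: "v \<in> V"
    have "(D ^^ i) (D v) \<in> img (D ^^ i)" by (rule img_mem[OF lin_vecs[OF D v]])
    then show "(D ^^ Suc i) v \<in> img (D ^^ i)" by (simp add: funpow_swap1)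
  qed
  define c where "c i = dm (U i) - dm (U (Suc i))" for i
  have dmdec: "dm (U (Suc i)) \<le> dm (U i)" for i by (rule dm_mono[OF sU sU Udec])
  have DU: "D u \<in> U (Suc i)" if uU: "u \<in> U i" for u i
  proof -
    obtain y w where yw: "y \<in> V" "w \<in> V" "u = (D ^^ i) y + cs (int p) w" using uU unfolding U_def img_def by blast
    have "D u = (D ^^ Suc i) y + cs (int p) (D w)"
      unfolding yw(3) using lin_add[OF D lin_vecs[OF lj yw(1)] vecs_cs[OF yw(2)]] lin_cs[OF D yw(2)] by simp
    then show ?thesis unfolding U_def img_def using yw lin_vecs[OF D yw(2)] by blast
  qed
  have cmono: "c (Suc i) \<le> c i" for i
  proof -
    have "\<exists>xs. set xs \<subseteq> U i \<and> ext (U (Suc i)) xs = U i \<and> length xs = dm (U i) - dm (U (Suc i))"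
      by (rule select_basis_dm[OF sU sU _ Udec]) auto
    then obtain xs where xs: "set xs \<subseteq> U i" "ext (U (Suc i)) xs = U i" "length xs = c i" by (auto simp: c_def)
    have xV: "set xs \<subseteq> V" using xs(1) subm_V[OF sU] by blast
    have DxV: "set (map D xs) \<subseteq> V" using xV lin_vecs[OF D] by auto
    let ?E = "ext (U (Suc (Suc i))) (map D xs)"
    have sE: "subm ?E" by (rule subm_ext[OF sU DxV])
    have "U (Suc i) \<subseteq> ?E" unfolding U_def[of "Suc i"]
    proof (rule img_subset[OF sE])
      fix v assume v: "v \<in> V"
      have "(D ^^ i) v \<in> ext (U (Suc i)) xs" using img_mem[OF v, of "D ^^ i"] xs(2) by (simp add: U_def)
      then obtain k u where u: "u \<in> U (Suc i)" "(D ^^ i) v = u + lc k xs" unfolding ext_iff by blast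
      then have "(D ^^ Suc i) v = D u + lc k (map D xs)"
        using lin_add[OF D subm_V[OF sU u(1)] vecs_lc[OF xV]] lin_lc[OF D xV] by simp
      then show "(D ^^ Suc i) v \<in> ?E" unfolding ext_iff using DU[OF u(1)] by blast
    qed
    then have "dm (U (Suc i)) \<le> dm ?E" by (rule dm_mono[OF sU sE])
    also have "\<dots> \<le> dm (U (Suc (Suc i))) + c i" using dm_ext_le[OF sU DxV] xs(3) by simp
    finally show ?thesis by (simp add: c_def)
  qed
  have tele: "(\<Sum>i<n. c i) = card S - dm (U n)" for n
  proof (induction n)
    case 0 then show ?case using U0 dm_V by simp
  next
    case (Suc n)
    then show ?case using dmdec[of n] dm_le[OF sU, of n] by (simp add: c_def)
  qed
  have "p * p ^ a * c 0 = (\<Sum>i<p * p ^ a. c i)"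
  proof (rule nonincreasing_sum)
    show "p * (\<Sum>i<p ^ a. c i) \<le> (\<Sum>i<p * p ^ a. c i)"
      using le Uq dm_pV by (simp add: tele UQ)
  qed (use cmono p_gt_1 in auto)
  also have "\<dots> = card S" using Uq dm_pV by (simp add: tele)
  finally show "p ^ Suc a * (card S - dm (img D)) = card S"
    using U0 dm_V by (simp add: c_def U_def)
qed

text \<open>Coordinates with respect to a basis modulo \<open>p\<close>, valid modulo \<open>p\<^sup>s\<close> and exactly additive.\<close>
lemma lc_span_mod:
  assumes "set xs \<subseteq> V" "ext pV xs = V" "length xs = card S"
  shows "\<exists>K :: ('i \<Rightarrow> int) \<Rightarrow> nat \<Rightarrow> int. (\<forall>v\<in>V. cg (int p ^ s) v (lc (K v) xs)) \<and>
     (\<forall>v w i. K (v + w) i = K v i + K w i)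
     \<and> (\<forall>v\<in>V. \<forall>c. cg (int p ^ s) v (lc c xs) \<longrightarrow> (\<forall>i<card S. [K v i = c i] (mod int p ^ s)))"
proof -
  let ?P = "int p ^ s"
  have "\<forall>t\<in>S. \<exists>c. cg ?P (dl t) (lc c xs)" using span_lift[OF assms(1,2)] by simp
  then obtain b where b: "\<And>t. t \<in> S \<Longrightarrow> cg ?P (dl t) (lc (b t) xs)" by metis
  define K where "K v i = (\<Sum>t\<in>S. v t * b t i)" for v :: "'i \<Rightarrow> int" and i :: nat
  have K1: "cg ?P v (lc (K v) xs)" if v: "v \<in> V" for v
  proof -
    have "cg ?P v (\<Sum>t\<in>S. cs (v t) (lc (b t) xs))"
      by (subst vecs_expand[OF fin v]) (intro cg_sum cg_cs b)
    also have "(\<Sum>t\<in>S. cs (v t) (lc (b t) xs)) = lc (\<lambda>i. K v i) xs"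
      unfolding K_def by (simp add: lc_cs flip: lc_sum)
    finally show ?thesis .
  qed
  have K2: "K (v + w) i = K v i + K w i" for v w i
    by (simp add: K_def fapp distrib_right sum.distrib)
  have K3: "[K v i = c i] (mod ?P)" if "v \<in> V" "cg ?P v (lc c xs)" "i < card S" for v c i
  proof -
    have "cg ?P (lc (K v) xs) (lc c xs)" by (rule cg_trans[OF cg_sym[OF K1] that(2)]) (rule that)
    then have "cg ?P (lc (\<lambda>i. K v i - c i) xs) 0" unfolding lc_diff by (simp add: cg_def fapp)
    then have "?P dvd K v i - c i" by (rule basis_indep[OF assms that(3)])
    then show ?thesis by (simp add: cong_iff_dvd_diff)
  qed
  show ?thesis using K1 K2 K3 by blast
qed

lemma stable_ext:
  assumes D: "lin S S D" and xs: "set xs \<subseteq> V" and st: "\<And>x. x \<in> set xs \<Longrightarrow> D x \<in> ext pV xs"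
    and v: "v \<in> ext pV xs"
  shows "D v \<in> ext pV xs"
proof -
  have W: "subm (ext pV xs)" by (rule subm_ext[OF subm_pV xs])
  obtain c u where u: "u \<in> pV" "v = u + lc c xs" using v unfolding ext_iff by blast
  obtain w where w: "w \<in> V" "u = cs (int p) w" using u(1) by (auto simp: pV_def)
  have "D v = cs (int p) (D w) + lc c (map D xs)"
    unfolding u(2) w(2) using lin_add[OF D vecs_cs[OF w(1)] vecs_lc[OF xs]] lin_cs[OF D w(1)] lin_lc[OF D xs] by simp
  moreover have "cs (int p) (D w) \<in> ext pV xs" by (rule subm_p[OF W lin_vecs[OF D w(1)]])
  moreover have "lc c (map D xs) \<in> ext pV xs" by (rule subm_lc[OF W]) (use st in auto)
  ultimately show ?thesis using subm_add[OF W] by simp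
qed

lemma lc_mem: assumes "x \<in> set xs" shows "\<exists>c. x = lc c xs"
proof -
  obtain l where "l < length xs" "xs ! l = x" using assms by (auto simp: in_set_conv_nth)
  then have "x = lc (\<lambda>i. if i = l then 1 else 0) xs" by (simp add: lc_single)
  then show ?thesis by blast
qed

lemma lc_of_lc:
  assumes "\<And>i. i \<in> I \<Longrightarrow> \<exists>c. f i = lc c ds" shows "\<exists>c. (\<Sum>i\<in>I. cs (k i) (f i)) = lc c ds"
proof -
  obtain c where c: "\<And>i. i \<in> I \<Longrightarrow> f i = lc (c i) ds" using assms by metis
  have "(\<Sum>i\<in>I. cs (k i) (f i)) = (\<Sum>i\<in>I. lc (\<lambda>t. k i * c i t) ds)"
    by (intro sum.cong refl) (simp add: c lc_cs)
  then show ?thesis by (simp add: lc_sum) blast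
qed

lemma lc_cong0: assumes "\<And>i. i < length xs \<Longrightarrow> k dvd c i" shows "cg k (lc c xs) 0"
proof -
  have "cg k (lc c xs) (\<Sum>i<length xs. 0)"
    unfolding lc_def by (rule cg_sum) (use assms in \<open>auto simp: cg_def fapp\<close>)
  then show ?thesis by simp
qed

text \<open>A free module over the group generated by \<open>g\<close> is induced from a complement of the image of \<open>g - 1\<close>. Averaging a projection over the group generated
by \<open>h\<close>, whose order is prime to \<open>p\<close>, makes that complement stable under \<open>h\<close> modulo any chosen power of \<open>p\<close>. Then \<open>g h\<close> permutes the \<open>g\<close>-translates
of the complement without fixing any, so that its matrix has zero diagonal. This is done modulo \<open>p\<^sup>s\<close> for every \<open>s\<close>.\<close>
lemma trace_zero_of_free:
  assumes g: "lin S S g" and h: "lin S S h" and comm: "\<And>v. v \<in> V \<Longrightarrow> g (h v) = h (g v)"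
    and q: "\<And>v. v \<in> V \<Longrightarrow> (g ^^ (p ^ Suc a)) v = v"
    and m: "\<And>v. v \<in> V \<Longrightarrow> (h ^^ m) v = v" "coprime m p"
    and le: "p * (card S - dm (img (\<lambda>v. (g ^^ (p ^ a)) v - v))) \<le> card S"
  shows "tr S (\<lambda>v. g (h v)) = 0"
proof -
  define D where "D = (\<lambda>v. g v - v)"
  define qq where "qq = p ^ Suc a"
  note fd = free_dimension[OF g q le, folded D_def, folded qq_def]
  have D: "lin S S D" by (rule fd(3))
  have lD: "lin S S (D ^^ j)" and lg: "lin S S (g ^^ j)" and lh: "lin S S (h ^^ j)" for j
    by (rule lin_funpow[OF D] lin_funpow[OF g] lin_funpow[OF h])+
  have "p ^ 1 \<le> p ^ Suc a" by (rule power_increasing) (use p_gt_1 in auto)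
  then have q2: "qq \<ge> 2" unfolding qq_def[symmetric] using p_gt_1 by simp
  have qv: "(g ^^ qq) v = v" if "v \<in> V" for v using q[OF that] by (simp add: qq_def)
  have sD: "subm (img D)" by (rule subm_img[OF D])
  have "\<exists>xs. set xs \<subseteq> V \<and> ext (img D) xs = V \<and> length xs = dm V - dm (img D)"
    by (rule select_basis_dm[OF sD subm_vecs]) (use subm_V[OF sD] in auto)
  then obtain vs where vs: "set vs \<subseteq> V" "ext (img D) vs = V" "length vs = card S - dm (img D)" using dm_V by auto
  define r where "r = length vs"
  have rq: "qq * r = card S" using fd(1) vs(3) by (simp add: r_def)
  have hD: "h (D v) = D (h v)" if "v \<in> V" for v
    using lin_diff[OF h lin_vecs[OF g that] that] comm[OF that] by (simp add: D_def)
  have hjD: "(h ^^ j) (D v) = D ((h ^^ j) v)" if "v \<in> V" for v j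
    by (rule funpow_lin_commute[OF h D hD that])
  have DjV: "(D ^^ j) v \<in> V" if "v \<in> set vs" for v j using that vs(1) lin_vecs[OF lD] by blast
  define ds where "ds = concat (map (\<lambda>j. map (D ^^ j) vs) [1..<qq])"
  define bs where "bs = vs @ ds"
  have set_ds: "set ds = {(D ^^ j) v | j v. 1 \<le> j \<and> j < qq \<and> v \<in> set vs}" by (auto simp: ds_def) blast
  have len_bs: "length bs = card S"
  proof -
    have "length ds = (qq - 1) * r" by (simp add: ds_def length_concat comp_def sum_list_triv r_def)
    then have "length bs = r + (qq - 1) * r" by (simp add: bs_def r_def)
    also have "\<dots> = qq * r" using q2 by (cases qq) auto
    finally show ?thesis using rq by simp
  qed
  have dsV: "set ds \<subseteq> V" unfolding set_ds using DjV by blast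
  have bsV: "set bs \<subseteq> V" using dsV vs by (simp add: bs_def)
  have bs_form: "\<exists>j v. b = (D ^^ j) v \<and> j < qq \<and> v \<in> set vs" if "b \<in> set bs" for b
  proof (cases "b \<in> set vs")
    case True then show ?thesis using q2 by (intro exI[of _ 0] exI[of _ b]) simp
  next
    case False then show ?thesis using that set_ds by (auto simp: bs_def)
  qed
  have extbs: "ext pV bs = V"
  proof (rule stable_span[OF D _ _ _ vs(2) fd(2)])
    show sW: "subm (ext pV bs)" by (rule subm_ext[OF subm_pV bsV])
    show "set vs \<subseteq> ext pV bs" using ext_set[OF subm_pV bsV] by (simp add: bs_def)
    fix v assume "v \<in> ext pV bs"
    then show "D v \<in> ext pV bs"
    proof (rule stable_ext[OF D bsV, rotated])
      fix b assume "b \<in> set bs"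
      then obtain j u where ju: "b = (D ^^ j) u" "j < qq" "u \<in> set vs" using bs_form by blast
      show "D b \<in> ext pV bs"
      proof (cases "Suc j < qq")
        case True
        then have "D b \<in> set ds" unfolding set_ds ju(1) using ju(3) by (auto intro!: exI[of _ "Suc j"] exI[of _ u])
        then show ?thesis using ext_set[OF subm_pV bsV] by (auto simp: bs_def)
      next
        case False
        then have "Suc j = qq" using ju(2) by simp
        then have "D b = (D ^^ qq) u" using ju(1) by auto
        then have "D b \<in> pV" using img_mem[of u "D ^^ qq"] fd(2) ju(3) vs(1) by auto
        then show ?thesis using ext_mono by blast
      qed
    qed
  qed
  have Db: "\<exists>c. D b = lc c ds" if bm: "b \<in> set bs" for b
  proof -
    obtain j u where ju: "b = (D ^^ j) u" "j < qq" "u \<in> set vs" using bs_form[OF bm] by blast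
    have uV: "u \<in> V" using ju vs by blast
    show ?thesis
    proof (cases "Suc j < qq")
      case True
      then have "D b \<in> set ds" unfolding set_ds ju(1) using ju(3) by (auto intro!: exI[of _ "Suc j"] exI[of _ u])
      then show ?thesis by (rule lc_mem)
    next
      case False
      then have "Suc j = qq" using ju(2) by simp
      then have e: "D b = (D ^^ qq) u" using ju(1) by auto
      have "u = (\<Sum>i\<le>qq. cs (int (qq choose i)) ((D ^^ i) u))"
        using binom_op[OF g, of D 1 u qq] qv[OF uV] uV by (simp add: D_def)
      also have "\<dots> = (\<Sum>i\<in>{0, qq} \<union> {1..<qq}. cs (int (qq choose i)) ((D ^^ i) u))" by (intro sum.cong) auto
      also have "\<dots> = (\<Sum>i\<in>{0, qq}. cs (int (qq choose i)) ((D ^^ i) u)) + (\<Sum>i\<in>{1..<qq}. cs (int (qq choose i)) ((D ^^ i) u))"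
        by (rule sum.union_disjoint) auto
      also have "(\<Sum>i\<in>{0, qq}. cs (int (qq choose i)) ((D ^^ i) u)) = u + (D ^^ qq) u" using q2 by simp
      finally have "(D ^^ qq) u = - (\<Sum>i\<in>{1..<qq}. cs (int (qq choose i)) ((D ^^ i) u))"
        by (simp add: eq_neg_iff_add_eq_0 add.assoc)
      also have "\<dots> = (\<Sum>i\<in>{1..<qq}. cs (- int (qq choose i)) ((D ^^ i) u))"
        by (simp add: sum_negf)
      finally have "D b = (\<Sum>i\<in>{1..<qq}. cs (- int (qq choose i)) ((D ^^ i) u))" using e by simp
      moreover have "\<exists>c. (\<Sum>i\<in>{1..<qq}. cs (- int (qq choose i)) ((D ^^ i) u)) = lc c ds"
      proof (rule lc_of_lc, rule lc_mem)
        fix i assume "i \<in> {1..<qq}"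
        then show "(D ^^ i) u \<in> set ds" unfolding set_ds using ju(3) by auto
      qed
      ultimately show ?thesis by simp
    qed
  qed
  have Dds: "\<exists>y\<in>V. lc c ds = D y" for c
  proof -
    have "\<forall>i<length ds. \<exists>y\<in>V. ds ! i = D y"
    proof (intro allI impI)
      fix i assume "i < length ds"
      then have "ds ! i \<in> set ds" by simp
      then obtain j v where jv: "ds ! i = (D ^^ j) v" "1 \<le> j" "v \<in> set vs" unfolding set_ds by blast
      then have "ds ! i = D ((D ^^ (j - 1)) v)" by (cases j) auto
      then show "\<exists>y\<in>V. ds ! i = D y" using DjV[OF jv(3)] by blast
    qed
    then obtain y where y: "\<And>i. i < length ds \<Longrightarrow> y i \<in> V" "\<And>i. i < length ds \<Longrightarrow> ds ! i = D (y i)" by metis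
    have "lc c ds = (\<Sum>i<length ds. D (cs (c i) (y i)))"
      unfolding lc_def by (intro sum.cong refl) (simp add: y lin_cs[OF D])
    also have "\<dots> = D (\<Sum>i<length ds. cs (c i) (y i))"
      by (rule lin_sum[OF D, symmetric]) (simp add: y)
    finally have "lc c ds = D (\<Sum>i<length ds. cs (c i) (y i))" .
    moreover have "(\<Sum>i<length ds. cs (c i) (y i)) \<in> V" by (intro vecs_sum vecs_cs) (simp add: y)
    ultimately show ?thesis by (rule bexI)
  qed
  have cong: "[tr S (\<lambda>v. g (h v)) = 0] (mod int p ^ Suc s)" for s
  proof -
    define P where "P = int p ^ Suc s"
    have pP: "int p dvd P" by (simp add: P_def)
    obtain K :: "('i \<Rightarrow> int) \<Rightarrow> nat \<Rightarrow> int" where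
      K1: "\<And>v. v \<in> V \<Longrightarrow> cg P v (lc (K v) bs)" and
      K2: "\<And>v w i. K (v + w) i = K v i + K w i" and
      K3: "\<And>v c i. v \<in> V \<Longrightarrow> cg P v (lc c bs) \<Longrightarrow> i < card S \<Longrightarrow> [K v i = c i] (mod P)"
      using lc_span_mod[OF bsV extbs len_bs, of "Suc s"] unfolding P_def by blast
    define e1 where "e1 v = lc (K v) vs" for v
    have e1: "lin S S e1"
    proof -
      have "K (v + w) = (\<lambda>i. K v i + K w i)" for v w using K2 by blast
      then show ?thesis unfolding lin_def e1_def by (simp add: vecs_lc[OF vs(1)] lc_add)
    qed
    have e1D: "cg P (e1 (D v)) 0" if v: "v \<in> V" for v
    proof -
      have "\<forall>i<length bs. \<exists>c. D (bs ! i) = lc c ds" using Db by simp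
      then have "\<exists>c. (\<Sum>i<length bs. cs (K v i) (D (bs ! i))) = lc c ds" by (intro lc_of_lc) auto
      then obtain c where c: "lc (K v) (map D bs) = lc c ds" by (auto simp: lc_def)
      have "cg P (D v) (D (lc (K v) bs))" by (rule lin_cg[OF D v vecs_lc[OF bsV] K1[OF v]])
      also have "D (lc (K v) bs) = lc c ds" using lin_lc[OF D bsV] c by simp
      also have "lc c ds = lc (\<lambda>t. if t < r then 0 else c (t - r)) bs"
      proof -
        have "lc (\<lambda>t. if t < r then 0 else c (t - r)) vs = lc (\<lambda>t. 0) vs" by (rule lc_cong) (simp add: r_def)
        then show ?thesis by (simp add: bs_def lc_append r_def[symmetric])
      qed
      finally have "cg P (D v) (lc (\<lambda>t. if t < r then 0 else c (t - r)) bs)" .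
      note K3' = K3[OF lin_vecs[OF D v] this]
      have "P dvd K (D v) i" if i: "i < r" for i
      proof -
        have "i < card S" using len_bs i by (simp add: bs_def r_def)
        from K3'[OF this] show ?thesis using i by (simp add: cong_0_iff)
      qed
      then show ?thesis unfolding e1_def by (intro lc_cong0) (simp add: r_def)
    qed
    have split: "\<exists>y\<in>V. cg P v (lc (K v) vs + D y)" if v: "v \<in> V" for v
    proof -
      obtain y where "y \<in> V" "lc (\<lambda>i. K v (length vs + i)) ds = D y" using Dds by blast
      then show ?thesis using K1[OF v] by (auto simp: bs_def lc_append)
    qed
    have e1v: "\<exists>y\<in>V. cg P (e1 v) (v + D y)" if v: "v \<in> V" for v
    proof -
      obtain y where y: "y \<in> V" "cg P v (e1 v + D y)" using split[OF v] unfolding e1_def by blast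
      have "cg P (e1 v) (v - D y)" using y(2) by (auto simp: cg_def fapp dvd_diff_commute algebra_simps)
      then show ?thesis using y(1) lin_uminus[OF D y(1)] by (intro bexI[of _ "- y"]) auto
    qed
    have "coprime (int m) P" using m(2) by (simp add: P_def)
    then obtain m' where m': "[int m * m' = 1] (mod P)" using cong_solve_coprime_int by blast
    \<comment> \<open>the average of the conjugates of the projection \<open>e1\<close> under \<open>h\<close>; \<open>m'\<close> inverts \<open>m\<close> modulo \<open>P\<close>\<close>
    define f where "f v = cs m' (\<Sum>k<m. (h ^^ k) (e1 ((h ^^ (m - k)) v)))" for v
    have f: "lin S S f" unfolding f_def
      by (intro lin_scale lin_setsum lin_comp[OF lin_comp[OF lh e1] lh])
    have fD: "cg P (f (D v)) 0" if v: "v \<in> V" for v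
    proof -
      have "cg P (\<Sum>k<m. (h ^^ k) (e1 ((h ^^ (m - k)) (D v)))) (\<Sum>k<m. 0)"
      proof (rule cg_sum)
        fix k
        have "cg P (e1 ((h ^^ (m - k)) (D v))) 0" unfolding hjD[OF v] by (rule e1D[OF lin_vecs[OF lh v]])
        from lin_cg[OF lh _ _ this, of k]
        show "cg P ((h ^^ k) (e1 ((h ^^ (m - k)) (D v)))) 0"
          using lin_vecs[OF e1 lin_vecs[OF lh lin_vecs[OF D v]]] lin_0[OF lh] by simp
      qed
      from cg_cs[OF this, of m'] show ?thesis by (simp add: f_def)
    qed
    have fv: "\<exists>y\<in>V. cg P (f v) (v + D y)" if v: "v \<in> V" for v
    proof -
      have "\<forall>k<m. \<exists>y\<in>V. cg P ((h ^^ k) (e1 ((h ^^ (m - k)) v))) (v + D y)"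
      proof (intro allI impI)
        fix k assume k: "k < m"
        let ?u = "(h ^^ (m - k)) v"
        have u: "?u \<in> V" by (rule lin_vecs[OF lh v])
        obtain y where y: "y \<in> V" "cg P (e1 ?u) (?u + D y)" using e1v[OF u] by blast
        have "cg P ((h ^^ k) (e1 ?u)) ((h ^^ k) (?u + D y))"
          by (rule lin_cg[OF lh lin_vecs[OF e1 u] _ y(2)]) (intro vecs_add u lin_vecs[OF D y(1)])
        also have "(h ^^ k) (?u + D y) = (h ^^ k) ?u + D ((h ^^ k) y)"
          using lin_add[OF lh u lin_vecs[OF D y(1)]] hjD[OF y(1)] by simp
        also have "(h ^^ k) ?u = v"
          using m(1)[OF v] k by (metis comp_apply funpow_add le_add_diff_inverse less_imp_le)
        finally show "\<exists>y\<in>V. cg P ((h ^^ k) (e1 ((h ^^ (m - k)) v))) (v + D y)"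
          using lin_vecs[OF lh y(1)] by blast
      qed
      then obtain y where y: "\<And>k. k < m \<Longrightarrow> y k \<in> V"
        "\<And>k. k < m \<Longrightarrow> cg P ((h ^^ k) (e1 ((h ^^ (m - k)) v))) (v + D (y k))" by metis
      have "cg P (\<Sum>k<m. (h ^^ k) (e1 ((h ^^ (m - k)) v))) (\<Sum>k<m. v + D (y k))"
        by (rule cg_sum) (simp add: y)
      also have "(\<Sum>k<m. v + D (y k)) = cs (int m) v + D (\<Sum>k<m. y k)"
        using lin_sum[OF D, of "{..<m}" y] y(1) by (simp add: sum.distrib sum_const_cs del: sum_constant)
      finally have "cg P (f v) (cs m' (cs (int m) v + D (\<Sum>k<m. y k)))"
        unfolding f_def by (rule cg_cs)
      also have "\<dots> = cs (int m * m') v + D (cs m' (\<Sum>k<m. y k))"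
        using lin_cs[OF D vecs_sum[of "{..<m}" y S]] y(1) by (simp add: cs_add mult.commute)
      also have "cg P \<dots> (cs 1 v + D (cs m' (\<Sum>k<m. y k)))"
        by (intro cg_add cg_refl cg_cs_coeff m')
      finally have "cg P (f v) (v + D (cs m' (\<Sum>k<m. y k)))" by simp
      moreover have "cs m' (\<Sum>k<m. y k) \<in> V" by (intro vecs_sum vecs_cs) (simp add: y)
      ultimately show ?thesis by (rule bexI)
    qed
    have hf: "h (f v) = f (h v)" if v: "v \<in> V" for v
    proof -
      define F where "F k = (h ^^ k) (e1 ((h ^^ (Suc m - k)) v))" for k
      have FV: "(h ^^ k) (e1 ((h ^^ j) v)) \<in> V" for k j
        by (intro lin_vecs[OF lh] lin_vecs[OF e1] v)
      have "h (f v) = cs m' (\<Sum>k<m. h ((h ^^ k) (e1 ((h ^^ (m - k)) v))))"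
        unfolding f_def by (subst lin_cs[OF h vecs_sum[OF FV]], subst lin_sum[OF h FV]) (rule refl)
      also have "(\<Sum>k<m. h ((h ^^ k) (e1 ((h ^^ (m - k)) v)))) = (\<Sum>k<m. F (Suc k))"
        by (simp add: F_def)
      also have "(\<Sum>k<m. F (Suc k)) = (\<Sum>k<m. F k)"
      proof -
        have "F 0 + (\<Sum>k<m. F (Suc k)) = (\<Sum>k<m. F k) + F m"
          using sum.lessThan_Suc_shift[of F m] by simp
        moreover have "F m = F 0"
          using m(1) lin_vecs[OF h v] lin_vecs[OF e1] by (simp add: F_def funpow_swap1)
        ultimately show ?thesis by (metis add.commute add_left_cancel)
      qed
      also have "(\<Sum>k<m. F k) = (\<Sum>k<m. (h ^^ k) (e1 ((h ^^ (m - k)) (h v))))"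
        by (intro sum.cong refl) (simp add: F_def Suc_diff_le funpow_swap1)
      finally show ?thesis by (simp add: f_def)
    qed
    define vs' where "vs' = map f vs"
    have vs'V: "set vs' \<subseteq> V" using vs(1) lin_vecs[OF f] by (auto simp: vs'_def)
    have len': "length vs' = r" by (simp add: vs'_def r_def)
    have ext': "ext (img D) vs' = V"
    proof
      have sE: "subm (ext (img D) vs')" by (rule subm_ext[OF sD vs'V])
      show "ext (img D) vs' \<subseteq> V" using subm_V[OF sE] by blast
      have "ext (img D) vs \<subseteq> ext (img D) vs'"
      proof (rule ext_least[OF sE ext_mono], rule subsetI)
        fix v assume v: "v \<in> set vs"
        then have vV: "v \<in> V" using vs by blast
        obtain y where y: "y \<in> V" "cg P (f v) (v + D y)" using fv[OF vV] by blast
        have "f v \<in> ext (img D) vs'" using ext_set[OF sD vs'V] v by (auto simp: vs'_def)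
        moreover have "D y \<in> ext (img D) vs'" using ext_mono img_mem[OF y(1), of D] by blast
        ultimately have mem: "f v - D y \<in> ext (img D) vs'" by (rule subm_diff[OF sE])
        have "cg P (f v - D y) v" using y(2) by (auto simp: cg_def fapp algebra_simps)
        then have "cp (f v - D y) v" using pP by (rule cg_dvd)
        then show "v \<in> ext (img D) vs'" by (rule subm_cp[OF sE mem vV])
      qed
      then show "V \<subseteq> ext (img D) vs'" using vs(2) by simp
    qed
    have hv': "\<exists>c. cg P (h (vs' ! i)) (lc c vs')" if "i < r" for i
    proof -
      have iV: "vs ! i \<in> V" using vs(1) that nth_mem unfolding r_def by blast
      have hV: "h (vs ! i) \<in> V" by (rule lin_vecs[OF h iV])
      obtain y where y: "y \<in> V" "cg P (h (vs ! i)) (lc (K (h (vs ! i))) vs + D y)" using split[OF hV] by blast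
      let ?c = "K (h (vs ! i))"
      have "h (vs' ! i) = f (h (vs ! i))" using hf[OF iV] that by (simp add: vs'_def r_def)
      also have "cg P \<dots> (f (lc ?c vs + D y))"
        by (rule lin_cg[OF f hV _ y(2)]) (intro vecs_add vecs_lc vs(1) lin_vecs[OF D y(1)])
      also have "f (lc ?c vs + D y) = lc ?c vs' + f (D y)"
        using lin_add[OF f vecs_lc[OF vs(1)] lin_vecs[OF D y(1)]] lin_lc[OF f vs(1)] by (simp add: vs'_def)
      also have "cg P \<dots> (lc ?c vs' + 0)" by (intro cg_add cg_refl fD y(1))
      finally show ?thesis by auto
    qed
    then obtain c where c: "\<And>i. i < r \<Longrightarrow> cg P (h (vs' ! i)) (lc (c i) vs')" by metis
    \<comment> \<open>the \<open>g\<close>-translates of the stable complement, the complement itself varying fastest\<close>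
    define gs where "gs = map (\<lambda>l. (g ^^ (l div r)) (vs' ! (l mod r))) [0..<qq * r]"
    have len_gs: "length gs = card S" using rq by (simp add: gs_def)
    have divr: "l div r < qq" "l mod r < r" if "l < qq * r" for l
      using that by (simp_all add: less_mult_imp_div_less) (metis gr0I mod_less_divisor mult_0_right not_less0)
    have v'V: "vs' ! i \<in> V" if "i < r" for i using vs'V that len' nth_mem by blast
    have gsV: "set gs \<subseteq> V"
    proof
      fix x assume "x \<in> set gs"
      then obtain l where "l < qq * r" "x = (g ^^ (l div r)) (vs' ! (l mod r))" by (auto simp: gs_def)
      then show "x \<in> V" using lin_vecs[OF lg v'V] divr by blast
    qed
    have gs_mem: "(g ^^ j) (vs' ! i) \<in> set gs" if "j < qq" "i < r" for j i
    proof -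
      have "j * r + i < qq * r"
      proof -
        have "j * r + i < Suc j * r" using that by simp
        also have "\<dots> \<le> qq * r" using that by (intro mult_le_mono1) simp
        finally show ?thesis .
      qed
      moreover have "(j * r + i) div r = j" "(j * r + i) mod r = i" using that by auto
      ultimately show ?thesis unfolding gs_def by (force intro!: image_eqI[of _ _ "j * r + i"])
    qed
    have gmod: "(g ^^ j) v = (g ^^ (j mod qq)) v" if v: "v \<in> V" for j v
    proof -
      have "(g ^^ (qq * n)) v = v" for n
        by (induction n) (simp_all add: funpow_add qv v)
      moreover have "(g ^^ j) v = (g ^^ (j mod qq)) ((g ^^ (qq * (j div qq))) v)"
        by (simp flip: comp_apply[of "g ^^ _"] funpow_add)
      ultimately show ?thesis by simp
    qed
    have extgs: "ext pV gs = V"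
    proof (rule stable_span[OF D _ _ _ ext' fd(2)])
      show sW: "subm (ext pV gs)" by (rule subm_ext[OF subm_pV gsV])
      show "set vs' \<subseteq> ext pV gs"
      proof
        fix x assume "x \<in> set vs'"
        then obtain i where "i < r" "x = vs' ! i" using len' by (auto simp: in_set_conv_nth)
        then have "x \<in> set gs" using gs_mem[of 0 i] q2 by simp
        then show "x \<in> ext pV gs" using ext_set[OF subm_pV gsV] by blast
      qed
      fix v assume v: "v \<in> ext pV gs"
      have "g v \<in> ext pV gs"
      proof (rule stable_ext[OF g gsV _ v])
        fix x assume "x \<in> set gs"
        then obtain l where l: "l < qq * r" "x = (g ^^ (l div r)) (vs' ! (l mod r))" by (auto simp: gs_def)
        have "g x = (g ^^ (Suc (l div r) mod qq)) (vs' ! (l mod r))"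
          using gmod[OF v'V, of "l mod r" "Suc (l div r)"] divr[OF l(1)] l(2) by simp
        then have "g x \<in> set gs" using gs_mem divr[OF l(1)] q2 by simp
        then show "g x \<in> ext pV gs" using ext_set[OF subm_pV gsV] by blast
      qed
      then show "D v \<in> ext pV gs" using v subm_diff[OF sW] by (simp add: D_def)
    qed
    define aa where "aa l t = (if t div r = Suc (l div r) mod qq then c (l mod r) (t mod r) else 0)" for l t
    have gh: "lin S S (\<lambda>v. g (h v))" by (rule lin_comp[OF h g])
    have "[tr S (\<lambda>v. g (h v)) = (\<Sum>l<card S. aa l l)] (mod int p ^ Suc s)"
    proof (rule trace_basis[where a = aa, OF gsV extgs len_gs gh], fold P_def)
      fix l assume "l < card S"
      then have l: "l < qq * r" using rq by simp
      let ?j = "l div r" and ?i = "l mod r"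
      let ?J = "Suc ?j mod qq"
      have i: "?i < r" using divr[OF l] by simp
      have J: "?J < qq" using q2 by simp
      have "g (h (gs ! l)) = g (h ((g ^^ ?j) (vs' ! ?i)))" using l by (simp add: gs_def)
      also have "\<dots> = (g ^^ Suc ?j) (h (vs' ! ?i))"
        using funpow_lin_commute[OF g h comm v'V[OF i]] by simp
      also have "cg P \<dots> ((g ^^ Suc ?j) (lc (c ?i) vs'))"
        by (rule lin_cg[OF lg lin_vecs[OF h v'V[OF i]] vecs_lc[OF vs'V] c[OF i]])
      also have "(g ^^ Suc ?j) (lc (c ?i) vs') = (g ^^ ?J) (lc (c ?i) vs')" by (rule gmod[OF vecs_lc[OF vs'V]])
      also have "\<dots> = (\<Sum>k<r. cs (c ?i k) ((g ^^ ?J) (vs' ! k)))"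
        using lin_lc[OF lg vs'V] len' by (simp add: lc_def)
      also have "\<dots> = (\<Sum>t\<in>{t \<in> {..<qq * r}. t div r = ?J}. cs (c ?i (t mod r)) ((g ^^ (t div r)) (vs' ! (t mod r))))"
      proof (rule sum.reindex_bij_witness[where i = "\<lambda>t. t mod r" and j = "\<lambda>k. ?J * r + k"])
        fix k assume k: "k \<in> {..<r}"
        have "?J * r + k < Suc ?J * r" using k by simp
        also have "\<dots> \<le> qq * r" using J by (intro mult_le_mono1) simp
        finally show "?J * r + k \<in> {t \<in> {..<qq * r}. t div r = ?J}" using k by simp
      qed (auto simp: divr, metis div_mult_mod_eq)
      also have "\<dots> = (\<Sum>t\<in>{..<qq * r}. if t div r = ?J then cs (c ?i (t mod r)) ((g ^^ (t div r)) (vs' ! (t mod r))) else 0)"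
        by (rule sum.inter_filter) simp
      also have "\<dots> = lc (aa l) gs"
        unfolding lc_def by (intro sum.cong) (auto simp: gs_def aa_def)
      finally show "cg P (g (h (gs ! l))) (lc (aa l) gs)" .
    qed
    also have "(\<Sum>l<card S. aa l l) = 0"
    proof (rule sum.neutral, rule ballI)
      fix l assume "l \<in> {..<card S}"
      then have "l div r < qq" using divr rq by simp
      then have "l div r \<noteq> Suc (l div r) mod qq" using q2
        by (cases "Suc (l div r) = qq") auto
      then show "aa l l = 0" by (simp add: aa_def)
    qed
    finally show ?thesis .
  qed
  have "[tr S (\<lambda>v. g (h v)) = 0] (mod int p ^ s)" for s
  proof (cases s)
    case (Suc n) then show ?thesis using cong[of n] by simp
  qed simp
  then show ?thesis by (rule eq_if_cong_powers[OF p_gt_1])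
qed

end

context fp_vecs
begin

text \<open>Because \<open>y - 1\<close> divides \<open>y\<^sup>k - 1\<close>.\<close>
lemma img_funpow_diff:
  assumes y: "lin S S y"
  shows "img (\<lambda>v. (y ^^ k) v - v) \<subseteq> img (\<lambda>v. y v - v)"
proof (rule img_subset)
  have l: "lin S S (\<lambda>v. y v - v)" by (intro lin_minus y lin_id)
  show s: "subm (img (\<lambda>v. y v - v))" by (rule subm_img[OF l])
  fix v assume v: "v \<in> V"
  show "(y ^^ k) v - v \<in> img (\<lambda>v. y v - v)"
  proof (induction k)
    case 0 then show ?case using subm_0[OF s] by simp
  next
    case (Suc k)
    have "y ((y ^^ k) v) - (y ^^ k) v \<in> img (\<lambda>v. y v - v)"
      by (rule img_mem[OF lin_vecs[OF lin_funpow[OF y] v]])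
    from subm_add[OF s this Suc] show ?case by simp
  qed
qed

text \<open>The criterion behind every vanishing statement. Split \<open>T\<close> into its \<open>p\<close>-part and its \<open>p'\<close>-part by the Chinese remainder theorem; \<open>T\<^bsup>n/p\<^esup>\<close> is
a generator of the subgroup of order \<open>p\<close> of the group generated by the \<open>p\<close>-part.\<close>
lemma trace_zero_op:
  assumes T: "lin S S T" and n: "\<And>v. v \<in> V \<Longrightarrow> (T ^^ n) v = v" "n > 0" "p dvd n"
    and le: "p * (card S - dm (img (\<lambda>v. (T ^^ (n div p)) v - v))) \<le> card S"
  shows "tr S T = 0"
proof -
  obtain b m where bm: "n = p ^ b * m" "\<not> p dvd m"
    using multiplicity_decompose'[of n p] n(2) p_gt_1 by (metis not_gr0 multiplicity_decompose' nat_dvd_1_iff_1 nat_neq_iff)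
  have "b \<noteq> 0" using bm n(3) by (cases b) auto
  then obtain a where a: "b = Suc a" by (cases b) auto
  let ?q = "p ^ Suc a"
  have n_eq: "n = ?q * m" using bm a by simp
  have cop: "coprime ?q m" using bm(2) prime by (simp add: prime_imp_coprime)
  \<comment> \<open>\<open>T\<^bsup>al\<^esup>\<close> is the \<open>p\<close>-part of \<open>T\<close> and \<open>T\<^bsup>be\<^esup>\<close> the part of order prime to \<open>p\<close>\<close>
  obtain al where al: "[al = 1] (mod ?q)" "[al = 0] (mod m)"
    using binary_chinese_remainder_nat[OF cop, of 1 0] by blast
  obtain be where be: "[be = 0] (mod ?q)" "[be = 1] (mod m)"
    using binary_chinese_remainder_nat[OF cop, of 0 1] by blast
  have "[al + be = 1] (mod ?q)" "[al + be = 1] (mod m)"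
    using cong_add[OF al(1) be(1)] cong_add[OF al(2) be(2)] by simp_all
  then have s1: "[al + be = 1] (mod n)" unfolding n_eq using cop by (rule coprime_cong_mult_nat)
  have lT: "lin S S (T ^^ k)" for k by (rule lin_funpow[OF T])
  have per: "(T ^^ (n * k)) v = v" if "v \<in> V" for v k
    by (induction k) (simp_all add: funpow_add n(1) that)
  have Tcong: "(T ^^ i) v = (T ^^ j) v" if "[i = j] (mod n)" "v \<in> V" for i j v
  proof -
    have "(T ^^ i) v = (T ^^ (i mod n)) v" for i
    proof -
      have "(T ^^ i) v = (T ^^ (i mod n + n * (i div n))) v" by simp
      also have "\<dots> = (T ^^ (i mod n)) ((T ^^ (n * (i div n))) v)" by (simp only: funpow_add comp_apply)
      finally show ?thesis by (simp add: per[OF that(2)])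
    qed
    then show ?thesis using that(1) by (metis cong_def)
  qed
  let ?g = "T ^^ al" and ?h = "T ^^ be"
  have gpow: "(?g ^^ k) = T ^^ (al * k)" for k by (simp add: funpow_mult)
  have hpow: "(?h ^^ k) = T ^^ (be * k)" for k by (simp add: funpow_mult)
  obtain al' where al': "al = m * al'" using al(2) by (auto simp: cong_0_iff)
  obtain be' where be': "be = ?q * be'" using be(1) by (auto simp: cong_0_iff)
  have "tr S (\<lambda>v. ?g (?h v)) = 0"
  proof (rule trace_zero_of_free[of ?g ?h a m])
    show "lin S S ?g" "lin S S ?h" by (rule lT)+
    show "?g (?h v) = ?h (?g v)" for v by (metis add.commute comp_apply funpow_add)
    show "(?g ^^ (p ^ Suc a)) v = v" if "v \<in> V" for v
      unfolding gpow using Tcong[of "al * ?q" 0 v] that by (simp add: n_eq al' cong_0_iff mult_ac)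
    show "(?h ^^ m) v = v" if "v \<in> V" for v
      unfolding hpow using Tcong[of "be * m" 0 v] that by (simp add: n_eq be' cong_0_iff mult_ac)
    show "coprime m p" using cop by (simp add: coprime_commute)
    let ?Z = "T ^^ (n div p)"
    have "n = p * (p ^ a * m)" using n_eq by simp
    then have ndp: "n div p = p ^ a * m" using p_pos by (metis nonzero_mult_div_cancel_left less_numeral_extra(3))
    have lZ: "lin S S ?Z" by (rule lT)
    have "[al = 1] (mod p)" by (rule cong_dvd_modulus_nat[OF al(1)]) simp
    then have "\<not> p dvd al" using p_gt_1 by (metis cong_dvd_iff nat_dvd_1_iff_1 nat_neq_iff)
    then have "\<not> p dvd al'" unfolding al' by (blast intro: dvd_mult)
    then have "coprime p al'" by (rule prime_imp_coprime[OF prime])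
    then have "coprime al' p" by (simp only: coprime_commute)
    from cong_solve_coprime_nat[OF this] obtain k where k: "[al' * k = 1] (mod p)" by auto
    have "(p ^ a * m) * (al' * k) mod (p ^ a * m * p) = (p ^ a * m) * ((al' * k) mod p)"
      by (rule mult_mod_right[symmetric])
    moreover have "(p ^ a * m) * 1 mod (p ^ a * m * p) = (p ^ a * m) * (1 mod p)"
      by (rule mult_mod_right[symmetric])
    ultimately have "[(p ^ a * m) * (al' * k) = (p ^ a * m) * 1] (mod n)"
      using k by (simp add: cong_def n_eq mult_ac)
    then have Zk: "((?g ^^ (p ^ a)) ^^ k) v = ?Z v" if "v \<in> V" for v
      using Tcong[of "(p ^ a * m) * (al' * k)" "p ^ a * m" v] that
      by (simp add: ndp gpow funpow_mult al' mult_ac)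
    have lgp: "lin S S (?g ^^ (p ^ a))" unfolding gpow by (rule lT)
    have "img (\<lambda>v. ?Z v - v) = img (\<lambda>v. ((?g ^^ (p ^ a)) ^^ k) v - v)"
      by (rule img_cong[OF lin_minus[OF lZ lin_id] lin_minus[OF lin_funpow[OF lgp] lin_id]]) (simp add: Zk)
    also have "\<dots> \<subseteq> img (\<lambda>v. (?g ^^ (p ^ a)) v - v)" by (rule img_funpow_diff[OF lgp])
    finally have sub: "img (\<lambda>v. ?Z v - v) \<subseteq> img (\<lambda>v. (?g ^^ (p ^ a)) v - v)" .
    have "dm (img (\<lambda>v. ?Z v - v)) \<le> dm (img (\<lambda>v. (?g ^^ (p ^ a)) v - v))"
      by (rule dm_mono[OF subm_img subm_img sub]) (intro lin_minus lZ lgp lin_id)+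
    then have "p * (card S - dm (img (\<lambda>v. (?g ^^ (p ^ a)) v - v))) \<le> p * (card S - dm (img (\<lambda>v. ?Z v - v)))"
      by (intro mult_le_mono2 diff_le_mono2)
    also note le
    finally show "p * (card S - dm (img (\<lambda>v. (?g ^^ (p ^ a)) v - v))) \<le> card S" .
  qed
  also have "tr S (\<lambda>v. ?g (?h v)) = tr S T"
    unfolding tr_def
  proof (rule sum.cong[OF refl])
    fix s assume "s \<in> S"
    then have "?g (?h (dl s)) = T (dl s)"
      using Tcong[OF s1, of "dl s"] by (simp add: funpow_add)
    then show "?g (?h (dl s)) s = T (dl s) s" by simp
  qed
  finally show ?thesis .
qed

end

section \<open>Operators on the integral group ring\<close>
locale fin_group = group G for G :: "('a, 'b) monoid_scheme" (structure) +
  assumes fin_carrier [simp]: "finite (carrier G)"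
begin

abbreviation "S \<equiv> carrier G"
abbreviation gm :: "('a \<Rightarrow> int) \<Rightarrow> ('a \<Rightarrow> int) \<Rightarrow> 'a \<Rightarrow> int" where
  "gm u v \<equiv> u \<otimes>\<^bsub>int_group_ring G\<^esub> v"
abbreviation gpow :: "('a \<Rightarrow> int) \<Rightarrow> nat \<Rightarrow> 'a \<Rightarrow> int" where
  "gpow u n \<equiv> u [^]\<^bsub>int_group_ring G\<^esub> n"

sublocale R: ring "int_group_ring G" by (rule ring_int_group_ring[OF fin_carrier])

lemma R_carrier: "carrier (int_group_ring G) = vecs S"
  by (auto simp: int_group_ring_def vecs_def)
lemma R_one: "\<one>\<^bsub>int_group_ring G\<^esub> = dl \<one>"
  by (simp add: int_group_ring_def dl_def)

lemma gm_vecs [simp]: "gm u v \<in> vecs S"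
  by (auto simp: vecs_def int_group_ring_mult_outside)
lemma gm_apply: "x \<in> S \<Longrightarrow> gm u v x = (\<Sum>h\<in>S. u h * v (inv h \<otimes> x))"
  by (rule int_group_ring_mult)
lemma gm_assoc: "gm (gm u v) w = gm u (gm v w)" by (rule int_group_ring_assoc)
lemma gm_one_left [simp]: "v \<in> vecs S \<Longrightarrow> gm (dl \<one>) v = v"
  using R.l_one[of v] by (simp add: R_carrier R_one)
lemma gm_one_right [simp]: "v \<in> vecs S \<Longrightarrow> gm v (dl \<one>) = v"
  using R.r_one[of v] by (simp add: R_carrier R_one)
lemma gm_add_left: "gm (u + v) w = gm u w + gm v w"
proof
  fix x show "gm (u + v) w x = (gm u w + gm v w) x"
    by (cases "x \<in> S") (simp_all add: gm_apply fapp distrib_right sum.distrib int_group_ring_mult_outside)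
qed
lemma gm_add_right: "gm w (u + v) = gm w u + gm w v"
proof
  fix x show "gm w (u + v) x = (gm w u + gm w v) x"
    by (cases "x \<in> S") (simp_all add: gm_apply fapp distrib_left sum.distrib int_group_ring_mult_outside)
qed
lemma lin_left: "lin S S (\<lambda>v. gm w v)" by (simp add: lin_def gm_add_right)
lemma lin_right: "lin S S (\<lambda>v. gm v w)" by (simp add: lin_def gm_add_left)

lemma gm_dl_left: assumes "a \<in> S" "x \<in> S" shows "gm (dl a) v x = v (inv a \<otimes> x)"
proof -
  have "(\<Sum>h\<in>S. dl a h * v (inv h \<otimes> x)) = (\<Sum>h\<in>S. if h = a then v (inv h \<otimes> x) else 0)"
    by (intro sum.cong) (auto simp: dl_def)
  then show ?thesis using assms by (simp add: gm_apply)
qed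
lemma gm_dl_dl: assumes "a \<in> S" "b \<in> S" shows "gm (dl a) (dl b) = dl (a \<otimes> b)"
proof
  fix x show "gm (dl a) (dl b) x = dl (a \<otimes> b) x"
  proof (cases "x \<in> S")
    case True
    have "inv a \<otimes> x = b \<longleftrightarrow> x = a \<otimes> b"
      using assms True by (metis inv_solve_left)
    then show ?thesis using True assms by (simp add: gm_dl_left) (simp add: dl_def)
  next
    case False then show ?thesis using assms by (auto simp: int_group_ring_mult_outside dl_def)
  qed
qed

lemma gpow_vecs [simp]: "u \<in> vecs S \<Longrightarrow> gpow u n \<in> vecs S"
  using R.nat_pow_closed[of u n] by (simp add: R_carrier)
lemma gpow_0 [simp]: "gpow u 0 = dl \<one>" by (simp add: R_one)
lemma gpow_Suc: "gpow u (Suc n) = gm (gpow u n) u" by simp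
lemma gpow_add: "u \<in> vecs S \<Longrightarrow> gm (gpow u m) (gpow u n) = gpow u (m + n)"
  using R.nat_pow_mult[of u m n] by (simp add: R_carrier)
lemma gpow_mult: "u \<in> vecs S \<Longrightarrow> gpow (gpow u m) n = gpow u (m * n)"
  using R.nat_pow_pow[of u m n] by (simp add: R_carrier)
lemma gpow_1 [simp]: "u \<in> vecs S \<Longrightarrow> gpow u (Suc 0) = u" by (simp add: R_one)
lemma gpow_dl: "a \<in> S \<Longrightarrow> gpow (dl a) n = dl (a [^] n)"
  by (induction n) (simp_all add: gpow_Suc gm_dl_dl R_one del: monoid.nat_pow_Suc)

lemma right_funpow: "u \<in> vecs S \<Longrightarrow> v \<in> vecs S \<Longrightarrow> ((\<lambda>v. gm v u) ^^ n) v = gm v (gpow u n)"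
  by (induction n) (simp_all add: gm_assoc R_one)

text \<open>Simultaneous left multiplication by a group element and right multiplication by a unit; its
traces are the class sums \<open>ctr\<close> of \<open>u\<close>, weighted by centraliser orders.\<close>
definition act :: "'a \<Rightarrow> ('a \<Rightarrow> int) \<Rightarrow> ('a \<Rightarrow> int) \<Rightarrow> 'a \<Rightarrow> int" where
  "act a u v = gm (gm (dl a) v) u"

lemma lin_act: "lin S S (act a u)" unfolding act_def by (rule lin_comp[OF lin_left lin_right])
lemma act_vecs [simp]: "act a u v \<in> vecs S" by (simp add: act_def)
lemma act_act: assumes "a \<in> S" "b \<in> S" shows "act a u (act b w v) = act (a \<otimes> b) (gm w u) v"
proof -
  have "act a u (act b w v) = gm (gm (dl a) (dl b)) (gm v (gm w u))" by (simp only: act_def gm_assoc)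
  also have "\<dots> = act (a \<otimes> b) (gm w u) v" using assms by (simp add: act_def gm_assoc gm_dl_dl)
  finally show ?thesis .
qed
lemma act_funpow: assumes "a \<in> S" "u \<in> vecs S" "v \<in> vecs S"
  shows "(act a u ^^ n) v = act (a [^] n) (gpow u n) v"
proof (induction n)
  case 0 then show ?case using assms by (simp add: act_def R_one)
next
  case (Suc n)
  have "act a u (act (a [^] n) (gpow u n) v) = act (a \<otimes> a [^] n) (gm (gpow u n) u) v"
    using assms by (intro act_act) simp_all
  moreover have "a \<otimes> a [^] n = a [^] Suc n" using nat_pow_Suc2[OF assms(1)] by simp
  ultimately show ?case using Suc by (simp only: funpow.simps comp_apply gpow_Suc)
qed

definition ctr :: "('a \<Rightarrow> int) \<Rightarrow> 'a \<Rightarrow> int" where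
  "ctr u x = (\<Sum>m\<in>S. u (inv m \<otimes> x \<otimes> m))"

lemma tr_act: assumes "a \<in> S" shows "tr S (act a u) = ctr u (inv a)"
  unfolding tr_def ctr_def
proof (rule sum.cong[OF refl])
  fix m assume m: "m \<in> S"
  have "act a u (dl m) m = gm (dl (a \<otimes> m)) u m" using assms m by (simp add: act_def gm_dl_dl)
  also have "\<dots> = u (inv (a \<otimes> m) \<otimes> m)" using assms m by (simp add: gm_dl_left)
  finally show "act a u (dl m) m = u (inv m \<otimes> inv a \<otimes> m)" using assms m by (simp add: inv_mult_group)
qed

end

locale fin_group_p = fin_group G + fp_vecs "carrier G" p
  for G :: "('a, 'b) monoid_scheme" (structure) and p
begin

text \<open>The cosets of the subgroup generated by \<open>y\<close> partition \<open>G\<close>, so representatives of them generate \<open>\<int>G\<close> modulo the image of \<open>y - 1\<close>.\<close>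
lemma free_left:
  assumes y: "y \<in> carrier G" "y \<noteq> \<one>" "y [^] p = \<one>"
  shows "p * (card S - dm (img (\<lambda>v. gm (dl y) v - v))) \<le> card S"
proof -
  define H where "H = generate G {y}"
  have Hsub: "subgroup H G" unfolding H_def by (rule generate_is_subgroup) (use y in auto)
  have "ord y dvd p" using y by (simp flip: pow_eq_id)
  then have "ord y = p" using prime y ord_eq_1[OF y(1)] by (auto simp: prime_nat_iff)
  then have cardH: "card H = p" unfolding H_def using generate_pow_card[OF y(1)] by simp
  define rep where "rep A = (SOME a. a \<in> A)" for A :: "'a set"
  define C where "C = rcosets H"
  have finC: "finite C" unfolding C_def RCOSETS_def by simp
  obtain As where As: "set As = C" "distinct As" using finite_distinct_list[OF finC] by blast
  define F where "F = map (\<lambda>A. dl (rep A)) As"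
  have lenF: "length F = card C" using As distinct_card[of As] by (simp add: F_def)
  have lag: "card C * p = card S" using lagrange[OF Hsub] cardH by (simp add: C_def order_def)
  have repA: "rep (H #> s) \<in> H #> s" if "s \<in> S" for s
    unfolding rep_def using rcos_self[OF that Hsub] by (rule someI)
  have cosS: "H #> s \<subseteq> S" if "s \<in> S" for s
    using that subgroup.subset[OF Hsub] r_coset_subset_G by blast
  have FV: "set F \<subseteq> V"
  proof
    fix v assume "v \<in> set F"
    then obtain A where "A \<in> C" "v = dl (rep A)" using As by (auto simp: F_def)
    moreover from this(1) obtain s where "s \<in> S" "A = H #> s" by (auto simp: C_def RCOSETS_def)
    moreover from this have "rep A \<in> S" using repA cosS by blast
    ultimately show "v \<in> V" by simp
  qed
  let ?D = "\<lambda>v. gm (dl y) v - v"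
  have ly: "lin S S (\<lambda>v. gm (dl y) v)" by (rule lin_left)
  have lD: "lin S S ?D" by (intro lin_minus ly lin_id)
  have sI: "subm (img ?D)" by (rule subm_img[OF lD])
  have sE: "subm (ext (img ?D) F)" by (rule subm_ext[OF sI FV])
  have dlE: "dl s \<in> ext (img ?D) F" if s: "s \<in> S" for s
  proof -
    let ?c = "rep (H #> s)"
    have cS: "?c \<in> S" using repA[OF s] cosS[OF s] by blast
    obtain h where h: "h \<in> H" "?c = h \<otimes> s" using repA[OF s] by (auto simp: r_coset_def)
    have "inv h \<in> H" by (rule subgroup.m_inv_closed[OF Hsub h(1)])
    then obtain i :: nat where i: "inv h = y [^] i"
      unfolding H_def generate_pow_on_finite_carrier[OF fin_carrier y(1)] by auto
    have hS: "h \<in> S" using h(1) subgroup.subset[OF Hsub] by blast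
    have s_eq: "s = y [^] i \<otimes> ?c" using h(2) hS s by (simp add: i[symmetric] m_assoc[symmetric])
    have "((\<lambda>v. gm (dl y) v) ^^ i) (dl ?c) = gm (dl (y [^] i)) (dl ?c)" for i
    proof (induction i)
      case 0 then show ?case using cS by simp
    next
      case (Suc i)
      have "gm (dl y) (gm (dl (y [^] i)) (dl ?c)) = dl (y \<otimes> (y [^] i \<otimes> ?c))"
        using cS y by (simp add: gm_dl_dl)
      also have "y \<otimes> (y [^] i \<otimes> ?c) = y [^] Suc i \<otimes> ?c"
        using cS y(1) nat_pow_Suc2[OF y(1), of i] by (simp add: m_assoc del: nat_pow_Suc)
      finally show ?case using Suc cS y(1) by (simp add: gm_dl_dl del: nat_pow_Suc)
    qed
    then have "((\<lambda>v. gm (dl y) v) ^^ i) (dl ?c) = dl s" using s_eq cS y(1) by (simp add: gm_dl_dl)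
    then have "dl s - dl ?c \<in> img (\<lambda>v. ((\<lambda>v. gm (dl y) v) ^^ i) v - v)"
      using img_mem[of "dl ?c" "\<lambda>v. ((\<lambda>v. gm (dl y) v) ^^ i) v - v"] cS by simp
    then have "dl s - dl ?c \<in> img ?D" using img_funpow_diff[OF ly] by blast
    then have 1: "dl s - dl ?c \<in> ext (img ?D) F" using ext_mono by blast
    have "dl ?c \<in> set F" using s As by (auto simp: F_def C_def RCOSETS_def)
    then have "dl ?c \<in> ext (img ?D) F" using ext_set[OF sI FV] by blast
    from subm_add[OF sE 1 this] show ?thesis by simp
  qed
  have "V \<subseteq> ext (img ?D) F"
  proof
    fix v assume v: "v \<in> V"
    show "v \<in> ext (img ?D) F"
      by (subst vecs_expand[OF fin v]) (intro subm_sum[OF sE] subm_cs[OF sE] dlE)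
  qed
  then have "dm V \<le> dm (ext (img ?D) F)" by (rule dm_mono[OF subm_vecs sE])
  also have "\<dots> \<le> dm (img ?D) + length F" by (rule dm_ext_le[OF sI FV])
  finally have "card S - dm (img ?D) \<le> card C" using dm_V lenF by simp
  then have "p * (card S - dm (img ?D)) \<le> p * card C" by (rule mult_le_mono2)
  also have "\<dots> = card S" using lag by (simp only: mult.commute)
  finally show ?thesis .
qed

lemma act_trace_zero:
  assumes a: "a \<in> carrier G" and u: "u \<in> vecs S" and n: "a [^] n = \<one>" "gpow u n = dl \<one>" "n > 0" "p dvd n"
    and le: "p * (card S - dm (img (\<lambda>v. act (a [^] (n div p)) (gpow u (n div p)) v - v))) \<le> card S"
  shows "ctr u (inv a) = 0"
proof -
  have "tr S (act a u) = 0"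
  proof (rule trace_zero_op[OF lin_act _ n(3,4)])
    show "(act a u ^^ n) v = v" if "v \<in> V" for v
      using act_funpow[OF a u that, of n] n that by (simp add: act_def)
    have "img (\<lambda>v. (act a u ^^ (n div p)) v - v) = img (\<lambda>v. act (a [^] (n div p)) (gpow u (n div p)) v - v)"
    proof (rule img_cong)
      show "lin S S (\<lambda>v. (act a u ^^ (n div p)) v - v)" by (intro lin_minus lin_funpow lin_act lin_id)
      show "lin S S (\<lambda>v. act (a [^] (n div p)) (gpow u (n div p)) v - v)" by (intro lin_minus lin_act lin_id)
    qed (simp add: act_funpow[OF a u])
    with le show "p * (card S - dm (img (\<lambda>v. (act a u ^^ (n div p)) v - v))) \<le> card S" by simp
  qed
  then show ?thesis by (simp add: tr_act[OF a])
qed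

text \<open>Here the power of the operator that has order \<open>p\<close> is left multiplication by a group element of order \<open>p\<close>, which acts freely.\<close>
lemma ctr_zero_if_p_part_large:
  assumes x: "x \<in> carrier G" and u: "u \<in> vecs S" and n: "x [^] n = \<one>" "gpow u n = dl \<one>" "n > 0" "p dvd n"
    and nd: "gpow u (n div p) = dl \<one>" "x [^] (n div p) \<noteq> \<one>"
  shows "ctr u x = 0"
proof -
  let ?a = "inv x" and ?y = "inv x [^] (n div p)"
  have a: "?a \<in> carrier G" "?a [^] n = \<one>" using x n(1) by (simp_all add: nat_pow_inv)
  have y: "?y \<in> carrier G" "?y \<noteq> \<one>" using x nd(2) by (simp_all add: nat_pow_inv)
  have "?y [^] p = ?a [^] (n div p * p)" using a(1) by (simp add: nat_pow_pow)
  then have y': "?y [^] p = \<one>" using n(4) a(2) by simp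
  have "(\<lambda>v. act ?y (dl \<one>) v - v) = (\<lambda>v. gm (dl ?y) v - v)" by (simp add: act_def)
  then have "ctr u (inv ?a) = 0"
    using act_trace_zero[OF a(1) u a(2) n(2-4)] free_left[OF y y'] nd(1) by simp
  then show ?thesis using x by simp
qed

end

section \<open>Normalised units of prime order\<close>
lemma fermat_int:
  fixes a :: int assumes "Factorial_Ring.prime (l::nat)" shows "[a ^ l = a] (mod int l)"
proof -
  define b where "b = nat (a mod int l)"
  have l: "l > 0" using assms prime_gt_0_nat by blast
  have b: "[int b = a] (mod int l)" using l by (simp add: b_def cong_def)
  have "[b ^ l = b] (mod l)"
  proof (cases "l dvd b")
    case True
    moreover have "l dvd b ^ l" using True l by (metis dvd_power dvd_trans)
    ultimately show ?thesis by (simp add: cong_def)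
  next
    case False
    have "[b ^ (l - 1) * b = 1 * b] (mod l)"
      by (intro cong_mult cong_refl fermat_theorem[OF assms False])
    moreover have "b ^ (l - 1) * b = b ^ l" using l by (metis power_minus_mult)
    ultimately show ?thesis by simp
  qed
  then have "[int b ^ l = int b] (mod int l)" by (simp flip: cong_int_iff)
  moreover have "[a ^ l = int b ^ l] (mod int l)" by (rule cong_pow[OF cong_sym[OF b]])
  ultimately show ?thesis using b cong_trans by blast
qed

text \<open>Orbits of an action of a cyclic group of prime order \<open>l\<close> are fixed points or have \<open>l\<close> elements.\<close>
lemma orbit_sum:
  fixes w :: "'x \<Rightarrow> int"
  assumes l: "Factorial_Ring.prime (l::nat)" and "finite Y" "\<And>x. x \<in> Y \<Longrightarrow> f x \<in> Y"
    "\<And>x. x \<in> Y \<Longrightarrow> (f ^^ l) x = x" "\<And>x. x \<in> Y \<Longrightarrow> w (f x) = w x"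
  shows "[sum w Y = sum w {x \<in> Y. f x = x}] (mod int l)"
  using assms(2-)
proof (induction "card Y" arbitrary: Y rule: less_induct)
  case less
  note fin = less.prems(1) and cl = less.prems(2) and per = less.prems(3) and inv = less.prems(4)
  show ?case
  proof (cases "\<forall>x\<in>Y. f x = x")
    case True
    then have "{x \<in> Y. f x = x} = Y" by blast
    then show ?thesis by simp
  next
    case False
    then obtain x where x: "x \<in> Y" "f x \<noteq> x" by blast
    have fY: "(f ^^ i) y \<in> Y" if "y \<in> Y" for i y by (induction i) (use that cl in auto)
    have wi: "w ((f ^^ i) x) = w x" for i by (induction i) (use inv fY x in auto)
    have perm: "(f ^^ (l * k)) y = y" if "y \<in> Y" for k y
      by (induction k) (simp_all add: funpow_add per that)
    have nofix: "(f ^^ k) x \<noteq> x" if k: "0 < k" "k < l" for k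
    proof
      assume fk: "(f ^^ k) x = x"
      have "\<not> l dvd k" using k by (simp add: nat_dvd_not_less)
      then have "coprime l k" by (rule prime_imp_coprime[OF l])
      then have "coprime k l" by (simp only: coprime_commute)
      from cong_solve_coprime_nat[OF this] obtain a where a: "[k * a = 1] (mod l)" by auto
      have fka: "(f ^^ (k * a)) x = x" by (induction a) (simp_all add: funpow_add fk)
      have "k * a mod l = 1" using a prime_gt_1_nat[OF l] by (simp add: cong_def)
      then have b: "k * a = 1 + l * (k * a div l)" by (metis add.commute mult_div_mod_eq)
      have "(f ^^ (1 + l * (k * a div l))) x = f x" using perm[OF x(1)] by (simp add: funpow_add)
      then have "(f ^^ (k * a)) x = f x" using b by metis
      then show False using fka x(2) by simp
    qed
    define Ob where "Ob = (\<lambda>i. (f ^^ i) x) ` {..<l}"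
    have inj: "inj_on (\<lambda>i. (f ^^ i) x) {..<l}"
    proof (rule linorder_inj_onI)
      fix i j assume ij: "i < j" "i \<in> {..<l}" "j \<in> {..<l}"
      show "(f ^^ i) x \<noteq> (f ^^ j) x"
      proof
        assume e: "(f ^^ i) x = (f ^^ j) x"
        have "(f ^^ (l - i)) ((f ^^ i) x) = x" using per[OF x(1)] ij by (simp flip: comp_apply[of "f ^^ _"] funpow_add)
        moreover have "(f ^^ (l - i)) ((f ^^ j) x) = (f ^^ (j - i)) x"
        proof -
          have "(l - i) + j = (j - i) + l" using ij by simp
          then have "(f ^^ (l - i)) ((f ^^ j) x) = (f ^^ (j - i)) ((f ^^ l) x)"
            by (metis comp_apply funpow_add)
          then show ?thesis using per[OF x(1)] by simp
        qed
        moreover have "0 < j - i" "j - i < l" using ij by auto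
        ultimately show False using e nofix[of "j - i"] by simp
      qed
    qed auto
    have cardO: "card Ob = l" unfolding Ob_def using card_image[OF inj] by simp
    have OY: "Ob \<subseteq> Y" unfolding Ob_def using fY x by blast
    have fO: "f y \<in> Ob \<longleftrightarrow> y \<in> Ob" if y: "y \<in> Y" for y
    proof
      assume "y \<in> Ob"
      then obtain i where i: "i < l" "y = (f ^^ i) x" by (auto simp: Ob_def)
      show "f y \<in> Ob"
      proof (cases "Suc i < l")
        case True then show ?thesis unfolding Ob_def i(2) by (intro image_eqI[of _ _ "Suc i"]) auto
      next
        case False
        then have "f y = (f ^^ l) x" using i by (metis Suc_lessI comp_apply funpow.simps(2))
        then have "f y = (f ^^ 0) x" using per[OF x(1)] by simp
        then show ?thesis unfolding Ob_def using i(1) by (intro image_eqI[of _ _ 0]) auto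
      qed
    next
      assume "f y \<in> Ob"
      then obtain i where i: "i < l" "f y = (f ^^ i) x" by (auto simp: Ob_def)
      have "l > 0" using i by simp
      then have "y = (f ^^ (l - 1)) (f y)" using per[OF y] by (metis One_nat_def Suc_pred comp_apply funpow_Suc_right)
      also have "\<dots> = (f ^^ (l - 1 + i)) x" unfolding i(2) by (simp only: funpow_add comp_apply)
      also have "\<dots> \<in> Ob"
      proof (cases "l - 1 + i < l")
        case True then show ?thesis unfolding Ob_def by blast
      next
        case False
        then have "l - 1 + i = (i - 1) + l" using i by simp
        then have "(f ^^ (l - 1 + i)) x = (f ^^ (i - 1)) x" using per[OF x(1)] by (simp add: funpow_add)
        then show ?thesis unfolding Ob_def using i by (intro image_eqI[of _ _ "i - 1"]) auto
      qed
      finally show "y \<in> Ob" .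
    qed
    have nofixO: "{y \<in> Y - Ob. f y = y} = {y \<in> Y. f y = y}"
    proof -
      have "f y \<noteq> y" if yOb: "y \<in> Ob" for y
      proof
        assume fy: "f y = y"
        obtain i where i: "i < l" "y = (f ^^ i) x" using yOb by (auto simp: Ob_def)
        have "(f ^^ k) y = y" for k by (induction k) (use fy in auto)
        then have "y = (f ^^ (l - i)) y" by simp
        also have "\<dots> = x" using per[OF x(1)] i by (simp flip: comp_apply[of "f ^^ _"] funpow_add)
        finally show False using fy x by simp
      qed
      then show ?thesis by blast
    qed
    have "[sum w (Y - Ob) = sum w {y \<in> Y - Ob. f y = y}] (mod int l)"
    proof (rule less.hyps)
      have "Ob \<noteq> {}" using cardO l by (metis card.empty not_prime_0)
      then show "card (Y - Ob) < card Y" using OY fin by (intro psubset_card_mono) auto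
      show "f y \<in> Y - Ob" if "y \<in> Y - Ob" for y using that fO cl by blast
    qed (use fin per inv in auto)
    moreover have "sum w Y = sum w (Y - Ob) + sum w Ob" using sum.subset_diff[OF OY fin] by simp
    moreover have "sum w Ob = int l * w x"
    proof -
      have "sum w Ob = (\<Sum>y\<in>Ob. w x)" unfolding Ob_def by (intro sum.cong) (auto simp: wi)
      then show ?thesis using cardO by simp
    qed
    ultimately show ?thesis using nofixO by (simp add: cong_def)
  qed
qed

lemma (in fin_group) gm_gpow_left: "u \<in> vecs S \<Longrightarrow> gm u (gpow u n) = gpow u (Suc n)"
  using gpow_add[of u "Suc 0" n] by (simp only: gpow_1 add_Suc add_0)

context fin_group
begin

definition mprod :: "'a list \<Rightarrow> 'a" where "mprod xs = foldr (\<otimes>) xs \<one>"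

text \<open>Coefficients of powers of a group ring element are sums over words with prescribed product; cyclic rotation acts on the words with product one.\<close>
definition words :: "nat \<Rightarrow> 'a \<Rightarrow> 'a list set" where
  "words n g = {xs. length xs = n \<and> set xs \<subseteq> S \<and> mprod xs = g}"

lemma mprod_Cons: "mprod (x # xs) = x \<otimes> mprod xs" by (simp add: mprod_def)
lemma mprod_Nil: "mprod [] = \<one>" by (simp add: mprod_def)
lemma mprod_closed: "set xs \<subseteq> S \<Longrightarrow> mprod xs \<in> S"
  by (induction xs) (auto simp: mprod_Cons mprod_Nil)
lemma mprod_snoc: "set xs \<subseteq> S \<Longrightarrow> x \<in> S \<Longrightarrow> mprod (xs @ [x]) = mprod xs \<otimes> x"
  by (induction xs) (auto simp: mprod_Cons mprod_Nil m_assoc mprod_closed)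
lemma mprod_replicate: "x \<in> S \<Longrightarrow> mprod (replicate n x) = x [^] n"
  by (induction n) (auto simp: mprod_Cons mprod_Nil nat_pow_Suc2[symmetric] simp del: nat_pow_Suc)

lemma finite_words: "finite (words n g)"
proof (rule finite_subset)
  show "words n g \<subseteq> {xs. set xs \<subseteq> S \<and> length xs = n}" by (auto simp: words_def)
  show "finite {xs. set xs \<subseteq> S \<and> length xs = n}" by (rule finite_lists_length_eq) simp
qed

lemma gpow_words:
  assumes u: "u \<in> vecs S" and g: "g \<in> S"
  shows "gpow u n g = (\<Sum>xs\<in>words n g. \<Prod>x\<leftarrow>xs. u x)"
  using g
proof (induction n arbitrary: g)
  case 0
  have "words 0 g = (if g = \<one> then {[]} else {})" by (auto simp: words_def mprod_Nil)
  then show ?case by (simp add: dl_def R_one)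
next
  case (Suc n)
  have "gpow u (Suc n) g = gm u (gpow u n) g" using gm_gpow_left[OF u] by simp
  also have "\<dots> = (\<Sum>h\<in>S. u h * gpow u n (inv h \<otimes> g))" by (rule gm_apply[OF Suc.prems])
  also have "\<dots> = (\<Sum>h\<in>S. \<Sum>xs\<in>words n (inv h \<otimes> g). u h * (\<Prod>x\<leftarrow>xs. u x))"
    by (intro sum.cong refl) (use Suc in \<open>simp add: sum_distrib_left\<close>)
  also have "\<dots> = (\<Sum>(h, xs)\<in>(SIGMA h:S. words n (inv h \<otimes> g)). u h * (\<Prod>x\<leftarrow>xs. u x))"
    by (rule sum.Sigma) (auto simp: finite_words)
  also have "\<dots> = (\<Sum>xs\<in>words (Suc n) g. \<Prod>x\<leftarrow>xs. u x)"
  proof (rule sum.reindex_bij_witness[where i = "\<lambda>xs. (hd xs, tl xs)" and j = "\<lambda>(h, xs). h # xs"])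
    fix a assume "a \<in> (SIGMA h:S. words n (inv h \<otimes> g))"
    then show "(case a of (h, xs) \<Rightarrow> h # xs) \<in> words (Suc n) g" using Suc.prems
      by (auto simp: words_def mprod_Cons m_assoc[symmetric])
  next
    fix b assume b: "b \<in> words (Suc n) g"
    then obtain h xs where hx: "b = h # xs" "h \<in> S" "set xs \<subseteq> S" "length xs = n" "h \<otimes> mprod xs = g"
      by (cases b) (auto simp: words_def mprod_Cons)
    then have "mprod xs = inv h \<otimes> g" using mprod_closed[OF hx(3)] by (auto simp: m_assoc[symmetric])
    then show "(hd b, tl b) \<in> (SIGMA h:S. words n (inv h \<otimes> g))" using hx by (simp add: words_def)
    show "(case (hd b, tl b) of (h, xs) \<Rightarrow> h # xs) = b" using hx by simp
  qed auto
  finally show ?case .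
qed

text \<open>Rotate the words of length \<open>l\<close> with product one. A fixed word is constant, with entry \<open>x\<close> such that \<open>x\<^sup>l = 1\<close>, and
for a prime \<open>l\<close> not dividing the group order this means \<open>x = 1\<close>. So only the word of ones survives modulo \<open>l\<close>.\<close>
lemma prime_power_coeff_one:
  assumes u: "u \<in> vecs S" and l: "Factorial_Ring.prime l" "\<not> l dvd card S"
  shows "[gpow u l \<one> = u \<one>] (mod int l)"
proof -
  let ?Y = "words l \<one>" and ?w = "\<lambda>xs. \<Prod>x\<leftarrow>xs. u x"
  have "[sum ?w ?Y = sum ?w {xs \<in> ?Y. rotate1 xs = xs}] (mod int l)"
  proof (rule orbit_sum[OF l(1) finite_words])
    fix xs assume xs: "xs \<in> ?Y"
    show "rotate1 xs \<in> ?Y"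
    proof (cases xs)
      case (Cons h t)
      then have "h \<in> S" "set t \<subseteq> S" "h \<otimes> mprod t = \<one>" using xs by (auto simp: words_def mprod_Cons)
      then have "mprod t \<otimes> h = \<one>" using mprod_closed[of t] inv_comm by blast
      then show ?thesis using xs Cons \<open>h \<in> S\<close> \<open>set t \<subseteq> S\<close> by (auto simp: words_def mprod_snoc)
    qed (use xs in simp)
    have "(rotate1 ^^ l) xs = rotate l xs" by (simp add: rotate_def)
    also have "\<dots> = xs" using xs by (simp add: words_def rotate_id)
    finally show "(rotate1 ^^ l) xs = xs" .
    show "?w (rotate1 xs) = ?w xs" by (cases xs) (simp_all add: mult.commute)
  qed
  also have "{xs \<in> ?Y. rotate1 xs = xs} = {replicate l \<one>}"
  proof
    show "{replicate l \<one>} \<subseteq> {xs \<in> ?Y. rotate1 xs = xs}"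
      by (auto simp: words_def mprod_replicate)
    show "{xs \<in> ?Y. rotate1 xs = xs} \<subseteq> {replicate l \<one>}"
    proof
      fix xs assume "xs \<in> {xs \<in> ?Y. rotate1 xs = xs}"
      then have xs: "length xs = l" "set xs \<subseteq> S" "mprod xs = \<one>" "rotate1 xs = xs" by (auto simp: words_def)
      have l0: "l > 0" using l prime_gt_0_nat by blast
      have step: "xs ! Suc i = xs ! i" if "Suc i < l" for i
        using nth_rotate1[of i xs] that xs by simp
      have all: "xs ! i = xs ! 0" if "i < l" for i
        using that by (induction i) (simp_all add: step)
      have rep: "xs = replicate l (xs ! 0)"
      proof (rule nth_equalityI)
        show "length xs = length (replicate l (xs ! 0))" by (simp add: xs(1))
        fix i assume "i < length xs"
        then have i: "i < l" by (simp add: xs(1))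
        show "xs ! i = replicate l (xs ! 0) ! i" unfolding List.nth_replicate[OF i] by (rule all[OF i])
      qed
      have x0: "xs ! 0 \<in> S" using xs l0 nth_mem by blast
      have "(xs ! 0) [^] l = \<one>" using mprod_replicate[OF x0, of l] xs(3) unfolding rep[symmetric] by simp
      then have "ord (xs ! 0) dvd l" using x0 by (simp add: pow_eq_id)
      moreover have "ord (xs ! 0) dvd card S" using ord_dvd_group_order[OF x0] by (simp add: order_def)
      moreover from calculation(1) have "ord (xs ! 0) = 1 \<or> ord (xs ! 0) = l"
        using l(1) by (auto simp: prime_nat_iff)
      ultimately have "ord (xs ! 0) = 1" using l(2) by auto
      then have "xs ! 0 = \<one>" using ord_eq_1[OF x0] by simp
      with rep have "xs = replicate l \<one>" by metis
      then show "xs \<in> {replicate l \<one>}" by simp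
    qed
  qed
  also have "sum ?w {replicate l \<one>} = u \<one> ^ l" by simp
  also have "[u \<one> ^ l = u \<one>] (mod int l)" by (rule fermat_int[OF l(1)])
  finally show ?thesis using gpow_words[OF u, of \<one> l] by simp
qed

end

context fin_group_p
begin

lemma gpow_aug: "u \<in> vecs S \<Longrightarrow> augmentation G u = 1 \<Longrightarrow> augmentation G (gpow u n) = 1"
  by (induction n) (simp_all add: augmentation_one augmentation_mult)

lemma tr_right: "tr S (\<lambda>v. gm v u) = int (card S) * u \<one>"
proof -
  have "gm (dl m) u m = u \<one>" if "m \<in> S" for m using that by (simp add: gm_dl_left)
  then show ?thesis by (simp add: tr_def)
qed

text \<open>A purely combinatorial replacement for Galois conjugacy of the values of a trace: by the previous congruence, taking the \<open>l\<close>-th power, for a prime \<open>l\<close>, preserves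
the coefficient at one as soon as \<open>l\<close> exceeds all relevant coefficients, and every exponent prime to \<open>p\<close> is congruent modulo \<open>p\<close> to a product
of such primes.\<close>
lemma prime_order_coeff_const:
  assumes z: "z \<in> vecs S" "gpow z p = dl \<one>" and i: "0 < i" "i < p"
  shows "gpow z i \<one> = gpow z 1 \<one>"
proof -
  define c where "c k = gpow z k \<one>" for k
  have per: "c k = c (k mod p)" for k
  proof -
    have "gpow z (p * j) = dl \<one>" for j using gpow_mult[OF z(1), of p j] gpow_dl[of \<one> j] z(2) by simp
    then have "gpow z (p * (k div p) + k mod p) = gpow z (k mod p)"
      using gpow_add[OF z(1), of "p * (k div p)" "k mod p"] z(1) by simp
    then show ?thesis by (simp add: c_def)
  qed
  define B where "B = (\<Sum>k<p. nat \<bar>c k\<bar>)"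
  have B: "\<bar>c k\<bar> \<le> int B" for k
  proof -
    have "nat \<bar>c (k mod p)\<bar> \<le> B" unfolding B_def by (rule member_le_sum) auto
    then show ?thesis using per[of k] by simp
  qed
  \<comment> \<open>large enough for congruent coefficients to be equal and for primes beyond it not to divide \<open>card S\<close>\<close>
  define M where "M = 2 * B + card S + p"
  have good: "c (k * l) = c k" if l: "Factorial_Ring.prime l" "l > M" for k l
  proof -
    have "card S > 0" using one_closed by (simp add: card_gt_0_iff) blast
    then have "\<not> l dvd card S" using l(2) by (auto simp: M_def dest: dvd_imp_le)
    then have "[gpow (gpow z k) l \<one> = gpow z k \<one>] (mod int l)"
      using prime_power_coeff_one l(1) z(1) by simp
    then have "int l dvd c (k * l) - c k" using gpow_mult[OF z(1)] by (simp add: c_def cong_iff_dvd_diff)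
    moreover have "\<bar>c (k * l) - c k\<bar> < int l" using B[of "k * l"] B[of k] l(2) by (simp add: M_def)
    ultimately show ?thesis by (metis abs_of_nat diff_eq_diff_eq dvd_imp_le_int not_less right_minus_eq)
  qed
  have prod: "c (k * j) = c k" if "j > 0" "\<And>l. Factorial_Ring.prime l \<Longrightarrow> l dvd j \<Longrightarrow> l > M" for k j
    using that
  proof (induction j arbitrary: k rule: less_induct)
    case (less j)
    show ?case
    proof (cases "j = 1")
      case False
      then obtain l where l: "Factorial_Ring.prime l" "l dvd j" using prime_factor_nat by blast
      then obtain j' where j': "j = l * j'" by blast
      have "j' > 0" "j' < j" using j' less.prems(1) l(1) prime_gt_1_nat[OF l(1)] by (auto intro: Nat.gr0I)
      then have "c (k * l * j') = c (k * l)" using less.IH[of j' "k * l"] less.prems(2) j' by simp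
      then show ?thesis using good[OF l(1)] less.prems(2)[OF l] j' by (simp add: mult.assoc)
    qed simp
  qed
  obtain e Q where eQ: "fact M = p ^ e * Q" "\<not> p dvd Q"
    using multiplicity_decompose'[of "fact M" p] p_gt_1 by (metis fact_nonzero nat_neq_iff nat_dvd_1_iff_1)
  have cop: "coprime p Q" by (rule prime_imp_coprime[OF prime eQ(2)])
  \<comment> \<open>congruent to one modulo each prime up to \<open>M\<close> other than \<open>p\<close>, so that all its prime factors are large\<close>
  obtain j where j: "[j = i] (mod p)" "[j = 1] (mod Q)" using binary_chinese_remainder_nat[OF cop] by blast
  have ip: "\<not> p dvd i" using i by (simp add: nat_dvd_not_less)
  have jp: "\<not> p dvd j" using cong_dvd_iff[OF j(1)] ip by simp
  have "c (1 * j) = c 1"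
  proof (rule prod)
    show "j > 0" using jp by (cases j) auto
    fix l assume l: "Factorial_Ring.prime l" "l dvd j"
    show "l > M"
    proof (rule ccontr)
      assume "\<not> l > M"
      then have "l dvd fact M" using l(1) prime_gt_0_nat[OF l(1)] by (intro dvd_fact) auto
      then have "l dvd p ^ e \<or> l dvd Q" using eQ(1) l(1) by (simp add: prime_dvd_mult_iff)
      then show False
      proof
        assume "l dvd p ^ e"
        then have "l dvd p" using l(1) by (rule prime_dvd_power[rotated])
        then have "l = p" using l(1) prime by (simp add: primes_dvd_imp_eq)
        then show False using l(2) jp by simp
      next
        assume "l dvd Q"
        then have "[j = 1] (mod l)" using j(2) cong_dvd_modulus_nat by blast
        then have "l dvd 1" using l(2) cong_dvd_iff by blast
        then show False using l(1) by simp
      qed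
    qed
  qed
  moreover have "c j = c i" using per[of j] per[of i] j(1) by (simp add: cong_def)
  ultimately show ?thesis by (simp add: c_def)
qed

text \<open>All nontrivial powers of \<open>z\<close> have the same coefficient \<open>b\<close> at one, so the trace of the norm of \<open>z\<close> is \<open>|G| (1 + (p - 1) b)\<close>. On the other hand
it lies strictly between \<open>0\<close> and \<open>p |G|\<close> by the extreme cases of \<open>norm_trace\<close>. Hence \<open>b = 0\<close>.\<close>
theorem berman_higman_prime:
  assumes z: "z \<in> vecs S" "gpow z p = dl \<one>" "augmentation G z = 1" "z \<noteq> dl \<one>"
  shows "tr S (\<lambda>v. \<Sum>i<p. ((\<lambda>v. gm v z) ^^ i) v) = int (card S)"
proof -
  let ?y = "\<lambda>v. gm v z"
  define sg where "sg = (\<lambda>v. \<Sum>i<p. (?y ^^ i) v)"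
  define Kh where "Kh = {v + cs (int p) w | v w. v \<in> V \<and> (\<Sum>i<p. (?y ^^ i) v) = 0 \<and> w \<in> V}"
  have yp: "(?y ^^ p) v = v" if "v \<in> V" for v using right_funpow[OF z(1) that, of p] z(2) that by simp
  note nt = norm_trace[OF lin_right[of z] yp, folded Kh_def, folded sg_def]
  define b where "b = gpow z 1 \<one>"
  have "tr S sg = (\<Sum>i<p. int (card S) * gpow z i \<one>)"
  proof -
    have "tr S sg = (\<Sum>s\<in>S. \<Sum>i<p. gm (dl s) (gpow z i) s)"
      unfolding tr_def sg_def by (intro sum.cong refl) (simp add: sum_fun_apply right_funpow z(1))
    also have "\<dots> = (\<Sum>i<p. \<Sum>s\<in>S. gm (dl s) (gpow z i) s)" by (rule sum.swap)
    also have "\<dots> = (\<Sum>i<p. tr S (\<lambda>v. gm v (gpow z i)))" by (simp add: tr_def)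
    finally show ?thesis by (simp only: tr_right)
  qed
  also have "\<dots> = int (card S) * (\<Sum>i<p. gpow z i \<one>)" by (simp add: sum_distrib_left)
  also have "(\<Sum>i<p. gpow z i \<one>) = 1 + (int p - 1) * b"
  proof -
    have "(\<Sum>i<p. gpow z i \<one>) = (\<Sum>i\<in>insert 0 {1..<p}. gpow z i \<one>)"
      using p_gt_1 by (intro sum.cong) auto
    also have "\<dots> = 1 + (\<Sum>i\<in>{1..<p}. gpow z i \<one>)" by (simp add: dl_def R_one)
    also have "(\<Sum>i\<in>{1..<p}. gpow z i \<one>) = (\<Sum>i\<in>{1..<p}. b)"
      unfolding b_def by (intro sum.cong refl prime_order_coeff_const z) auto
    finally show ?thesis using p_gt_1 by (simp add: of_nat_diff)
  qed
  finally have t: "tr S sg = int (card S) * (1 + (int p - 1) * b)" .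
  have c0: "card S > 0" using one_closed by (simp add: card_gt_0_iff) blast
  have eq: "int (card S) * (1 + (int p - 1) * b) = int p * (int (card S) - int (dm Kh))" using t nt(3) by simp
  have le: "dm Kh \<le> card S" by (rule dm_le[OF nt(1)])
  have ne0: "dm Kh \<noteq> 0"
  proof
    assume "dm Kh = 0"
    then have "gm (dl \<one>) z = dl \<one>" using nt(4)[of "dl \<one>"] by simp
    then show False using z by simp
  qed
  have neS: "dm Kh \<noteq> card S"
  proof
    assume "dm Kh = card S"
    then have "sg (dl \<one>) = 0" using nt(5)[of "dl \<one>"] by (simp add: sg_def)
    then have "0 = (\<Sum>s\<in>S. sg (dl \<one>) s)" by (simp add: fapp)
    also have "\<dots> = (\<Sum>s\<in>S. \<Sum>i<p. gpow z i s)"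
      unfolding sg_def by (intro sum.cong refl) (simp add: sum_fun_apply right_funpow z(1))
    also have "\<dots> = (\<Sum>i<p. \<Sum>s\<in>S. gpow z i s)" by (rule sum.swap)
    also have "\<dots> = (\<Sum>i<p. augmentation G (gpow z i))" by (simp add: augmentation_def)
    also have "\<dots> = int p" using z by (simp add: gpow_aug)
    finally show False using p_gt_1 by simp
  qed
  have "0 < int (card S) * (1 + (int p - 1) * b)" using eq le neS p_gt_1 by simp
  then have pos: "0 < 1 + (int p - 1) * b" using c0 by (simp add: zero_less_mult_iff)
  have "int (card S) * (1 + (int p - 1) * b) < int (card S) * int p"
    unfolding eq using ne0 p_gt_1 by (simp add: mult.commute[of "int (card S)"])
  then have lt: "1 + (int p - 1) * b < int p" using c0 by simp
  have "b = 0"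
  proof (rule ccontr)
    assume "b \<noteq> 0"
    then consider "b \<ge> 1" | "b \<le> -1" by linarith
    then show False
    proof cases
      case 1
      then have "(int p - 1) * 1 \<le> (int p - 1) * b" using p_gt_1 by (intro mult_left_mono) auto
      then show ?thesis using lt by simp
    next
      case 2
      then have "(int p - 1) * b \<le> (int p - 1) * (-1)" using p_gt_1 by (intro mult_left_mono) auto
      then show ?thesis using pos p_gt_1 by simp
    qed
  qed
  then show ?thesis using t by (simp add: sg_def)
qed

end

section \<open>Joint eigenvectors modulo p\<close>
lemma power_sum_mod:
  assumes p: "Factorial_Ring.prime (p::nat)" and i: "i < p - 1"
  shows "int p dvd (\<Sum>s<p. int s ^ i)"
  using i
proof (induction i rule: less_induct)
  case (less i)
  have tele: "(\<Sum>s<n. (int s + 1) ^ Suc i - int s ^ Suc i) = int n ^ Suc i" for n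
    by (induction n) (simp_all add: algebra_simps)
  have exp: "(int s + 1) ^ Suc i - int s ^ Suc i = (\<Sum>j\<le>i. int (Suc i choose j) * int s ^ j)" for s
    using binomial_ring[of "int s" 1 "Suc i"] by simp
  have "int p ^ Suc i = (\<Sum>s<p. \<Sum>j\<le>i. int (Suc i choose j) * int s ^ j)"
    using tele[of p] by (simp only: exp)
  also have "\<dots> = (\<Sum>j\<le>i. int (Suc i choose j) * (\<Sum>s<p. int s ^ j))"
    by (subst sum.swap) (simp add: sum_distrib_left)
  also have "\<dots> = (\<Sum>j<i. int (Suc i choose j) * (\<Sum>s<p. int s ^ j)) + int (Suc i) * (\<Sum>s<p. int s ^ i)"
    by (simp add: lessThan_Suc_atMost[symmetric])
  finally have e: "int (Suc i) * (\<Sum>s<p. int s ^ i)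
      = int p ^ Suc i - (\<Sum>j<i. int (Suc i choose j) * (\<Sum>s<p. int s ^ j))" by simp
  have "int p dvd (\<Sum>j<i. int (Suc i choose j) * (\<Sum>s<p. int s ^ j))"
    by (intro dvd_sum dvd_mult less.IH) (use less.prems in auto)
  then have "int p dvd int (Suc i) * (\<Sum>s<p. int s ^ i)" unfolding e by (intro dvd_diff) simp_all
  moreover have "\<not> int p dvd int (Suc i)" using less.prems by (simp only: of_nat_dvd_iff) (auto dest: dvd_imp_le)
  ultimately show ?case using p prime_dvd_mult_iff[of "int p"] by simp
qed

lemma fermat_int1:
  assumes "Factorial_Ring.prime (p::nat)" "\<not> int p dvd a" shows "[a ^ (p - 1) = 1] (mod int p)"
proof -
  have "p > 0" using assms(1) prime_gt_0_nat by blast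
  then have e: "a ^ p = a ^ (p - 1) * a" by (metis power_minus_mult)
  have "int p dvd a ^ p - a" using fermat_int[OF assms(1), of a] by (simp add: cong_iff_dvd_diff)
  also have "a ^ p - a = (a ^ (p - 1) - 1) * a" unfolding e by (simp add: algebra_simps)
  finally have "int p dvd a ^ (p - 1) - 1" using assms prime_dvd_mult_iff[of "int p"] by simp
  then show ?thesis by (simp add: cong_iff_dvd_diff)
qed

lemma neg_power_sum_mod:
  assumes p: "Factorial_Ring.prime (p::nat)"
  shows "i < p - 1 \<Longrightarrow> int p dvd (\<Sum>s<p. (- int s) ^ i)" "[(\<Sum>s<p. (- int s) ^ (p - 1)) = -1] (mod int p)"
proof -
  have "(\<Sum>s<p. (- int s) ^ i) = (-1) ^ i * (\<Sum>s<p. int s ^ i)"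
    by (simp add: sum_distrib_left power_minus[of "int _"])
  then show "i < p - 1 \<Longrightarrow> int p dvd (\<Sum>s<p. (- int s) ^ i)" using power_sum_mod[OF p, of i] by simp
  have p1: "p > 1" using p prime_gt_1_nat by blast
  have "(\<Sum>s<p. (- int s) ^ (p - 1)) = (\<Sum>s\<in>insert 0 {1..<p}. (- int s) ^ (p - 1))"
    using p1 by (intro sum.cong) auto
  also have "\<dots> = (\<Sum>s\<in>{1..<p}. (- int s) ^ (p - 1))" using p1 by simp
  also have "[\<dots> = (\<Sum>s\<in>{1..<p}. 1)] (mod int p)"
  proof (rule cong_sum, rule fermat_int1[OF p])
    fix s assume "s \<in> {1..<p}"
    then have "\<not> p dvd s" by (auto dest: dvd_imp_le)
    then show "\<not> int p dvd - int s" by simp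
  qed
  also have "(\<Sum>s\<in>{1..<p}. 1) = int p - 1" using p1 by (simp add: of_nat_diff)
  also have "[\<dots> = -1] (mod int p)" by (simp add: cong_iff_dvd_diff)
  finally show "[(\<Sum>s<p. (- int s) ^ (p - 1)) = -1] (mod int p)" .
qed

text \<open>A polynomial of degree at most \<open>p\<close> that agrees with \<open>a\<^sub>0 + a\<^sub>p s\<close> on all residues has vanishing linear coefficient, as
\<open>s\<^sup>p = s\<close>; the coefficient is extracted with power sums.\<close>
lemma linear_coeff_mod:
  fixes a :: "nat \<Rightarrow> int"
  assumes p: "Factorial_Ring.prime (p::nat)"
    and z: "\<And>s. s < p \<Longrightarrow> [(\<Sum>i\<le>p. int s ^ i * a i) = a 0 + int s * a p] (mod int p)"
  shows "int p dvd a 1"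
proof -
  have p1: "p > 1" using p prime_gt_1_nat by blast
  have z': "int p dvd (\<Sum>i\<in>{1..<p}. int s ^ i * a i)" if s: "s < p" for s
  proof -
    have "(\<Sum>i\<le>p. int s ^ i * a i) = (\<Sum>i\<in>{0, p} \<union> {1..<p}. int s ^ i * a i)" by (intro sum.cong) auto
    also have "\<dots> = (\<Sum>i\<in>{0, p}. int s ^ i * a i) + (\<Sum>i\<in>{1..<p}. int s ^ i * a i)"
      by (rule sum.union_disjoint) auto
    also have "(\<Sum>i\<in>{0, p}. int s ^ i * a i) = a 0 + int s ^ p * a p" using p1 by simp
    finally have "int p dvd (int s ^ p - int s) * a p + (\<Sum>i\<in>{1..<p}. int s ^ i * a i)"
      using z[OF s] by (simp add: cong_iff_dvd_diff algebra_simps)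
    moreover have "int p dvd int s ^ p - int s" using fermat_int[OF p, of "int s"] by (simp add: cong_iff_dvd_diff)
    ultimately show ?thesis by (metis dvd_add_right_iff dvd_mult2)
  qed
  have red: "int p dvd (\<Sum>s<p. int s ^ (p - 2 + i))" if i: "i \<in> {1<..<p}" for i
  proof -
    have "[(\<Sum>s<p. int s ^ (p - 2 + i)) = (\<Sum>s<p. int s ^ (i - 1))] (mod int p)"
    proof (rule cong_sum)
      fix s
      have e1: "p - 2 + i = p + (i - 2)" and e2: "i - 1 = Suc (i - 2)" using i p1 by auto
      have "int s ^ (p - 2 + i) = int s ^ p * int s ^ (i - 2)" unfolding e1 by (rule power_add)
      also have "[\<dots> = int s * int s ^ (i - 2)] (mod int p)" by (intro cong_mult cong_refl fermat_int[OF p])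
      also have "int s * int s ^ (i - 2) = int s ^ (i - 1)" unfolding e2 by simp
      finally show "[int s ^ (p - 2 + i) = int s ^ (i - 1)] (mod int p)" .
    qed
    moreover have "int p dvd (\<Sum>s<p. int s ^ (i - 1))" by (rule power_sum_mod[OF p]) (use i in auto)
    ultimately show ?thesis by (simp only: cong_dvd_iff)
  qed
  have lead: "[(\<Sum>s<p. int s ^ (p - 1)) = -1] (mod int p)"
  proof -
    have "(\<Sum>s<p. (- int s) ^ (p - 1)) = (-1) ^ (p - 1) * (\<Sum>s<p. int s ^ (p - 1))"
      by (simp add: sum_distrib_left power_minus[of "int _"])
    moreover have "[(-1) ^ (p - 1) = (1::int)] (mod int p)"
      by (rule fermat_int1[OF p]) (use p1 in auto)
    ultimately have "[(\<Sum>s<p. (- int s) ^ (p - 1)) = 1 * (\<Sum>s<p. int s ^ (p - 1))] (mod int p)"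
      by (simp only:) (intro cong_mult cong_refl)
    then have "[(\<Sum>s<p. int s ^ (p - 1)) = (\<Sum>s<p. (- int s) ^ (p - 1))] (mod int p)"
      unfolding mult_1 by (rule cong_sym)
    then show ?thesis by (rule cong_trans[OF _ neg_power_sum_mod(2)[OF p]])
  qed
  have "int p dvd (\<Sum>s<p. int s ^ (p - 2) * (\<Sum>i\<in>{1..<p}. int s ^ i * a i))"
    by (intro dvd_sum dvd_mult z') auto
  also have "(\<Sum>s<p. int s ^ (p - 2) * (\<Sum>i\<in>{1..<p}. int s ^ i * a i))
      = (\<Sum>i\<in>{1..<p}. a i * (\<Sum>s<p. int s ^ (p - 2 + i)))"
  proof -
    have "(\<Sum>s<p. int s ^ (p - 2) * (\<Sum>i\<in>{1..<p}. int s ^ i * a i))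
       = (\<Sum>s<p. \<Sum>i\<in>{1..<p}. a i * int s ^ (p - 2 + i))"
      by (simp only: sum_distrib_left power_add mult_ac)
    also have "\<dots> = (\<Sum>i\<in>{1..<p}. \<Sum>s<p. a i * int s ^ (p - 2 + i))" by (rule sum.swap)
    finally show ?thesis by (simp add: sum_distrib_left)
  qed
  also have "\<dots> = (\<Sum>i\<in>insert 1 {1<..<p}. a i * (\<Sum>s<p. int s ^ (p - 2 + i)))"
    using p1 by (intro sum.cong) auto
  also have "\<dots> = a 1 * (\<Sum>s<p. int s ^ (p - 2 + 1)) + (\<Sum>i\<in>{1<..<p}. a i * (\<Sum>s<p. int s ^ (p - 2 + i)))"
    by simp
  finally have "int p dvd a 1 * (\<Sum>s<p. int s ^ (p - 2 + 1)) + (\<Sum>i\<in>{1<..<p}. a i * (\<Sum>s<p. int s ^ (p - 2 + i)))" .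
  moreover have "int p dvd (\<Sum>i\<in>{1<..<p}. a i * (\<Sum>s<p. int s ^ (p - 2 + i)))"
    by (intro dvd_sum dvd_mult red)
  ultimately have d: "int p dvd a 1 * (\<Sum>s<p. int s ^ (p - 2 + 1))" by (simp only: dvd_add_left_iff)
  have "p - 2 + 1 = p - 1" using p1 by simp
  then have "[a 1 * (\<Sum>s<p. int s ^ (p - 2 + 1)) = a 1 * -1] (mod int p)"
    using lead by (simp only:) (intro cong_mult cong_refl)
  then have "int p dvd a 1 * -1" using d by (simp only: cong_dvd_iff)
  then show ?thesis by simp
qed

context fp_vecs
begin

lemma subm_Inter: "\<F> \<noteq> {} \<Longrightarrow> (\<And>U. U \<in> \<F> \<Longrightarrow> subm U) \<Longrightarrow> subm (\<Inter>\<F>)"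
  unfolding subm_def by blast

lemma subm_preimage:
  assumes A: "lin S S A" and U: "subm U" shows "subm {v \<in> V. A v \<in> U}"
  unfolding subm_def
proof (intro conjI ballI)
  show "0 \<in> {v \<in> V. A v \<in> U}" using lin_0[OF A] subm_0[OF U] by simp
next
  fix v w assume "v \<in> {v \<in> V. A v \<in> U}" "w \<in> {v \<in> V. A v \<in> U}"
  then show "v + w \<in> {v \<in> V. A v \<in> U}" using lin_add[OF A, of v w] subm_add[OF U] by simp
next
  fix v assume "v \<in> {v \<in> V. A v \<in> U}"
  then show "- v \<in> {v \<in> V. A v \<in> U}" using lin_uminus[OF A, of v] subm_uminus[OF U] by simp
next
  fix v assume v: "v \<in> V"
  then show "cs (int p) v \<in> {v \<in> V. A v \<in> U}"
    using lin_cs[OF A v] subm_p[OF U lin_vecs[OF A v]] by simp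
qed blast

lemma subm_kernel_mod:
  assumes A: "lin S S' A" shows "subm {v \<in> V. cg (int p) (A v) 0}"
  unfolding subm_def
proof (intro conjI ballI)
  show "0 \<in> {v \<in> V. cp (A v) 0}" using lin_0[OF A] by simp
next
  fix v w assume "v \<in> {v \<in> V. cg (int p) (A v) 0}" "w \<in> {v \<in> V. cg (int p) (A v) 0}"
  then show "v + w \<in> {v \<in> V. cg (int p) (A v) 0}" using lin_add[OF A, of v w] by (auto simp: cg_def fapp)
next
  fix v assume "v \<in> {v \<in> V. cg (int p) (A v) 0}"
  then show "- v \<in> {v \<in> V. cg (int p) (A v) 0}" using lin_uminus[OF A, of v] by (auto simp: cg_def fapp)
next
  fix v assume v: "v \<in> V"
  then show "cs (int p) v \<in> {v \<in> V. cg (int p) (A v) 0}" using lin_cs[OF A v] by simp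
qed blast

text \<open>As \<open>X\<^sup>p - X\<close> splits into distinct linear factors, the vectors \<open>w - (A - k)\<^bsup>p-1\<^esup> w\<close> for
\<open>k < p\<close> are eigenvectors, and their sum is a unit multiple of \<open>w\<close> modulo \<open>p\<close>.\<close>
lemma eigen_decomp:
  assumes A: "lin S S A" and Ap: "\<And>v. v \<in> V \<Longrightarrow> cp ((A ^^ p) v) (A v)"
    and E: "subm E" "\<And>v. v \<in> E \<Longrightarrow> A v \<in> E"
    and W: "subm W" "\<And>v k. v \<in> E \<Longrightarrow> cp (A v) (cs k v) \<Longrightarrow> v \<in> W"
  shows "E \<subseteq> W"
proof
  fix w assume w: "w \<in> E"
  have wV: "w \<in> V" by (rule subm_V[OF E(1) w])
  define B where "B k v = A v - cs (int k) v" for k :: nat and v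
  have B: "lin S S (B k)" for k
    unfolding B_def by (intro lin_minus A lin_scale lin_id)
  have BE: "B k v \<in> E" if "v \<in> E" for k v
    unfolding B_def by (intro subm_diff[OF E(1)] E(2) subm_cs[OF E(1)] that)
  have BnE: "(B k ^^ n) v \<in> E" if "v \<in> E" for k n v
    by (induction n) (use that BE in auto)
  define u where "u k = w - (B k ^^ (p - 1)) w" for k
  have uE: "u k \<in> E" for k unfolding u_def by (intro subm_diff[OF E(1)] w BnE)
  have uW: "u k \<in> W" for k
  proof (rule W(2)[OF uE])
    have "B k (u k) = B k w - (B k ^^ p) w"
    proof -
      have "B k (u k) = B k w - B k ((B k ^^ (p - 1)) w)"
        unfolding u_def by (rule lin_diff[OF B wV subm_V[OF E(1) BnE[OF w]]])
      also have "B k ((B k ^^ (p - 1)) w) = (B k ^^ p) w"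
        using p_pos by (metis Suc_diff_1 comp_apply funpow.simps(2))
      finally show ?thesis .
    qed
    moreover have "cp ((A ^^ p) w) ((B k ^^ p) w + cs (int k ^ p) w)"
      using prime_power_op[OF A, of "B k" "int k" w 1] wV by (simp add: B_def)
    moreover have "cp (cs (int k ^ p) w) (cs (int k) w)" by (rule cg_cs_coeff[OF fermat_int[OF prime]])
    ultimately have "\<forall>x. int p dvd B k (u k) x"
    proof -
      assume 1: "B k (u k) = B k w - (B k ^^ p) w" and 2: "cp ((A ^^ p) w) ((B k ^^ p) w + cs (int k ^ p) w)"
        and 3: "cp (cs (int k ^ p) w) (cs (int k) w)"
      have "cp ((B k ^^ p) w + cs (int k ^ p) w) (A w)" by (rule cg_trans[OF cg_sym[OF 2] Ap[OF wV]])
      from cg_diff[OF this 3] have 4: "cp ((B k ^^ p) w) (A w - cs (int k) w)" by simp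
      have "cp (B k w - (B k ^^ p) w) (B k w - (A w - cs (int k) w))" by (rule cg_diff[OF cg_refl 4])
      then show ?thesis using 1 by (simp add: B_def cg_def fapp)
    qed
    then show "cp (A (u k)) (cs (int k) (u k))" by (simp add: B_def cg_def fapp)
  qed
  have sumB: "cp (\<Sum>k<p. (B k ^^ (p - 1)) w) (- w)"
  proof -
    have Bexp: "(B k ^^ (p - 1)) w = (\<Sum>i\<le>p - 1. cs (int (p - 1 choose i) * (- int k) ^ (p - 1 - i)) ((A ^^ i) w))" for k
      by (rule binom_op[OF B _ wV]) (simp add: B_def)
    have "(\<Sum>k<p. (B k ^^ (p - 1)) w)
       = (\<Sum>i\<le>p - 1. \<Sum>k<p. cs (int (p - 1 choose i) * (- int k) ^ (p - 1 - i)) ((A ^^ i) w))"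
      unfolding Bexp by (rule sum.swap)
    also have "\<dots> = (\<Sum>i\<le>p - 1. cs (int (p - 1 choose i) * (\<Sum>k<p. (- int k) ^ (p - 1 - i))) ((A ^^ i) w))"
      by (simp add: sum_distrib_left flip: cs_sum_left)
    also have "cp \<dots> (\<Sum>i\<le>p - 1. if i = 0 then - w else 0)"
    proof (rule cg_sum)
      fix i assume i: "i \<in> {..p - 1}"
      show "cp (cs (int (p - 1 choose i) * (\<Sum>k<p. (- int k) ^ (p - 1 - i))) ((A ^^ i) w)) (if i = 0 then - w else 0)"
      proof (cases "i = 0")
        case True
        have "cp (cs (\<Sum>k<p. (- int k) ^ (p - 1)) w) (cs (-1) w)"
          by (rule cg_cs_coeff[OF neg_power_sum_mod(2)[OF prime]])
        then show ?thesis using True by simp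
      next
        case False
        then have "int p dvd (\<Sum>k<p. (- int k) ^ (p - 1 - i))"
          by (intro neg_power_sum_mod(1)[OF prime]) (use i p_gt_1 in auto)
        then show ?thesis using False by (simp add: cg_def fapp)
      qed
    qed
    finally show ?thesis by simp
  qed
  have "(\<Sum>k<p. u k) \<in> W" by (intro subm_sum[OF W(1)] uW)
  moreover have "cp (\<Sum>k<p. u k) w"
  proof -
    have "(\<Sum>k<p. u k) = cs (int p) w - (\<Sum>k<p. (B k ^^ (p - 1)) w)"
      by (simp add: u_def sum_subtractf sum_const_cs del: sum_constant)
    also have "cp \<dots> (0 - (- w))" by (intro cg_diff sumB cg_0_cs)
    finally show ?thesis by simp
  qed
  ultimately show "w \<in> W" using subm_cp[OF W(1)] wV by blast
qed

fun cf :: "(('i \<Rightarrow> int) \<Rightarrow> 'i \<Rightarrow> int) \<Rightarrow> (('i \<Rightarrow> int) \<Rightarrow> 'i \<Rightarrow> int) \<Rightarrow> nat \<Rightarrow> nat \<Rightarrow> ('i \<Rightarrow> int) \<Rightarrow> 'i \<Rightarrow> int" where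
  "cf A B 0 0 w = w"
| "cf A B 0 (Suc i) w = 0"
| "cf A B (Suc m) 0 w = A (cf A B m 0 w)"
| "cf A B (Suc m) (Suc i) w = A (cf A B m (Suc i) w) + B (cf A B m i w)"

text \<open>The relation \<open>(A + s B)\<^sup>p = A + s B\<close> for all residues \<open>s\<close> forces the linear coefficient in \<open>s\<close> of the noncommutative expansion to
vanish, apart from the term \<open>B\<close> absorbed by \<open>s\<^sup>p = s\<close>. On an eigenvector of \<open>A\<close> this coefficient is \<open>(A - k)\<^bsup>p-1\<^esup> B w\<close>, so
\<open>B w\<close> is annihilated by a power of \<open>A - k\<close>; as \<open>A\<close> is diagonalisable it is an eigenvector again.\<close>
lemma commute_eigen:
  assumes A: "lin S S A" and B: "lin S S B"
    and Bp: "\<And>v. v \<in> V \<Longrightarrow> cp ((B ^^ p) v) (B v)"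
    and AB: "\<And>s v. s < p \<Longrightarrow> v \<in> V \<Longrightarrow> cp (((\<lambda>v. A v + cs (int s) (B v)) ^^ p) v) (A v + cs (int s) (B v))"
    and w: "w \<in> V" "cp (A w) (cs k w)"
  shows "cp (A (B w)) (cs k (B w))"
proof -
  have cV: "cf A B m i w \<in> V" for m i
  proof (induction m arbitrary: i)
    case 0 then show ?case using w(1) by (cases i) auto
  next
    case (Suc m) then show ?case using lin_vecs[OF A] lin_vecs[OF B] by (cases i) auto
  qed
  have c0: "cf A B m 0 w = (A ^^ m) w" for m by (induction m) auto
  have cbig: "cf A B m i w = 0" if "i > m" for m i
    using that
  proof (induction m arbitrary: i)
    case 0 then show ?case by (cases i) auto
  next
    case (Suc m) then show ?case by (cases i) (auto simp: lin_0[OF A] lin_0[OF B])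
  qed
  have cmm: "cf A B m m w = (B ^^ m) w" for m
    by (induction m) (auto simp: cbig lin_0[OF A])
  have exp: "((\<lambda>v. A v + cs s (B v)) ^^ m) w = (\<Sum>i\<le>m. cs (s ^ i) (cf A B m i w))" for s m
  proof (induction m)
    case 0 then show ?case by simp
  next
    case (Suc m)
    let ?T = "\<Sum>i\<le>m. cs (s ^ i) (cf A B m i w)"
    have "A ?T = (\<Sum>i\<le>m. cs (s ^ i) (A (cf A B m i w)))"
      by (subst lin_sum[OF A vecs_cs[OF cV]]) (simp add: lin_cs[OF A cV])
    also have "\<dots> = (\<Sum>i\<le>Suc m. cs (s ^ i) (A (cf A B m i w)))" by (simp add: cbig lin_0[OF A])
    also have "\<dots> = A (cf A B m 0 w) + (\<Sum>i\<le>m. cs (s ^ Suc i) (A (cf A B m (Suc i) w)))"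
      by (subst sum.atMost_Suc_shift) simp
    finally have a: "A ?T = A (cf A B m 0 w) + (\<Sum>i\<le>m. cs (s ^ Suc i) (A (cf A B m (Suc i) w)))" .
    have b: "cs s (B ?T) = (\<Sum>i\<le>m. cs (s ^ Suc i) (B (cf A B m i w)))"
      by (subst lin_sum[OF B vecs_cs[OF cV]]) (simp add: lin_cs[OF B cV] cs_sum)
    have "((\<lambda>v. A v + cs s (B v)) ^^ Suc m) w = A ?T + cs s (B ?T)" using Suc by simp
    also have "\<dots> = A (cf A B m 0 w) + (\<Sum>i\<le>m. cs (s ^ Suc i) (cf A B (Suc m) (Suc i) w))"
      unfolding a b by (simp add: cs_add sum.distrib add.assoc)
    also have "\<dots> = (\<Sum>i\<le>Suc m. cs (s ^ i) (cf A B (Suc m) i w))"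
      by (subst sum.atMost_Suc_shift) simp
    finally show ?case .
  qed
  have Ap: "cp ((A ^^ p) v) (A v)" if "v \<in> V" for v using AB[of 0 v] that by simp
  have c1: "cp (cf A B p 1 w) 0"
  proof -
    have "int p dvd cf A B p 1 w x" for x
    proof (rule linear_coeff_mod[OF prime, where a = "\<lambda>i. cf A B p i w x"])
      fix s assume s: "s < p"
      have "cp (\<Sum>i\<le>p. cs (int s ^ i) (cf A B p i w)) (A w + cs (int s) (B w))"
        using AB[OF s w(1)] by (simp add: exp)
      also have "cp \<dots> (cf A B p 0 w + cs (int s) (cf A B p p w))"
        unfolding c0 cmm by (intro cg_add cg_cs cg_sym[OF Ap] cg_sym[OF Bp] w)
      finally show "[(\<Sum>i\<le>p. int s ^ i * cf A B p i w x) = cf A B p 0 w x + int s * cf A B p p w x] (mod int p)"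
        by (simp add: cg_iff_cong fapp)
    qed
    then show ?thesis by (simp add: cg_def fapp)
  qed
  have Am: "cp ((A ^^ m) w) (cs (k ^ m) w)" for m
  proof (induction m)
    case (Suc m)
    have "cp (A ((A ^^ m) w)) (A (cs (k ^ m) w))"
      by (rule lin_cg[OF A lin_vecs[OF lin_funpow[OF A] w(1)] vecs_cs[OF w(1)] Suc])
    also have "A (cs (k ^ m) w) = cs (k ^ m) (A w)" by (rule lin_cs[OF A w(1)])
    also have "cp \<dots> (cs (k ^ m) (cs k w))" by (rule cg_cs[OF w(2)])
    finally show ?case by (simp add: mult.commute)
  qed simp
  have BV: "B w \<in> V" by (rule lin_vecs[OF B w(1)])
  have AmV: "(A ^^ m) v \<in> V" if "v \<in> V" for m v by (rule lin_vecs[OF lin_funpow[OF A] that])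
  define D where "D v = A v - cs k v" for v
  have D: "lin S S D" unfolding D_def by (intro lin_minus A lin_scale lin_id)
  have key: "cp (D (cf A B m 1 w)) ((A ^^ m) (B w) - cs (k ^ m) (B w))" for m
  proof (induction m)
    case 0 then show ?case by (simp add: lin_0[OF D])
  next
    case (Suc m)
    have e: "cf A B (Suc m) 1 w = A (cf A B m 1 w) + B ((A ^^ m) w)" by (simp add: c0)
    have "D (cf A B (Suc m) 1 w) = D (A (cf A B m 1 w)) + D (B ((A ^^ m) w))"
      unfolding e by (rule lin_add[OF D lin_vecs[OF A cV] lin_vecs[OF B AmV[OF w(1)]]])
    also have "D (A (cf A B m 1 w)) = A (D (cf A B m 1 w))"
      unfolding D_def using lin_diff[OF A lin_vecs[OF A cV] vecs_cs[OF cV]] lin_cs[OF A cV] by simp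
    also have "cp (A (D (cf A B m 1 w)) + D (B ((A ^^ m) w)))
        (A ((A ^^ m) (B w) - cs (k ^ m) (B w)) + D (cs (k ^ m) (B w)))"
    proof (rule cg_add)
      show "cp (A (D (cf A B m 1 w))) (A ((A ^^ m) (B w) - cs (k ^ m) (B w)))"
        by (rule lin_cg[OF A lin_vecs[OF D cV] _ Suc]) (intro vecs_diff vecs_cs AmV BV)
      have "cp (B ((A ^^ m) w)) (B (cs (k ^ m) w))" by (rule lin_cg[OF B AmV[OF w(1)] vecs_cs[OF w(1)] Am])
      then have "cp (B ((A ^^ m) w)) (cs (k ^ m) (B w))" using lin_cs[OF B w(1)] by simp
      then show "cp (D (B ((A ^^ m) w))) (D (cs (k ^ m) (B w)))"
        by (rule lin_cg[OF D lin_vecs[OF B AmV[OF w(1)]] vecs_cs[OF BV]])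
    qed
    also have "A ((A ^^ m) (B w) - cs (k ^ m) (B w)) + D (cs (k ^ m) (B w))
        = (A ^^ Suc m) (B w) - cs (k ^ Suc m) (B w)"
      unfolding D_def using lin_diff[OF A AmV[OF BV] vecs_cs[OF BV]] lin_cs[OF A BV]
      by (simp add: algebra_simps)
    finally show ?case .
  qed
  have "cp ((A ^^ p) (B w) - cs (k ^ p) (B w)) (D (cf A B p 1 w))" by (rule cg_sym[OF key])
  also have "cp \<dots> (D 0)" by (rule lin_cg[OF D cV vecs_0 c1])
  also have "D 0 = 0" by (rule lin_0[OF D])
  finally have 1: "cp ((A ^^ p) (B w) - cs (k ^ p) (B w)) 0" .
  have "cp (A (B w)) ((A ^^ p) (B w))" by (rule cg_sym[OF Ap[OF BV]])
  also have "cp \<dots> (cs (k ^ p) (B w))" using 1 by (simp add: cg_def fapp)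
  also have "cp \<dots> (cs k (B w))" by (rule cg_cs_coeff[OF fermat_int[OF prime]])
  finally show ?thesis .
qed

text \<open>Refine the decomposition into eigenspaces one operator at a time; stability of the eigenspaces makes each operator act on the pieces already found.\<close>
lemma joint_eigen:
  fixes A :: "nat \<Rightarrow> ('i \<Rightarrow> int) \<Rightarrow> 'i \<Rightarrow> int"
  assumes A: "\<And>i. i < r \<Longrightarrow> lin S S (A i)"
    and Ap: "\<And>i v. i < r \<Longrightarrow> v \<in> V \<Longrightarrow> cp ((A i ^^ p) v) (A i v)"
    and comm: "\<And>i j v k. i < r \<Longrightarrow> j < r \<Longrightarrow> v \<in> V \<Longrightarrow> cp (A i v) (cs k v) \<Longrightarrow> cp (A i (A j v)) (cs k (A j v))"
    and W: "subm W" "\<And>v \<kappa>. v \<in> V \<Longrightarrow> (\<And>i. i < r \<Longrightarrow> cp (A i v) (cs (\<kappa> i) v)) \<Longrightarrow> v \<in> W"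
  shows "W = V"
proof -
  define E where "E n \<kappa> = {v \<in> V. \<forall>i<n. cp (A i v) (cs (\<kappa> i) v)}" for n and \<kappa> :: "nat \<Rightarrow> int"
  have sE: "subm (E n \<kappa>)" if "n \<le> r" for n \<kappa>
  proof -
    have "E n \<kappa> = \<Inter>(insert V ((\<lambda>i. {v \<in> V. cg (int p) (A i v - cs (\<kappa> i) v) 0}) ` {..<n}))"
      by (auto simp: E_def cg_def fapp)
    moreover have "subm \<dots>"
    proof (rule subm_Inter)
      fix U assume "U \<in> insert V ((\<lambda>i. {v \<in> V. cg (int p) (A i v - cs (\<kappa> i) v) 0}) ` {..<n})"
      then consider "U = V" | i where "i < n" "U = {v \<in> V. cg (int p) (A i v - cs (\<kappa> i) v) 0}" by blast
      then show "subm U"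
      proof cases
        case 2
        have "lin S S (\<lambda>v. A i v - cs (\<kappa> i) v)" using A[of i] 2(1) \<open>n \<le> r\<close> by (intro lin_minus lin_scale lin_id) simp
        then show ?thesis unfolding 2(2) by (rule subm_kernel_mod)
      qed simp
    qed simp
    ultimately show ?thesis by simp
  qed
  have "E n \<kappa> \<subseteq> W" if "n \<le> r" for n \<kappa>
    using that
  proof (induction "r - n" arbitrary: n \<kappa>)
    case 0
    then show ?case using W(2)[of _ \<kappa>] by (auto simp: E_def)
  next
    case (Suc d)
    then have n: "n < r" by simp
    show ?case
    proof (rule eigen_decomp[OF A[OF n] Ap[OF n] sE[of n \<kappa>] _ W(1)])
      show "n \<le> r" using n by simp
      fix v assume v: "v \<in> E n \<kappa>"
      then show "A n v \<in> E n \<kappa>"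
        using comm n lin_vecs[OF A[OF n]] by (auto simp: E_def)
      fix k assume k: "cp (A n v) (cs k v)"
      have "v \<in> E (Suc n) (\<kappa>(n := k))" using v k by (auto simp: E_def less_Suc_eq)
      moreover have "E (Suc n) (\<kappa>(n := k)) \<subseteq> W" using Suc.hyps n by (intro Suc.hyps(1)) auto
      ultimately show "v \<in> W" by blast
    qed
  qed
  then have "E 0 (\<lambda>_. 0) \<subseteq> W" by simp
  moreover have "E 0 (\<lambda>_. 0) = V" by (simp add: E_def)
  ultimately show ?thesis using subm_V[OF W(1)] by blast
qed

end

section \<open>Extensions by elementary abelian p-groups\<close>
lemma lin_eqI:
  assumes "finite S" "lin S S' A" "lin S S' B" "\<And>s. s \<in> S \<Longrightarrow> A (dl s) = B (dl s)" "v \<in> vecs S"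
  shows "A v = B v"
  unfolding lin_expand[OF assms(1,2,5)] lin_expand[OF assms(1,3,5)]
  by (intro sum.cong refl) (simp add: assms(4))

lemma lin_cgI:
  assumes "finite S" "lin S S' A" "lin S S' B" "\<And>s. s \<in> S \<Longrightarrow> cg k (A (dl s)) (B (dl s))" "v \<in> vecs S"
  shows "cg k (A v) (B v)"
  unfolding lin_expand[OF assms(1,2,5)] lin_expand[OF assms(1,3,5)]
  by (intro cg_sum cg_cs assms(4))

locale elem_ext = A: fin_group_p G p + B: fin_group_p H p
  for G :: "('a, 'b) monoid_scheme" (structure) and H :: "('c, 'd) monoid_scheme" and p +
  fixes \<phi> :: "'a \<Rightarrow> 'c"
  assumes hom: "group_hom G H \<phi>"
    and surj: "\<phi> ` carrier G = carrier H"
    and Ncomm: "\<And>m n. m \<in> kernel G H \<phi> \<Longrightarrow> n \<in> kernel G H \<phi> \<Longrightarrow> m \<otimes> n = n \<otimes> m"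
    and Nexp: "\<And>n. n \<in> kernel G H \<phi> \<Longrightarrow> n [^] p = \<one>"
begin

abbreviation "SG \<equiv> carrier G"
abbreviation "SH \<equiv> carrier H"
abbreviation "VG \<equiv> vecs (carrier G)"
abbreviation "VH \<equiv> vecs (carrier H)"
abbreviation "N \<equiv> kernel G H \<phi>"
abbreviation lm :: "'a \<Rightarrow> ('a \<Rightarrow> int) \<Rightarrow> 'a \<Rightarrow> int" where "lm n v \<equiv> A.gm (dl n) v"

sublocale gh: group_hom G H \<phi> by (rule hom)

lemma N_sub: "subgroup N G" by (rule gh.subgroup_kernel)
lemma N_G: "n \<in> N \<Longrightarrow> n \<in> SG" by (simp add: kernel_def)
lemma N_phi: "n \<in> N \<Longrightarrow> \<phi> n = \<one>\<^bsub>H\<^esub>" by (simp add: kernel_def)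
lemma N_one: "\<one> \<in> N" by (rule subgroup.one_closed[OF N_sub])
lemma N_mult: "m \<in> N \<Longrightarrow> n \<in> N \<Longrightarrow> m \<otimes> n \<in> N" by (rule subgroup.m_closed[OF N_sub])
lemma N_inv: "n \<in> N \<Longrightarrow> inv n \<in> N" by (rule subgroup.m_inv_closed[OF N_sub])
lemma N_pow: "n \<in> N \<Longrightarrow> n [^] (k::nat) \<in> N" by (induction k) (simp_all add: N_one N_mult)
lemma finN: "finite N" by (rule finite_subset[OF _ A.fin_carrier]) (auto simp: kernel_def)

text \<open>A set-theoretic section; every \<open>g\<close> is \<open>nn g\<close> times the chosen representative of its image.\<close>
definition rho :: "'c \<Rightarrow> 'a" where "rho b = (SOME g. g \<in> SG \<and> \<phi> g = b)"
lemma rho: assumes "b \<in> SH" shows "rho b \<in> SG" "\<phi> (rho b) = b"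
proof -
  have "b \<in> \<phi> ` SG" unfolding surj by (rule assms)
  then have "\<exists>g. g \<in> SG \<and> \<phi> g = b" by auto
  then have "rho b \<in> SG \<and> \<phi> (rho b) = b" unfolding rho_def by (rule someI_ex)
  then show "rho b \<in> SG" "\<phi> (rho b) = b" by auto
qed
definition nn :: "'a \<Rightarrow> 'a" where "nn g = g \<otimes> inv (rho (\<phi> g))"
lemma nn: assumes "g \<in> SG" shows "nn g \<in> N" "nn g \<otimes> rho (\<phi> g) = g"
proof -
  have r: "rho (\<phi> g) \<in> SG" "\<phi> (rho (\<phi> g)) = \<phi> g" using rho[of "\<phi> g"] assms by simp_all
  show "nn g \<otimes> rho (\<phi> g) = g" unfolding nn_def using r assms by (simp add: A.m_assoc)
  show "nn g \<in> N" unfolding nn_def kernel_def using r assms by simp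
qed
lemma nn_mult: assumes "n \<in> N" "g \<in> SG" shows "nn (n \<otimes> g) = n \<otimes> nn g" "\<phi> (n \<otimes> g) = \<phi> g"
proof -
  show 1: "\<phi> (n \<otimes> g) = \<phi> g" using assms N_G[OF assms(1)] N_phi[OF assms(1)] by simp
  show "nn (n \<otimes> g) = n \<otimes> nn g" unfolding nn_def 1
    using assms N_G[OF assms(1)] rho[of "\<phi> g"] by (simp add: A.m_assoc)
qed

lemma lm_lm: "m \<in> SG \<Longrightarrow> n \<in> SG \<Longrightarrow> lm m (lm n v) = lm (m \<otimes> n) v"
  by (simp add: A.gm_dl_dl flip: A.gm_assoc)
lemma lm_lin: "lin SG SG (lm n)" by (rule A.lin_left)
lemma lm_comm: "m \<in> N \<Longrightarrow> n \<in> N \<Longrightarrow> lm m (lm n v) = lm n (lm m v)"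
  using Ncomm[of m n] by (simp add: lm_lm N_G)
lemma lm_dl: "n \<in> SG \<Longrightarrow> g \<in> SG \<Longrightarrow> lm n (dl g) = dl (n \<otimes> g)" by (rule A.gm_dl_dl)
lemma lm_funpow: "n \<in> SG \<Longrightarrow> v \<in> VG \<Longrightarrow> (lm n ^^ k) v = lm (n [^] k) v"
proof (induction k)
  case (Suc k)
  have "n \<otimes> n [^] k = n [^] Suc k" using A.nat_pow_Suc2[OF Suc.prems(1)] by simp
  then show ?case using Suc by (simp add: lm_lm del: A.nat_pow_Suc)
qed simp

definition pr :: "('a \<Rightarrow> int) \<Rightarrow> 'c \<Rightarrow> int" where
  "pr v = (\<lambda>b. if b \<in> SH then \<Sum>g\<in>SG. if \<phi> g = b then v g else 0 else 0)"
definition lift :: "('c \<Rightarrow> int) \<Rightarrow> 'a \<Rightarrow> int" where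
  "lift w = (\<Sum>b\<in>SH. cs (w b) (dl (rho b)))"

lemma pr_lin: "lin SG SH pr"
proof -
  have "(\<Sum>g\<in>SG. if \<phi> g = b then (v + w) g else 0) = (\<Sum>g\<in>SG. if \<phi> g = b then v g else 0) + (\<Sum>g\<in>SG. if \<phi> g = b then w g else 0)" for v w :: "'a \<Rightarrow> int" and b
    unfolding sum.distrib[symmetric] by (intro sum.cong) (auto simp: fapp)
  then show ?thesis unfolding lin_def by (auto simp: pr_def vecs_def fun_eq_iff fapp)
qed
lemma pr_dl: assumes "a \<in> SG" shows "pr (dl a) = dl (\<phi> a)"
proof
  fix b
  have "(\<Sum>g\<in>SG. if \<phi> g = b then dl a g else 0) = (\<Sum>g\<in>SG. if g = a then (if \<phi> a = b then 1 else 0) else 0)"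
    by (intro sum.cong) (auto simp: dl_def)
  also have "\<dots> = (if \<phi> a = b then 1 else 0)" using assms by simp
  finally show "pr (dl a) b = dl (\<phi> a) b" using assms by (auto simp: pr_def dl_def[of "\<phi> a"])
qed
lemma lift_lin: "lin SH SG lift"
  unfolding lin_def lift_def
  using rho by (auto simp: fapp cs_add_left sum.distrib intro!: vecs_sum vecs_cs)
lemma lift_dl: assumes "b \<in> SH" shows "lift (dl b) = dl (rho b)"
proof -
  have "lift (dl b) = (\<Sum>c\<in>SH. if c = b then dl (rho b) else 0)"
    unfolding lift_def by (intro sum.cong) (auto simp: dl_def)
  then show ?thesis using assms by simp
qed
lemma pr_lift: "w \<in> VH \<Longrightarrow> pr (lift w) = w"
  by (rule lin_eqI[OF B.fin_carrier lin_comp[OF lift_lin pr_lin] lin_id]) (simp_all add: lift_dl pr_dl rho)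
lemma pr_VH: "v \<in> VG \<Longrightarrow> pr v \<in> VH" by (rule lin_vecs[OF pr_lin])
lemma pr_gm: assumes "u \<in> VG" "v \<in> VG" shows "pr (A.gm u v) = B.gm (pr u) (pr v)"
proof -
  have 1: "pr (A.gm (dl a) v) = B.gm (pr (dl a)) (pr v)" if a: "a \<in> SG" for a
    by (rule lin_eqI[OF A.fin_carrier lin_comp[OF A.lin_left pr_lin] lin_comp[OF pr_lin B.lin_left] _ assms(2)])
       (use a in \<open>simp add: A.gm_dl_dl B.gm_dl_dl pr_dl\<close>)
  show ?thesis
    by (rule lin_eqI[OF A.fin_carrier lin_comp[OF A.lin_right pr_lin] lin_comp[OF pr_lin B.lin_right] 1 assms(1)])
qed
lemma pr_gpow: "u \<in> VG \<Longrightarrow> pr (A.gpow u k) = B.gpow (pr u) k"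
  by (induction k) (simp_all add: A.gpow_Suc B.gpow_Suc pr_gm A.R_one B.R_one pr_dl)
lemma pr_lm: "n \<in> N \<Longrightarrow> v \<in> VG \<Longrightarrow> pr (lm n v) = pr v"
  using pr_gm[of "dl n" v] N_G[of n] N_phi[of n] pr_VH[of v] by (simp add: pr_dl)

text \<open>The product of the augmentation ideal of the subgroup generated by \<open>Y\<close> with \<open>U\<close>, modulo \<open>p\<close>.\<close>
definition gens :: "'a set \<Rightarrow> ('a \<Rightarrow> int) set \<Rightarrow> ('a \<Rightarrow> int) set" where
  "gens Y U = \<Inter>{W. A.subm W \<and> (\<forall>n\<in>Y. \<forall>u\<in>U. lm n u - u \<in> W)}"

lemma gens_subm: "U \<subseteq> VG \<Longrightarrow> A.subm (gens Y U)"
proof -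
  assume U: "U \<subseteq> VG"
  have "VG \<in> {W. A.subm W \<and> (\<forall>n\<in>Y. \<forall>u\<in>U. lm n u - u \<in> W)}" using U by (auto intro!: vecs_diff)
  then have ne: "{W. A.subm W \<and> (\<forall>n\<in>Y. \<forall>u\<in>U. lm n u - u \<in> W)} \<noteq> {}" by blast
  show ?thesis unfolding gens_def by (rule A.subm_Inter[OF ne]) blast
qed
lemma gens_mem: "n \<in> Y \<Longrightarrow> u \<in> U \<Longrightarrow> lm n u - u \<in> gens Y U" unfolding gens_def by blast
lemma gens_least: "A.subm W \<Longrightarrow> (\<And>n u. n \<in> Y \<Longrightarrow> u \<in> U \<Longrightarrow> lm n u - u \<in> W) \<Longrightarrow> gens Y U \<subseteq> W"
  unfolding gens_def by blast
lemma gens_mono: "U \<subseteq> U' \<Longrightarrow> gens Y U \<subseteq> gens Y U'" unfolding gens_def by blast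

text \<open>The \<open>j\<close>-th power of the augmentation ideal of \<open>N\<close>, times \<open>\<int>G\<close>, modulo \<open>p\<close>.\<close>
definition I :: "nat \<Rightarrow> ('a \<Rightarrow> int) set" where "I j = (gens N ^^ j) VG"

lemma I_0: "I 0 = VG" by (simp add: I_def)
lemma I_Suc: "I (Suc j) = gens N (I j)" by (simp add: I_def)
lemma I_subm: "A.subm (I j)"
proof (induction j)
  case (Suc j) then show ?case unfolding I_Suc by (intro gens_subm) (auto intro: A.subm_V)
qed (simp add: I_0)
lemma I_V: "v \<in> I j \<Longrightarrow> v \<in> VG" by (rule A.subm_V[OF I_subm])
lemma I_step: "n \<in> N \<Longrightarrow> u \<in> I j \<Longrightarrow> lm n u - u \<in> I (Suc j)" unfolding I_Suc by (rule gens_mem)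
lemma I_dec: "I (Suc j) \<subseteq> I j"
proof (induction j)
  case 0 show ?case using I_V by (auto simp: I_0)
next
  case (Suc j) then show ?case unfolding I_Suc[of "Suc j"] I_Suc[of j] by (intro gens_mono) (simp add: I_Suc)
qed
lemma I_lm: assumes "n \<in> N" "u \<in> I j" shows "lm n u \<in> I j"
proof -
  have "lm n u - u \<in> I j" using I_step[OF assms] I_dec by blast
  from A.subm_add[OF I_subm this assms(2)] show ?thesis by simp
qed
lemma I_least: "A.subm W \<Longrightarrow> (\<And>n u. n \<in> N \<Longrightarrow> u \<in> I j \<Longrightarrow> lm n u - u \<in> W) \<Longrightarrow> I (Suc j) \<subseteq> W"
  unfolding I_Suc by (rule gens_least)

lemma minus_lift_pr: assumes v: "v \<in> VG" shows "v - lift (pr v) \<in> I 1"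
proof -
  have g: "dl g - lift (pr (dl g)) \<in> I 1" if "g \<in> SG" for g
  proof -
    have "dl g = lm (nn g) (dl (rho (\<phi> g)))" using nn[OF that] rho[of "\<phi> g"] that N_G by (simp add: lm_dl)
    moreover have "lift (pr (dl g)) = dl (rho (\<phi> g))" using that by (simp add: pr_dl lift_dl)
    ultimately show ?thesis using I_step[OF nn(1)[OF that], of "dl (rho (\<phi> g))" 0] rho[of "\<phi> g"] that by (simp add: I_0)
  qed
  have l: "lin SG SG (\<lambda>v. v - lift (pr v))" by (intro lin_minus lin_id lin_comp[OF pr_lin lift_lin])
  show ?thesis unfolding lin_expand[OF A.fin_carrier l v]
    by (intro A.subm_sum[OF I_subm] A.subm_cs[OF I_subm] g)
qed
lemma ker_pr_I: "v \<in> VG \<Longrightarrow> pr v = 0 \<Longrightarrow> v \<in> I 1"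
  using minus_lift_pr[of v] lin_0[OF lift_lin] by simp
lemma I1_pr: assumes "u \<in> I 1" shows "cg (int p) (pr u) 0"
proof -
  have "I (Suc 0) \<subseteq> {v \<in> VG. cg (int p) (pr v) 0}"
  proof (rule I_least[OF A.subm_kernel_mod[OF pr_lin]])
    fix n u assume "n \<in> N" "u \<in> I 0"
    then have "pr (lm n u - u) = 0" using lin_diff[OF pr_lin, of "lm n u" u] pr_lm by (simp add: I_0)
    then show "lm n u - u \<in> {v \<in> VG. cg (int p) (pr v) 0}" using \<open>u \<in> I 0\<close> by (simp add: I_0)
  qed
  then show ?thesis using assms by auto
qed

text \<open>Right multiplication by \<open>z - 1\<close> raises the filtration degree, because \<open>z - 1\<close> lies in the kernel of the projection.\<close>
lemma I_right_minus:
  assumes z: "z \<in> VG" "pr z = dl \<one>\<^bsub>H\<^esub>" and u: "u \<in> I j" shows "A.gm u z - u \<in> I (Suc j)"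
proof -
  have l: "lin SG SG (\<lambda>v. A.gm v z - v)" by (intro lin_minus A.lin_right lin_id)
  have "I j \<subseteq> {v \<in> VG. A.gm v z - v \<in> I (Suc j)}"
  proof (induction j)
    case 0
    have "A.gm v z - v \<in> I 1" if "v \<in> VG" for v
      using that lin_diff[OF pr_lin, of "A.gm v z" v] pr_gm[OF that z(1)] z(2) pr_VH[OF that]
      by (intro ker_pr_I) simp_all
    then show ?case by (auto simp: I_0)
  next
    case (Suc j)
    show ?case
    proof (rule I_least[OF A.subm_preimage[OF l I_subm]])
      fix n u assume n: "n \<in> N" "u \<in> I j"
      have uV: "u \<in> VG" by (rule I_V[OF n(2)])
      have "A.gm (lm n u - u) z - (lm n u - u) = lm n (A.gm u z - u) - (A.gm u z - u)"
        using lin_diff[OF A.lin_right, of "lm n u" u z] lin_diff[OF A.lin_left, of "A.gm u z" u "dl n"] uV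
        by (simp add: A.gm_assoc)
      moreover have "A.gm u z - u \<in> I (Suc j)" using Suc n by blast
      ultimately have m: "A.gm (lm n u - u) z - (lm n u - u) \<in> I (Suc (Suc j))" using I_step[OF n(1)] by metis
      show "lm n u - u \<in> {v \<in> VG. A.gm v z - v \<in> I (Suc (Suc j))}"
        by (intro CollectI conjI m vecs_diff A.gm_vecs uV)
    qed
  qed
  then show ?thesis using u by blast
qed

text \<open>Remove the generators of \<open>N\<close> one at a time: modulo the remaining ones, \<open>U = (n - 1) U\<close>, and \<open>(n - 1)\<^sup>p = n\<^sup>p - 1 = 0\<close> modulo \<open>p\<close>.\<close>
lemma nakayama:
  assumes U: "A.subm U" and st: "\<And>n u. n \<in> N \<Longrightarrow> u \<in> U \<Longrightarrow> lm n u \<in> U"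
    and Y: "finite Y" "Y \<subseteq> N" and sub: "U \<subseteq> gens Y U"
  shows "U \<subseteq> A.pV"
  using Y sub
proof (induction Y rule: finite_induct)
  case empty
  have "gens {} U \<subseteq> A.pV" by (rule gens_least) auto
  then show ?case using empty by blast
next
  case (insert n Y)
  have UV: "U \<subseteq> VG" using A.subm_V[OF U] by blast
  let ?W = "gens Y U"
  have W: "A.subm ?W" by (rule gens_subm[OF UV])
  have n: "n \<in> N" using insert by simp
  have D: "lin SG SG (\<lambda>v. lm n v - v)" by (intro lin_minus lm_lin lin_id)
  let ?D = "\<lambda>v. lm n v - v"
  have WD: "?D w \<in> ?W" if w: "w \<in> ?W" for w
  proof -
    have "?W \<subseteq> {v \<in> VG. ?D v \<in> ?W}"
    proof (rule gens_least[OF A.subm_preimage[OF D W]])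
      fix m u assume m: "m \<in> Y" "u \<in> U"
      have mN: "m \<in> N" using m insert by blast
      have uV: "u \<in> VG" using m UV by blast
      have "?D (lm m u - u) = (lm m (lm n u) - lm n u) - (lm m u - u)"
        using lin_diff[OF lm_lin, of "lm m u" u n] lm_comm[OF n mN] uV by simp
      moreover have "lm m (lm n u) - lm n u \<in> ?W" "lm m u - u \<in> ?W"
        using gens_mem[OF m(1) st[OF n m(2)]] gens_mem[OF m] by auto
      ultimately show "lm m u - u \<in> {v \<in> VG. ?D v \<in> ?W}" using A.subm_diff[OF W] uV by simp
    qed
    then show ?thesis using w by blast
  qed
  have DU: "?D u \<in> U" if "u \<in> U" for u using A.subm_diff[OF U st[OF n that] that] .
  have DnU: "(?D ^^ j) u \<in> U" if "u \<in> U" for u j by (induction j) (use that DU in auto)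
  have DnW: "(?D ^^ j) u \<in> ?W" if "u \<in> ?W" for u j by (induction j) (use that WD in auto)
  have one: "\<exists>u'\<in>U. u - ?D u' \<in> ?W" if u: "u \<in> U" for u
  proof -
    let ?Z = "{w \<in> VG. \<exists>u'\<in>U. w - ?D u' \<in> ?W}"
    have Z: "A.subm ?Z"
      unfolding A.subm_def
    proof (intro conjI ballI)
      have "0 - ?D 0 \<in> ?W" using A.subm_0[OF W] lin_0[OF lm_lin] by simp
      then show "0 \<in> ?Z" using A.subm_0[OF U] vecs_0 by blast
    next
      fix v w assume "v \<in> ?Z" "w \<in> ?Z"
      then obtain a b where ab: "v \<in> VG" "w \<in> VG" "a \<in> U" "b \<in> U" "v - ?D a \<in> ?W" "w - ?D b \<in> ?W" by blast
      have "(v + w) - ?D (a + b) = (v - ?D a) + (w - ?D b)"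
        using lin_add[OF lm_lin, of a b n] subsetD[OF UV ab(3)] subsetD[OF UV ab(4)] by (simp add: algebra_simps)
      then have "(v + w) - ?D (a + b) \<in> ?W" using A.subm_add[OF W ab(5,6)] by (simp only:)
      then show "v + w \<in> ?Z" using A.subm_add[OF U ab(3,4)] vecs_add[OF ab(1,2)] by blast
    next
      fix v assume "v \<in> ?Z"
      then obtain a where ab: "v \<in> VG" "a \<in> U" "v - ?D a \<in> ?W" by blast
      have "- v - ?D (- a) = - (v - ?D a)" using lin_uminus[OF lm_lin, of a n] subsetD[OF UV ab(2)] by (simp add: algebra_simps)
      then have "- v - ?D (- a) \<in> ?W" using A.subm_uminus[OF W ab(3)] by (simp only:)
      then show "- v \<in> ?Z" using A.subm_uminus[OF U ab(2)] vecs_uminus[OF ab(1)] by blast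
    next
      fix v assume v: "v \<in> VG"
      have "cs (int p) v - ?D 0 \<in> ?W" using A.subm_p[OF W v] lin_0[OF lm_lin] by simp
      then show "cs (int p) v \<in> ?Z" using A.subm_0[OF U] vecs_cs[OF v] by blast
    qed auto
    have "gens (insert n Y) U \<subseteq> ?Z"
    proof (rule gens_least[OF Z])
      fix m u assume m: "m \<in> insert n Y" "u \<in> U"
      have V: "lm m u - u \<in> VG" using m UV by auto
      show "lm m u - u \<in> ?Z"
      proof (cases "m = n")
        case True
        then have "(lm m u - u) - ?D u \<in> ?W" using A.subm_0[OF W] by simp
        then show ?thesis using V m by blast
      next
        case False
        then have "(lm m u - u) - ?D 0 \<in> ?W" using gens_mem[of m Y u U] m lin_0[OF lm_lin] by simp
        then show ?thesis using V A.subm_0[OF U] by blast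
      qed
    qed
    then show ?thesis using insert.prems u by blast
  qed
  have many: "\<exists>u'\<in>U. u - (?D ^^ j) u' \<in> ?W" if u: "u \<in> U" for u j
  proof (induction j)
    case 0 then show ?case using u A.subm_0[OF W] by (intro bexI[of _ u]) auto
  next
    case (Suc j)
    then obtain a where a: "a \<in> U" "u - (?D ^^ j) a \<in> ?W" by blast
    obtain b where b: "b \<in> U" "a - ?D b \<in> ?W" using one[OF a(1)] by blast
    have "(?D ^^ j) (a - ?D b) = (?D ^^ j) a - (?D ^^ j) (?D b)"
      by (rule lin_diff[OF lin_funpow[OF D]]) (use a b UV DU in auto)
    moreover have "(?D ^^ Suc j) b = (?D ^^ j) (?D b)" by (simp only: funpow_Suc_right comp_apply)
    ultimately have "(?D ^^ j) a - (?D ^^ Suc j) b \<in> ?W" using DnW[OF b(2), of j] by (simp only:)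
    from A.subm_add[OF W a(2) this] have "u - (?D ^^ Suc j) b \<in> ?W" by (simp only: add_diff_eq diff_add_cancel)
    then show ?case using b(1) by blast
  qed
  have "U \<subseteq> ?W"
  proof
    fix u assume u: "u \<in> U"
    obtain a where a: "a \<in> U" "u - (?D ^^ p) a \<in> ?W" using many[OF u] by blast
    have aV: "a \<in> VG" using a UV by blast
    have "cg (int p) ((lm n ^^ (p ^ 1)) a) ((?D ^^ (p ^ 1)) a + cs (1 ^ (p ^ 1)) a)"
      by (rule A.prime_power_op[OF lm_lin _ aV]) simp
    moreover have "(lm n ^^ p) a = a" using lm_funpow[OF N_G[OF n] aV] Nexp[OF n] aV by simp
    ultimately have "cg (int p) ((?D ^^ p) a) 0" by (simp add: cg_def fapp)
    moreover have "(?D ^^ p) a \<in> VG" by (rule lin_vecs[OF lin_funpow[OF D] aV])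
    ultimately have "(?D ^^ p) a \<in> A.pV" by (simp add: A.pV_iff)
    then have "(?D ^^ p) a \<in> ?W" using A.pV_subset[OF W] by blast
    from A.subm_add[OF W a(2) this] show "u \<in> ?W" by simp
  qed
  then show ?case using insert by blast
qed

text \<open>The dimensions of the \<open>I j\<close> cannot decrease for ever, and \<open>nakayama\<close> applies where they become stationary.\<close>
lemma I_nilpotent: "\<exists>j. I j \<subseteq> A.pV"
proof -
  have "\<exists>j. A.dm (I (Suc j)) = A.dm (I j)"
  proof (rule ccontr)
    assume n: "\<nexists>j. A.dm (I (Suc j)) = A.dm (I j)"
    have lt: "A.dm (I (Suc j)) < A.dm (I j)" for j
      using A.dm_mono[OF I_subm I_subm I_dec] n by (metis le_neq_implies_less)
    have "A.dm (I j) + j \<le> A.dm (I 0)" for j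
    proof (induction j)
      case (Suc j) then show ?case using lt[of j] by simp
    qed simp
    from this[of "Suc (A.dm (I 0))"] show False by simp
  qed
  then obtain j where "A.dm (I (Suc j)) = A.dm (I j)" by blast
  then have e: "I (Suc j) = I j" by (rule A.dm_eq[OF I_subm I_subm I_dec])
  have "I j \<subseteq> A.pV"
    by (rule nakayama[OF I_subm I_lm finN subset_refl]) (use e I_Suc in auto)
  then show ?thesis by blast
qed

text \<open>By nilpotency \<open>z\<^bsup>p^s\<^esup>\<close> tends to one \<open>p\<close>-adically. If the order of \<open>z\<close> is prime to \<open>p\<close>, then \<open>z\<close> is a power of \<open>z\<^bsup>p^s\<^esup>\<close> for every \<open>s\<close>.\<close>
lemma kernel_p_element:
  assumes z: "z \<in> VG" "pr z = dl \<one>\<^bsub>H\<^esub>" "A.gpow z k = dl \<one>" "coprime k p"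
  shows "z = dl \<one>"
proof -
  let ?R = "\<lambda>v. A.gm v z"
  let ?D = "\<lambda>v. A.gm v z - v"
  have R: "lin SG SG ?R" by (rule A.lin_right)
  have D: "lin SG SG ?D" by (intro lin_minus R lin_id)
  obtain j where j: "I j \<subseteq> A.pV" using I_nilpotent by blast
  have DI: "(?D ^^ i) v \<in> I i" if "v \<in> VG" for v i
    by (induction i) (use that I_right_minus[OF z(1,2)] in \<open>auto simp: I_0\<close>)
  have Idec: "I (i + m) \<subseteq> I i" for i m
  proof (induction m)
    case (Suc m) then show ?case using I_dec[of "i + m"] by auto
  qed simp
  have jp: "j \<le> p ^ j" using A.p_gt_1 by (simp add: less_imp_le power_gt_expt)
  have step: "cg (int p) (A.gm v (A.gpow z (p ^ j))) v" if v: "v \<in> VG" for v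
  proof -
    have "I (p ^ j) \<subseteq> I j" using Idec[of j "p ^ j - j"] jp by simp
    then have "(?D ^^ (p ^ j)) v \<in> A.pV" using DI[OF v, of "p ^ j"] j by blast
    then have "cg (int p) ((?D ^^ (p ^ j)) v) 0" by (simp add: A.pV_iff)
    moreover have "cg (int p) ((?R ^^ (p ^ j)) v) ((?D ^^ (p ^ j)) v + cs (1 ^ (p ^ j)) v)"
      by (rule A.prime_power_op[OF R _ v]) simp
    ultimately have "cg (int p) ((?R ^^ (p ^ j)) v) v" by (auto simp: cg_iff_cong fapp intro: cong_trans[OF _ cong_add[of _ 0 _ _ _, simplified]])
    then show ?thesis using A.right_funpow[OF z(1) v] by simp
  qed
  have "cg (int p ^ Suc s) (A.gm v (A.gpow z (p ^ (j + s)))) v" if v: "v \<in> VG" for v s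
    using v
  proof (induction s arbitrary: v)
    case 0 then show ?case using step by simp
  next
    case (Suc s)
    let ?q = "p ^ (j + s)"
    let ?Rq = "\<lambda>v. A.gm v (A.gpow z ?q)"
    let ?E = "\<lambda>v. ?Rq v - v"
    have Rq: "lin SG SG ?Rq" by (rule A.lin_right)
    have E: "lin SG SG ?E" by (intro lin_minus Rq lin_id)
    have Em: "\<exists>y\<in>VG. ?E v = cs (int p ^ Suc s) y" if "v \<in> VG" for v
    proof -
      have "cg (int p ^ Suc s) (?E v) 0" using Suc.IH[OF that] by (simp add: cg_def fapp)
      then show ?thesis using cg_iff[OF lin_vecs[OF E that] vecs_0] by simp
    qed
    have zq: "A.gpow z (p ^ (j + Suc s)) = A.gpow (A.gpow z ?q) p"
      using A.gpow_mult[OF z(1), of ?q p] by (simp add: mult.commute)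
    have En: "cg (int p ^ Suc (Suc s)) ((?E ^^ i) v) 0" if i2: "2 \<le> i" and vV: "v \<in> VG" for i v
    proof -
      from le_Suc_ex[OF i2] obtain m where m: "i = Suc (Suc m)" by auto
      let ?u = "(?E ^^ m) v"
      have uV: "?u \<in> VG" by (rule lin_vecs[OF lin_funpow[OF E] vV])
      obtain y where y: "y \<in> VG" "?E ?u = cs (int p ^ Suc s) y" using Em[OF uV] by blast
      obtain y' where y': "y' \<in> VG" "?E y = cs (int p ^ Suc s) y'" using Em[OF y(1)] by blast
      have "(?E ^^ i) v = ?E (cs (int p ^ Suc s) y)" using m y(2) by simp
      also have "\<dots> = cs (int p ^ Suc s) (?E y)" by (rule lin_cs[OF E y(1)])
      also have "\<dots> = cs (int p ^ Suc (Suc s)) (cs (int p ^ s) y')" unfolding y'(2) by (simp add: mult_ac)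
      finally show ?thesis by (simp only: cg_0_cs)
    qed
    have "A.gm v (A.gpow z (p ^ (j + Suc s))) = (?Rq ^^ p) v"
      unfolding zq using A.right_funpow[OF A.gpow_vecs[OF z(1)] Suc.prems] by simp
    also have "\<dots> = (\<Sum>i\<le>p. cs (int (p choose i) * 1 ^ (p - i)) ((?E ^^ i) v))"
      by (rule binom_op[OF Rq _ Suc.prems]) simp
    also have "cg (int p ^ Suc (Suc s)) \<dots> (\<Sum>i\<le>p. if i = 0 then v else 0)"
    proof (rule cg_sum)
      fix i assume "i \<in> {..p}"
      consider "i = 0" | "i = 1" | "2 \<le> i" by linarith
      then show "cg (int p ^ Suc (Suc s)) (cs (int (p choose i) * 1 ^ (p - i)) ((?E ^^ i) v)) (if i = 0 then v else 0)"
      proof cases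
        case 2
        obtain y where y: "y \<in> VG" "?E v = cs (int p ^ Suc s) y" using Em[OF Suc.prems] by blast
        have "cs (int (p choose i) * 1 ^ (p - i)) ((?E ^^ i) v) = cs (int p) (?E v)" using 2 by simp
        also have "\<dots> = cs (int p ^ Suc (Suc s)) y" unfolding y(2) by simp
        finally have "cg (int p ^ Suc (Suc s)) (cs (int (p choose i) * 1 ^ (p - i)) ((?E ^^ i) v)) 0"
          by (simp only: cg_0_cs)
        then show ?thesis using 2 by simp
      next
        case 3
        from cg_cs[OF En[OF this Suc.prems], of "int (p choose i) * 1 ^ (p - i)"] show ?thesis using 3 by simp
      qed simp
    qed
    finally show ?case by simp
  qed
  note conv = this
  have "cg (int p ^ s) z (dl \<one>)" for s
  proof -
    have k0: "k \<noteq> 0" using z(4) A.p_gt_1 by (cases "k = 0") auto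
    define m where "m = j + s"
    have "[p ^ (totient k * m) = 1] (mod k)"
    proof -
      have "[p ^ totient k = 1] (mod k)" by (rule euler_theorem) (use z(4) in \<open>simp add: coprime_commute\<close>)
      from cong_pow[OF this, of m] show ?thesis by (simp add: power_mult)
    qed
    moreover have "totient k > 0" using k0 by simp
    then have "totient k * m \<ge> m" by (cases "totient k") auto
    from le_Suc_ex[OF this] obtain i where "totient k * m = m + i" by blast
    then have i: "totient k * m = j + (s + i)" by (simp add: m_def)
    ultimately have c: "[p ^ (j + (s + i)) = 1] (mod k)" by simp
    have "A.gpow z (p ^ (j + (s + i))) = z"
    proof -
      let ?M = "p ^ (j + (s + i))"
      have per: "A.gpow z (k * a) = dl \<one>" for a
        using A.gpow_mult[OF z(1), of k a] z(3) A.gpow_dl[of "\<one>" a] by simp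
      have "A.gpow z a = A.gpow z (a mod k)" for a
      proof -
        have "A.gm (A.gpow z (k * (a div k))) (A.gpow z (a mod k)) = A.gpow z a"
          using A.gpow_add[OF z(1)] by simp
        then show ?thesis using per z(1) by simp
      qed
      then have "A.gpow z ?M = A.gpow z (Suc 0)" using c unfolding cong_def One_nat_def by metis
      then show ?thesis by (simp only: A.gpow_1[OF z(1)])
    qed
    then have "cg (int p ^ Suc (s + i)) (A.gm (dl \<one>) z) (dl \<one>)"
      using conv[of "dl \<one>" "s + i"] by simp
    then have "cg (int p ^ Suc (s + i)) z (dl \<one>)" using z(1) by simp
    then show ?thesis by (rule cg_dvd) (intro le_imp_power_dvd, simp)
  qed
  then have "z x = dl \<one> x" for x
    by (intro eq_if_cong_powers[OF A.p_gt_1]) (simp add: cg_iff_cong)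
  then show ?thesis by blast
qed

end

section \<open>Units in the kernel to first order\<close>

context elem_ext
begin

text \<open>Additive characters of \<open>N\<close> with values in the integers modulo \<open>p\<close>.\<close>
definition add_char :: "('a \<Rightarrow> int) \<Rightarrow> bool" where
  "add_char t \<longleftrightarrow> (\<forall>m\<in>N. \<forall>n\<in>N. [t (m \<otimes> n) = t m + t n] (mod int p))"

lemma add_char_mult: "add_char t \<Longrightarrow> m \<in> N \<Longrightarrow> n \<in> N \<Longrightarrow> [t (m \<otimes> n) = t m + t n] (mod int p)"
  by (simp add: add_char_def)
lemma add_char_one: assumes "add_char t" shows "[t \<one> = 0] (mod int p)"
proof -
  have "[t \<one> = t \<one> + t \<one>] (mod int p)" using add_char_mult[OF assms N_one N_one] by simp
  then show ?thesis by (simp add: cong_iff_dvd_diff)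
qed
lemma add_char_pow: assumes "add_char t" "n \<in> N" shows "[t (n [^] (k::nat)) = int k * t n] (mod int p)"
proof (induction k)
  case 0 then show ?case using add_char_one[OF assms(1)] by simp
next
  case (Suc k)
  have "[t (n [^] k \<otimes> n) = t (n [^] k) + t n] (mod int p)"
    by (rule add_char_mult[OF assms(1) N_pow[OF assms(2)] assms(2)])
  also have "[t (n [^] k) + t n = int k * t n + t n] (mod int p)" by (rule cong_add[OF Suc cong_refl])
  finally show ?case by (simp add: distrib_right add.commute)
qed

text \<open>The derivation attached to \<open>t\<close>. On \<open>I 1\<close> it depends, modulo \<open>p\<close>, only on the class modulo \<open>I 2\<close>, and all characters together determine that class.\<close>
definition Dt :: "('a \<Rightarrow> int) \<Rightarrow> ('a \<Rightarrow> int) \<Rightarrow> 'c \<Rightarrow> int" where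
  "Dt t y = (\<Sum>g\<in>SG. cs (y g * t (nn g)) (dl (\<phi> g)))"

lemma Dt_lin: "lin SG SH (Dt t)"
  unfolding lin_def Dt_def
  by (auto simp: fapp distrib_right cs_add_left sum.distrib intro!: vecs_sum vecs_cs)
lemma Dt_dl: assumes "a \<in> SG" shows "Dt t (dl a) = cs (t (nn a)) (dl (\<phi> a))"
proof -
  have "Dt t (dl a) = (\<Sum>g\<in>SG. if g = a then cs (t (nn a)) (dl (\<phi> a)) else 0)"
    unfolding Dt_def by (intro sum.cong) (auto simp: dl_def)
  then show ?thesis using assms by simp
qed
lemma Dt_apply: "Dt t y b = (\<Sum>g\<in>SG. y g * (if \<phi> g = b then t (nn g) else 0))"
  unfolding Dt_def fapp by (intro sum.cong) (auto simp: dl_def)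
lemma pr_apply: "b \<in> SH \<Longrightarrow> pr y b = (\<Sum>g\<in>SG. y g * (if \<phi> g = b then 1 else 0))"
  unfolding pr_def by (auto intro!: sum.cong)

text \<open>On \<open>(n - 1) x\<close> the map \<open>Dt t\<close> is \<open>t n\<close> times the projection; in particular it kills the square of the augmentation ideal.\<close>
lemma Dt_step: assumes t: "add_char t" and n: "n \<in> N" and x: "x \<in> VG"
  shows "cg (int p) (Dt t (lm n x - x)) (cs (t n) (pr x))"
proof (rule lin_cgI[OF A.fin_carrier _ _ _ x])
  show "lin SG SH (\<lambda>x. Dt t (lm n x - x))" by (rule lin_comp[OF lin_minus[OF lm_lin lin_id] Dt_lin])
  show "lin SG SH (\<lambda>x. cs (t n) (pr x))" by (rule lin_scale[OF pr_lin])
  fix g assume g: "g \<in> SG"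
  have ng: "n \<otimes> g \<in> SG" using g N_G[OF n] by simp
  have "Dt t (lm n (dl g) - dl g) = Dt t (dl (n \<otimes> g)) - Dt t (dl g)"
    using lin_diff[OF Dt_lin, of "dl (n \<otimes> g)" "dl g"] g ng N_G[OF n] by (simp add: lm_dl)
  also have "\<dots> = cs (t (n \<otimes> nn g) - t (nn g)) (dl (\<phi> g))"
    using nn_mult[OF n g] g ng by (simp add: Dt_dl cs_diff_left)
  also have "cg (int p) \<dots> (cs (t n) (dl (\<phi> g)))"
  proof (rule cg_cs_coeff)
    show "[t (n \<otimes> nn g) - t (nn g) = t n] (mod int p)"
      using cong_diff[OF add_char_mult[OF t n nn(1)[OF g]] cong_refl, of "t (nn g)"] by simp
  qed
  finally show "cg (int p) (Dt t (lm n (dl g) - dl g)) (cs (t n) (pr (dl g)))" using g by (simp add: pr_dl)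
qed

lemma Dt_I2: assumes t: "add_char t" and u: "u \<in> I (Suc 1)" shows "cg (int p) (Dt t u) 0"
proof -
  have "I (Suc 1) \<subseteq> {v \<in> VG. cg (int p) (Dt t v) 0}"
  proof (rule I_least[OF A.subm_kernel_mod[OF Dt_lin]])
    fix n u assume n: "n \<in> N" "u \<in> I 1"
    have uV: "u \<in> VG" by (rule I_V[OF n(2)])
    have "cg (int p) (Dt t (lm n u - u)) (cs (t n) (pr u))" by (rule Dt_step[OF t n(1) uV])
    also have "cg (int p) \<dots> (cs (t n) 0)" by (rule cg_cs[OF I1_pr[OF n(2)]])
    finally show "lm n u - u \<in> {v \<in> VG. cg (int p) (Dt t v) 0}" using uV by simp
  qed
  then show ?thesis using u by blast
qed

text \<open>Right multiplication by \<open>z - 1\<close>, seen through \<open>t\<close> as an operator on \<open>\<int>H\<close>.\<close>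
definition At :: "('a \<Rightarrow> int) \<Rightarrow> ('a \<Rightarrow> int) \<Rightarrow> ('c \<Rightarrow> int) \<Rightarrow> 'c \<Rightarrow> int" where
  "At z t w = Dt t (A.gm (lift w) z - lift w)"

lemma At_lin: "lin SH SH (At z t)"
  unfolding At_def
  by (rule lin_comp[OF _ Dt_lin]) (intro lin_minus lin_comp[OF lift_lin A.lin_right] lift_lin)

lemma At_pr: assumes z: "z \<in> VG" "pr z = dl \<one>\<^bsub>H\<^esub>" and t: "add_char t" and v: "v \<in> VG"
  shows "cg (int p) (Dt t (A.gm v z - v)) (At z t (pr v))"
proof -
  let ?l = "lift (pr v)"
  have lV: "?l \<in> VG" by (rule lin_vecs[OF lift_lin pr_VH[OF v]])
  have "A.gm (v - ?l) z - (v - ?l) \<in> I (Suc 1)"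
    by (rule I_right_minus[OF z minus_lift_pr[OF v]])
  moreover have "A.gm (v - ?l) z - (v - ?l) = (A.gm v z - v) - (A.gm ?l z - ?l)"
    using lin_diff[OF A.lin_right v lV] by simp
  ultimately have "cg (int p) (Dt t ((A.gm v z - v) - (A.gm ?l z - ?l))) 0" using Dt_I2[OF t] by metis
  moreover have "Dt t ((A.gm v z - v) - (A.gm ?l z - ?l)) = Dt t (A.gm v z - v) - Dt t (A.gm ?l z - ?l)"
    by (rule lin_diff[OF Dt_lin]) (use v lV in auto)
  ultimately show ?thesis by (simp add: At_def cg_def fapp)
qed

text \<open>The orbit of \<open>g\<close> under the kernel of the character \<open>t\<close>, which acts on \<open>G\<close> from the left; \<open>K t\<close> below is the kernel of the induced map of lattices, which is pure. Modulo \<open>K t\<close> the group \<open>N\<close> acts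
through a cyclic group of order dividing \<open>p\<close>.\<close>
definition chi :: "('a \<Rightarrow> int) \<Rightarrow> 'a \<Rightarrow> 'c \<times> int" where "chi t g = (\<phi> g, t (nn g) mod int p)"
definition tau :: "('a \<Rightarrow> int) \<Rightarrow> ('a \<Rightarrow> int) \<Rightarrow> 'c \<times> int \<Rightarrow> int" where
  "tau t v y = (\<Sum>g\<in>SG. v g * (if chi t g = y then 1 else 0))"
definition K :: "('a \<Rightarrow> int) \<Rightarrow> ('a \<Rightarrow> int) set" where "K t = {v \<in> VG. \<forall>y. tau t v y = 0}"

lemma K_tau: "v \<in> K t \<Longrightarrow> tau t v y = 0" unfolding K_def by blast
lemma K_I: "v \<in> VG \<Longrightarrow> (\<And>y. tau t v y = 0) \<Longrightarrow> v \<in> K t" unfolding K_def by blast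
lemma tau_add: "tau t (v + w) y = tau t v y + tau t w y" by (simp add: tau_def fapp distrib_right sum.distrib)
lemma tau_cs: "tau t (cs k v) y = k * tau t v y" by (simp add: tau_def fapp sum_distrib_left mult.assoc)
lemma K_add: "v \<in> K t \<Longrightarrow> w \<in> K t \<Longrightarrow> v + w \<in> K t" by (simp add: K_def tau_add)
lemma K_cs: "v \<in> K t \<Longrightarrow> cs k v \<in> K t" by (simp add: K_def tau_cs)
lemma K_diff: "v \<in> K t \<Longrightarrow> w \<in> K t \<Longrightarrow> v - w \<in> K t"
  using K_add[of v t "cs (-1) w"] K_cs[of w t "-1"] by simp
lemma K_0: "0 \<in> K t" by (simp add: K_def tau_def fapp)
lemma K_sum: "(\<And>i. i \<in> J \<Longrightarrow> f i \<in> K t) \<Longrightarrow> (\<Sum>i\<in>J. f i) \<in> K t"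
proof (induction J rule: infinite_finite_induct)
  case (insert x F) then show ?case using K_add[of "f x" t "sum f F"] by simp
qed (simp_all add: K_0)
lemma K_pure: "cs k v \<in> K t \<Longrightarrow> k \<noteq> 0 \<Longrightarrow> v \<in> VG \<Longrightarrow> v \<in> K t" by (simp add: K_def tau_cs)

lemma K_kernel:
  assumes v: "v \<in> K t" and f: "\<And>g. g \<in> SG \<Longrightarrow> f g = F (chi t g)"
  shows "(\<Sum>g\<in>SG. v g * f g) = (0::int)"
proof -
  have "(\<Sum>g\<in>SG. v g * f g) = (\<Sum>y\<in>chi t ` SG. \<Sum>g\<in>{g \<in> SG. chi t g = y}. v g * f g)"
    by (rule sum.image_gen) simp
  also have "\<dots> = (\<Sum>y\<in>chi t ` SG. 0)"
  proof (rule sum.cong[OF refl])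
    fix y
    have "(\<Sum>g\<in>{g \<in> SG. chi t g = y}. v g * f g) = (\<Sum>g\<in>{g \<in> SG. chi t g = y}. v g * F y)"
      by (intro sum.cong refl) (auto simp: f)
    also have "\<dots> = (\<Sum>g\<in>SG. if chi t g = y then v g * F y else 0)"
      by (rule sum.inter_filter) simp
    also have "\<dots> = F y * tau t v y" unfolding tau_def sum_distrib_left by (intro sum.cong) auto
    also have "\<dots> = 0" using K_tau[OF v] by simp
    finally show "(\<Sum>g\<in>{g \<in> SG. chi t g = y}. v g * f g) = 0" .
  qed
  finally show ?thesis by simp
qed

lemma K_Dt: assumes "v \<in> K t" shows "cg (int p) (Dt t v) 0"
proof -
  have "[Dt t v b = 0] (mod int p)" for b
  proof -
    have "[Dt t v b = (\<Sum>g\<in>SG. v g * (if \<phi> g = b then t (nn g) mod int p else 0))] (mod int p)"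
      unfolding Dt_apply by (intro cong_sum cong_mult cong_refl) (simp add: cong_def)
    also have "(\<Sum>g\<in>SG. v g * (if \<phi> g = b then t (nn g) mod int p else 0)) = 0"
      by (rule K_kernel[OF assms, where F = "\<lambda>(c, j). if c = b then j else 0"]) (simp add: chi_def)
    finally show ?thesis .
  qed
  then show ?thesis by (simp add: cg_iff_cong fapp)
qed

lemma chi_left: assumes "add_char t" "n \<in> N" "h \<in> SG"
  shows "chi t (n \<otimes> h) = (fst (chi t h), (t n + snd (chi t h)) mod int p)"
proof -
  have "t (n \<otimes> nn h) mod int p = (t n + t (nn h)) mod int p"
    using add_char_mult[OF assms(1,2) nn(1)[OF assms(3)]] by (simp add: cong_def)
  then show ?thesis using nn_mult[OF assms(2,3)] by (simp add: chi_def mod_simps)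
qed

lemma chi_right: assumes "add_char t" "h \<in> SG" "c \<in> SG"
  shows "chi t (h \<otimes> c) = (fst (chi t h) \<otimes>\<^bsub>H\<^esub> \<phi> c, (snd (chi t h) + t (nn (rho (fst (chi t h)) \<otimes> c))) mod int p)"
proof -
  have r: "rho (\<phi> h) \<in> SG" "\<phi> (rho (\<phi> h)) = \<phi> h" using rho[of "\<phi> h"] assms by simp_all
  have e: "h \<otimes> c = nn h \<otimes> (rho (\<phi> h) \<otimes> c)"
    using nn[OF assms(2)] r assms N_G by (simp flip: A.m_assoc)
  have rc: "rho (\<phi> h) \<otimes> c \<in> SG" using r assms by simp
  have "chi t (h \<otimes> c) = (fst (chi t (rho (\<phi> h) \<otimes> c)), (t (nn h) + snd (chi t (rho (\<phi> h) \<otimes> c))) mod int p)"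
    unfolding e by (rule chi_left[OF assms(1) nn(1)[OF assms(2)] rc])
  then show ?thesis using r assms by (simp add: chi_def mod_simps)
qed

text \<open>The kernel of \<open>t\<close> need not be normal in \<open>G\<close>, but the class of \<open>h c\<close> under \<open>chi t\<close> depends on \<open>h\<close> only through its own class, since \<open>N\<close> stands on the left.\<close>
lemma K_right: assumes v: "v \<in> K t" and t: "add_char t" shows "A.gm v z \<in> K t"
proof -
  have "tau t (A.gm v z) y = 0" for y
  proof -
    let ?i = "\<lambda>g. if chi t g = y then 1 else (0::int)"
    have "tau t (A.gm v z) y = (\<Sum>g\<in>SG. \<Sum>h\<in>SG. v h * (z (inv h \<otimes> g) * ?i g))"
      unfolding tau_def by (intro sum.cong refl) (simp add: A.gm_apply sum_distrib_right mult.assoc)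
    also have "\<dots> = (\<Sum>h\<in>SG. v h * (\<Sum>g\<in>SG. z (inv h \<otimes> g) * ?i g))"
      by (subst sum.swap) (simp add: sum_distrib_left)
    also have "\<dots> = 0"
    proof (rule K_kernel[OF v, where F = "\<lambda>x. \<Sum>c\<in>SG. z c * (if (fst x \<otimes>\<^bsub>H\<^esub> \<phi> c, (snd x + t (nn (rho (fst x) \<otimes> c))) mod int p) = y then 1 else 0)"])
      fix h assume h: "h \<in> SG"
      have "(\<Sum>g\<in>SG. z (inv h \<otimes> g) * ?i g) = (\<Sum>c\<in>SG. z c * ?i (h \<otimes> c))"
        by (rule sum.reindex_bij_witness[where i = "\<lambda>c. h \<otimes> c" and j = "\<lambda>g. inv h \<otimes> g"])
           (use h in \<open>auto simp: A.m_assoc[symmetric]\<close>)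
      also have "\<dots> = (\<Sum>c\<in>SG. z c * (if (fst (chi t h) \<otimes>\<^bsub>H\<^esub> \<phi> c, (snd (chi t h) + t (nn (rho (fst (chi t h)) \<otimes> c))) mod int p) = y then 1 else 0))"
        by (intro sum.cong refl) (simp add: chi_right[OF t h])
      finally show "(\<Sum>g\<in>SG. z (inv h \<otimes> g) * ?i g) = \<dots>" .
    qed
    finally show ?thesis .
  qed
  then show ?thesis by (intro K_I A.gm_vecs)
qed

lemma tau_left: assumes n: "n \<in> N" shows "tau t (lm n v) y = (\<Sum>h\<in>SG. v h * (if chi t (n \<otimes> h) = y then 1 else 0))"
proof -
  have nG: "n \<in> SG" by (rule N_G[OF n])
  have "tau t (lm n v) y = (\<Sum>g\<in>SG. v (inv n \<otimes> g) * (if chi t g = y then 1 else 0))"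
    unfolding tau_def by (intro sum.cong refl) (simp add: A.gm_dl_left[OF nG])
  also have "\<dots> = (\<Sum>h\<in>SG. v h * (if chi t (n \<otimes> h) = y then 1 else 0))"
    by (rule sum.reindex_bij_witness[where i = "\<lambda>c. n \<otimes> c" and j = "\<lambda>g. inv n \<otimes> g"])
       (use nG in \<open>auto simp: A.m_assoc[symmetric]\<close>)
  finally show ?thesis .
qed

lemma K_left: assumes v: "v \<in> K t" and t: "add_char t" and n: "n \<in> N" shows "lm n v \<in> K t"
proof -
  have "tau t (lm n v) y = 0" for y
    unfolding tau_left[OF n]
    by (rule K_kernel[OF v, where F = "\<lambda>x. if (fst x, (t n + snd x) mod int p) = y then 1 else 0"])
       (simp add: chi_left[OF t n])
  then show ?thesis by (intro K_I A.gm_vecs)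
qed

lemma K_same: assumes t: "add_char t" and n: "m \<in> N" "n \<in> N" "[t m = t n] (mod int p)" and x: "x \<in> VG"
  shows "lm m x - lm n x \<in> K t"
proof -
  have e: "chi t (m \<otimes> h) = chi t (n \<otimes> h)" if "h \<in> SG" for h
    using cong_add[OF n(3) cong_refl, of "snd (chi t h)"] that by (simp add: chi_left[OF t] n cong_def)
  have "tau t (lm m x) y = tau t (lm n x) y" for y
    unfolding tau_left[OF n(1)] tau_left[OF n(2)] by (intro sum.cong refl) (simp add: e)
  then have "tau t (lm m x + cs (-1) (lm n x)) y = 0" for y unfolding tau_add tau_cs by simp
  then have "lm m x + cs (-1) (lm n x) \<in> K t" by (intro K_I vecs_add vecs_cs A.gm_vecs)
  then show ?thesis by simp
qed

text \<open>Modulo \<open>K t\<close> the augmentation ideal is generated by the single element \<open>n0 - 1\<close>.\<close>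
lemma solve_mod_K:
  assumes t: "add_char t" and n0: "n0 \<in> N" "[t n0 = 1] (mod int p)" and y: "y \<in> VG" "pr y = 0"
  shows "\<exists>v\<in>VG. y - (lm n0 v - v) \<in> K t"
proof -
  let ?r = "\<lambda>g. dl (rho (\<phi> g)) :: 'a \<Rightarrow> int"
  define j where "j g = nat (t (nn g) mod int p)" for g
  have j: "[int (j g) = t (nn g)] (mod int p)" for g using A.p_pos by (simp add: j_def cong_def)
  define s where "s g = (\<Sum>i<j g. lm (n0 [^] i) (?r g))" for g
  have n0G: "n0 \<in> SG" by (rule N_G[OF n0(1)])
  have sV: "s g \<in> VG" for g unfolding s_def by (intro vecs_sum) simp
  have rV: "?r g \<in> VG" if "g \<in> SG" for g using rho[of "\<phi> g"] that by simp
  have ts: "lm n0 (s g) - s g = lm (n0 [^] j g) (?r g) - ?r g" if g: "g \<in> SG" for g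
  proof -
    have "lm n0 (\<Sum>i<k. lm (n0 [^] i) (?r g)) - (\<Sum>i<k. lm (n0 [^] i) (?r g))
        = lm (n0 [^] k) (?r g) - ?r g" for k :: nat
    proof (induction k)
      case 0 then show ?case using rV[OF g] by (simp add: lin_0[OF lm_lin])
    next
      case (Suc k)
      let ?T = "\<Sum>i<k. lm (n0 [^] i) (?r g)"
      have "lm n0 (?T + lm (n0 [^] k) (?r g)) = lm n0 ?T + lm n0 (lm (n0 [^] k) (?r g))"
        by (rule lin_add[OF lm_lin]) (auto intro: vecs_sum)
      moreover have "lm n0 (lm (n0 [^] k) (?r g)) = lm (n0 [^] Suc k) (?r g)"
        using n0G A.nat_pow_Suc2[OF n0G, of k] by (simp add: lm_lm del: A.nat_pow_Suc)
      ultimately show ?case using Suc by (simp add: algebra_simps)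
    qed
    then show ?thesis by (simp add: s_def)
  qed
  have "lift (pr y) = 0" using y(2) lin_0[OF lift_lin] by simp
  moreover have "lift (pr y) = (\<Sum>g\<in>SG. cs (y g) (lift (pr (dl g))))"
    by (rule lin_expand[OF A.fin_carrier lin_comp[OF pr_lin lift_lin] y(1)])
  ultimately have l0: "(\<Sum>g\<in>SG. cs (y g) (?r g)) = 0" by (simp add: pr_dl lift_dl cong: sum.cong)
  have "y = (\<Sum>g\<in>SG. cs (y g) (dl g)) - (\<Sum>g\<in>SG. cs (y g) (?r g))" using vecs_expand[OF A.fin_carrier y(1)] l0 by simp
  also have "\<dots> = (\<Sum>g\<in>SG. cs (y g) (dl g - ?r g))" by (simp add: cs_diff sum_subtractf)
  finally have ye: "y = (\<Sum>g\<in>SG. cs (y g) (dl g - ?r g))" .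
  define v where "v = (\<Sum>g\<in>SG. cs (y g) (s g))"
  have vV: "v \<in> VG" unfolding v_def by (intro vecs_sum vecs_cs sV)
  have D: "lin SG SG (\<lambda>v. lm n0 v - v)" by (intro lin_minus lm_lin lin_id)
  have "lm n0 v - v = (\<Sum>g\<in>SG. cs (y g) (lm n0 (s g) - s g))"
    unfolding v_def by (subst lin_sum[OF D]) (simp_all add: sV lin_cs[OF D])
  then have "y - (lm n0 v - v) = (\<Sum>g\<in>SG. cs (y g) (dl g - ?r g)) - (\<Sum>g\<in>SG. cs (y g) (lm n0 (s g) - s g))"
    using ye by simp
  also have "\<dots> = (\<Sum>g\<in>SG. cs (y g) (lm (nn g) (?r g) - lm (n0 [^] j g) (?r g)))"
    unfolding sum_subtractf[symmetric] cs_diff[symmetric]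
  proof (intro sum.cong refl arg_cong2[where f = cs])
    fix g assume g: "g \<in> SG"
    have "lm (nn g) (?r g) = dl g" using nn[OF g] rho[of "\<phi> g"] g N_G by (simp add: lm_dl)
    then show "dl g - ?r g - (lm n0 (s g) - s g) = lm (nn g) (?r g) - lm (n0 [^] j g) (?r g)"
      unfolding ts[OF g] by simp
  qed
  also have "\<dots> \<in> K t"
  proof (intro K_sum K_cs K_same[OF t])
    fix g assume g: "g \<in> SG"
    show "nn g \<in> N" by (rule nn(1)[OF g])
    show "n0 [^] j g \<in> N" by (rule N_pow[OF n0(1)])
    show "?r g \<in> VG" by (rule rV[OF g])
    have "[t (n0 [^] j g) = int (j g) * t n0] (mod int p)" by (rule add_char_pow[OF t n0(1)])
    also have "[int (j g) * t n0 = int (j g) * 1] (mod int p)" by (intro cong_mult cong_refl n0(2))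
    also have "[int (j g) * 1 = t (nn g)] (mod int p)" using j by simp
    finally show "[t (nn g) = t (n0 [^] j g)] (mod int p)" by (rule cong_sym)
  qed
  finally show ?thesis using vV by blast
qed

text \<open>A vector invariant under a cyclic group of order \<open>p\<close> permuting the basis freely is constant along each fibre, so that its projection is divisible by \<open>p\<close>.\<close>
lemma invariant_mod_K:
  assumes t: "add_char t" and n0: "n0 \<in> N" "[t n0 = 1] (mod int p)" and f: "f \<in> VG" "lm n0 f - f \<in> K t"
  shows "cg (int p) (pr f) 0"
proof -
  have n0G: "n0 \<in> SG" by (rule N_G[OF n0(1)])
  have it: "lm (n0 [^] i) f - f \<in> K t" for i :: nat
  proof (induction i)
    case 0 then show ?case using f K_0 by simp
  next
    case (Suc i)
    have "lm n0 (lm (n0 [^] i) f - f) + (lm n0 f - f) \<in> K t"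
      by (intro K_add K_left[OF Suc t n0(1)] f(2))
    moreover have "lm n0 (lm (n0 [^] i) f - f) = lm (n0 [^] Suc i) f - lm n0 f"
      using lin_diff[OF lm_lin, of "lm (n0 [^] i) f" f n0] f n0G A.nat_pow_Suc2[OF n0G, of i]
      by (simp add: lm_lm del: A.nat_pow_Suc)
    ultimately show ?case by (simp del: A.nat_pow_Suc)
  qed
  have same: "tau t (lm (n0 [^] i) f) y = tau t f y" for i :: nat and y
  proof -
    have "tau t (lm (n0 [^] i) f) y = tau t ((lm (n0 [^] i) f - f) + f) y" by simp
    also have "\<dots> = tau t f y" unfolding tau_add using K_tau[OF it[of i]] by simp
    finally show ?thesis .
  qed
  have cnt: "(\<Sum>i<p. if (int i + a) mod int p = 0 then 1 else 0) = (1::int)" for a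
  proof -
    define i0 where "i0 = nat ((- a) mod int p)"
    have i0: "i0 < p" "int i0 = (- a) mod int p" using A.p_pos by (auto simp: i0_def nat_less_iff)
    have "(int i + a) mod int p = 0 \<longleftrightarrow> i = i0" if "i < p" for i
    proof -
      have "(int i + a) mod int p = 0 \<longleftrightarrow> int i mod int p = (- a) mod int p"
        by (simp add: mod_eq_dvd_iff dvd_eq_mod_eq_0)
      also have "\<dots> \<longleftrightarrow> i = i0" using i0 that by auto
      finally show ?thesis .
    qed
    then have "(\<Sum>i<p. if (int i + a) mod int p = 0 then 1 else 0) = (\<Sum>i<p. if i = i0 then 1 else (0::int))"
      by (intro sum.cong) auto
    then show ?thesis using i0 by simp
  qed
  have "int p dvd pr f b" if b: "b \<in> SH" for b
  proof -
    have chi: "chi t (n0 [^] i \<otimes> h) = (b, 0) \<longleftrightarrow> \<phi> h = b \<and> (int i + t (nn h)) mod int p = 0" if h: "h \<in> SG" for h and i :: nat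
    proof -
      have "[t (n0 [^] i) = int i * t n0] (mod int p)" by (rule add_char_pow[OF t n0(1)])
      also have "[int i * t n0 = int i * 1] (mod int p)" by (intro cong_mult cong_refl n0(2))
      finally have "[t (n0 [^] i) + t (nn h) = int i + t (nn h)] (mod int p)" by (intro cong_add cong_refl) simp
      then have "(t (n0 [^] i) + t (nn h)) mod int p = (int i + t (nn h)) mod int p" by (simp add: cong_def)
      then show ?thesis unfolding chi_left[OF t N_pow[OF n0(1)] h] by (simp add: chi_def mod_simps)
    qed
    have "int p * tau t f (b, 0) = (\<Sum>i<p. tau t (lm (n0 [^] i) f) (b, 0))" by (simp add: same)
    also have "\<dots> = (\<Sum>i<p. \<Sum>h\<in>SG. f h * (if \<phi> h = b \<and> (int i + t (nn h)) mod int p = 0 then 1 else 0))"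
      by (intro sum.cong refl) (simp add: tau_left[OF N_pow[OF n0(1)]] chi cong: sum.cong)
    also have "\<dots> = (\<Sum>h\<in>SG. \<Sum>i<p. f h * (if \<phi> h = b \<and> (int i + t (nn h)) mod int p = 0 then 1 else 0))"
      by (rule sum.swap)
    also have "\<dots> = (\<Sum>h\<in>SG. f h * (if \<phi> h = b then 1 else 0))"
    proof (rule sum.cong[OF refl])
      fix h
      have "(\<Sum>i<p. f h * (if \<phi> h = b \<and> (int i + t (nn h)) mod int p = 0 then 1 else 0))
         = f h * (if \<phi> h = b then (\<Sum>i<p. if (int i + t (nn h)) mod int p = 0 then 1 else 0) else 0)"
        unfolding sum_distrib_left[symmetric] by auto
      then show "(\<Sum>i<p. f h * (if \<phi> h = b \<and> (int i + t (nn h)) mod int p = 0 then 1 else 0)) = f h * (if \<phi> h = b then 1 else 0)"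
        unfolding cnt by simp
    qed
    also have "\<dots> = pr f b" by (simp add: pr_apply[OF b])
    finally show ?thesis by (metis dvd_triv_left)
  qed
  then have "int p dvd pr f b" for b by (cases "b \<in> SH") (auto simp: pr_def)
  then show ?thesis by (simp add: cg_def fapp)
qed

text \<open>Modulo \<open>K t\<close> write \<open>v\<^sub>i (z - 1) = (n0 - 1) v\<^bsub>i+1\<^esub>\<close>, starting from the lift of \<open>w\<close>; then \<open>v\<^sub>i\<close> projects to \<open>A\<^sup>i w\<close>. Expanding \<open>z\<^sup>p = 1\<close> and
\<open>n0\<^sup>p = 1\<close> by the binomial theorem and subtracting gives \<open>p (n0 - 1) f \<in> K t\<close> for some \<open>f\<close> whose projection is \<open>A w - A\<^sup>p w\<close>. Purity removes the factor \<open>p\<close>.\<close>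
lemma At_pow_nontrivial:
  assumes t: "add_char t" and n0: "n0 \<in> N" "[t n0 = 1] (mod int p)"
    and z: "z \<in> VG" "pr z = dl \<one>\<^bsub>H\<^esub>" "A.gpow z p = dl \<one>" and w: "w \<in> VH"
  shows "cg (int p) ((At z t ^^ p) w) (At z t w)"
proof -
  have n0G: "n0 \<in> SG" by (rule N_G[OF n0(1)])
  let ?R = "\<lambda>v. A.gm v z"
  define W where "W v = A.gm v z - v" for v
  define D where "D v = lm n0 v - v" for v
  have R: "lin SG SG ?R" by (rule A.lin_right)
  have W: "lin SG SG W" unfolding W_def by (intro lin_minus R lin_id)
  have D: "lin SG SG D" unfolding D_def by (intro lin_minus lm_lin lin_id)
  have lW: "lin SG SG (W ^^ i)" and lD: "lin SG SG (D ^^ i)" for i by (rule lin_funpow[OF W] lin_funpow[OF D])+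
  have WD: "W (D v) = D (W v)" if "v \<in> VG" for v
    unfolding W_def D_def
    using lin_diff[OF R, of "lm n0 v" v] lin_diff[OF lm_lin, of "A.gm v z" v n0] that by (simp add: A.gm_assoc)
  have KW: "W k \<in> K t" if "k \<in> K t" for k unfolding W_def by (intro K_diff K_right that t)
  have KD: "D k \<in> K t" if "k \<in> K t" for k unfolding D_def by (intro K_diff K_left that t n0)
  have KDi: "(D ^^ i) k \<in> K t" if "k \<in> K t" for k i by (induction i) (use that KD in auto)
  have prW: "pr (W v) = 0" if "v \<in> VG" for v
    unfolding W_def using lin_diff[OF pr_lin, of "A.gm v z" v] pr_gm[OF that z(1)] z(2) pr_VH[OF that] that by simp
  have prD: "pr (D v) = 0" if "v \<in> VG" for v
    unfolding D_def using lin_diff[OF pr_lin, of "lm n0 v" v] pr_lm[OF n0(1) that] that by simp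
  have "\<forall>v\<in>VG. \<exists>v'. v' \<in> VG \<and> W v - D v' \<in> K t"
    using solve_mod_K[OF t n0 lin_vecs[OF W] prW] by (auto simp: D_def)
  then obtain nx where nx: "\<And>v. v \<in> VG \<Longrightarrow> nx v \<in> VG" "\<And>v. v \<in> VG \<Longrightarrow> W v - D (nx v) \<in> K t" by metis
  define v where "v i = (nx ^^ i) (lift w)" for i
  have vV: "v i \<in> VG" for i unfolding v_def by (induction i) (use nx lin_vecs[OF lift_lin w] in auto)
  have vK: "W (v i) - D (v (Suc i)) \<in> K t" for i using nx(2)[OF vV[of i]] by (simp add: v_def)
  have prv: "cg (int p) (pr (v i)) ((At z t ^^ i) w)" for i
  proof (induction i)
    case 0 then show ?case using pr_lift[OF w] by (simp add: v_def)
  next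
    case (Suc i)
    have "Dt t (W (v i)) = Dt t (W (v i) - D (v (Suc i))) + Dt t (D (v (Suc i)))"
      using lin_diff[OF Dt_lin lin_vecs[OF W vV] lin_vecs[OF D vV], of t i "Suc i"] by simp
    moreover have "cg (int p) (Dt t (W (v i) - D (v (Suc i)))) 0" by (rule K_Dt[OF vK])
    moreover have "cg (int p) (Dt t (D (v (Suc i)))) (cs (t n0) (pr (v (Suc i))))"
      unfolding D_def by (rule Dt_step[OF t n0(1) vV])
    moreover have "cg (int p) (cs (t n0) (pr (v (Suc i)))) (cs 1 (pr (v (Suc i))))" by (rule cg_cs_coeff[OF n0(2)])
    ultimately have "cg (int p) (Dt t (W (v i))) (0 + cs 1 (pr (v (Suc i))))"
      by (simp only:) (intro cg_add, assumption, rule cg_trans)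
    then have 1: "cg (int p) (pr (v (Suc i))) (Dt t (W (v i)))" by (simp add: cg_sym)
    have "cg (int p) (Dt t (W (v i))) (At z t (pr (v i)))" unfolding W_def by (rule At_pr[OF z(1,2) t vV])
    from cg_trans[OF 1 this] have "cg (int p) (pr (v (Suc i))) (At z t (pr (v i)))" .
    also have "cg (int p) \<dots> (At z t ((At z t ^^ i) w))"
      by (rule lin_cg[OF At_lin pr_VH[OF vV] lin_vecs[OF lin_funpow[OF At_lin] w] Suc])
    finally show ?case by simp
  qed
  have chain: "(W ^^ i) (v 0) - (D ^^ i) (v i) \<in> K t" for i
  proof (induction i)
    case 0 then show ?case using K_0 by simp
  next
    case (Suc i)
    have 1: "W ((W ^^ i) (v 0) - (D ^^ i) (v i)) \<in> K t" by (rule KW[OF Suc])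
    have "W ((W ^^ i) (v 0) - (D ^^ i) (v i)) = (W ^^ Suc i) (v 0) - W ((D ^^ i) (v i))"
      using lin_diff[OF W lin_vecs[OF lW vV] lin_vecs[OF lD vV]] by simp
    moreover have "W ((D ^^ i) (v i)) = (D ^^ i) (W (v i))"
      by (rule funpow_lin_commute[OF D W _ vV, symmetric]) (simp add: WD)
    ultimately have 2: "(W ^^ Suc i) (v 0) - (D ^^ i) (W (v i)) \<in> K t" using 1 by simp
    have "(D ^^ i) (W (v i) - D (v (Suc i))) \<in> K t" by (rule KDi[OF vK])
    moreover have "(D ^^ i) (W (v i) - D (v (Suc i))) = (D ^^ i) (W (v i)) - (D ^^ Suc i) (v (Suc i))"
      using lin_diff[OF lD lin_vecs[OF W vV] lin_vecs[OF D vV]] by (simp add: funpow_swap1)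
    ultimately have 3: "(D ^^ i) (W (v i)) - (D ^^ Suc i) (v (Suc i)) \<in> K t" by simp
    from K_add[OF 2 3] show ?case by (simp only: add_diff_eq diff_add_cancel)
  qed
  define c where "c i = int (p choose i)" for i
  have sW: "(\<Sum>i\<in>{1..p}. cs (c i) ((W ^^ i) (v 0))) = 0"
  proof -
    have "v 0 = (?R ^^ p) (v 0)" using A.right_funpow[OF z(1) vV, of p 0] z(3) vV[of 0] by simp
    also have "\<dots> = (\<Sum>i\<le>p. cs (int (p choose i) * 1 ^ (p - i)) ((W ^^ i) (v 0)))"
      by (rule binom_op[OF R _ vV]) (simp add: W_def)
    also have "\<dots> = (\<Sum>i\<in>insert 0 {1..p}. cs (c i) ((W ^^ i) (v 0)))"
      by (intro sum.cong) (auto simp: c_def)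
    also have "\<dots> = v 0 + (\<Sum>i\<in>{1..p}. cs (c i) ((W ^^ i) (v 0)))" by (simp add: c_def)
    finally show ?thesis by simp
  qed
  have sD: "(\<Sum>i\<in>{1..p}. cs (c i) ((D ^^ i) (v p))) = 0"
  proof -
    have "v p = (lm n0 ^^ p) (v p)" using lm_funpow[OF n0G vV, of p p] Nexp[OF n0(1)] vV[of p] by simp
    also have "\<dots> = (\<Sum>i\<le>p. cs (int (p choose i) * 1 ^ (p - i)) ((D ^^ i) (v p)))"
      by (rule binom_op[OF lm_lin _ vV]) (simp add: D_def)
    also have "\<dots> = (\<Sum>i\<in>insert 0 {1..p}. cs (c i) ((D ^^ i) (v p)))"
      by (intro sum.cong) (auto simp: c_def)
    also have "\<dots> = v p + (\<Sum>i\<in>{1..p}. cs (c i) ((D ^^ i) (v p)))" by (simp add: c_def)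
    finally show ?thesis by simp
  qed
  \<comment> \<open>\<open>v p\<close> is the common reference vector for which both binomial expansions can be subtracted\<close>
  define u where "u i = v i - v p" for i
  have uV: "u i \<in> VG" for i unfolding u_def by (intro vecs_diff vV)
  have "(\<Sum>i\<in>{1..p}. cs (c i) ((W ^^ i) (v 0) - (D ^^ i) (v i))) \<in> K t" by (intro K_sum K_cs chain)
  moreover have "(\<Sum>i\<in>{1..p}. cs (c i) ((W ^^ i) (v 0) - (D ^^ i) (v i)))
      = - (\<Sum>i\<in>{1..p}. cs (c i) ((D ^^ i) (u i)))"
  proof -
    have "(D ^^ i) (u i) = (D ^^ i) (v i) - (D ^^ i) (v p)" for i
      unfolding u_def by (rule lin_diff[OF lD vV vV])
    then show ?thesis using sW sD by (simp add: cs_diff sum_subtractf)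
  qed
  ultimately have "- (\<Sum>i\<in>{1..p}. cs (c i) ((D ^^ i) (u i))) \<in> K t" by simp
  then have m1: "(\<Sum>i\<in>{1..p}. cs (c i) ((D ^^ i) (u i))) \<in> K t"
    using K_cs[of "- (\<Sum>i\<in>{1..p}. cs (c i) ((D ^^ i) (u i)))" t "-1"] by simp
  define e where "e i = c i div int p" for i
  have ce: "c i = int p * e i" if "i \<in> {1..<p}" for i
  proof -
    have "p dvd (p choose i)" using prime_dvd_choose_prime_power[OF A.prime, of i 1] that by simp
    then show ?thesis by (simp add: e_def c_def)
  qed
  define f where "f = (\<Sum>i\<in>{1..<p}. cs (e i) ((D ^^ (i - 1)) (u i)))"
  have fV: "f \<in> VG" unfolding f_def by (intro vecs_sum vecs_cs lin_vecs[OF lD] uV)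
  have "(\<Sum>i\<in>{1..p}. cs (c i) ((D ^^ i) (u i))) = (\<Sum>i\<in>insert p {1..<p}. cs (c i) ((D ^^ i) (u i)))"
    using A.p_gt_1 by (intro sum.cong) auto
  also have "\<dots> = (\<Sum>i\<in>{1..<p}. cs (c i) ((D ^^ i) (u i)))"
    by (simp add: u_def lin_0[OF lD])
  also have "\<dots> = cs (int p) (\<Sum>i\<in>{1..<p}. cs (e i) ((D ^^ i) (u i)))"
    unfolding cs_sum by (intro sum.cong refl) (simp add: ce)
  also have "(\<Sum>i\<in>{1..<p}. cs (e i) ((D ^^ i) (u i))) = D f"
  proof -
    have "D f = (\<Sum>i\<in>{1..<p}. cs (e i) (D ((D ^^ (i - 1)) (u i))))"
      unfolding f_def lin_sum[OF D vecs_cs[OF lin_vecs[OF lD uV]]] by (simp only: lin_cs[OF D lin_vecs[OF lD uV]])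
    also have "\<dots> = (\<Sum>i\<in>{1..<p}. cs (e i) ((D ^^ i) (u i)))"
    proof (intro sum.cong refl)
      fix i assume "i \<in> {1..<p}"
      then obtain k where "i = Suc k" by (cases i) auto
      then show "cs (e i) (D ((D ^^ (i - 1)) (u i))) = cs (e i) ((D ^^ i) (u i))" by simp
    qed
    finally show ?thesis by simp
  qed
  finally have "cs (int p) (D f) \<in> K t" using m1 by simp
  then have "D f \<in> K t" by (rule K_pure) (use A.p_gt_1 lin_vecs[OF D fV] in auto)
  then have p0: "cg (int p) (pr f) 0" unfolding D_def by (rule invariant_mod_K[OF t n0 fV])
  have "pr f = (\<Sum>i\<in>{1..<p}. cs (e i) (pr ((D ^^ (i - 1)) (u i))))"
    unfolding f_def lin_sum[OF pr_lin vecs_cs[OF lin_vecs[OF lD uV]]] by (simp only: lin_cs[OF pr_lin lin_vecs[OF lD uV]])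
  also have "\<dots> = (\<Sum>i\<in>{1..<p}. if i = 1 then pr (u 1) else 0)"
  proof (intro sum.cong refl)
    fix i assume i: "i \<in> {1..<p}"
    show "cs (e i) (pr ((D ^^ (i - 1)) (u i))) = (if i = 1 then pr (u 1) else 0)"
    proof (cases "i = 1")
      case True
      then show ?thesis using A.p_gt_1 by (simp add: e_def c_def)
    next
      case False
      then obtain k where "i = Suc (Suc k)" using i by (cases i; cases "i - 1") auto
      then show ?thesis using prD[OF lin_vecs[OF lD uV]] by simp
    qed
  qed
  also have "\<dots> = pr (u 1)" using A.p_gt_1 by simp
  also have "\<dots> = pr (v 1) - pr (v p)" unfolding u_def by (rule lin_diff[OF pr_lin vV vV])
  finally have e1: "cg (int p) (pr (v 1)) (pr (v p))" using p0 by (simp add: cg_def fapp)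
  have "cg (int p) ((At z t ^^ p) w) (pr (v p))" by (rule cg_sym[OF prv])
  also have "cg (int p) \<dots> (pr (v 1))" by (rule cg_sym[OF e1])
  also have "cg (int p) \<dots> ((At z t ^^ 1) w)" by (rule prv)
  finally show ?thesis by simp
qed

text \<open>A nonzero character takes the value one after passing to a power; for the zero character both sides vanish.\<close>
lemma At_pow:
  assumes t: "add_char t" and z: "z \<in> VG" "pr z = dl \<one>\<^bsub>H\<^esub>" "A.gpow z p = dl \<one>" and w: "w \<in> VH"
  shows "cg (int p) ((At z t ^^ p) w) (At z t w)"
proof (cases "\<exists>n\<in>N. \<not> int p dvd t n")
  case True
  then obtain n where n: "n \<in> N" "\<not> int p dvd t n" by blast
  have "coprime (int p) (t n)" by (rule prime_imp_coprime) (use n A.prime in auto)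
  then have "coprime (t n) (int p)" by (simp only: coprime_commute)
  from cong_solve_coprime_int[OF this] obtain a where a: "[t n * a = 1] (mod int p)" by blast
  define k where "k = nat (a mod int p)"
  have k: "[int k = a] (mod int p)" using A.p_pos by (simp add: k_def cong_def)
  have "[t (n [^] k) = int k * t n] (mod int p)" by (rule add_char_pow[OF t n(1)])
  also have "[int k * t n = a * t n] (mod int p)" by (intro cong_mult k cong_refl)
  also have "a * t n = t n * a" by simp
  also note a
  finally show ?thesis by (rule At_pow_nontrivial[OF t N_pow[OF n(1)] _ z w])
next
  case False
  have "cg (int p) (At z t w) 0" if "w \<in> VH" for w
  proof -
    have "cg (int p) (Dt t y) (\<Sum>g\<in>SG. 0)" for y
      unfolding Dt_def by (intro cg_sum) (use False nn(1) in \<open>auto simp: cg_def fapp\<close>)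
    then show ?thesis by (simp add: At_def)
  qed
  note z0 = this
  obtain q where q: "p = Suc q" using A.p_gt_1 by (cases p) auto
  have "cg (int p) ((At z t ^^ p) w) 0"
    using z0[OF lin_vecs[OF lin_funpow[OF At_lin] w]] by (simp add: q)
  from cg_trans[OF this cg_sym[OF z0[OF w]]] show ?thesis .
qed

lemma At_plus: "At z (\<lambda>n. t n + s * t' n) w = At z t w + cs s (At z t' w)"
  unfolding At_def Dt_def cs_sum sum.distrib[symmetric]
  by (intro sum.cong refl) (simp add: distrib_left cs_add_left mult.left_commute)

text \<open>Since \<open>At z t\<close> depends linearly on \<open>t\<close>, the relation \<open>A\<^sup>p = A\<close> holds on all combinations, as \<open>commute_eigen\<close> requires.\<close>
lemma At_eigen:
  assumes t: "add_char t" "add_char t'" and z: "z \<in> VG" "pr z = dl \<one>\<^bsub>H\<^esub>" "A.gpow z p = dl \<one>"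
    and w: "w \<in> VH" "cg (int p) (At z t w) (cs k w)"
  shows "cg (int p) (At z t (At z t' w)) (cs k (At z t' w))"
proof (rule B.commute_eigen[OF At_lin At_lin _ _ w])
  show "cg (int p) ((At z t' ^^ p) v) (At z t' v)" if "v \<in> VH" for v by (rule At_pow[OF t(2) z that])
  fix s v assume "s < p" "v \<in> VH"
  have add_char: "add_char (\<lambda>n. t n + int s * t' n)"
    unfolding add_char_def
  proof (intro ballI)
    fix m n assume mn: "m \<in> N" "n \<in> N"
    have "[t (m \<otimes> n) + int s * t' (m \<otimes> n) = (t m + t n) + int s * (t' m + t' n)] (mod int p)"
      by (intro cong_add cong_mult cong_refl add_char_mult t mn)
    then show "[t (m \<otimes> n) + int s * t' (m \<otimes> n) = t m + int s * t' m + (t n + int s * t' n)] (mod int p)"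
      by (simp add: algebra_simps)
  qed
  have "(\<lambda>v. At z t v + cs (int s) (At z t' v)) = At z (\<lambda>n. t n + int s * t' n)"
    by (rule ext) (simp add: At_plus)
  then show "cg (int p) (((\<lambda>v. At z t v + cs (int s) (At z t' v)) ^^ p) v) (At z t v + cs (int s) (At z t' v))"
    using At_pow[OF add_char z \<open>v \<in> VH\<close>] by (simp add: At_plus)
qed

end

section \<open>Coordinates on the kernel and an adapted basis\<close>

context elem_ext
begin

lemma N_pow_p: assumes "n \<in> N" "p dvd k" shows "n [^] k = \<one>"
proof -
  obtain c where c: "k = p * c" using assms(2) by (auto simp: dvd_def)
  have "n [^] k = (n [^] p) [^] c" unfolding c using N_G[OF assms(1)] by (simp add: A.nat_pow_pow)
  then show ?thesis using Nexp[OF assms(1)] by simp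
qed
lemma N_pow_mod: assumes "n \<in> N" shows "n [^] (k::nat) = n [^] (k mod p)"
proof -
  have "n [^] k = n [^] (p * (k div p) + k mod p)" by simp
  also have "\<dots> = n [^] (p * (k div p)) \<otimes> n [^] (k mod p)"
    by (rule A.nat_pow_mult[OF N_G[OF assms], symmetric])
  finally show ?thesis using N_pow_p[OF assms] N_G[OF assms] by simp
qed
lemma N_pow_cong: "n \<in> N \<Longrightarrow> [k = l] (mod p) \<Longrightarrow> n [^] k = n [^] (l::nat)"
  using N_pow_mod[of n k] N_pow_mod[of n l] by (simp add: cong_def)
lemma N_pow_root: assumes n: "n \<in> N" and k: "\<not> p dvd k" shows "\<exists>l. (n [^] k) [^] (l::nat) = n"
proof -
  have "coprime p k" by (rule prime_imp_coprime[OF A.prime k])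
  then have "coprime k p" by (simp only: coprime_commute)
  from cong_solve_coprime_nat[OF this] obtain l where l: "[k * l = 1] (mod p)" by auto
  have "(n [^] k) [^] l = n [^] (k * l)" using N_G[OF n] by (simp add: A.nat_pow_pow)
  also have "\<dots> = n [^] (1::nat)" by (rule N_pow_cong[OF n l])
  also have "\<dots> = n" using N_G[OF n] by simp
  finally show ?thesis by blast
qed

primrec bprod :: "nat \<Rightarrow> (nat \<Rightarrow> 'a) \<Rightarrow> (nat \<Rightarrow> nat) \<Rightarrow> 'a" where
  "bprod 0 b k = \<one>"
| "bprod (Suc r) b k = bprod r b k \<otimes> b r [^] k r"

lemma bprod_N: "(\<And>i. i < r \<Longrightarrow> b i \<in> N) \<Longrightarrow> bprod r b k \<in> N"
  by (induction r) (simp_all add: N_one N_mult N_pow)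
lemma bprod_cong: "(\<And>i. i < r \<Longrightarrow> b i = b' i) \<Longrightarrow> (\<And>i. i < r \<Longrightarrow> k i = k' i) \<Longrightarrow> bprod r b k = bprod r b' k'"
  by (induction r) simp_all
lemma bprod_one: "(\<And>i. i < r \<Longrightarrow> b i \<in> N) \<Longrightarrow> (\<And>i. i < r \<Longrightarrow> p dvd k i) \<Longrightarrow> bprod r b k = \<one>"
  by (induction r) (simp_all add: N_pow_p)
lemma bprod_add: "(\<And>i. i < r \<Longrightarrow> b i \<in> N) \<Longrightarrow> bprod r b (\<lambda>i. k i + l i) = bprod r b k \<otimes> bprod r b l"
proof (induction r)
  case (Suc r)
  let ?x = "b r"
  have P: "bprod r b k \<in> SG" "bprod r b l \<in> SG" and PN: "bprod r b l \<in> N" using bprod_N[of r b] Suc.prems N_G by simp_all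
  have x: "?x \<in> N" "?x \<in> SG" using Suc.prems N_G by simp_all
  have "bprod r b l \<otimes> ?x [^] k r = ?x [^] k r \<otimes> bprod r b l" by (rule Ncomm[OF PN N_pow[OF x(1)]])
  then have "bprod r b l \<otimes> (?x [^] k r \<otimes> ?x [^] l r) = ?x [^] k r \<otimes> (bprod r b l \<otimes> ?x [^] l r)"
    using P x by (simp flip: A.m_assoc)
  then show ?case using Suc P x by (simp add: A.m_assoc A.nat_pow_mult[symmetric])
qed simp
lemma bprod_mult: "(\<And>i. i < r \<Longrightarrow> b i \<in> N) \<Longrightarrow> bprod r b (\<lambda>i. c * k i) = bprod r b k [^] (c::nat)"
proof (induction c)
  case 0 then show ?case using bprod_one[of r b "\<lambda>i. 0"] by simp
next
  case (Suc c)
  have "bprod r b (\<lambda>i. Suc c * k i) = bprod r b (\<lambda>i. c * k i + k i)" by (rule bprod_cong) simp_all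
  also have "\<dots> = bprod r b (\<lambda>i. c * k i) \<otimes> bprod r b k" by (rule bprod_add) (rule Suc.prems)
  finally show ?case using Suc by simp
qed
lemma bprod_single: "(\<And>i. i < r \<Longrightarrow> b i \<in> N) \<Longrightarrow> i < r \<Longrightarrow> bprod r b (\<lambda>j. if j = i then 1 else 0) = b i"
proof (induction r)
  case (Suc r)
  show ?case
  proof (cases "i = r")
    case True
    have "bprod r b (\<lambda>j. if j = i then 1 else 0) = \<one>" by (rule bprod_one) (use Suc.prems True in auto)
    then show ?thesis using True Suc.prems(1)[of r] N_G by simp
  next
    case False
    then show ?thesis using Suc N_G by simp
  qed
qed simp

definition indep :: "nat \<Rightarrow> (nat \<Rightarrow> 'a) \<Rightarrow> bool" where
  "indep r b \<longleftrightarrow> (\<forall>i<r. b i \<in> N) \<and> (\<forall>k. bprod r b k = \<one> \<longrightarrow> (\<forall>i<r. p dvd k i))"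

lemma indep_N: "indep r b \<Longrightarrow> i < r \<Longrightarrow> b i \<in> N" by (simp add: indep_def)
lemma indep_dvd: "indep r b \<Longrightarrow> bprod r b k = \<one> \<Longrightarrow> i < r \<Longrightarrow> p dvd k i" by (simp add: indep_def)

text \<open>Division is avoided by multiplying with the power \<open>p - 1\<close> instead of inverting.\<close>
lemma indep_eq: assumes "indep r b" "bprod r b k = bprod r b l" "i < r" shows "[int (k i) = int (l i)] (mod int p)"
proof -
  note bN = indep_N[OF assms(1)]
  obtain q where q: "p = Suc q" using A.p_gt_1 by (cases p) auto
  have "bprod r b (\<lambda>i. k i + q * l i) = bprod r b k \<otimes> bprod r b (\<lambda>i. q * l i)" by (rule bprod_add[OF bN])
  also have "\<dots> = bprod r b l \<otimes> bprod r b (\<lambda>i. q * l i)" by (simp only: assms(2))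
  also have "\<dots> = bprod r b (\<lambda>i. l i + q * l i)" by (rule bprod_add[OF bN, symmetric])
  also have "\<dots> = \<one>" 
  proof (rule bprod_one[OF bN])
    fix j
    have "l j + q * l j = p * l j" by (simp add: q)
    then show "p dvd l j + q * l j" by simp
  qed
  finally have "p dvd k i + q * l i" by (rule indep_dvd[OF assms(1) _ assms(3)])
  then have "int p dvd int (k i + q * l i)" by (simp only: int_dvd_int_iff)
  then have "int p dvd int (k i + q * l i) - int p * int (l i)" by (rule dvd_diff) simp
  moreover have "int (k i + q * l i) - int p * int (l i) = int (k i) - int (l i)" by (simp add: q algebra_simps)
  ultimately show ?thesis by (simp only: cong_iff_dvd_diff)
qed

text \<open>If \<open>x\<^sup>e\<close> with \<open>e\<close> prime to \<open>p\<close> were a product of powers of the \<open>b i\<close>, so would be \<open>x\<close>.\<close>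
lemma indep_extend:
  assumes i: "indep r b" and x: "x \<in> N" "\<And>k. bprod r b k \<noteq> x"
  shows "indep (Suc r) (b(r := x))"
proof -
  let ?b = "b(r := x)"
  note bN = indep_N[OF i]
  have bN': "?b j \<in> N" if "j < Suc r" for j using that bN x by auto
  have P: "bprod r ?b k = bprod r b k" for k by (rule bprod_cong) simp_all
  have "p dvd k j" if h: "bprod (Suc r) ?b k = \<one>" and j: "j < Suc r" for k j
  proof -
    have h': "bprod r b k \<otimes> x [^] k r = \<one>" using h by (simp add: P)
    have PG: "bprod r b k \<in> SG" "x \<in> SG" using bprod_N[of r b k] bN N_G x by auto
    have kr: "p dvd k r"
    proof (rule ccontr)
      assume nd: "\<not> p dvd k r"
      obtain l where l: "(x [^] k r) [^] (l::nat) = x" using N_pow_root[OF x(1) nd] by blast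
      have "x [^] k r = inv (bprod r b k)" using h' PG by (metis A.inv_equality A.inv_inv A.nat_pow_closed)
      moreover have "inv (bprod r b k) = bprod r b (\<lambda>i. (p - 1) * k i)"
      proof (rule A.inv_equality)
        have "bprod r b (\<lambda>i. (p - 1) * k i) \<otimes> bprod r b k = bprod r b (\<lambda>i. (p - 1) * k i + k i)" by (rule bprod_add[OF bN, symmetric])
        also have "\<dots> = \<one>"
        proof (rule bprod_one[OF bN])
          fix i
          have "(p - 1) * k i + k i = p * k i" using A.p_gt_1 by (cases p) auto
          then show "p dvd (p - 1) * k i + k i" by simp
        qed
        finally show "bprod r b (\<lambda>i. (p - 1) * k i) \<otimes> bprod r b k = \<one>" .
      qed (use PG bprod_N[of r b] bN N_G in auto)
      ultimately have "bprod r b (\<lambda>i. l * ((p - 1) * k i)) = x" using l bprod_mult[where r = r and b = b and c = l and k = "\<lambda>i. (p - 1) * k i", OF bN] by simp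
      then show False using x(2) by blast
    qed
    then have "x [^] k r = \<one>" by (rule N_pow_p[OF x(1)])
    then have "bprod r b k = \<one>" using h' PG by simp
    then show ?thesis using indep_dvd[OF i] kr j by (cases "j = r") auto
  qed
  with bN' show ?thesis unfolding indep_def by blast
qed

definition is_coord :: "nat \<Rightarrow> (nat \<Rightarrow> 'a) \<Rightarrow> (nat \<Rightarrow> 'a \<Rightarrow> int) \<Rightarrow> bool" where
  "is_coord r b t \<longleftrightarrow> (\<forall>i<r. b i \<in> N) \<and> (\<forall>i<r. add_char (t i)) \<and> (\<forall>k. \<exists>n\<in>N. \<forall>i<r. [t i n = int (k i)] (mod int p))
     \<and> (\<forall>n\<in>N. n = bprod r b (\<lambda>i. nat (t i n))) \<and> (\<forall>i n. 0 \<le> t i n)"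

text \<open>A maximal independent family of elements of \<open>N\<close> is a basis; its coordinate functions are the characters \<open>t i\<close>.\<close>
lemma coordinates: "\<exists>r b t. is_coord r b t"
proof -
  have bound: "r \<le> card N" if i: "indep r b" for r b
  proof -
    have "inj_on b {..<r}"
    proof (rule inj_onI, rule ccontr)
      fix j l assume h: "j \<in> {..<r}" "l \<in> {..<r}" "b j = b l" "j \<noteq> l"
      have "bprod r b (\<lambda>m. if m = j then 1 else 0) = bprod r b (\<lambda>m. if m = l then 1 else 0)"
        using bprod_single[OF indep_N[OF i]] h by simp
      from indep_eq[OF i this, of j] h have "[1 = 0] (mod int p)" by simp
      then show False using A.p_gt_1 by (simp add: cong_def)
    qed
    then have "card (b ` {..<r}) = r" by (simp add: card_image)
    moreover have "card (b ` {..<r}) \<le> card N" using indep_N[OF i] by (intro card_mono finN) auto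
    ultimately show ?thesis by simp
  qed
  have "indep 0 (\<lambda>_. \<one>)" by (simp add: indep_def)
  then have "\<exists>x. (\<lambda>(r, b). indep r b) x \<and> (\<forall>y. (\<lambda>(r, b). indep r b) y \<longrightarrow> fst y \<le> fst x)"
    by (intro ex_has_greatest_nat[where k = "(0, \<lambda>_. \<one>)" and b = "Suc (card N)"]) (auto dest!: bound)
  then obtain r b where i: "indep r b" and mx: "\<And>r' b'. indep r' b' \<Longrightarrow> r' \<le> r" by auto
  note bN = indep_N[OF i]
  have ex: "\<exists>k. bprod r b k = n" if "n \<in> N" for n
  proof (rule ccontr)
    assume "\<nexists>k. bprod r b k = n"
    then have "indep (Suc r) (b(r := n))" by (intro indep_extend[OF i that]) blast
    from mx[OF this] show False by simp
  qed
  define \<kappa> where "\<kappa> n = (SOME k. bprod r b k = n)" for n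
  have \<kappa>: "bprod r b (\<kappa> n) = n" if "n \<in> N" for n unfolding \<kappa>_def by (rule someI_ex[OF ex[OF that]])
  define t where "t i n = int (\<kappa> n i)" for i n
  have "add_char (t i)" if "i < r" for i
    unfolding add_char_def
  proof (intro ballI)
    fix m n assume mn: "m \<in> N" "n \<in> N"
    have "bprod r b (\<kappa> (m \<otimes> n)) = bprod r b (\<lambda>i. \<kappa> m i + \<kappa> n i)"
      using \<kappa>[OF mn(1)] \<kappa>[OF mn(2)] \<kappa>[OF N_mult[OF mn]] bprod_add[where k = "\<kappa> m" and l = "\<kappa> n", OF bN] by simp
    from indep_eq[OF i this that] show "[t i (m \<otimes> n) = t i m + t i n] (mod int p)" by (simp add: t_def)
  qed
  moreover have "\<exists>n\<in>N. \<forall>i<r. [t i n = int (k i)] (mod int p)" for k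
  proof (intro bexI[of _ "bprod r b k"] allI impI)
    show "bprod r b k \<in> N" by (rule bprod_N[OF bN])
    fix j assume "j < r"
    show "[t j (bprod r b k) = int (k j)] (mod int p)"
      unfolding t_def by (rule indep_eq[OF i \<kappa>[OF bprod_N[OF bN]] \<open>j < r\<close>])
  qed
  moreover have "n = bprod r b (\<lambda>i. nat (t i n))" if "n \<in> N" for n using \<kappa>[OF that] by (simp add: t_def)
  moreover have "0 \<le> t i n" for i n by (simp add: t_def)
  ultimately show ?thesis using bN unfolding is_coord_def by (intro exI[of _ r] exI[of _ b] exI[of _ t]) blast
qed

text \<open>The identity \<open>mn - 1 = (m - 1) + (n - 1) + (m - 1)(n - 1)\<close>.\<close>
lemma lm_mult_I2: assumes m: "m \<in> N" and n: "n \<in> N" and v: "v \<in> I j"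
  shows "lm (m \<otimes> n) v - v - ((lm m v - v) + (lm n v - v)) \<in> I (Suc (Suc j))"
proof -
  have vV: "v \<in> VG" by (rule I_V[OF v])
  have "lm (m \<otimes> n) v - v - ((lm m v - v) + (lm n v - v)) = lm m (lm n v - v) - (lm n v - v)"
    using lin_diff[OF lm_lin, of "lm n v" v m] vV by (simp add: lm_lm N_G[OF m] N_G[OF n] algebra_simps)
  also have "\<dots> \<in> I (Suc (Suc j))" by (rule I_step[OF m I_step[OF n v]])
  finally show ?thesis .
qed
lemma lm_pow_I2: assumes n: "n \<in> N" and v: "v \<in> I j"
  shows "lm (n [^] k) v - v - cs (int k) (lm n v - v) \<in> I (Suc (Suc j))"
proof (induction k)
  case 0
  have "lm (n [^] (0::nat)) v - v - cs (int 0) (lm n v - v) = 0" using I_V[OF v] by simp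
  then show ?case using A.subm_0[OF I_subm] by (simp only:)
next
  case (Suc k)
  have "lm (n [^] Suc k) v - v - cs (int (Suc k)) (lm n v - v)
     = (lm (n [^] k \<otimes> n) v - v - ((lm (n [^] k) v - v) + (lm n v - v)))
      + (lm (n [^] k) v - v - cs (int k) (lm n v - v))"
    by (simp add: cs_add_left)
  also have "\<dots> \<in> I (Suc (Suc j))" by (rule A.subm_add[OF I_subm lm_mult_I2[OF N_pow[OF n] n v] Suc])
  finally show ?case .
qed
lemma lm_bprod_I2: assumes b: "\<And>i. i < r \<Longrightarrow> b i \<in> N" and v: "v \<in> I j"
  shows "lm (bprod r b k) v - v - (\<Sum>i<r. cs (int (k i)) (lm (b i) v - v)) \<in> I (Suc (Suc j))"
  using b
proof (induction r)
  case 0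
  have "lm (bprod 0 b k) v - v - (\<Sum>i<0. cs (int (k i)) (lm (b i) v - v)) = 0" using I_V[OF v] by simp
  then show ?case using A.subm_0[OF I_subm] by (simp only:)
next
  case (Suc r)
  let ?P = "bprod r b k" and ?x = "b r [^] k r" and ?s = "\<Sum>i<r. cs (int (k i)) (lm (b i) v - v)"
  have bN: "b i \<in> N" if "i < r" for i using Suc.prems[of i] that by simp
  have br: "b r \<in> N" using Suc.prems[of r] by simp
  have "lm (bprod (Suc r) b k) v - v - (\<Sum>i<Suc r. cs (int (k i)) (lm (b i) v - v))
     = (lm (?P \<otimes> ?x) v - v - ((lm ?P v - v) + (lm ?x v - v)))
      + ((lm ?P v - v - ?s) + (lm ?x v - v - cs (int (k r)) (lm (b r) v - v)))"
    by simp
  also have "\<dots> \<in> I (Suc (Suc j))"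
    by (intro A.subm_add[OF I_subm] lm_mult_I2 lm_pow_I2 bprod_N N_pow bN br v Suc.IH)
  finally show ?case .
qed

text \<open>Modulo \<open>I 2\<close> an element of \<open>I 1\<close> is \<open>\<Sum>i. (b\<^sub>i - 1) x\<^sub>i\<close>, where \<open>x\<^sub>i\<close> lifts its image under \<open>Dt (t i)\<close>.\<close>
lemma I2_of_Dt:
  assumes b: "\<And>i. i < r \<Longrightarrow> b i \<in> N" and rep: "\<And>n. n \<in> N \<Longrightarrow> n = bprod r b (\<lambda>i. nat (t i n))" and t0: "\<And>i n. 0 \<le> t i n"
    and y: "y \<in> VG" "pr y = 0" "\<And>i. i < r \<Longrightarrow> cg (int p) (Dt (t i) y) 0"
  shows "y \<in> I (Suc 1)"
proof -
  let ?r = "\<lambda>g. dl (rho (\<phi> g)) :: 'a \<Rightarrow> int"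
  have rV: "?r g \<in> VG" if "g \<in> SG" for g using rho[of "\<phi> g"] that by simp
  have "lift (pr y) = 0" using y(2) lin_0[OF lift_lin] by simp
  moreover have "lift (pr y) = (\<Sum>g\<in>SG. cs (y g) (lift (pr (dl g))))"
    by (rule lin_expand[OF A.fin_carrier lin_comp[OF pr_lin lift_lin] y(1)])
  ultimately have l0: "(\<Sum>g\<in>SG. cs (y g) (?r g)) = 0" by (simp add: pr_dl lift_dl cong: sum.cong)
  have "y = (\<Sum>g\<in>SG. cs (y g) (dl g)) - (\<Sum>g\<in>SG. cs (y g) (?r g))" using vecs_expand[OF A.fin_carrier y(1)] l0 by simp
  also have "\<dots> = (\<Sum>g\<in>SG. cs (y g) (lm (nn g) (?r g) - ?r g))"
    unfolding sum_subtractf[symmetric] cs_diff[symmetric]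
  proof (intro sum.cong refl arg_cong2[where f = cs])
    fix g assume g: "g \<in> SG"
    have "lm (nn g) (?r g) = dl g" using nn[OF g] rho[of "\<phi> g"] g N_G by (simp add: lm_dl)
    then show "dl g - ?r g = lm (nn g) (?r g) - ?r g" by simp
  qed
  finally have ye: "y = (\<Sum>g\<in>SG. cs (y g) (lm (nn g) (?r g) - ?r g))" .
  define x where "x i = lift (Dt (t i) y)" for i
  define L where "L i v = lm (b i) v - v" for i v
  have L: "lin SG SG (L i)" for i unfolding L_def by (intro lin_minus lm_lin lin_id)
  define T where "T = (\<Sum>i<r. L i (x i))"
  have xe: "x i = (\<Sum>g\<in>SG. cs (y g * t i (nn g)) (?r g))" for i
    unfolding x_def Dt_def
    by (subst lin_sum[OF lift_lin]) (auto simp: lin_cs[OF lift_lin] lift_dl intro!: sum.cong)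
  have Te: "T = (\<Sum>g\<in>SG. cs (y g) (\<Sum>i<r. cs (t i (nn g)) (L i (?r g))))"
  proof -
    have "L i (x i) = (\<Sum>g\<in>SG. cs (y g * t i (nn g)) (L i (?r g)))" for i
      unfolding xe by (subst lin_sum[OF L]) (auto simp: lin_cs[OF L] rV intro!: sum.cong)
    then show ?thesis unfolding T_def by (simp add: cs_sum sum.swap[of _ "{..<r}"])
  qed
  have "y - T = (\<Sum>g\<in>SG. cs (y g) (lm (nn g) (?r g) - ?r g - (\<Sum>i<r. cs (t i (nn g)) (L i (?r g)))))"
    unfolding cs_diff[of _ "lm _ _ - _"] sum_subtractf Te[symmetric] ye[symmetric] ..
  also have "\<dots> \<in> I (Suc 1)"
  proof (intro A.subm_sum[OF I_subm] A.subm_cs[OF I_subm])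
    fix g assume g: "g \<in> SG"
    let ?k = "\<lambda>i. nat (t i (nn g))"
    have e: "bprod r b ?k = nn g" by (rule rep[OF nn(1)[OF g], symmetric])
    have "?r g \<in> I 0" using rV[OF g] by (simp add: I_0)
    from lm_bprod_I2[where r = r and b = b and k = ?k, OF b this] show "lm (nn g) (?r g) - ?r g - (\<Sum>i<r. cs (t i (nn g)) (L i (?r g))) \<in> I (Suc 1)"
      unfolding e L_def by (simp add: t0)
  qed
  finally have 1: "y - T \<in> I (Suc 1)" .
  have "L i (x i) \<in> I (Suc 1)" if i: "i < r" for i
  proof -
    have xV: "x i \<in> VG" unfolding x_def by (intro lin_vecs[OF lift_lin] lin_vecs[OF Dt_lin] y(1))
    have "cg (int p) (x i) (lift 0)" unfolding x_def
      by (rule lin_cg[OF lift_lin lin_vecs[OF Dt_lin y(1)] vecs_0 y(3)[OF i]])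
    then have "cg (int p) (x i) 0" by (simp add: lin_0[OF lift_lin])
    from lin_cg[OF L xV vecs_0 this] have "cg (int p) (L i (x i)) 0" by (simp add: lin_0[OF L])
    from cg_sym[OF this] show ?thesis by (rule A.subm_cp[OF I_subm A.subm_0[OF I_subm] lin_vecs[OF L xV]])
  qed
  then have "T \<in> I (Suc 1)" unfolding T_def by (intro A.subm_sum[OF I_subm]) simp
  from A.subm_add[OF I_subm 1 this] show ?thesis by simp
qed

text \<open>A joint eigenvector of the operators \<open>At z (t i)\<close> with eigenvalues \<open>k\<^sub>i\<close> corresponds to the element of \<open>N\<close>
with coordinates \<open>k\<^sub>i\<close>: multiplication by \<open>z\<close> on the right and by that element on the left agree on its lift modulo \<open>I 2\<close>. Joint eigenvectors span, so a basis can be chosen among them.\<close>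
lemma adapted_basis:
  assumes z: "z \<in> VG" "pr z = dl \<one>\<^bsub>H\<^esub>" "A.gpow z p = dl \<one>"
  shows "\<exists>w ns. (\<forall>s<card SH. w s \<in> VH \<and> ns s \<in> N \<and> A.gm (lift (w s)) z - lm (ns s) (lift (w s)) \<in> I (Suc 1))
    \<and> (\<forall>W. A.subm W \<longrightarrow> (\<forall>s<card SH. \<forall>m\<in>N. lm m (lift (w s)) \<in> W) \<longrightarrow> VG \<subseteq> W)"
proof -
  obtain r b t where cd: "is_coord r b t" using coordinates by blast
  note cd' = cd[unfolded is_coord_def]
  note b = cd'[THEN conjunct1, rule_format] and t = cd'[THEN conjunct2, THEN conjunct1, rule_format]
    and sj = cd'[THEN conjunct2, THEN conjunct2, THEN conjunct1, rule_format]
    and rep = cd'[THEN conjunct2, THEN conjunct2, THEN conjunct2, THEN conjunct1, rule_format]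
    and t0 = cd'[THEN conjunct2, THEN conjunct2, THEN conjunct2, THEN conjunct2, rule_format]
  define E where "E = {w \<in> VH. \<exists>n\<in>N. A.gm (lift w) z - lm n (lift w) \<in> I (Suc 1)}"
  have eig: "v \<in> E" if v: "v \<in> VH" and k: "\<And>i. i < r \<Longrightarrow> cg (int p) (At z (t i) v) (cs (\<kappa> i) v)" for v \<kappa>
  proof -
    obtain n where n: "n \<in> N" "\<And>i. i < r \<Longrightarrow> [t i n = int (nat (\<kappa> i mod int p))] (mod int p)"
      using sj[of "\<lambda>i. nat (\<kappa> i mod int p)"] by blast
    have tk: "[t i n = \<kappa> i] (mod int p)" if "i < r" for i
      using n(2)[OF that] A.p_pos by (simp add: cong_def)
    have lv: "lift v \<in> VG" by (rule lin_vecs[OF lift_lin v])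
    let ?y = "A.gm (lift v) z - lm n (lift v)"
    have "?y \<in> I (Suc 1)"
    proof (rule I2_of_Dt[OF b rep t0])
      show "?y \<in> VG" by simp
      show "pr ?y = 0"
        using lin_diff[OF pr_lin, of "A.gm (lift v) z" "lm n (lift v)"] pr_gm[OF lv z(1)] pr_lm[OF n(1) lv] v
        by (simp add: pr_lift z(2))
      fix i assume i: "i < r"
      have e: "?y = (A.gm (lift v) z - lift v) - (lm n (lift v) - lift v)" by simp
      have "Dt (t i) ?y = At z (t i) v - Dt (t i) (lm n (lift v) - lift v)"
        unfolding At_def e by (rule lin_diff[OF Dt_lin]) (use lv in auto)
      also have "cg (int p) \<dots> (cs (\<kappa> i) v - cs (\<kappa> i) v)"
      proof (rule cg_diff[OF k[OF i]])
        have "cg (int p) (Dt (t i) (lm n (lift v) - lift v)) (cs (t i n) (pr (lift v)))" by (rule Dt_step[OF t[OF i] n(1) lv])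
        also have "pr (lift v) = v" by (rule pr_lift[OF v])
        also have "cg (int p) (cs (t i n) v) (cs (\<kappa> i) v)" by (rule cg_cs_coeff[OF tk[OF i]])
        finally show "cg (int p) (Dt (t i) (lm n (lift v) - lift v)) (cs (\<kappa> i) v)" .
      qed
      finally show "cg (int p) (Dt (t i) ?y) 0" by simp
    qed
    then show ?thesis unfolding E_def using v n(1) by blast
  qed
  have EV: "E \<subseteq> VH" unfolding E_def by (rule Collect_restrict)
  have "\<exists>xs. set xs \<subseteq> E \<and> B.ext B.pV xs = VH \<and> length xs = B.dm VH - B.dm B.pV"
  proof (rule B.select_basis_dm[OF B.subm_pV B.subm_vecs EV B.pV_subset[OF B.subm_vecs]])
    fix W assume W: "B.subm W" "B.pV \<subseteq> W" "E \<subseteq> W"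
    have "W = VH"
    proof (rule B.joint_eigen[where A = "\<lambda>i. At z (t i)" and r = r])
      show "lin SH SH (At z (t i))" for i by (rule At_lin)
      show "cg (int p) ((At z (t i) ^^ p) v) (At z (t i) v)" if "i < r" "v \<in> VH" for i v by (rule At_pow[OF t[OF that(1)] z that(2)])
      show "cg (int p) (At z (t i) (At z (t j) v)) (cs k (At z (t j) v))"
        if h: "i < r" "j < r" "v \<in> VH" "cg (int p) (At z (t i) v) (cs k v)" for i j v k
        by (rule At_eigen[OF t[OF h(1)] t[OF h(2)] z h(3,4)])
      show "B.subm W" by (rule W(1))
      show "v \<in> W" if "v \<in> VH" "\<And>i. i < r \<Longrightarrow> cg (int p) (At z (t i) v) (cs (\<kappa> i) v)" for v \<kappa>
        using eig[OF that] W(3) by (rule rev_subsetD)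
    qed
    then show "VH \<subseteq> W" by simp
  qed
  then obtain xs where xs: "set xs \<subseteq> E" "B.ext B.pV xs = VH" "length xs = card SH" by (auto simp: B.dm_V B.dm_pV)
  have xsV: "set xs \<subseteq> VH" using xs(1) EV by (rule subset_trans)
  have xE: "xs ! s \<in> E" if "s < card SH" for s using xs(1,3) that nth_mem[of s xs] by auto
  then have "\<forall>s. \<exists>n. s < card SH \<longrightarrow> n \<in> N \<and> A.gm (lift (xs ! s)) z - lm n (lift (xs ! s)) \<in> I (Suc 1)"
    unfolding E_def by blast
  then obtain ns where ns: "\<And>s. s < card SH \<Longrightarrow> ns s \<in> N \<and> A.gm (lift (xs ! s)) z - lm (ns s) (lift (xs ! s)) \<in> I (Suc 1)"
    by (metis (lifting))
  have gen: "VG \<subseteq> W" if W: "A.subm W" and g: "\<And>s m. s < card SH \<Longrightarrow> m \<in> N \<Longrightarrow> lm m (lift (xs ! s)) \<in> W" for W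
  proof -
    have lW: "lm m (lift w) \<in> W" if m: "m \<in> N" and w: "w \<in> VH" for m w
    proof -
      let ?L = "\<lambda>w. lm m (lift w)"
      have L: "lin SH SG ?L" by (rule lin_comp[OF lift_lin lm_lin])
      obtain c where c: "cg (int p) w (lc c xs)" using w xs(2) B.ext_pV_iff[OF xsV w] by blast
      have "?L (lc c xs) = lc c (map ?L xs)" by (rule lin_lc[OF L xsV])
      also have "\<dots> \<in> W"
      proof (rule A.subm_lc[OF W], rule subsetI)
        fix x assume "x \<in> set (map ?L xs)"
        then obtain s where "s < length xs" "x = ?L (xs ! s)" by (auto simp: in_set_conv_nth)
        then show "x \<in> W" using g m xs(3) by simp
      qed
      finally show ?thesis
        by (rule A.subm_cp[OF W _ _ cg_sym[OF lin_cg[OF L w vecs_lc[OF xsV] c]]]) simp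
    qed
    have "dl g \<in> W" if "g \<in> SG" for g
      using lW[OF nn(1)[OF that], of "dl (\<phi> g)"] that nn[OF that] rho[of "\<phi> g"] N_G by (simp add: lift_dl lm_dl)
    then show "VG \<subseteq> W"
      using vecs_expand[OF A.fin_carrier] A.subm_sum[OF W] A.subm_cs[OF W] by (metis (no_types, lifting) subsetI)
  qed
  show ?thesis
  proof (intro exI[of _ "\<lambda>s. xs ! s"] exI[of _ ns] conjI allI impI)
    fix s assume s: "s < card SH"
    show "xs ! s \<in> VH" using xE[OF s] EV by (rule rev_subsetD)
    show "ns s \<in> N" "A.gm (lift (xs ! s)) z - lm (ns s) (lift (xs ! s)) \<in> I (Suc 1)" using ns[OF s] by simp_all
  next
    fix W assume "A.subm W" "\<forall>s<card SH. \<forall>m\<in>N. lm m (lift (xs ! s)) \<in> W"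
    then show "VG \<subseteq> W" by (intro gen) simp_all
  qed
qed

text \<open>The kernel of a coordinate that does not vanish at \<open>h\<close> is a complement of the subgroup generated by \<open>h\<close>.\<close>
lemma complement_subgroup:
  assumes h: "h \<in> N" "h \<noteq> \<one>"
  shows "\<exists>C. C \<subseteq> N \<and> \<one> \<in> C \<and> (\<forall>c\<in>C. \<forall>d\<in>C. c \<otimes> d \<in> C) \<and> p * card C = card N
    \<and> (\<forall>m\<in>N. \<exists>e::nat. \<exists>c\<in>C. m = h [^] e \<otimes> c)"
proof -
  obtain r b t where cd: "is_coord r b t" using coordinates by blast
  note cd' = cd[unfolded is_coord_def]
  note b = cd'[THEN conjunct1, rule_format] and t = cd'[THEN conjunct2, THEN conjunct1, rule_format]
    and sj = cd'[THEN conjunct2, THEN conjunct2, THEN conjunct1, rule_format]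
    and rep = cd'[THEN conjunct2, THEN conjunct2, THEN conjunct2, THEN conjunct1, rule_format]
    and t0 = cd'[THEN conjunct2, THEN conjunct2, THEN conjunct2, THEN conjunct2, rule_format]
  have "\<exists>i<r. \<not> int p dvd t i h"
  proof (rule ccontr)
    assume a: "\<not> (\<exists>i<r. \<not> int p dvd t i h)"
    have "bprod r b (\<lambda>i. nat (t i h)) = \<one>"
    proof (rule bprod_one[OF b])
      fix i assume "i < r"
      then have "int p dvd t i h" using a by blast
      then show "p dvd nat (t i h)" using t0[of i h] by (metis int_dvd_int_iff nat_0_le)
    qed
    then show False using rep[OF h(1)] h(2) by simp
  qed
  then obtain i where i: "i < r" and nd: "\<not> int p dvd t i h" by blast
  have add_char: "add_char (t i)" by (rule t[OF i])
  define C where "C = {c \<in> N. int p dvd t i c}"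
  have CN: "C \<subseteq> N" by (auto simp: C_def)
  have one: "\<one> \<in> C" using add_char_one[OF add_char] N_one by (simp add: C_def cong_0_iff)
  have cl: "c \<otimes> d \<in> C" if "c \<in> C" "d \<in> C" for c d
  proof -
    have cd: "c \<in> N" "d \<in> N" "int p dvd t i c" "int p dvd t i d" using that by (auto simp: C_def)
    have "int p dvd t i (c \<otimes> d) \<longleftrightarrow> int p dvd t i c + t i d" by (rule cong_dvd_iff[OF add_char_mult[OF add_char cd(1,2)]])
    then show ?thesis using cd N_mult[OF cd(1,2)] by (simp add: C_def)
  qed
  have hG: "h \<in> SG" by (rule N_G[OF h(1)])
  have tp: "[t i (h [^] e \<otimes> c) = int e * t i h + t i c] (mod int p)" if "c \<in> N" for e :: nat and c
    using cong_trans[OF add_char_mult[OF add_char N_pow[OF h(1)] that] cong_add[OF add_char_pow[OF add_char h(1)] cong_refl]] .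
  have co: "coprime (t i h) (int p)"
  proof -
    have "coprime (int p) (t i h)" by (rule prime_imp_coprime) (use nd A.prime in auto)
    then show ?thesis by (simp only: coprime_commute)
  qed
  have gen: "\<exists>e<p. \<exists>c\<in>C. m = h [^] e \<otimes> c" if m: "m \<in> N" for m
  proof -
    obtain a where a: "[t i h * a = 1] (mod int p)" using cong_solve_coprime_int[OF co] by blast
    define e where "e = nat ((t i m * a) mod int p)"
    have ep: "e < p" using A.p_pos by (simp add: e_def nat_less_iff)
    have "[int e = t i m * a] (mod int p)" using A.p_pos by (simp add: e_def cong_def)
    then have "[int e * t i h = (t i m * a) * t i h] (mod int p)" by (rule cong_mult[OF _ cong_refl])
    also have "(t i m * a) * t i h = t i m * (t i h * a)" by simp
    also have "[t i m * (t i h * a) = t i m * 1] (mod int p)" by (rule cong_mult[OF cong_refl a])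
    finally have ee: "[int e * t i h = t i m] (mod int p)" by simp
    define c where "c = inv (h [^] e) \<otimes> m"
    have cN: "c \<in> N" unfolding c_def by (intro N_mult N_inv N_pow h(1) m)
    have mc: "m = h [^] e \<otimes> c" unfolding c_def using hG N_G[OF m] by (simp flip: A.m_assoc)
    have "[t i m = int e * t i h + t i c] (mod int p)" using tp[OF cN, of e] mc by simp
    also have "[int e * t i h + t i c = t i m + t i c] (mod int p)" by (rule cong_add[OF ee cong_refl])
    finally have "int p dvd t i c" by (simp add: cong_iff_dvd_diff)
    then have "c \<in> C" using cN by (simp add: C_def)
    then show ?thesis using mc ep by blast
  qed
  have "bij_betw (\<lambda>(e, c). h [^] e \<otimes> c) ({..<p} \<times> C) N"
    unfolding bij_betw_def
  proof
    show "inj_on (\<lambda>(e, c). h [^] e \<otimes> c) ({..<p} \<times> C)"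
    proof (rule inj_onI, clarsimp)
      fix e c e' c' assume a: "e < p" "c \<in> C" "e' < p" "c' \<in> C" "h [^] e \<otimes> c = h [^] e' \<otimes> c'"
      have cN: "c \<in> N" "c' \<in> N" "[t i c = 0] (mod int p)" "[t i c' = 0] (mod int p)" using a by (auto simp: C_def cong_0_iff)
      have "[int e * t i h + 0 = int e * t i h + t i c] (mod int p)" by (rule cong_add[OF cong_refl cong_sym[OF cN(3)]])
      also have "[int e * t i h + t i c = t i (h [^] e \<otimes> c)] (mod int p)" by (rule cong_sym[OF tp[OF cN(1)]])
      also have "[t i (h [^] e \<otimes> c) = int e' * t i h + t i c'] (mod int p)" unfolding a(5) by (rule tp[OF cN(2)])
      also have "[int e' * t i h + t i c' = int e' * t i h + 0] (mod int p)" by (rule cong_add[OF cong_refl cN(4)])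
      finally have "[int e = int e'] (mod int p)" using co by (simp add: cong_mult_rcancel)
      then have ee: "e = e'" using a(1,3) by (simp add: cong_def)
      then show "e = e' \<and> c = c'" using a(5) hG N_G[OF cN(1)] N_G[OF cN(2)] by simp
    qed
    show "(\<lambda>(e, c). h [^] e \<otimes> c) ` ({..<p} \<times> C) = N"
    proof
      show "(\<lambda>(e, c). h [^] e \<otimes> c) ` ({..<p} \<times> C) \<subseteq> N"
        using CN by (auto intro!: N_mult N_pow h(1))
      show "N \<subseteq> (\<lambda>(e, c). h [^] e \<otimes> c) ` ({..<p} \<times> C)"
      proof
        fix m assume "m \<in> N"
        from gen[OF this] obtain e c where "e < p" "c \<in> C" "m = h [^] e \<otimes> c" by blast
        then show "m \<in> (\<lambda>(e, c). h [^] e \<otimes> c) ` ({..<p} \<times> C)" by (intro image_eqI[of _ _ "(e, c)"]) auto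
      qed
    qed
  qed
  from bij_betw_same_card[OF this] have "p * card C = card N" by (simp add: card_cartesian_product)
  then show ?thesis using CN one cl gen by (intro exI[of _ C]) blast
qed

end

section \<open>Units of order p in the kernel act freely\<close>

context fp_vecs
begin

text \<open>Sums \<open>U + D U'\<close>, in particular \<open>U + U'\<close> when \<open>D\<close> is the identity.\<close>
lemma subm_image_sum:
  assumes U: "subm U" and U': "subm U'" and D: "lin S S D"
  shows "subm {a + D b | a b. a \<in> U \<and> b \<in> U'}"
  unfolding subm_def
proof (intro conjI ballI)
  let ?Q = "{a + D b | a b. a \<in> U \<and> b \<in> U'}"
  show "?Q \<subseteq> V"
  proof
    fix v assume "v \<in> ?Q"
    then obtain a b where h: "v = a + D b" "a \<in> U" "b \<in> U'" by blast
    show "v \<in> V" unfolding h(1) by (rule vecs_add[OF subm_V[OF U h(2)] lin_vecs[OF D subm_V[OF U' h(3)]]])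
  qed
  have "0 + D 0 \<in> ?Q" using subm_0[OF U] subm_0[OF U'] by blast
  then show "0 \<in> ?Q" by (simp only: lin_0[OF D] add_0_right)
next
  let ?Q = "{a + D b | a b. a \<in> U \<and> b \<in> U'}"
  fix v w assume "v \<in> ?Q" "w \<in> ?Q"
  then obtain a b c d where h: "a \<in> U" "b \<in> U'" "c \<in> U" "d \<in> U'" "v = a + D b" "w = c + D d" by blast
  have e: "v + w = (a + c) + D (b + d)"
    using lin_add[OF D subm_V[OF U' h(2)] subm_V[OF U' h(4)]] h(5,6) by (simp add: algebra_simps)
  show "v + w \<in> ?Q" unfolding e using subm_add[OF U h(1,3)] subm_add[OF U' h(2,4)] by blast
next
  let ?Q = "{a + D b | a b. a \<in> U \<and> b \<in> U'}"
  fix v assume "v \<in> ?Q"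
  then obtain a b where h: "a \<in> U" "b \<in> U'" "v = a + D b" by blast
  have e: "- v = (- a) + D (- b)" using lin_uminus[OF D subm_V[OF U' h(2)]] h(3) by (simp add: algebra_simps)
  show "- v \<in> ?Q" unfolding e using subm_uminus[OF U h(1)] subm_uminus[OF U' h(2)] by blast
next
  let ?Q = "{a + D b | a b. a \<in> U \<and> b \<in> U'}"
  fix v assume v: "v \<in> V"
  have "cs (int p) v + D 0 \<in> ?Q" using subm_p[OF U v] subm_0[OF U'] by blast
  then show "cs (int p) v \<in> ?Q" by (simp only: lin_0[OF D] add_0_right)
qed

definition sp :: "('i \<Rightarrow> int) set \<Rightarrow> ('i \<Rightarrow> int) set" where "sp Y = \<Inter>{W. subm W \<and> Y \<subseteq> W}"

lemma subm_sp: assumes "Y \<subseteq> V" shows "subm (sp Y)"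
proof -
  have "V \<in> {W. subm W \<and> Y \<subseteq> W}" using assms by simp
  then have ne: "{W. subm W \<and> Y \<subseteq> W} \<noteq> {}" by blast
  show ?thesis unfolding sp_def by (rule subm_Inter[OF ne]) blast
qed
lemma sp_mem: "y \<in> Y \<Longrightarrow> y \<in> sp Y" unfolding sp_def by blast
lemma sp_least: "subm W \<Longrightarrow> (\<And>y. y \<in> Y \<Longrightarrow> y \<in> W) \<Longrightarrow> sp Y \<subseteq> W" unfolding sp_def by blast

end

context elem_ext
begin

lemma lm_pow_diff: assumes n: "n \<in> SG" and u: "u \<in> VG"
  shows "lm (n [^] (k::nat)) u - u = lm n (\<Sum>i<k. lm (n [^] i) u) - (\<Sum>i<k. lm (n [^] i) u)"
proof (induction k)
  case 0 then show ?case using u by (simp add: lin_0[OF lm_lin])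
next
  case (Suc k)
  let ?T = "\<Sum>i<k. lm (n [^] i) u"
  have "lm n (?T + lm (n [^] k) u) = lm n ?T + lm n (lm (n [^] k) u)"
    by (rule lin_add[OF lm_lin]) (auto intro: vecs_sum)
  moreover have "lm n (lm (n [^] k) u) = lm (n [^] Suc k) u"
    using n A.nat_pow_Suc2[OF n, of k] by (simp add: lm_lm del: A.nat_pow_Suc)
  ultimately show ?case using Suc by (simp add: algebra_simps del: A.nat_pow_Suc)
qed

text \<open>The filtration \<open>I\<close> restricted to the \<open>N\<close>-submodule generated by \<open>v\<close>.\<close>
definition J :: "('a \<Rightarrow> int) \<Rightarrow> nat \<Rightarrow> ('a \<Rightarrow> int) set" where
  "J v j = (gens N ^^ j) (A.sp ((\<lambda>m. lm m v) ` N))"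

lemma J_0: "J v 0 = A.sp ((\<lambda>m. lm m v) ` N)" by (simp add: J_def)
lemma J_Suc: "J v (Suc j) = gens N (J v j)" by (simp add: J_def)
lemma J_subm: "A.subm (J v j)"
proof (induction j)
  case 0 show ?case unfolding J_0 by (rule A.subm_sp) auto
next
  case (Suc j) show ?case unfolding J_Suc by (rule gens_subm) (use A.subm_V[OF Suc] in blast)
qed
lemma J_V: "u \<in> J v j \<Longrightarrow> u \<in> VG" by (rule A.subm_V[OF J_subm])
lemma J_base: "m \<in> N \<Longrightarrow> lm m v \<in> J v 0" unfolding J_0 by (rule A.sp_mem) (rule imageI)
lemma J_step: "n \<in> N \<Longrightarrow> u \<in> J v j \<Longrightarrow> lm n u - u \<in> J v (Suc j)" unfolding J_Suc by (rule gens_mem)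
lemma J_least: "A.subm W \<Longrightarrow> (\<And>n u. n \<in> N \<Longrightarrow> u \<in> J v j \<Longrightarrow> lm n u - u \<in> W) \<Longrightarrow> J v (Suc j) \<subseteq> W"
  unfolding J_Suc by (rule gens_least)
lemma J_0_least: "A.subm W \<Longrightarrow> (\<And>m. m \<in> N \<Longrightarrow> lm m v \<in> W) \<Longrightarrow> J v 0 \<subseteq> W"
  unfolding J_0 by (rule A.sp_least) auto
lemma J_0_lm: assumes n: "n \<in> N" and u: "u \<in> J v 0" shows "lm n u \<in> J v 0"
proof -
  have "J v 0 \<subseteq> {u \<in> VG. lm n u \<in> J v 0}"
  proof (rule J_0_least[OF A.subm_preimage[OF lm_lin J_subm]])
    fix m assume m: "m \<in> N"
    have "lm (n \<otimes> m) v \<in> J v 0" by (rule J_base[OF N_mult[OF n m]])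
    then show "lm m v \<in> {u \<in> VG. lm n u \<in> J v 0}" using N_G[OF n] N_G[OF m] by (simp add: lm_lm)
  qed
  then show ?thesis using u by blast
qed
lemma J_dec: "J v (Suc j) \<subseteq> J v j"
proof (induction j)
  case 0
  show ?case
    by (rule J_least[OF J_subm]) (rule A.subm_diff[OF J_subm J_0_lm])
next
  case (Suc j) then show ?case unfolding J_Suc[of v "Suc j"] J_Suc[of v j] by (intro gens_mono) (simp add: J_Suc)
qed
lemma J_lm: assumes "n \<in> N" "u \<in> J v j" shows "lm n u \<in> J v j"
proof -
  have "lm n u - u \<in> J v j" using J_step[OF assms] J_dec by blast
  from A.subm_add[OF J_subm this assms(2)] show ?thesis by simp
qed

text \<open>The relation \<open>v z \<equiv> n0 v\<close> modulo \<open>I 2\<close> propagates with a gain of one further degree per step of the filtration, as \<open>z\<close> acts on the right and \<open>N\<close> is commutative.\<close>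
lemma J_z:
  assumes z: "z \<in> VG" and n0: "n0 \<in> N" and v: "v \<in> VG" "A.gm v z - lm n0 v \<in> I (Suc 1)" and u: "u \<in> J v j"
  shows "A.gm u z - lm n0 u \<in> I (Suc (Suc j))"
proof -
  have L: "lin SG SG (\<lambda>u. A.gm u z - lm n0 u)" by (intro lin_minus A.lin_right lm_lin)
  have c: "A.gm (lm m u) z - lm n0 (lm m u) = lm m (A.gm u z - lm n0 u)" if m: "m \<in> N" and u: "u \<in> VG" for m u
    using lin_diff[OF lm_lin, of "A.gm u z" "lm n0 u" m] lm_comm[OF n0 m] by (simp add: A.gm_assoc)
  have "J v j \<subseteq> {u \<in> VG. A.gm u z - lm n0 u \<in> I (Suc (Suc j))}"
  proof (induction j)
    case 0
    show ?case
    proof (rule J_0_least[OF A.subm_preimage[OF L I_subm]])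
      fix m assume m: "m \<in> N"
      have "lm m (A.gm v z - lm n0 v) \<in> I (Suc 1)" by (rule I_lm[OF m v(2)])
      then show "lm m v \<in> {u \<in> VG. A.gm u z - lm n0 u \<in> I (Suc (Suc 0))}" by (simp add: c[OF m v(1)])
    qed
  next
    case (Suc j)
    show ?case
    proof (rule J_least[OF A.subm_preimage[OF L I_subm]])
      fix m u assume m: "m \<in> N" and u: "u \<in> J v j"
      let ?y = "A.gm u z - lm n0 u"
      have y: "?y \<in> I (Suc (Suc j))" using Suc u by blast
      have uV: "u \<in> VG" by (rule J_V[OF u])
      have "A.gm (lm m u - u) z - lm n0 (lm m u - u) = (A.gm (lm m u) z - lm n0 (lm m u)) - ?y"
        using lin_diff[OF L, of "lm m u" u] uV by simp
      also have "\<dots> = lm m ?y - ?y" by (simp only: c[OF m uV])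
      also have "\<dots> \<in> I (Suc (Suc (Suc j)))" by (rule I_step[OF m y])
      finally have "A.gm (lm m u - u) z - lm n0 (lm m u - u) \<in> I (Suc (Suc (Suc j)))" .
      then show "lm m u - u \<in> {u \<in> VG. A.gm u z - lm n0 u \<in> I (Suc (Suc (Suc j)))}"
        by (intro CollectI conjI vecs_diff A.gm_vecs uV)
    qed
  qed
  then show ?thesis using u by blast
qed

text \<open>As every element of \<open>N\<close> is \<open>h\<^sup>e c\<close> with \<open>c \<in> C\<close>, the translates of \<open>v\<close> by \<open>C\<close> generate the submodule modulo \<open>h - 1\<close>, compatibly with
the filtration. At \<open>j = 0\<close> the truncated difference \<open>j - 1\<close> is again \<open>0\<close>, which is what the statement needs there.\<close>
lemma J_split:
  assumes v: "v \<in> VG" and h: "h \<in> N" and C: "C \<subseteq> N" "\<And>c d. c \<in> C \<Longrightarrow> d \<in> C \<Longrightarrow> c \<otimes> d \<in> C"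
    and gen: "\<And>m. m \<in> N \<Longrightarrow> \<exists>e::nat. \<exists>c\<in>C. m = h [^] e \<otimes> c"
  shows "J v j \<subseteq> {a + (lm h b - b) | a b. a \<in> A.sp ((\<lambda>c. lm c v) ` C) \<inter> J v j \<and> b \<in> J v (j - 1)}"
proof -
  let ?Cs = "A.sp ((\<lambda>c. lm c v) ` C)"
  have Cs: "A.subm ?Cs" by (rule A.subm_sp) auto
  have hG: "h \<in> SG" by (rule N_G[OF h])
  have Cslm: "lm c u \<in> ?Cs" if c: "c \<in> C" and u: "u \<in> ?Cs" for c u
  proof -
    have "?Cs \<subseteq> {u \<in> VG. lm c u \<in> ?Cs}"
    proof (rule A.sp_least[OF A.subm_preimage[OF lm_lin Cs]])
      fix y assume "y \<in> (\<lambda>c. lm c v) ` C"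
      then obtain d where d: "d \<in> C" "y = lm d v" by blast
      have "c \<in> N" "d \<in> N" using c d(1) C(1) by auto
      then have "lm c y = lm (c \<otimes> d) v" unfolding d(2) by (intro lm_lm N_G)
      also have "\<dots> \<in> ?Cs" by (intro A.sp_mem imageI C(2) c d(1))
      finally show "y \<in> {u \<in> VG. lm c u \<in> ?Cs}" by (simp add: d(2))
    qed
    then show ?thesis using u by blast
  qed
  have D: "lin SG SG (\<lambda>b. lm h b - b)" by (intro lin_minus lm_lin lin_id)
  define Q where "Q j = {a + (lm h b - b) | a b. a \<in> ?Cs \<inter> J v j \<and> b \<in> J v (j - 1)}" for j
  have QI: "a + (lm h b - b) \<in> Q j" if "a \<in> ?Cs" "a \<in> J v j" "b \<in> J v (j - 1)" for a b j using that unfolding Q_def by blast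
  have Q: "A.subm (Q j)" for j
    unfolding Q_def by (rule A.subm_image_sum[OF A.subm_Int[OF Cs J_subm] J_subm D])
  have pw: "lm (h [^] e) u - u = lm h (\<Sum>i<e. lm (h [^] i) u) - (\<Sum>i<e. lm (h [^] i) u)" if "u \<in> VG" for u and e :: nat
    by (rule lm_pow_diff[OF hG that])
  have sJ: "(\<Sum>i<e. lm (h [^] i) u) \<in> J v i" if "u \<in> J v i" for u i and e :: nat
    by (intro A.subm_sum[OF J_subm] J_lm N_pow h that)
  have "J v j \<subseteq> Q j"
  proof (induction j)
    case 0
    show ?case
    proof (rule J_0_least[OF Q])
      fix m assume "m \<in> N"
      from gen[OF this] obtain e :: nat and c where ec: "c \<in> C" "m = h [^] e \<otimes> c" by blast
      have cN: "c \<in> N" using ec(1) C(1) by blast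
      let ?u = "lm c v"
      let ?b = "\<Sum>i<e. lm (h [^] i) ?u"
      have "lm m v = lm (h [^] e) ?u" unfolding ec(2) by (rule lm_lm[symmetric]) (use hG N_G[OF cN] in auto)
      also have "\<dots> = ?u + (lm h ?b - ?b)" using pw[of ?u e] by (simp add: algebra_simps)
      also have "\<dots> \<in> Q 0"
      proof (rule QI)
        show "?u \<in> ?Cs" by (intro A.sp_mem imageI ec(1))
        show u: "?u \<in> J v 0" by (rule J_base[OF cN])
        show "?b \<in> J v (0 - 1)" using sJ[OF u] by simp
      qed
      finally show "lm m v \<in> Q 0" .
    qed
  next
    case (Suc j)
    show ?case
    proof (rule J_least[OF Q])
      fix m u assume m: "m \<in> N" and "u \<in> J v j"
      then have "u \<in> Q j" using Suc by blast
      then obtain a b where ab: "u = a + (lm h b - b)" "a \<in> ?Cs" "a \<in> J v j" "b \<in> J v (j - 1)" unfolding Q_def by blast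
      from gen[OF m] obtain e :: nat and c where ec: "c \<in> C" "m = h [^] e \<otimes> c" by blast
      have cN: "c \<in> N" using ec(1) C(1) by blast
      have aV: "a \<in> VG" and bV: "b \<in> VG" using J_V[OF ab(3)] J_V[OF ab(4)] by simp_all
      let ?s = "\<Sum>i<e. lm (h [^] i) (lm c a)"
      have hb: "lm m (lm h b - b) - (lm h b - b) = lm h (lm m b - b) - (lm m b - b)"
        using lin_diff[OF lm_lin, of "lm h b" b m] lin_diff[OF lm_lin, of "lm m b" b h] lm_comm[OF m h] bV by simp
      have ma: "lm m a - a = (lm c a - a) + (lm h ?s - ?s)"
      proof -
        have "lm m a = lm (h [^] e) (lm c a)" unfolding ec(2) by (rule lm_lm[symmetric]) (use hG N_G[OF cN] in auto)
        then have "lm m a - a = (lm c a - a) + (lm (h [^] e) (lm c a) - lm c a)" by simp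
        then show ?thesis unfolding pw[OF A.gm_vecs] .
      qed
      have sV: "?s \<in> VG" by (intro vecs_sum A.gm_vecs)
      have "lm m u - u = (lm m a - a) + (lm m (lm h b - b) - (lm h b - b))"
        unfolding ab(1) using lin_add[OF lm_lin, of a "lm h b - b" m] aV bV by simp
      also have "\<dots> = (lm c a - a) + ((lm h ?s - ?s) + (lm h (lm m b - b) - (lm m b - b)))"
        unfolding hb ma by (simp only: add.assoc)
      also have "\<dots> = (lm c a - a) + (lm h (?s + (lm m b - b)) - (?s + (lm m b - b)))"
        using lin_add[OF D sV, of "lm m b - b"] bV by simp
      also have "\<dots> \<in> Q (Suc j)"
      proof (rule QI)
        show "lm c a - a \<in> ?Cs" by (rule A.subm_diff[OF Cs Cslm[OF ec(1) ab(2)] ab(2)])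
        show "lm c a - a \<in> J v (Suc j)" by (rule J_step[OF cN ab(3)])
        have "?s \<in> J v j" by (rule sJ[OF J_lm[OF cN ab(3)]])
        moreover have "lm m b - b \<in> J v j"
        proof (cases j)
          case 0 then show ?thesis using A.subm_diff[OF J_subm J_lm[OF m ab(4)] ab(4)] by simp
        next
          case (Suc i) then show ?thesis using J_step[OF m ab(4)] by simp
        qed
        ultimately have "?s + (lm m b - b) \<in> J v j" by (rule A.subm_add[OF J_subm])
        then show "?s + (lm m b - b) \<in> J v (Suc j - 1)" by simp
      qed
      finally show "lm m u - u \<in> Q (Suc j)" .
    qed
  qed
  then show ?thesis by (simp only: Q_def)
qed

text \<open>The filtrations of the cyclic submodules together exhaust the filtration of \<open>\<int>G\<close>.\<close>
lemma I_from_J: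
  assumes gen: "\<And>W. A.subm W \<Longrightarrow> (\<And>s m. s < d \<Longrightarrow> m \<in> N \<Longrightarrow> lm m (v s) \<in> W) \<Longrightarrow> VG \<subseteq> W"
    and W: "A.subm W" "\<And>s. s < d \<Longrightarrow> J (v s) j \<subseteq> W"
  shows "I j \<subseteq> W"
  using W
proof (induction j arbitrary: W)
  case 0
  show ?case unfolding I_0
  proof (rule gen[OF 0(1)])
    fix s m assume "s < d" "m \<in> N"
    then show "lm m (v s) \<in> W" using 0(2)[OF \<open>s < d\<close>] J_base[of m "v s"] by blast
  qed
next
  case (Suc j)
  show ?case
  proof (rule I_least[OF Suc.prems(1)])
    fix n u assume n: "n \<in> N" and u: "u \<in> I j"
    have D: "lin SG SG (\<lambda>u. lm n u - u)" by (intro lin_minus lm_lin lin_id)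
    have "I j \<subseteq> {u \<in> VG. lm n u - u \<in> W}"
    proof (rule Suc.IH[OF A.subm_preimage[OF D Suc.prems(1)]])
      fix s assume s: "s < d"
      show "J (v s) j \<subseteq> {u \<in> VG. lm n u - u \<in> W}"
        using Suc.prems(2)[OF s] J_step[OF n] J_V by blast
    qed
    then show "lm n u - u \<in> W" using u by blast
  qed
qed

text \<open>A minimal set of translations needed besides \<open>h\<close>: everything if \<open>h = 1\<close>, and a complement of the group generated by \<open>h\<close> otherwise.\<close>
definition cmpl :: "'a \<Rightarrow> 'a set" where
  "cmpl h = (if h = \<one> then N else SOME C. C \<subseteq> N \<and> \<one> \<in> C \<and> (\<forall>c\<in>C. \<forall>d\<in>C. c \<otimes> d \<in> C) \<and> p * card C = card N
    \<and> (\<forall>m\<in>N. \<exists>e::nat. \<exists>c\<in>C. m = h [^] e \<otimes> c))"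

lemma cmpl: assumes h: "h \<in> N"
  shows "cmpl h \<subseteq> N" "c \<in> cmpl h \<Longrightarrow> d \<in> cmpl h \<Longrightarrow> c \<otimes> d \<in> cmpl h"
    "p * card (cmpl h) = (if h = \<one> then p * card N else card N)"
    "m \<in> N \<Longrightarrow> \<exists>e::nat. \<exists>c\<in>cmpl h. m = h [^] e \<otimes> c"
proof -
  have "cmpl h \<subseteq> N \<and> (\<forall>c\<in>cmpl h. \<forall>d\<in>cmpl h. c \<otimes> d \<in> cmpl h) \<and> p * card (cmpl h) = (if h = \<one> then p * card N else card N)
    \<and> (\<forall>m\<in>N. \<exists>e::nat. \<exists>c\<in>cmpl h. m = h [^] e \<otimes> c)"
  proof (cases "h = \<one>")
    case True
    have "\<exists>e::nat. \<exists>c\<in>N. m = \<one> [^] e \<otimes> c" if "m \<in> N" for m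
      using that N_G[OF that] by (intro exI[of _ "0::nat"] bexI[of _ m]) simp_all
    then show ?thesis using True N_mult by (simp add: cmpl_def)
  next
    case False
    have "cmpl h = (SOME C. C \<subseteq> N \<and> \<one> \<in> C \<and> (\<forall>c\<in>C. \<forall>d\<in>C. c \<otimes> d \<in> C) \<and> p * card C = card N
    \<and> (\<forall>m\<in>N. \<exists>e::nat. \<exists>c\<in>C. m = h [^] e \<otimes> c))" using False by (simp add: cmpl_def)
    from someI_ex[OF complement_subgroup[OF h False], folded this] False show ?thesis by simp
  qed
  then show "cmpl h \<subseteq> N" "c \<in> cmpl h \<Longrightarrow> d \<in> cmpl h \<Longrightarrow> c \<otimes> d \<in> cmpl h"
    "p * card (cmpl h) = (if h = \<one> then p * card N else card N)"
    "m \<in> N \<Longrightarrow> \<exists>e::nat. \<exists>c\<in>cmpl h. m = h [^] e \<otimes> c" by (elim conjE; simp)+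
qed

lemma act_z: "A.act n z b = lm n (A.gm b z)" by (simp add: A.act_def A.gm_assoc)

text \<open>On the submodule generated by \<open>v s\<close> the operator \<open>b \<mapsto> n b z\<close> agrees, up to higher filtration degree, with multiplication by
\<open>h = n n\<^sub>s\<close>. So the translates of \<open>v s\<close> by a complement of \<open>h\<close> generate modulo the image of the operator minus one, first up to higher degree, then exactly by nilpotency.\<close>
lemma span_bound:
  fixes d :: nat
  assumes z: "z \<in> VG" and n: "n \<in> N"
    and w: "\<And>s. s < d \<Longrightarrow> v s \<in> VG" "\<And>s. s < d \<Longrightarrow> ns s \<in> N" "\<And>s. s < d \<Longrightarrow> A.gm (v s) z - lm (ns s) (v s) \<in> I (Suc 1)"
    and gen: "\<And>W. A.subm W \<Longrightarrow> (\<And>s m. s < d \<Longrightarrow> m \<in> N \<Longrightarrow> lm m (v s) \<in> W) \<Longrightarrow> VG \<subseteq> W"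
  shows "card SG - A.dm (A.img (\<lambda>b. A.act n z b - b)) \<le> (\<Sum>s<d. card (cmpl (n \<otimes> ns s)))"
proof -
  let ?D = "\<lambda>b. A.act n z b - b" and ?h = "\<lambda>s. n \<otimes> ns s"
  have hN: "?h s \<in> N" if "s < d" for s by (rule N_mult[OF n w(2)[OF that]])
  have D: "lin SG SG ?D" by (intro lin_minus A.lin_act lin_id)
  define F where "F = (\<Union>s\<in>{..<d}. (\<lambda>c. lm c (v s)) ` cmpl (?h s))"
  have finC: "finite (cmpl (?h s))" if "s < d" for s by (rule finite_subset[OF cmpl(1)[OF hN[OF that]] finN])
  have finF: "finite F" unfolding F_def by (intro finite_UN_I finite_imageI finC finite_lessThan) simp
  have cF: "card F \<le> (\<Sum>s<d. card (cmpl (?h s)))"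
  proof -
    have "card F \<le> (\<Sum>s<d. card ((\<lambda>c. lm c (v s)) ` cmpl (?h s)))" unfolding F_def by (rule card_UN_le) simp
    also have "\<dots> \<le> (\<Sum>s<d. card (cmpl (?h s)))" by (intro sum_mono card_image_le finC) simp
    finally show ?thesis .
  qed
  obtain xs where xs: "set xs = F" "distinct xs" using finite_distinct_list[OF finF] by blast
  have FV: "set xs \<subseteq> VG" unfolding xs(1) F_def by auto
  let ?E = "A.ext (A.img ?D) xs"
  have sI: "A.subm (A.img ?D)" by (rule A.subm_img[OF D])
  have E: "A.subm ?E" by (rule A.subm_ext[OF sI FV])
  have DE: "?D b \<in> ?E" if "b \<in> VG" for b using A.img_mem[OF that, of ?D] A.ext_mono by blast
  have cE: "lm c (v s) \<in> ?E" if "s < d" "c \<in> cmpl (?h s)" for s c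
    using A.ext_set[OF sI FV] that unfolding xs(1) F_def by blast
  have JE: "J (v s) j \<subseteq> {a + b | a b. a \<in> ?E \<and> b \<in> I (Suc j)}" if s: "s < d" for s j
  proof
    fix u assume "u \<in> J (v s) j"
    then obtain a b where ab: "u = a + (lm (?h s) b - b)" "a \<in> A.sp ((\<lambda>c. lm c (v s)) ` cmpl (?h s))" "b \<in> J (v s) (j - 1)"
      using J_split[OF w(1)[OF s] hN[OF s] cmpl(1,2)[OF hN[OF s]] cmpl(4)[OF hN[OF s]], of j] by blast
    have bV: "b \<in> VG" by (rule J_V[OF ab(3)])
    have "A.sp ((\<lambda>c. lm c (v s)) ` cmpl (?h s)) \<subseteq> ?E" by (rule A.sp_least[OF E]) (use cE[OF s] in blast)
    then have aE: "a \<in> ?E" using ab(2) by blast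
    let ?y = "A.gm b z - lm (ns s) b"
    have yI: "?y \<in> I (Suc (Suc (j - 1)))" by (rule J_z[OF z w(2)[OF s] w(1)[OF s] w(3)[OF s] ab(3)])
    have "Suc (Suc (j - 1)) = Suc j \<or> Suc (Suc (j - 1)) = Suc (Suc j)" by (cases j) auto
    then have "?y \<in> I (Suc j)" using yI I_dec[of "Suc j"] by auto
    then have ly: "lm n ?y \<in> I (Suc j)" by (rule I_lm[OF n])
    have "lm n ?y = A.act n z b - lm (?h s) b"
      using lin_diff[OF lm_lin, of "A.gm b z" "lm (ns s) b" n] N_G[OF n] N_G[OF w(2)[OF s]] by (simp add: act_z lm_lm)
    then have "u = (a + ?D b) + (- lm n ?y)" unfolding ab(1) by simp
    moreover have "a + ?D b \<in> ?E" by (rule A.subm_add[OF E aE DE[OF bV]])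
    moreover have "- lm n ?y \<in> I (Suc j)" by (rule A.subm_uminus[OF I_subm ly])
    ultimately show "u \<in> {a + b | a b. a \<in> ?E \<and> b \<in> I (Suc j)}" by blast
  qed
  have IE: "I j \<subseteq> {a + b | a b. a \<in> ?E \<and> b \<in> I (Suc j)}" for j
    by (rule I_from_J[OF gen A.subm_image_sum[OF E I_subm lin_id] JE])
  have all: "VG \<subseteq> {a + b | a b. a \<in> ?E \<and> b \<in> I j}" for j
  proof (induction j)
    case 0
    show ?case
    proof
      fix u assume "u \<in> VG"
      then have "u = 0 + u \<and> 0 \<in> ?E \<and> u \<in> I 0" using A.subm_0[OF E] by (simp add: I_0)
      then show "u \<in> {a + b | a b. a \<in> ?E \<and> b \<in> I 0}" by blast
    qed
  next
    case (Suc j)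
    show ?case
    proof
      fix u assume "u \<in> VG"
      then obtain a b where ab: "u = a + b" "a \<in> ?E" "b \<in> I j" using Suc by blast
      then obtain a' b' where ab': "b = a' + b'" "a' \<in> ?E" "b' \<in> I (Suc j)" using IE by blast
      have "u = (a + a') + b'" unfolding ab(1) ab'(1) by (simp only: add.assoc)
      then show "u \<in> {a + b | a b. a \<in> ?E \<and> b \<in> I (Suc j)}" using A.subm_add[OF E ab(2) ab'(2)] ab'(3) by blast
    qed
  qed
  obtain j where j: "I j \<subseteq> A.pV" using I_nilpotent by blast
  have VE: "VG \<subseteq> ?E"
  proof
    fix u assume "u \<in> VG"
    then obtain a b where ab: "u = a + b" "a \<in> ?E" "b \<in> I j" using all[of j] by blast
    have "b \<in> ?E" using ab(3) j A.pV_subset[OF E] by blast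
    then show "u \<in> ?E" unfolding ab(1) by (rule A.subm_add[OF E ab(2)])
  qed
  have "A.dm VG \<le> A.dm ?E" by (rule A.dm_mono[OF A.subm_vecs E VE])
  also have "\<dots> \<le> A.dm (A.img ?D) + length xs" by (rule A.dm_ext_le[OF sI FV])
  also have "length xs = card F" using distinct_card[OF xs(2)] xs(1) by simp
  finally show ?thesis using cF A.dm_V by simp
qed

lemma card_SG: "card SG = card SH * card N"
proof -
  have "bij_betw (\<lambda>(b, n). n \<otimes> rho b) (SH \<times> N) SG"
  proof (rule bij_betwI[where g = "\<lambda>g. (\<phi> g, nn g)"])
    show "(\<lambda>(b, n). n \<otimes> rho b) \<in> SH \<times> N \<rightarrow> SG" using rho N_G by auto
    show "(\<lambda>g. (\<phi> g, nn g)) \<in> SG \<rightarrow> SH \<times> N" using nn by auto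
    show "(\<lambda>g. (\<phi> g, nn g)) ((\<lambda>(b, n). n \<otimes> rho b) x) = x" if xSN: "x \<in> SH \<times> N" for x
    proof -
      obtain b n where x: "x = (b, n)" "b \<in> SH" "n \<in> N" using xSN by blast
      have "\<phi> (n \<otimes> rho b) = b" using nn_mult(2)[OF x(3) rho(1)[OF x(2)]] rho(2)[OF x(2)] by simp
      then show ?thesis using x rho[OF x(2)] N_G[OF x(3)] by (simp add: nn_def A.m_assoc)
    qed
    show "(\<lambda>(b, n). n \<otimes> rho b) ((\<lambda>g. (\<phi> g, nn g)) x) = x" if "x \<in> SG" for x using nn[OF that] by simp
  qed
  from bij_betw_same_card[OF this] show ?thesis by (simp add: card_cartesian_product)
qed

text \<open>Conjugation maps the coset \<open>N x\<close> onto a coset, and the sum of the coefficients of \<open>v\<close> over a coset is a coefficient of the projection.\<close>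
lemma ctr_sum_N: assumes v: "v \<in> VG" and x: "x \<in> SG"
  shows "(\<Sum>n\<in>N. A.ctr v (n \<otimes> x)) = int (card N) * B.ctr (pr v) (\<phi> x)"
proof -
  have fib: "(\<Sum>n\<in>N. v (inv m \<otimes> (n \<otimes> x) \<otimes> m)) = pr v (inv\<^bsub>H\<^esub> (\<phi> m) \<otimes>\<^bsub>H\<^esub> \<phi> x \<otimes>\<^bsub>H\<^esub> \<phi> m)" if m: "m \<in> SG" for m
  proof -
    let ?b = "inv\<^bsub>H\<^esub> (\<phi> m) \<otimes>\<^bsub>H\<^esub> \<phi> x \<otimes>\<^bsub>H\<^esub> \<phi> m"
    have "pr v ?b = (\<Sum>g\<in>SG. if \<phi> g = ?b then v g else 0)" using m x by (simp add: pr_def)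
    also have "\<dots> = (\<Sum>g\<in>{g \<in> SG. \<phi> g = ?b}. v g)" by (rule sum.inter_filter[symmetric]) simp
    also have "\<dots> = (\<Sum>n\<in>N. v (inv m \<otimes> (n \<otimes> x) \<otimes> m))"
    proof (rule sum.reindex_bij_witness[where j = "\<lambda>g. m \<otimes> g \<otimes> inv m \<otimes> inv x"
          and i = "\<lambda>n. inv m \<otimes> (n \<otimes> x) \<otimes> m"])
      fix g assume g: "g \<in> {g \<in> SG. \<phi> g = ?b}"
      have e1: "m \<otimes> g \<otimes> inv m \<otimes> inv x \<otimes> x = m \<otimes> g \<otimes> inv m" using g m x by (simp add: A.m_assoc)
      have e2: "inv m \<otimes> (m \<otimes> g \<otimes> inv m) \<otimes> m = g"
      proof -
        have "inv m \<otimes> (m \<otimes> g) = g" using g m by (simp flip: A.m_assoc)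
        then show ?thesis using g m by (simp add: A.m_assoc)
      qed
      show 1: "inv m \<otimes> (m \<otimes> g \<otimes> inv m \<otimes> inv x \<otimes> x) \<otimes> m = g" unfolding e1 by (rule e2)
      show "v (inv m \<otimes> (m \<otimes> g \<otimes> inv m \<otimes> inv x \<otimes> x) \<otimes> m) = v g" unfolding 1 ..
      have mb: "\<phi> m \<otimes>\<^bsub>H\<^esub> ?b \<otimes>\<^bsub>H\<^esub> inv\<^bsub>H\<^esub> (\<phi> m) = \<phi> x"
      proof -
        have "\<phi> m \<otimes>\<^bsub>H\<^esub> (inv\<^bsub>H\<^esub> (\<phi> m) \<otimes>\<^bsub>H\<^esub> \<phi> x) = \<phi> x" using m x by (simp flip: B.m_assoc)
        then show ?thesis using m x by (simp add: B.m_assoc)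
      qed
      have "\<phi> (m \<otimes> g \<otimes> inv m \<otimes> inv x) = \<one>\<^bsub>H\<^esub>" using g m x mb by simp
      then show "m \<otimes> g \<otimes> inv m \<otimes> inv x \<in> N" unfolding kernel_def using g m x by simp
    next
      fix n assume n: "n \<in> N"
      have nG: "n \<in> SG" by (rule N_G[OF n])
      let ?y = "n \<otimes> x"
      have y: "?y \<in> SG" using nG x by simp
      have "m \<otimes> (inv m \<otimes> ?y) = ?y" using m y A.m_assoc[of m "inv m" ?y] by simp
      then have "m \<otimes> (inv m \<otimes> ?y \<otimes> m) \<otimes> inv m = ?y" using m nG x by (simp add: A.m_assoc)
      then show "m \<otimes> (inv m \<otimes> ?y \<otimes> m) \<otimes> inv m \<otimes> inv x = n"
        using nG x by (simp add: A.m_assoc)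
      show "inv m \<otimes> ?y \<otimes> m \<in> {g \<in> SG. \<phi> g = ?b}" using nG N_phi[OF n] m x by simp
    qed
    finally show ?thesis by simp
  qed
  have "(\<Sum>n\<in>N. A.ctr v (n \<otimes> x)) = (\<Sum>m\<in>SG. \<Sum>n\<in>N. v (inv m \<otimes> (n \<otimes> x) \<otimes> m))"
    unfolding A.ctr_def by (rule sum.swap)
  also have "\<dots> = (\<Sum>m\<in>SG. pr v (inv\<^bsub>H\<^esub> (\<phi> m) \<otimes>\<^bsub>H\<^esub> \<phi> x \<otimes>\<^bsub>H\<^esub> \<phi> m))" by (intro sum.cong refl fib)
  also have "\<dots> = (\<Sum>b\<in>SH. \<Sum>m\<in>{m \<in> SG. \<phi> m = b}. pr v (inv\<^bsub>H\<^esub> (\<phi> m) \<otimes>\<^bsub>H\<^esub> \<phi> x \<otimes>\<^bsub>H\<^esub> \<phi> m))"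
    unfolding surj[symmetric] by (rule sum.image_gen) simp
  also have "\<dots> = (\<Sum>b\<in>SH. int (card N) * pr v (inv\<^bsub>H\<^esub> b \<otimes>\<^bsub>H\<^esub> \<phi> x \<otimes>\<^bsub>H\<^esub> b))"
  proof (rule sum.cong[OF refl])
    fix b assume b: "b \<in> SH"
    have "bij_betw (\<lambda>n. n \<otimes> rho b) N {m \<in> SG. \<phi> m = b}"
    proof (rule bij_betwI[where g = nn])
      show "(\<lambda>n. n \<otimes> rho b) \<in> N \<rightarrow> {m \<in> SG. \<phi> m = b}" using rho[OF b] N_G N_phi b by auto
      show "nn \<in> {m \<in> SG. \<phi> m = b} \<rightarrow> N" using nn by auto
      show "nn (n \<otimes> rho b) = n" if "n \<in> N" for n
        using that rho[OF b] N_G[OF that] N_phi[OF that] b by (simp add: nn_def A.m_assoc)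
      show "nn m \<otimes> rho b = m" if "m \<in> {m \<in> SG. \<phi> m = b}" for m using nn[of m] that by auto
    qed
    from bij_betw_same_card[OF this] have "card {m \<in> SG. \<phi> m = b} = card N" by simp
    moreover have "(\<Sum>m\<in>{m \<in> SG. \<phi> m = b}. pr v (inv\<^bsub>H\<^esub> (\<phi> m) \<otimes>\<^bsub>H\<^esub> \<phi> x \<otimes>\<^bsub>H\<^esub> \<phi> m))
       = (\<Sum>m\<in>{m \<in> SG. \<phi> m = b}. pr v (inv\<^bsub>H\<^esub> b \<otimes>\<^bsub>H\<^esub> \<phi> x \<otimes>\<^bsub>H\<^esub> b))" by (rule sum.cong) auto
    ultimately show "(\<Sum>m\<in>{m \<in> SG. \<phi> m = b}. pr v (inv\<^bsub>H\<^esub> (\<phi> m) \<otimes>\<^bsub>H\<^esub> \<phi> x \<otimes>\<^bsub>H\<^esub> \<phi> m)) = int (card N) * pr v (inv\<^bsub>H\<^esub> b \<otimes>\<^bsub>H\<^esub> \<phi> x \<otimes>\<^bsub>H\<^esub> b)"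
      by simp
  qed
  also have "\<dots> = int (card N) * B.ctr (pr v) (\<phi> x)" by (simp add: B.ctr_def sum_distrib_left)
  finally show ?thesis .
qed

text \<open>Inverse and power maps of exponent prime to \<open>p\<close> permute \<open>N\<close>.\<close>
lemma sum_N_power:
  assumes i: "0 < i" "i < p"
  shows "(\<Sum>n\<in>N. f (inv (n [^] i))) = (\<Sum>n\<in>N. f n :: int)"
proof -
  let ?g = "\<lambda>n. inv (n [^] i)"
  have nd: "\<not> p dvd i" using i by (auto dest: dvd_imp_le)
  have inj: "inj_on ?g N"
  proof (rule inj_onI)
    fix m n assume h: "m \<in> N" "n \<in> N" "?g m = ?g n"
    have e: "m [^] i = n [^] i" using h N_G by (metis A.inv_inv A.nat_pow_closed)
    have "coprime p i" by (rule prime_imp_coprime[OF A.prime nd])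
    then have "coprime i p" by (simp only: coprime_commute)
    from cong_solve_coprime_nat[OF this] obtain l where l: "[i * l = 1] (mod p)" by auto
    have r: "a = (a [^] i) [^] l" if a: "a \<in> N" for a
    proof -
      have "(a [^] i) [^] l = a [^] (i * l)" by (rule A.nat_pow_pow[OF N_G[OF a]])
      also have "\<dots> = a [^] (1::nat)" by (rule N_pow_cong[OF a l])
      finally show ?thesis using N_G[OF a] by simp
    qed
    show "m = n" using r[OF h(1)] r[OF h(2)] e by simp
  qed
  have im: "?g ` N = N"
    by (rule endo_inj_surj[OF finN _ inj]) (auto intro!: N_inv N_pow)
  have "(\<Sum>n\<in>N. f (?g n)) = (\<Sum>n\<in>?g ` N. f n)" by (simp add: sum.reindex[OF inj])
  then show ?thesis unfolding im .
qed

text \<open>Upper and lower estimates for the codimensions of \<open>y\<^sub>n - 1\<close>, where \<open>y\<^sub>n\<close> is \<open>m \<mapsto> n m z\<close>, have the same sum over \<open>n\<close>, namely \<open>|G| (|N| + p - 1)\<close> after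
multiplication by \<open>p\<close>. Hence they agree for each \<open>n\<close>, and \<open>n = 1\<close> gives the claim.\<close>
lemma kernel_unit_rank:
  assumes z: "z \<in> VG" "pr z = dl \<one>\<^bsub>H\<^esub>" "A.gpow z p = dl \<one>" "augmentation G z = 1" "z \<noteq> dl \<one>"
  shows "p * (card SG - A.dm (A.img (\<lambda>v. A.gm v z - v))) \<le> card SG"
proof -
  let ?d = "card SH"
  obtain w ns where wg: "(\<forall>s<?d. w s \<in> VH \<and> ns s \<in> N \<and> A.gm (lift (w s)) z - lm (ns s) (lift (w s)) \<in> I (Suc 1))
    \<and> (\<forall>W. A.subm W \<longrightarrow> (\<forall>s<?d. \<forall>m\<in>N. lm m (lift (w s)) \<in> W) \<longrightarrow> VG \<subseteq> W)"
    using adapted_basis[OF z(1-3)] by blast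
  note wn = wg[THEN conjunct1, rule_format]
  have gen: "VG \<subseteq> W" if "A.subm W" "\<And>s m. s < ?d \<Longrightarrow> m \<in> N \<Longrightarrow> lm m (lift (w s)) \<in> W" for W
    using wg[THEN conjunct2, rule_format, of W] that by simp
  have lV: "lift (w s) \<in> VG" if "s < ?d" for s by (rule lin_vecs[OF lift_lin]) (use wn[OF that] in simp)
  have nsN: "ns s \<in> N" if "s < ?d" for s using wn[OF that] by simp
  define E where "E n = (\<Sum>s<?d. card (cmpl (n \<otimes> ns s)))" for n
  have bound: "card SG - A.dm (A.img (\<lambda>b. A.act n z b - b)) \<le> E n" if "n \<in> N" for n
    unfolding E_def by (rule span_bound[OF z(1) that lV nsN _ gen]) (use wn in auto)
  define T where "T n = tr SG (\<lambda>v. \<Sum>i<p. (A.act n z ^^ i) v)" for n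
  have act_pow: "(A.act n z ^^ i) v = A.act (n [^] i) (A.gpow z i) v" if "n \<in> N" "v \<in> VG" for n i v
    by (rule A.act_funpow[OF N_G[OF that(1)] z(1) that(2)])
  have Tle: "T n \<le> int p * int (E n)" if n: "n \<in> N" for n
  proof -
    define Kh where "Kh = {v + cs (int p) w | v w. v \<in> VG \<and> (\<Sum>i<p. (A.act n z ^^ i) v) = 0 \<and> w \<in> VG}"
    have yp: "(A.act n z ^^ p) v = v" if "v \<in> VG" for v
      using act_pow[OF n that, of p] that z(3) Nexp[OF n] by (simp add: A.act_def)
    note nt = A.norm_trace[OF A.lin_act yp, folded Kh_def]
    have "A.dm (A.img (\<lambda>v. A.act n z v - v)) \<le> A.dm Kh"
      by (rule A.dm_mono[OF A.subm_img nt(1,2)]) (intro lin_minus A.lin_act lin_id)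
    then have "int (card SG) - int (A.dm Kh) \<le> int (E n)" using bound[OF n] by linarith
    then have le: "int p * (int (card SG) - int (A.dm Kh)) \<le> int p * int (E n)" by (rule mult_left_mono) simp
    have "T n = int p * (int (card SG) - int (A.dm Kh))" unfolding T_def by (rule nt(3))
    then show ?thesis using le by simp
  qed
  have Tctr: "T n = (\<Sum>i<p. A.ctr (A.gpow z i) (inv (n [^] i)))" if n: "n \<in> N" for n
  proof -
    have "T n = (\<Sum>s\<in>SG. \<Sum>i<p. A.act (n [^] i) (A.gpow z i) (dl s) s)"
      unfolding T_def tr_def by (intro sum.cong refl) (simp add: fapp act_pow[OF n])
    also have "\<dots> = (\<Sum>i<p. tr SG (A.act (n [^] i) (A.gpow z i)))" unfolding tr_def by (rule sum.swap)
    also have "\<dots> = (\<Sum>i<p. A.ctr (A.gpow z i) (inv (n [^] i)))"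
      by (intro sum.cong refl A.tr_act A.nat_pow_closed N_G[OF n])
    finally show ?thesis .
  qed
  have D: "int (card SG) = int ?d * int (card N)" by (simp add: card_SG)
  have sumT: "(\<Sum>n\<in>N. T n) = int (card SG) * (int (card N) + int p - 1)"
  proof -
    have one: "(\<Sum>n\<in>N. A.ctr (A.gpow z i) n) = int (card SG)" for i
    proof -
      have pz: "pr (A.gpow z i) = dl \<one>\<^bsub>H\<^esub>" by (simp add: pr_gpow[OF z(1)] z(2) B.gpow_dl)
      have "(\<Sum>n\<in>N. A.ctr (A.gpow z i) n) = (\<Sum>n\<in>N. A.ctr (A.gpow z i) (n \<otimes> \<one>))"
        by (intro sum.cong refl) (simp add: N_G)
      also have "\<dots> = int (card N) * B.ctr (pr (A.gpow z i)) (\<phi> \<one>)" by (rule ctr_sum_N) (use z(1) in auto)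
      also have "B.ctr (pr (A.gpow z i)) (\<phi> \<one>) = int ?d" unfolding pz by (simp add: B.ctr_def dl_def)
      finally show ?thesis by (simp add: D)
    qed
    have "(\<Sum>n\<in>N. T n) = (\<Sum>n\<in>N. \<Sum>i<p. A.ctr (A.gpow z i) (inv (n [^] i)))" by (intro sum.cong refl Tctr)
    also have "\<dots> = (\<Sum>i<p. \<Sum>n\<in>N. A.ctr (A.gpow z i) (inv (n [^] i)))" by (rule sum.swap)
    also have "\<dots> = (\<Sum>i<p. int (card SG) + (if i = 0 then int (card SG) * (int (card N) - 1) else 0))"
    proof (rule sum.cong[OF refl])
      fix i assume i: "i \<in> {..<p}"
      show "(\<Sum>n\<in>N. A.ctr (A.gpow z i) (inv (n [^] i))) = int (card SG) + (if i = 0 then int (card SG) * (int (card N) - 1) else 0)"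
      proof (cases "i = 0")
        case True
        have "A.ctr (dl \<one>) \<one> = int (card SG)" by (simp add: A.ctr_def dl_def)
        then show ?thesis using True A.gpow_0[of z] by (simp add: algebra_simps)
      next
        case False
        then show ?thesis using sum_N_power[of i "A.ctr (A.gpow z i)"] one[of i] i by simp
      qed
    qed
    also have "\<dots> = int p * int (card SG) + int (card SG) * (int (card N) - 1)"
      using A.p_pos by (simp add: sum.distrib)
    finally show ?thesis by (simp add: algebra_simps)
  qed
  have sumE: "(\<Sum>n\<in>N. int p * int (E n)) = int (card SG) * (int (card N) + int p - 1)"
  proof -
    have sh: "(\<Sum>n\<in>N. int (p * card (cmpl (n \<otimes> ns s)))) = int (card N) * (int (card N) + int p - 1)" if s: "s < ?d" for s
    proof -
      have nG: "ns s \<in> SG" by (rule N_G[OF nsN[OF s]])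
      have "(\<Sum>n\<in>N. int (p * card (cmpl (n \<otimes> ns s)))) = (\<Sum>h\<in>N. int (p * card (cmpl h)))"
        by (rule sum.reindex_bij_witness[where i = "\<lambda>h. h \<otimes> inv (ns s)" and j = "\<lambda>n. n \<otimes> ns s"])
           (use nG nsN[OF s] in \<open>auto intro!: N_mult N_inv simp: A.m_assoc N_G\<close>)
      also have "\<dots> = (\<Sum>h\<in>N. int (card N) + (if h = \<one> then (int p - 1) * int (card N) else 0))"
        by (intro sum.cong refl) (simp add: cmpl(3) algebra_simps del: of_nat_mult, simp add: algebra_simps)
      also have "\<dots> = int (card N) * (int (card N) + int p - 1)"
        using finN N_one by (simp add: sum.distrib algebra_simps)
      finally show ?thesis .
    qed
    have "(\<Sum>n\<in>N. int p * int (E n)) = (\<Sum>n\<in>N. \<Sum>s<?d. int (p * card (cmpl (n \<otimes> ns s))))"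
      by (simp add: E_def sum_distrib_left)
    also have "\<dots> = (\<Sum>s<?d. \<Sum>n\<in>N. int (p * card (cmpl (n \<otimes> ns s))))" by (rule sum.swap)
    also have "\<dots> = (\<Sum>s<?d. int (card N) * (int (card N) + int p - 1))" by (intro sum.cong refl sh) simp
    finally show ?thesis by (simp add: D)
  qed
  \<comment> \<open>termwise inequalities between equal sums are equalities\<close>
  have "T \<one> = int p * int (E \<one>)"
    by (rule sum_mono_inv[of T N "\<lambda>n. int p * int (E n)", OF _ Tle N_one finN]) (simp only: sumT sumE)
  moreover have "T \<one> = tr SG (\<lambda>v. \<Sum>i<p. ((\<lambda>v. A.gm v z) ^^ i) v)"
    unfolding T_def tr_def
    by (intro sum.cong refl) (simp add: fapp act_pow[OF N_one] A.right_funpow[OF z(1)] A.act_def)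
  ultimately have "int p * int (E \<one>) = int (card SG)"
    using A.berman_higman_prime[OF z(1,3,4,5)] by simp
  then have pE: "p * E \<one> = card SG" by (metis of_nat_eq_iff of_nat_mult)
  have "A.img (\<lambda>v. A.gm v z - v) = A.img (\<lambda>b. A.act \<one> z b - b)"
    by (rule A.img_cong, (intro lin_minus A.lin_right A.lin_act lin_id)+) (simp add: A.act_def)
  then have "card SG - A.dm (A.img (\<lambda>v. A.gm v z - v)) \<le> E \<one>" using bound[OF N_one] by simp
  from mult_le_mono2[OF this, of p] show ?thesis unfolding pE .
qed

end

section \<open>Passing from the quotient to the extension\<close>

context elem_ext
begin

text \<open>Here the power of the operator that has order \<open>p\<close> is right multiplication by \<open>z\<close>, covered by \<open>kernel_unit_rank\<close>.\<close>
lemma ctr_zero_if_p_part_in_kernel: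
  assumes x: "x \<in> SG" and u: "u \<in> VG" "augmentation G u = 1"
    and n: "x [^] n = \<one>" "A.gpow u n = dl \<one>" "n > 0" "p dvd n"
    and xd: "x [^] (n div p) = \<one>" and zd: "pr (A.gpow u (n div p)) = dl \<one>\<^bsub>H\<^esub>" "A.gpow u (n div p) \<noteq> dl \<one>"
  shows "A.ctr u x = 0"
proof -
  let ?a = "inv x" and ?z = "A.gpow u (n div p)"
  have a: "?a \<in> SG" "?a [^] n = \<one>" "?a [^] (n div p) = \<one>"
    using x n(1) xd by (simp_all add: A.nat_pow_inv)
  have zV: "?z \<in> VG" by (rule A.gpow_vecs[OF u(1)])
  have zp: "A.gpow ?z p = dl \<one>" using n(2,4) by (simp add: A.gpow_mult[OF u(1)])
  have "A.img (\<lambda>v. A.act \<one> ?z v - v) = A.img (\<lambda>v. A.gm v ?z - v)"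
    by (rule A.img_cong, (intro lin_minus A.lin_right A.lin_act lin_id)+) (simp add: A.act_def)
  then have "p * (card SG - A.dm (A.img (\<lambda>v. A.act (?a [^] (n div p)) ?z v - v))) \<le> card SG"
    using kernel_unit_rank[OF zV zd(1) zp A.gpow_aug[OF u] zd(2)] by (simp only: a(3))
  from A.act_trace_zero[OF a(1) u(1) a(2) n(2-4) this] show ?thesis using x by simp
qed

lemma aug_pr: "augmentation H (pr u) = augmentation G u"
proof -
  have "augmentation H (pr u) = (\<Sum>b\<in>SH. \<Sum>g\<in>SG. if \<phi> g = b then u g else 0)"
    unfolding augmentation_def by (intro sum.cong refl) (simp add: pr_def)
  also have "\<dots> = (\<Sum>g\<in>SG. \<Sum>b\<in>SH. if \<phi> g = b then u g else 0)" by (rule sum.swap)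
  also have "\<dots> = (\<Sum>g\<in>SG. u g)" by (intro sum.cong refl) simp
  finally show ?thesis by (simp add: augmentation_def)
qed

end

context fin_group
begin

text \<open>Two elements have equal order when the same powers of them are trivial; this form transfers along homomorphisms
without reference to the unit group.\<close>
definition realises_orders :: bool where
  "realises_orders \<longleftrightarrow> (\<forall>u\<in>vecs S. augmentation G u = 1 \<longrightarrow> (\<exists>k>0. gpow u k = dl \<one>) \<longrightarrow>
     (\<exists>x\<in>S. (\<forall>k::nat. gpow u k = dl \<one> \<longleftrightarrow> x [^] k = \<one>) \<and> ctr u x \<noteq> 0))"

lemma realises_ordersD:
  assumes realises_orders "u \<in> vecs S" "augmentation G u = 1" "k > 0" "gpow u k = dl \<one>"
  shows "\<exists>x\<in>S. (\<forall>k::nat. gpow u k = dl \<one> \<longleftrightarrow> x [^] k = \<one>) \<and> ctr u x \<noteq> 0"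
  using assms unfolding realises_orders_def by blast

lemma unit_order:
  assumes u: "u \<in> vecs S" and k: "k > 0" "gpow u k = dl \<one>"
  shows "\<exists>n>0. \<forall>k. gpow u k = dl \<one> \<longleftrightarrow> n dvd k"
proof -
  define n where "n = (LEAST k. k > 0 \<and> gpow u k = dl \<one>)"
  have n: "n > 0 \<and> gpow u n = dl \<one>" unfolding n_def by (rule LeastI[of _ k]) (use k in blast)
  have least: "\<not> (k > 0 \<and> gpow u k = dl \<one>)" if "k < n" for k
    using not_less_Least[of k "\<lambda>k. k > 0 \<and> gpow u k = dl \<one>"] that unfolding n_def by blast
  have red: "gpow u k = gpow u (k mod n)" for k
  proof -
    have "gpow u k = gpow u (n * (k div n) + k mod n)" by simp
    also have "\<dots> = gm (gpow u (n * (k div n))) (gpow u (k mod n))" by (rule gpow_add[OF u, symmetric])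
    also have "gpow u (n * (k div n)) = gpow (gpow u n) (k div n)" by (rule gpow_mult[OF u, symmetric])
    also have "\<dots> = dl \<one>" using n gpow_dl[OF one_closed, of "k div n"] by simp
    also have "gm (dl \<one>) (gpow u (k mod n)) = gpow u (k mod n)" using u by simp
    finally show ?thesis .
  qed
  have "gpow u k = dl \<one> \<longleftrightarrow> n dvd k" for k
  proof
    assume "gpow u k = dl \<one>"
    then have "gpow u (k mod n) = dl \<one>" using red[of k] by simp
    moreover have "k mod n < n" using n by simp
    ultimately have "\<not> k mod n > 0" using least[of "k mod n"] by simp
    then show "n dvd k" by (simp add: dvd_eq_mod_eq_0)
  next
    assume "n dvd k"
    then have m: "k mod n = 0" by (simp add: dvd_eq_mod_eq_0)
    have "gpow u k = gpow u 0" using red[of k] unfolding m .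
    then show "gpow u k = dl \<one>" by (simp only: gpow_0)
  qed
  then show ?thesis using n by blast
qed

lemma realises_orders_trivial: assumes "S = {\<one>}" shows realises_orders
  unfolding realises_orders_def
proof (intro ballI impI)
  fix u assume u: "u \<in> vecs S" "augmentation G u = 1"
  have "u = (\<Sum>s\<in>S. cs (u s) (dl s))" by (rule vecs_expand[OF fin_carrier u(1)])
  also have "\<dots> = dl \<one>" using u(2) by (simp add: augmentation_def assms)
  finally have ue: "u = dl \<one>" .
  have "gpow u k = dl \<one> \<longleftrightarrow> \<one> [^] k = \<one>" for k :: nat using gpow_dl[OF one_closed, of k] ue by simp
  moreover have "ctr u \<one> \<noteq> 0" by (simp add: ctr_def ue assms dl_def)
  ultimately show "\<exists>x\<in>S. (\<forall>k::nat. gpow u k = dl \<one> \<longleftrightarrow> x [^] k = \<one>) \<and> ctr u x \<noteq> 0"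
    using one_closed by blast
qed

end

text \<open>Let \<open>n\<close>, \<open>n'\<close> be the orders of \<open>u\<close> and of its image, and \<open>m\<close> the order of a lift \<open>x\<close> with nonzero class trace. Then \<open>n = n' p\<^sup>e\<close> and
\<open>m\<close> is \<open>n'\<close> or \<open>n' p\<close>. If \<open>m \<noteq> n\<close>, then \<open>e = 0\<close> contradicts the criterion for a large \<open>p\<close>-part of \<open>x\<close>, and \<open>e > 0\<close> contradicts the one for a
\<open>p\<close>-part of \<open>u\<close> in the kernel.\<close>
lemma (in elem_ext) realises_orders_step:
  assumes B: "B.realises_orders" shows "A.realises_orders"
  unfolding A.realises_orders_def
proof (intro ballI impI)
  fix u assume u: "u \<in> VG" "augmentation G u = 1" and "\<exists>k>0. A.gpow u k = dl \<one>"
  then obtain k0 where k0: "k0 > 0" "A.gpow u k0 = dl \<one>" by blast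
  obtain n where n: "n > 0" and ord: "\<And>k. A.gpow u k = dl \<one> \<longleftrightarrow> n dvd k"
    using A.unit_order[OF u(1) k0] by blast
  have prk: "pr (A.gpow u k) = B.gpow (pr u) k" for k by (rule pr_gpow[OF u(1)])
  have prn: "B.gpow (pr u) n = dl \<one>\<^bsub>H\<^esub>"
  proof -
    have "A.gpow u n = dl \<one>" by (simp add: ord)
    then show ?thesis using prk[of n] by (simp add: pr_dl)
  qed
  have "augmentation H (pr u) = 1" by (simp add: aug_pr u(2))
  from B.realises_ordersD[OF B pr_VH[OF u(1)] this n prn] obtain y where y: "y \<in> SH" "B.ctr (pr u) y \<noteq> 0"
    and yk: "\<And>k::nat. B.gpow (pr u) k = dl \<one>\<^bsub>H\<^esub> \<longleftrightarrow> y [^]\<^bsub>H\<^esub> k = \<one>\<^bsub>H\<^esub>" by blast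
  define n' where "n' = B.ord y"
  have n'k: "B.gpow (pr u) k = dl \<one>\<^bsub>H\<^esub> \<longleftrightarrow> n' dvd k" for k
    unfolding yk n'_def by (rule B.pow_eq_id[OF y(1)])
  have n'n: "n' dvd n" using n'k prn by blast
  have n'0: "n' > 0" using n'n n by (auto intro: Nat.gr0I)
  have r: "rho y \<in> SG" "\<phi> (rho y) = y" by (rule rho[OF y(1)])+
  have "(\<Sum>\<nu>\<in>N. A.ctr u (\<nu> \<otimes> rho y)) = int (card N) * B.ctr (pr u) y"
    using ctr_sum_N[OF u(1) r(1)] r(2) by simp
  moreover have "card N \<noteq> 0" using finN N_one by auto
  ultimately have s0: "(\<Sum>\<nu>\<in>N. A.ctr u (\<nu> \<otimes> rho y)) \<noteq> 0" using y(2) by simp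
  have "\<exists>\<nu>\<in>N. A.ctr u (\<nu> \<otimes> rho y) \<noteq> 0"
  proof (rule ccontr)
    assume "\<not> (\<exists>\<nu>\<in>N. A.ctr u (\<nu> \<otimes> rho y) \<noteq> 0)"
    then have "(\<Sum>\<nu>\<in>N. A.ctr u (\<nu> \<otimes> rho y)) = 0" by (intro sum.neutral) simp
    with s0 show False by simp
  qed
  then obtain \<nu> where \<nu>: "\<nu> \<in> N" "A.ctr u (\<nu> \<otimes> rho y) \<noteq> 0" by (rule bexE)
  define x where "x = \<nu> \<otimes> rho y"
  have xG: "x \<in> SG" unfolding x_def using N_G[OF \<nu>(1)] r(1) by simp
  have px: "\<phi> x = y" unfolding x_def using nn_mult(2)[OF \<nu>(1) r(1)] r(2) by simp
  have cx: "A.ctr u x \<noteq> 0" unfolding x_def by (rule \<nu>(2))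
  have pxk: "\<phi> (x [^] k) = y [^]\<^bsub>H\<^esub> k" for k :: nat using gh.hom_nat_pow[OF xG, of k] px by simp
  define m where "m = A.ord x"
  have mk: "x [^] k = \<one> \<longleftrightarrow> m dvd k" for k unfolding m_def by (rule A.pow_eq_id[OF xG])
  have "n' dvd m"
  proof -
    have "x [^] m = \<one>" by (simp add: mk)
    then have "y [^]\<^bsub>H\<^esub> m = \<one>\<^bsub>H\<^esub>" using pxk[of m] by simp
    then show ?thesis unfolding n'_def by (simp add: B.pow_eq_id[OF y(1)])
  qed
  moreover have "m dvd n' * p"
  proof -
    have "y [^]\<^bsub>H\<^esub> n' = \<one>\<^bsub>H\<^esub>" unfolding n'_def by (rule B.pow_ord_eq_1[OF y(1)])
    then have "x [^] n' \<in> N" using pxk[of n'] xG by (simp add: kernel_def)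
    from Nexp[OF this] have "x [^] (n' * p) = \<one>" using xG by (simp add: A.nat_pow_pow)
    then show ?thesis by (simp only: mk)
  qed
  ultimately have m: "m = n' \<or> m = n' * p"
  proof -
    assume h: "n' dvd m" "m dvd n' * p"
    then obtain t where t: "m = n' * t" by (auto simp: dvd_def)
    then have "t dvd p" using h(2) n'0 by simp
    then have "t = 1 \<or> t = p" using A.prime by (simp add: prime_nat_iff)
    then show ?thesis using t by auto
  qed
  define k where "k = n div n'"
  have nk: "n = n' * k" and k0: "k > 0" using n'n n by (auto simp: k_def dvd_def)
  define e where "e = multiplicity p k"
  define l where "l = k div p ^ e"
  have el: "k = p ^ e * l" "\<not> p dvd l"
  proof -
    show "k = p ^ e * l" unfolding l_def e_def by (rule dvd_mult_div_cancel[OF multiplicity_dvd, symmetric])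
    show "\<not> p dvd l" unfolding l_def e_def
      by (rule multiplicity_decompose) (use k0 A.p_gt_1 in auto)
  qed
  have "n dvd n' * p ^ e"
  proof -
    have zV: "A.gpow u (n' * p ^ e) \<in> VG" by (rule A.gpow_vecs[OF u(1)])
    have "pr (A.gpow u (n' * p ^ e)) = dl \<one>\<^bsub>H\<^esub>" unfolding prk n'k by simp
    moreover have "A.gpow (A.gpow u (n' * p ^ e)) l = dl \<one>"
      unfolding A.gpow_mult[OF u(1)] ord nk el(1) by (simp add: mult.assoc)
    moreover have "coprime l p"
    proof -
      have "coprime p l" by (rule prime_imp_coprime[OF A.prime el(2)])
      then show ?thesis by (simp only: coprime_commute)
    qed
    ultimately have "A.gpow u (n' * p ^ e) = dl \<one>" by (rule kernel_p_element[OF zV])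
    then show ?thesis by (simp only: ord)
  qed
  then have "k dvd p ^ e" using nk n'0 by simp
  then have ne: "n = n' * p ^ e" using el(1) nk by (auto dest: dvd_antisym)
  have "m = n"
  proof (rule ccontr)
    assume mn: "m \<noteq> n"
    show False
    proof (cases e)
      case 0
      then have nn': "n = n'" using ne by simp
      then have mp: "m = n' * p" using m mn by blast
      \<comment> \<open>\<open>x\<close> has order \<open>n' p\<close> while \<open>u\<close> has order \<open>n'\<close>\<close>
      have "A.ctr u x = 0"
      proof (rule A.ctr_zero_if_p_part_large[OF xG u(1), of "n' * p"])
        show "x [^] (n' * p) = \<one>" by (simp add: mk mp)
        show "A.gpow u (n' * p) = dl \<one>" by (simp add: ord nn')
        show "n' * p > 0" using n'0 by simp
        show "p dvd n' * p" by simp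
        show "A.gpow u (n' * p div p) = dl \<one>" by (simp add: ord nn')
        show "x [^] (n' * p div p) \<noteq> \<one>" using n'0 A.p_gt_1 by (auto simp: mk mp dest: dvd_imp_le)
      qed
      then show False using cx by simp
    next
      case (Suc e')
      have np: "n = (n' * p ^ e') * p" using ne Suc by simp
      have "p \<noteq> 0" using A.p_gt_1 by simp
      then have nd: "n div p = n' * p ^ e'" unfolding np by (rule nonzero_mult_div_cancel_right)
      have mnp: "m dvd n div p"
      proof (cases "m = n'")
        case True then show ?thesis by (simp add: nd)
      next
        case False
        then have mp: "m = n' * p" using m by blast
        then obtain e'' where "e' = Suc e''" using mn ne Suc by (cases e') auto
        then show ?thesis by (simp add: nd mp)
      qed
      have "A.ctr u x = 0"
      proof (rule ctr_zero_if_p_part_in_kernel[OF xG u, of n])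
        have pn: "p dvd n" unfolding ne Suc power_Suc by (intro dvd_mult dvd_triv_left)
        from pn have "n div p * p = n" by (rule dvd_div_mult_self)
        then have "n div p dvd n" by (metis dvd_triv_left)
        from dvd_trans[OF mnp this] show "x [^] n = \<one>" by (simp only: mk)
        show "A.gpow u n = dl \<one>" by (simp add: ord)
        show "n > 0" by (rule n)
        show "p dvd n" by (rule pn)
        show "x [^] (n div p) = \<one>" unfolding mk by (rule mnp)
        show "pr (A.gpow u (n div p)) = dl \<one>\<^bsub>H\<^esub>" unfolding prk n'k nd by simp
        have "n div p < n" using n A.p_gt_1 by simp
        moreover have "n div p > 0" unfolding nd using n'0 by simp
        ultimately show "A.gpow u (n div p) \<noteq> dl \<one>" unfolding ord by (auto dest: dvd_imp_le)
      qed
      then show False using cx by simp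
    qed
  qed
  then have "\<forall>k::nat. A.gpow u k = dl \<one> \<longleftrightarrow> x [^] k = \<one>" by (simp only: mk ord) simp
  then show "\<exists>x\<in>SG. (\<forall>k::nat. A.gpow u k = dl \<one> \<longleftrightarrow> x [^] k = \<one>) \<and> A.ctr u x \<noteq> 0"
    using xG cx by blast
qed

section \<open>Induction along a solvable group\<close>

context group
begin

lemma conj_pow: assumes "g \<in> carrier G" "h \<in> carrier G"
  shows "(g \<otimes> h \<otimes> inv g) [^] (n::nat) = g \<otimes> h [^] n \<otimes> inv g"
proof (induction n)
  case (Suc n)
  have "inv g \<otimes> (g \<otimes> (h \<otimes> inv g)) = h \<otimes> inv g" using assms by (simp flip: m_assoc)
  then show ?case using Suc assms by (simp add: m_assoc)
qed (use assms in simp)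

text \<open>The last nontrivial term of the derived series is normal and abelian; its elements of exponent \<open>p\<close> form a characteristic subgroup.\<close>
lemma minimal_elementary_normal:
  assumes fin: "finite (carrier G)" and sol: "solvable G" and nt: "carrier G \<noteq> {\<one>}"
  shows "\<exists>N p. N \<lhd> G \<and> Factorial_Ring.prime (p::nat) \<and> N \<noteq> {\<one>} \<and> (\<forall>a\<in>N. \<forall>b\<in>N. a \<otimes> b = b \<otimes> a) \<and> (\<forall>a\<in>N. a [^] p = \<one>)"
proof -
  define K where "K n = (derived G ^^ n) (carrier G)" for n
  define n where "n = (LEAST n. K n = {\<one>})"
  have "\<exists>n. K n = {\<one>}" using sol unfolding K_def by (simp add: solvable_iff_trivial_derived_seq)
  then have Kn: "K n = {\<one>}" unfolding n_def by (rule LeastI_ex)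
  have K0: "K 0 = carrier G" by (simp add: K_def)
  have "n \<noteq> 0"
  proof
    assume "n = 0"
    from Kn[unfolded this K0] nt show False by (rule notE[rotated])
  qed
  then obtain k where k: "n = Suc k" using not0_implies_Suc by blast
  have "k < n" by (simp add: k)
  from not_less_Least[OF this[unfolded n_def]] have Kk: "K k \<noteq> {\<one>}" .
  have nrm: "K j \<lhd> G" for j
    by (induction j) (simp_all add: K_def normal_self derived_is_normal)
  have sub: "subgroup (K k) G" by (rule normal_imp_subgroup[OF nrm])
  have KG: "a \<in> carrier G" if "a \<in> K k" for a using subgroup.subset[OF sub] that by blast
  have comm: "a \<otimes> b = b \<otimes> a" if ab: "a \<in> K k" "b \<in> K k" for a b
  proof -
    have "a \<otimes> b \<otimes> inv a \<otimes> inv b \<in> derived_set G (K k)" using ab by blast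
    then have "a \<otimes> b \<otimes> inv a \<otimes> inv b \<in> derived G (K k)" unfolding derived_def by (rule generate.incl)
    moreover have "derived G (K k) = {\<one>}" using Kn by (simp add: K_def k)
    ultimately have "a \<otimes> b \<otimes> inv a \<otimes> inv b = \<one>" by simp
    then have "a \<otimes> b \<otimes> (inv a \<otimes> inv b) = \<one>" using KG[OF ab(1)] KG[OF ab(2)] by (simp add: m_assoc)
    then have "a \<otimes> b \<otimes> inv (b \<otimes> a) = \<one>" using KG[OF ab(1)] KG[OF ab(2)] by (simp add: inv_mult_group)
    then show ?thesis using KG[OF ab(1)] KG[OF ab(2)] inv_equality inv_inv by (metis inv_closed m_closed)
  qed
  obtain x where x: "x \<in> K k" "x \<noteq> \<one>" using Kk subgroup.one_closed[OF sub] by blast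
  have xG: "x \<in> carrier G" by (rule KG[OF x(1)])
  have "ord x \<noteq> 1" using x(2) ord_eq_1[OF xG] by simp
  then obtain p where p: "Factorial_Ring.prime p" "p dvd ord x" using prime_factor_nat by blast
  define N where "N = {a \<in> K k. a [^] p = \<one>}"
  have NG: "N \<subseteq> carrier G" using KG by (auto simp: N_def)
  have sN: "subgroup N G"
  proof (rule subgroupI[OF NG])
    show "N \<noteq> {}" using subgroup.one_closed[OF sub] by (auto simp: N_def)
    show "inv a \<in> N" if "a \<in> N" for a
      using that subgroup.m_inv_closed[OF sub, of a] KG[of a] by (simp add: N_def nat_pow_inv)
    show "a \<otimes> b \<in> N" if "a \<in> N" "b \<in> N" for a b
      using that subgroup.m_closed[OF sub, of a b] KG[of a] KG[of b] comm[of a b]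
      by (simp add: N_def pow_mult_distrib)
  qed
  have "N \<lhd> G"
    unfolding normal_inv_iff
  proof (intro conjI sN ballI)
    fix g h assume g: "g \<in> carrier G" and h: "h \<in> N"
    have hK: "h \<in> K k" "h [^] p = \<one>" using h by (auto simp: N_def)
    have "g \<otimes> h \<otimes> inv g \<in> K k" by (rule normal.inv_op_closed2[OF nrm g hK(1)])
    then show "g \<otimes> h \<otimes> inv g \<in> N" using conj_pow[OF g KG[OF hK(1)], of p] g hK by (simp add: N_def)
  qed
  moreover have "N \<noteq> {\<one>}"
  proof -
    let ?y = "x [^] (ord x div p)"
    have o: "ord x > 0" using ord_ge_1[OF fin xG] by simp
    have "?y [^] p = x [^] (ord x div p * p)" by (rule nat_pow_pow[OF xG])
    then have "?y [^] p = \<one>" using p(2) xG by simp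
    moreover have "x [^] j \<in> K k" for j :: nat
      by (induction j) (simp_all add: x(1) subgroup.one_closed[OF sub] subgroup.m_closed[OF sub])
    ultimately have "?y \<in> N" by (simp add: N_def)
    moreover have "?y \<noteq> \<one>"
    proof
      assume "?y = \<one>"
      then have "ord x dvd ord x div p" by (simp add: pow_eq_id[OF xG])
      moreover have "ord x div p < ord x" "ord x div p > 0"
        using o prime_gt_1_nat[OF p(1)] p(2) by (auto simp: div_greater_zero_iff dest: dvd_imp_le)
      ultimately show False by (auto dest: dvd_imp_le)
    qed
    ultimately show ?thesis by blast
  qed
  ultimately show ?thesis using p(1) comm unfolding N_def by blast
qed

text \<open>Quotients are realised on natural numbers, so that the induction on the group order can stay within one type.\<close>
lemma nat_quotient:
  assumes fin: "finite (carrier G)" and N: "N \<lhd> G" shows "\<exists>F :: 'a \<Rightarrow> nat. weak_group_morphism F N G"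
proof -
  have sub: "subgroup N G" by (rule normal_imp_subgroup[OF N])
  have "finite (rcosets N)" using fin by (simp add: RCOSETS_def)
  from finite_imp_inj_to_nat_seg[OF this] obtain f :: "'a set \<Rightarrow> nat" where f: "inj_on f (rcosets N)" by blast
  have "weak_group_morphism (\<lambda>g. f (N #> g)) N G"
  proof (rule weak_group_morphismsI[OF N])
    fix a b assume ab: "a \<in> carrier G" "b \<in> carrier G"
    have "f (N #> a) = f (N #> b) \<longleftrightarrow> N #> a = N #> b"
      by (rule inj_on_eq_iff[OF f]) (use ab in \<open>auto simp: RCOSETS_def\<close>)
    also have "\<dots> \<longleftrightarrow> a \<in> N #> b"
      using rcos_self[OF ab(1) sub] repr_independence[OF _ ab(2) sub, of a] by blast
    also have "\<dots> \<longleftrightarrow> a \<otimes> inv b \<in> N" by (rule subgroup.rcos_module[OF sub is_group ab(2,1)])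
    finally show "f (N #> a) = f (N #> b) \<longleftrightarrow> a \<otimes> inv b \<in> N" .
  qed
  then show ?thesis by blast
qed

end

lemma (in fin_group) elem_ext_image:
  assumes F: "weak_group_morphism F N G" and p: "Factorial_Ring.prime (p::nat)"
    and ab: "\<forall>a\<in>N. \<forall>b\<in>N. a \<otimes> b = b \<otimes> a" and ex: "\<forall>a\<in>N. a [^] p = \<one>"
  shows "elem_ext G (image_group F G) p F" "fin_group (image_group F G)" "solvable G \<Longrightarrow> solvable (image_group F G)"
    "card (carrier (image_group F G)) * card N = card S"
proof -
  let ?H = "image_group F G"
  have h: "group_hom G ?H F" by (rule weak_group_morphism_group_hom[OF F])
  have sj: "F ` carrier G = carrier ?H" by (simp only: image_group_carrier)
  have ker: "kernel G ?H F = N" by (rule weak_group_morphism_ker[OF F])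
  have fH: "finite (carrier ?H)" by (simp add: image_group_carrier)
  show gH: "fin_group ?H"
    by (intro fin_group.intro image_group_is_group[OF F] fin_group_axioms.intro fH)
  show e: "elem_ext G ?H p F"
  proof (intro elem_ext.intro fin_group_p.intro gH elem_ext_axioms.intro h sj)
    show "fin_group G" by (rule fin_group_axioms)
    show "fp_vecs (carrier G) p" "fp_vecs (carrier ?H) p" by (auto intro!: fp_vecs.intro fH p)
  qed (simp_all add: ker ab[rule_format] ex[rule_format])
  show "solvable ?H" if "solvable G" by (rule group_hom.surj_hom_imp_solvable[OF h sj that])
  show "card (carrier ?H) * card N = card S" using elem_ext.card_SG[OF e] ker by simp
qed

lemma solvable_realises_orders_nat:
  fixes G :: "nat monoid"
  assumes "fin_group G" "solvable G" shows "fin_group.realises_orders G"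
  using assms
proof (induction "card (carrier G)" arbitrary: G rule: less_induct)
  case less
  interpret fin_group G by (rule less.prems(1))
  show ?case
  proof (cases "carrier G = {\<one>\<^bsub>G\<^esub>}")
    case True then show ?thesis by (rule realises_orders_trivial)
  next
    case False
    from minimal_elementary_normal[OF fin_carrier less.prems(2) False] obtain N and p :: nat where N: "N \<lhd> G" "N \<noteq> {\<one>\<^bsub>G\<^esub>}"
      and p: "Factorial_Ring.prime p" and ab: "\<forall>a\<in>N. \<forall>b\<in>N. a \<otimes>\<^bsub>G\<^esub> b = b \<otimes>\<^bsub>G\<^esub> a" and ex: "\<forall>a\<in>N. a [^]\<^bsub>G\<^esub> p = \<one>\<^bsub>G\<^esub>" by blast
    obtain F :: "nat \<Rightarrow> nat" where F: "weak_group_morphism F N G" using nat_quotient[OF fin_carrier N(1)] by blast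
    note ei = elem_ext_image[OF F p ab ex]
    let ?H = "image_group F G"
    have NS: "subgroup N G" by (rule normal_imp_subgroup[OF N(1)])
    have finN: "finite N" by (rule finite_subset[OF subgroup.subset[OF NS] fin_carrier])
    have "card N \<noteq> 1" using N(2) subgroup.one_closed[OF NS] by (auto simp: card_1_singleton_iff)
    moreover have "card N \<noteq> 0" using finN subgroup.one_closed[OF NS] by auto
    ultimately have N2: "card N \<ge> 2" by linarith
    have H0: "card (carrier ?H) > 0"
      using ei(4) one_closed card_gt_0_iff[of "carrier G"] by (metis card_eq_0_iff empty_iff fin_carrier mult_is_0 not_gr_zero)
    have "card (carrier ?H) * 2 \<le> card (carrier ?H) * card N" by (rule mult_le_mono2[OF N2])
    then have "card (carrier ?H) < card (carrier G)" using H0 ei(4) by linarith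
    then have "fin_group.realises_orders ?H" by (rule less.hyps[OF _ ei(2) ei(3)[OF less.prems(2)]])
    then show ?thesis by (rule elem_ext.realises_orders_step[OF ei(1)])
  qed
qed

text \<open>The quotient by the trivial subgroup is a copy of \<open>G\<close> on the natural numbers; it is reached by one step with trivial kernel, for which any prime will do.\<close>
lemma (in fin_group) solvable_realises_orders:
  assumes "solvable G" shows realises_orders
proof -
  obtain F :: "'a \<Rightarrow> nat" where F: "weak_group_morphism F {\<one>} G" using nat_quotient[OF fin_carrier one_is_normal] by blast
  have "\<forall>a\<in>{\<one>}. \<forall>b\<in>{\<one>}. a \<otimes> b = b \<otimes> a" "\<forall>a\<in>{\<one>}. a [^] (2::nat) = \<one>" by simp_all
  note e = elem_ext_image[OF F two_is_prime_nat this]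
  show ?thesis by (rule elem_ext.realises_orders_step[OF e(1) solvable_realises_orders_nat[OF e(2) e(3)[OF assms]]])
qed

section \<open>Orders of torsion units\<close>

text \<open>Each conjugate of \<open>x\<close> is hit by a coset of the centraliser.\<close>
lemma (in fin_group) ctr_partial_augmentation:
  assumes x: "x \<in> S" shows "ctr u x = int (card {m \<in> S. m \<otimes> x \<otimes> inv m = x}) * partial_augmentation G x u"
proof -
  let ?c = "\<lambda>m. m \<otimes> x \<otimes> inv m"
  have cc: "conjugacy_class G x = ?c ` S" by (auto simp: conjugacy_class_def)
  have "ctr u x = (\<Sum>m\<in>S. u (?c m))"
    unfolding ctr_def by (rule sum.reindex_bij_witness[where i = "\<lambda>m. inv m" and j = "\<lambda>m. inv m"]) auto
  also have "\<dots> = (\<Sum>y\<in>?c ` S. \<Sum>m\<in>{m \<in> S. ?c m = y}. u (?c m))" by (rule sum.image_gen) simp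
  also have "\<dots> = (\<Sum>y\<in>?c ` S. int (card {m \<in> S. ?c m = x}) * u y)"
  proof (rule sum.cong[OF refl])
    fix y assume "y \<in> ?c ` S"
    then obtain g where g: "g \<in> S" "y = ?c g" by blast
    have "bij_betw (\<lambda>m. g \<otimes> m) {m \<in> S. ?c m = x} {m \<in> S. ?c m = y}"
    proof (rule bij_betwI[where g = "\<lambda>m. inv g \<otimes> m"])
      have c: "?c (a \<otimes> m) = a \<otimes> ?c m \<otimes> inv a" if "a \<in> S" "m \<in> S" for a m
        using that x by (simp add: inv_mult_group m_assoc)
      show "(\<lambda>m. g \<otimes> m) \<in> {m \<in> S. ?c m = x} \<rightarrow> {m \<in> S. ?c m = y}" using g c by auto
      have "inv g \<otimes> y \<otimes> inv (inv g) = x"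
      proof -
        have "inv g \<otimes> (g \<otimes> x) = x" using g(1) x by (simp flip: m_assoc)
        then show ?thesis using g x by (simp add: m_assoc)
      qed
      then show "(\<lambda>m. inv g \<otimes> m) \<in> {m \<in> S. ?c m = y} \<rightarrow> {m \<in> S. ?c m = x}" using g(1) c[of "inv g"] by auto
    qed (use g(1) in \<open>auto simp flip: m_assoc\<close>)
    from bij_betw_same_card[OF this] have "card {m \<in> S. ?c m = y} = card {m \<in> S. ?c m = x}" by simp
    moreover have "(\<Sum>m\<in>{m \<in> S. ?c m = y}. u (?c m)) = (\<Sum>m\<in>{m \<in> S. ?c m = y}. u y)" by (rule sum.cong) auto
    ultimately show "(\<Sum>m\<in>{m \<in> S. ?c m = y}. u (?c m)) = int (card {m \<in> S. ?c m = x}) * u y" by simp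
  qed
  finally show ?thesis unfolding partial_augmentation_def cc by (simp only: sum_distrib_left)
qed

theorem mainTheorem1:
  fixes G :: "('a, 'b) monoid_scheme"
  assumes "group G"
    and "finite (carrier G)"
    and "solvable G"
  shows "(\<forall>u \<in> torsion_elements (normalized_units G).
            \<exists>x \<in> carrier G. group.ord G x = group.ord (normalized_units G) u \<and>
              partial_augmentation G x u \<noteq> 0) \<and>
         group.ord (normalized_units G) ` torsion_elements (normalized_units G)
           = group.ord G ` carrier G"
proof -
  interpret fin_group G using assms by (intro fin_group.intro fin_group_axioms.intro)
  let ?U = "normalized_units G"
  interpret U: group ?U by (rule group_normalized_units[OF assms(2)])
  have carr: "u \<in> carrier ?U \<longleftrightarrow> u \<in> Units (int_group_ring G) \<and> augmentation G u = 1" for u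
    by (simp add: normalized_units_def)
  have U1: "\<one>\<^bsub>?U\<^esub> = dl \<one>\<^bsub>G\<^esub>" by (simp add: normalized_units_def units_of_def R_one)
  have Upow: "u [^]\<^bsub>?U\<^esub> k = gpow u k" for u and k :: nat
    by (simp add: nat_pow_def normalized_units_def units_of_def)
  have Uvec: "u \<in> vecs S" if "u \<in> carrier ?U" for u
    using that R.Units_closed[of u] by (simp add: carr R_carrier)
  have dl_inj: "dl a = (dl b :: 'a \<Rightarrow> int) \<longleftrightarrow> a = b" for a b :: 'a
    by (auto simp: dl_def fun_eq_iff split: if_splits)
  have part1: "\<exists>x\<in>carrier G. ord x = U.ord u \<and> partial_augmentation G x u \<noteq> 0"
    if "u \<in> torsion_elements ?U" for u
  proof -
    from that have "u \<in> carrier ?U \<and> (\<exists>n::nat. n > 0 \<and> u [^]\<^bsub>?U\<^esub> n = \<one>\<^bsub>?U\<^esub>)"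
      unfolding torsion_elements_def by (rule CollectD)
    then obtain n :: nat where u: "u \<in> carrier ?U" "n > 0" "gpow u n = dl \<one>\<^bsub>G\<^esub>"
      unfolding Upow U1 by blast
    have "augmentation G u = 1" using u(1) by (simp add: carr)
    from realises_ordersD[OF solvable_realises_orders[OF assms(3)] Uvec[OF u(1)] this u(2,3)]
    obtain x where x: "x \<in> S" "ctr u x \<noteq> 0" and k: "\<And>k::nat. gpow u k = dl \<one>\<^bsub>G\<^esub> \<longleftrightarrow> x [^]\<^bsub>G\<^esub> k = \<one>\<^bsub>G\<^esub>" by blast
    have "U.ord u = ord x"
      unfolding U.ord_unique[OF u(1)] Upow U1 k pow_eq_id[OF x(1)] by simp
    moreover have "partial_augmentation G x u \<noteq> 0" using x(2) ctr_partial_augmentation[OF x(1), of u] by auto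
    ultimately show ?thesis using x(1) by auto
  qed
  moreover have "U.ord ` torsion_elements ?U = ord ` carrier G"
  proof
    show "U.ord ` torsion_elements ?U \<subseteq> ord ` carrier G"
    proof
      fix k assume "k \<in> U.ord ` torsion_elements ?U"
      then obtain u where u: "u \<in> torsion_elements ?U" "k = U.ord u" by blast
      from part1[OF u(1)] obtain x where "x \<in> carrier G" "ord x = U.ord u" by blast
      then show "k \<in> ord ` carrier G" unfolding u(2) by (intro image_eqI[of _ ord x]) simp_all
    qed
    show "ord ` carrier G \<subseteq> U.ord ` torsion_elements ?U"
    proof
      fix k assume "k \<in> ord ` carrier G"
      then obtain x where x: "x \<in> S" "k = ord x" by blast
      have inv: "gm (dl x) (dl (inv\<^bsub>G\<^esub> x)) = dl \<one>\<^bsub>G\<^esub>" "gm (dl (inv\<^bsub>G\<^esub> x)) (dl x) = dl \<one>\<^bsub>G\<^esub>"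
        using x(1) by (simp_all add: gm_dl_dl)
      have "dl x \<in> carrier (int_group_ring G)" "dl (inv\<^bsub>G\<^esub> x) \<in> carrier (int_group_ring G)"
        using x(1) by (simp_all add: R_carrier)
      then have "dl x \<in> Units (int_group_ring G)" unfolding Units_def R_one using inv by blast
      moreover have "augmentation G (dl x) = 1" using x(1) by (simp add: augmentation_def dl_def)
      ultimately have xU: "dl x \<in> carrier ?U" by (simp add: carr)
      have pw: "dl x [^]\<^bsub>?U\<^esub> j = \<one>\<^bsub>?U\<^esub> \<longleftrightarrow> x [^]\<^bsub>G\<^esub> j = \<one>\<^bsub>G\<^esub>" for j :: nat
        unfolding Upow U1 gpow_dl[OF x(1)] dl_inj ..
      have "ord x > 0" using ord_ge_1[OF assms(2) x(1)] by simp
      then have "dl x \<in> torsion_elements ?U"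
        unfolding torsion_elements_def using xU pw[of "ord x"] x(1) by auto
      moreover have "U.ord (dl x) = ord x" unfolding U.ord_unique[OF xU] pw pow_eq_id[OF x(1)] by simp
      ultimately show "k \<in> U.ord ` torsion_elements ?U" unfolding x(2) by (intro image_eqI[of _ _ "dl x"]) simp_all
    qed
  qed
  ultimately show ?thesis by blast
qed

end
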